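(* Let $N=\mathbf{Z}^d$, let $\widetilde{\Sigma}$ be a complete nonsingular fan in $\widetilde N=\{\mathbf n\in N : \text{the } d\text{-th coordinate of }\mathbf n\text{ is }0\}$, and let $\Sigma$ be a complete nonsingular fan in $N$ containing $\widetilde\Sigma$ as a subfan, satisfying all the assumptions of the setting described in the context (in particular $\widetilde V$ is isomorphic to either $\mathbf{P}^{d-1}$ or a toric bundle over $\mathbf{P}^1$, with the vectors $\mathbf e_i,\mathbf a_i,\mathbf b_i,\mathbf c_i$ chosen as there). Let $V$ be the nonsingular complete toric $d$-fold corresponding to $\Sigma$, and let $k$ be a nonnegative integer. For $t\in\mathbf{C}$ let $V_t$ be obtained by patching $V^+$ and $V^-$ along their open subsets identified with $\widetilde V\times\mathbf{C}^\times$, via the automorphism $(x^-_1,\ldots,x^-_{d-1},y^-_1,\ldots,y^-_\rho,w)\mapsto(x^+_1,\ldots,x^+_{d-1},y^+_1,\ldots,y^+_\rho,z)$ of $\widetilde V\times\mathbf{C}^\times$ given by $$x^+_1=x^-_1w^{c_{1,1}}+t\,y^-_1w^{k},\quad x^+_i=x^-_iw^{c_{1,i}}\ (2\le i\le d-1),\quad y^+_j=y^-_j\ (1\le j\le\rho),\quad z=1/w.$$ Then $\{V_t\}_{t\in\mathbf{C}}$ is a complex analytic family whose special fiber $V_0$ is isomorphic to $V$.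
   Context: **Conventions.** All varieties are over $\mathbf{C}$; cones are nonsingular rational cones and fans are nonsingular. $N=\mathbf{Z}^d$ (column vectors). For a fan $\Sigma$, $\mathrm{G}(\Sigma)$ is the set of primitive generators of its one-dimensional cones, and $\mathrm{G}(\sigma)=\sigma\cap \mathrm{G}(\Sigma)$ for $\sigma\in\Sigma$. A complex analytic family $\{V_t\}_{t\in\mathbf C}$ is understood in the usual sense: a complex manifold with a proper holomorphic submersion onto $\mathbf{C}$ whose fiber over $t$ is $V_t$ (here the total space is obtained by patching $V^+\times\mathbf C$ and $V^-\times\mathbf C$ by the given formula); the special fiber is the fiber over $t=0$. **Homogeneous coordinates.** For a fan $\Sigma$ containing at least one cone of full dimension, with toric variety $V$, put $\mathbf U(\Sigma)=\{(X_\rho)_{\rho\in \mathrm G(\Sigma)}\in\mathbf C^{\mathrm G(\Sigma)} : \prod_{\rho\in \mathrm G(\Sigma)\setminus \mathrm G(\sigma)}X_\rho\ne0 \text{ for some }\sigma\in\Sigma\}$. The group $G=\mathrm{Hom}_{\mathbf Z}(\mathrm{Pic}(V),\mathbf C^\times)$ acts by $g\cdot(X_\rho)_\rho=(g([D_\rho])X_\rho)_\rho$, where $D_\rho$ is the torus-invariant prime divisor of $\rho$, and $V=\mathbf U(\Sigma)/G$ (geometric quotient). The $X_\rho$ are the homogeneous coordinates of $V$. For $\sigma\in\Sigma$, $\mathbf U(\Sigma)_\sigma=\{X\in\mathbf U(\Sigma):\prod_{\rho\in \mathrm G(\Sigma)\setminus \mathrm G(\sigma)}X_\rho\neq0\}$,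 and $\mathbf U(\Sigma)_\sigma/G$ is the affine open toric subvariety of $\sigma$. **Setting.** Let $\widetilde N\subset N$ be the sublattice of vectors with $d$-th coordinate $0$, $\widetilde\Sigma$ a complete fan in $\widetilde N$, and $\Sigma$ a complete fan in $N$ containing $\widetilde\Sigma$ as a subfan. Let $\Sigma^+$ (resp. $\Sigma^-$) be the subfan of $\sigma\in\Sigma$ all of whose points have nonnegative (resp. nonpositive) $d$-th coordinate; then $\widetilde\Sigma=\Sigma^+\cap\Sigma^-$. Let $V,V^+,V^-$ be the toric varieties of $\Sigma,\Sigma^+,\Sigma^-$ (fans in $N$), and $\widetilde V$ the toric $(d-1)$-fold of $\widetilde\Sigma$ (fan in $\widetilde N$). Write $$\mathrm G(\widetilde\Sigma)=\{\mathbf e_1,\ldots,\mathbf e_{d-1},\mathbf a_1,\ldots,\mathbf a_\rho\},\quad \mathrm G(\Sigma^+)=\{\mathbf b_1,\ldots,\mathbf b_m\}\cup \mathrm G(\widetilde\Sigma),\quad \mathrm G(\Sigma^-)=\{\mathbf c_1,\ldots,\mathbf c_n\}\cup \mathrm G(\widetilde\Sigma),$$ where $\{\mathbf e_1,\ldots,\mathbf e_{d-1},\mathbf b_1\}$ is the standard basis of $N$, and denote coordinates by $\mathbf a_j={}^t(a_{j,1},\ldots,a_{j,d})$, $\mathbf b_j={}^t(b_{j,1},\ldots,b_{j,d})$, $\mathbf c_j={}^t(c_{j,1},\ldots,c_{j,d})$. Assumptions: - $\widetilde V$ is isomorphic to either $\mathbf P^{d-1}$ or a toric bundle over $\mathbf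 P^1$. - If $\widetilde V$ is isomorphic to a toric bundle over $\mathbf P^1$, the torus-invariant prime divisors on $\widetilde V$ corresponding to $\mathbf e_1$ and $\mathbf a_1$ are fibers of the bundle. - $\{\mathbf e_1,\ldots,\mathbf e_{d-1},\mathbf b_1\}$ generates a $d$-dimensional cone of $\Sigma^+$, and $\{\mathbf e_1,\ldots,\mathbf e_{d-1},\mathbf c_1\}$ generates a $d$-dimensional cone of $\Sigma^-$ (so $c_{1,d}=-1$). **Identifications with $\widetilde V\times\mathbf C^\times$.** Let $(X^+_1,\ldots,X^+_{d-1},Y^+_1,\ldots,Y^+_\rho,Z^+_1,\ldots,Z^+_m)$ be the homogeneous coordinates of $V^+$ corresponding to $\mathbf e_1,\ldots,\mathbf e_{d-1},\mathbf a_1,\ldots,\mathbf a_\rho,\mathbf b_1,\ldots,\mathbf b_m$, and $(X^-_1,\ldots,X^-_{d-1},Y^-_1,\ldots,Y^-_\rho,W^-_1,\ldots,W^-_n)$ those of $V^-$ corresponding to $\mathbf e_1,\ldots,\mathbf e_{d-1},\mathbf a_1,\ldots,\mathbf a_\rho,\mathbf c_1,\ldots,\mathbf c_n$; let $G^\pm=\mathrm{Hom}_{\mathbf Z}(\mathrm{Pic}(V^\pm),\mathbf C^\times)$. The open subset $\left(\bigcup_{\sigma\in\widetilde\Sigma}\mathbf U(\Sigma^+)_\sigma\right)/G^+\subset V^+$ is identified with $\widetilde V\times\mathbf C^\times$ by $$x^+_i=X^+_i\prod_{j=2}^m(Z^+_j)^{b_{j,i}}\ (1\le i\le d-1),\quad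 y^+_j=Y^+_j,\quad z=Z^+_1\prod_{j=2}^m(Z^+_j)^{b_{j,d}},$$ and the open subset $\left(\bigcup_{\sigma\in\widetilde\Sigma}\mathbf U(\Sigma^-)_\sigma\right)/G^-\subset V^-$ is identified with $\widetilde V\times\mathbf C^\times$ by $$x^-_i=X^-_i\prod_{j=2}^n(W^-_j)^{c_{j,i}+c_{1,i}c_{j,d}}\ (1\le i\le d-1),\quad y^-_j=Y^-_j,\quad w=W^-_1\prod_{j=2}^n(W^-_j)^{-c_{j,d}}.$$ Here $(x^\pm_1,\ldots,x^\pm_{d-1},y^\pm_1,\ldots,y^\pm_\rho)$ are homogeneous coordinates of $\widetilde V$ corresponding to $\mathbf e_1,\ldots,\mathbf e_{d-1},\mathbf a_1,\ldots,\mathbf a_\rho$, and $z,w\in\mathbf C^\times$. *)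

theory Defs
  imports "HOL-Complex_Analysis.Complex_Analysis" "HOL-Algebra.Coset"
begin

section \<open>Spaces with functions\<close>

text \<open>Varieties and complex manifolds are both modelled as a topological space together with,
  for every open set, the complex-valued functions on it that are regular (respectively
  holomorphic). \<open>funs X W\<close> is only meaningful for open \<open>W\<close>; its members are total HOL functions
  whose values outside \<open>W\<close> are irrelevant.\<close>

record 'a fspace =
  top_of :: "'a topology"
  funs :: "'a set \<Rightarrow> ('a \<Rightarrow> complex) set"

abbreviation points :: "'a fspace \<Rightarrow> 'a set" where
  "points X \<equiv> topspace (top_of X)"

definition morphism :: "'a fspace \<Rightarrow> 'b fspace \<Rightarrow> ('a \<Rightarrow> 'b) \<Rightarrow> bool" where
  "morphism X Y f \<longleftrightarrow> continuous_map (top_of X) (top_of Y) f \<and>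
     (\<forall>W g. openin (top_of Y) W \<longrightarrow> g \<in> funs Y W \<longrightarrow> g \<circ> f \<in> funs X {x \<in> points X. f x \<in> W})"

definition isomorphism_pair :: "'a fspace \<Rightarrow> 'b fspace \<Rightarrow> ('a \<Rightarrow> 'b) \<Rightarrow> ('b \<Rightarrow> 'a) \<Rightarrow> bool" where
  "isomorphism_pair X Y f g \<longleftrightarrow> morphism X Y f \<and> morphism Y X g \<and>
     (\<forall>x \<in> points X. g (f x) = x) \<and> (\<forall>y \<in> points Y. f (g y) = y)"

definition isomorphism :: "'a fspace \<Rightarrow> 'b fspace \<Rightarrow> ('a \<Rightarrow> 'b) \<Rightarrow> bool" where
  "isomorphism X Y f \<longleftrightarrow> (\<exists>g. isomorphism_pair X Y f g)"

definition isomorphic :: "'a fspace \<Rightarrow> 'b fspace \<Rightarrow> bool" where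
  "isomorphic X Y \<longleftrightarrow> (\<exists>f. isomorphism X Y f)"

text \<open>The functions on a subset are those that are locally restrictions of functions of the
  ambient space; this serves for open subsets as well as for closed ones (fibers).\<close>

definition subspace_of :: "'a fspace \<Rightarrow> 'a set \<Rightarrow> 'a fspace" where
  "subspace_of X S =
     \<lparr>top_of = subtopology (top_of X) S,
      funs = (\<lambda>W. {f. \<forall>x\<in>W. \<exists>W' g. openin (top_of X) W' \<and> x \<in> W' \<and> g \<in> funs X W' \<and>
                        (\<forall>y \<in> W \<inter> W'. f y = g y)})\<rparr>"

definition quotient_space :: "'a fspace \<Rightarrow> ('a \<Rightarrow> 'b) \<Rightarrow> 'b fspace" where
  "quotient_space X q =
     \<lparr>top_of = topology (\<lambda>W. W \<subseteq> q ` points X \<and> openin (top_of X) {x \<in> points X. q x \<in> W}),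
      funs = (\<lambda>W. {f. f \<circ> q \<in> funs X {x \<in> points X. q x \<in> W}})\<rparr>"

definition sum_space :: "'a fspace \<Rightarrow> 'b fspace \<Rightarrow> ('a + 'b) fspace" where
  "sum_space X Y =
     \<lparr>top_of = topology (\<lambda>W. openin (top_of X) (Inl -` W) \<and> openin (top_of Y) (Inr -` W)),
      funs = (\<lambda>W. {f. f \<circ> Inl \<in> funs X (Inl -` W) \<and> f \<circ> Inr \<in> funs Y (Inr -` W)})\<rparr>"

text \<open>Patching of \<open>X\<close> and \<open>Y\<close> along the graph \<open>R\<close> of a map between open subsets.\<close>

definition patch_class :: "('a \<times> 'b) set \<Rightarrow> 'a + 'b \<Rightarrow> ('a + 'b) set" where
  "patch_class R z =
     (let S = {(Inl x, Inr y) | x y. (x, y) \<in> R} in (S \<union> S\<inverse>)\<^sup>* `` {z})"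

definition patch :: "'a fspace \<Rightarrow> 'b fspace \<Rightarrow> ('a \<times> 'b) set \<Rightarrow> ('a + 'b) set fspace" where
  "patch X Y R = quotient_space (sum_space X Y) (patch_class R)"

lemma istopology_quotient_space:
  "istopology (\<lambda>W. W \<subseteq> q ` topspace T \<and> openin T {x \<in> topspace T. q x \<in> W})"
  unfolding istopology_def
proof (intro conjI allI impI)
  fix S S' assume "S \<subseteq> q ` topspace T \<and> openin T {x \<in> topspace T. q x \<in> S}"
    "S' \<subseteq> q ` topspace T \<and> openin T {x \<in> topspace T. q x \<in> S'}"
  moreover have "{x \<in> topspace T. q x \<in> S \<inter> S'} =
      {x \<in> topspace T. q x \<in> S} \<inter> {x \<in> topspace T. q x \<in> S'}" by auto
  ultimately show "S \<inter> S' \<subseteq> q ` topspace T" "openin T {x \<in> topspace T. q x \<in> S \<inter> S'}" by auto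
next
  fix \<K> assume K: "\<forall>K\<in>\<K>. K \<subseteq> q ` topspace T \<and> openin T {x \<in> topspace T. q x \<in> K}"
  then show "\<Union>\<K> \<subseteq> q ` topspace T" by blast
  have "{x \<in> topspace T. q x \<in> \<Union>\<K>} = \<Union>((\<lambda>K. {x \<in> topspace T. q x \<in> K}) ` \<K>)" by auto
  also have "openin T \<dots>" using K by blast
  finally show "openin T {x \<in> topspace T. q x \<in> \<Union>\<K>}" .
qed

lemma istopology_sum_space:
  "istopology (\<lambda>W. openin T (Inl -` W) \<and> openin T' (Inr -` W))"
  unfolding istopology_def
proof (intro conjI allI impI)
  fix \<K> assume K: "\<forall>K\<in>\<K>. openin T (Inl -` K) \<and> openin T' (Inr -` K)"
  show "openin T (Inl -` \<Union>\<K>)" unfolding vimage_Union by (rule openin_Union) (use K in blast)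
  show "openin T' (Inr -` \<Union>\<K>)" unfolding vimage_Union by (rule openin_Union) (use K in blast)
qed (simp_all add: vimage_Int openin_Int)

section \<open>Complex affine space: holomorphic and regular functions\<close>

definition coord_space :: "'i set \<Rightarrow> ('i \<Rightarrow> complex) set" where
  "coord_space I = {x. \<forall>i. i \<notin> I \<longrightarrow> x i = 0}"

text \<open>For finite \<open>I\<close>, the subspace topology inherited from the product topology on
  \<open>'i \<Rightarrow> complex\<close> is the Euclidean one. Holomorphic means continuous and holomorphic in each
  variable separately.\<close>

definition affine_an :: "'i set \<Rightarrow> ('i \<Rightarrow> complex) fspace" where
  "affine_an I =
     \<lparr>top_of = top_of_set (coord_space I),
      funs = (\<lambda>W. {f. continuous_on W f \<and>
                (\<forall>x\<in>W. \<forall>i\<in>I. (\<lambda>z. f (x(i := z))) field_differentiable at (x i))})\<rparr>"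

definition complex_line :: "complex fspace" where
  "complex_line = \<lparr>top_of = euclidean, funs = (\<lambda>W. {f. f holomorphic_on W})\<rparr>"

text \<open>Products of complex manifolds, with the same convention of continuous, separately
  holomorphic functions.\<close>

definition prod_an :: "'a fspace \<Rightarrow> 'b fspace \<Rightarrow> ('a \<times> 'b) fspace" where
  "prod_an X Y =
     \<lparr>top_of = prod_topology (top_of X) (top_of Y),
      funs = (\<lambda>W. {f.
        continuous_map (subtopology (prod_topology (top_of X) (top_of Y)) W) euclidean f \<and>
        (\<forall>y \<in> points Y. (\<lambda>x. f (x, y)) \<in> funs X {x \<in> points X. (x, y) \<in> W}) \<and>
        (\<forall>x \<in> points X. (\<lambda>y. f (x, y)) \<in> funs Y {y \<in> points Y. (x, y) \<in> W})})\<rparr>"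

inductive_set poly_funs :: "'i set \<Rightarrow> (('i \<Rightarrow> complex) \<Rightarrow> complex) set" for I :: "'i set" where
  const: "(\<lambda>x. c) \<in> poly_funs I"
| coord: "i \<in> I \<Longrightarrow> (\<lambda>x. x i) \<in> poly_funs I"
| add: "p \<in> poly_funs I \<Longrightarrow> q \<in> poly_funs I \<Longrightarrow> (\<lambda>x. p x + q x) \<in> poly_funs I"
| mult: "p \<in> poly_funs I \<Longrightarrow> q \<in> poly_funs I \<Longrightarrow> (\<lambda>x. p x * q x) \<in> poly_funs I"

definition zariski_open :: "'i set \<Rightarrow> ('i \<Rightarrow> complex) set \<Rightarrow> bool" where
  "zariski_open I W \<longleftrightarrow> (\<exists>P \<subseteq> poly_funs I. W = {x \<in> coord_space I. \<exists>p\<in>P. p x \<noteq> 0})"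

definition affine_alg :: "'i set \<Rightarrow> ('i \<Rightarrow> complex) fspace" where
  "affine_alg I =
     \<lparr>top_of = topology (zariski_open I),
      funs = (\<lambda>W. {f. \<forall>x\<in>W. \<exists>p \<in> poly_funs I. \<exists>q \<in> poly_funs I. q x \<noteq> 0 \<and>
                (\<forall>y\<in>W. q y \<noteq> 0 \<longrightarrow> f y = p y / q y)})\<rparr>"

lemma istopology_zariski_open: "istopology (zariski_open I)"
  unfolding istopology_def
proof (intro conjI allI impI)
  fix S T assume "zariski_open I S" "zariski_open I T"
  then obtain P Q where P: "P \<subseteq> poly_funs I" "S = {x \<in> coord_space I. \<exists>p\<in>P. p x \<noteq> 0}"
    and Q: "Q \<subseteq> poly_funs I" "T = {x \<in> coord_space I. \<exists>q\<in>Q. q x \<noteq> 0}"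
    unfolding zariski_open_def by auto
  let ?R = "(\<lambda>(p, q) x. p x * q x) ` (P \<times> Q)"
  have "p \<in> P \<Longrightarrow> q \<in> Q \<Longrightarrow> (\<lambda>x. p x * q x) \<in> poly_funs I" for p q
    using P(1) Q(1) poly_funs.mult[of p I q] by blast
  then have "?R \<subseteq> poly_funs I" by auto
  moreover have "S \<inter> T = {x \<in> coord_space I. \<exists>r\<in>?R. r x \<noteq> 0}"
    unfolding P(2) Q(2) by auto
  ultimately show "zariski_open I (S \<inter> T)"
    unfolding zariski_open_def by (intro exI[of _ ?R] conjI)
next
  fix \<K> assume K: "\<forall>K\<in>\<K>. zariski_open I K"
  define P where "P = {p \<in> poly_funs I. \<exists>K\<in>\<K>. \<forall>x\<in>coord_space I. p x \<noteq> 0 \<longrightarrow> x \<in> K}"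
  have "x \<in> coord_space I \<and> (\<exists>p\<in>P. p x \<noteq> 0)" if KK: "K \<in> \<K>" and x: "x \<in> K" for x K
  proof -
    obtain Q where Q: "Q \<subseteq> poly_funs I" "K = {x \<in> coord_space I. \<exists>p\<in>Q. p x \<noteq> 0}"
      using K KK unfolding zariski_open_def by blast
    obtain p where p: "p \<in> Q" "p x \<noteq> 0" "x \<in> coord_space I" using x unfolding Q(2) by blast
    have "\<forall>y\<in>coord_space I. p y \<noteq> 0 \<longrightarrow> y \<in> K" using p(1) unfolding Q(2) by blast
    then have "p \<in> P" unfolding P_def using p(1) Q(1) KK by blast
    then show ?thesis using p by blast
  qed
  then have "\<Union>\<K> = {x \<in> coord_space I. \<exists>p\<in>P. p x \<noteq> 0}"
    unfolding P_def by blast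
  moreover have "P \<subseteq> poly_funs I" unfolding P_def by blast
  ultimately show "zariski_open I (\<Union>\<K>)" unfolding zariski_open_def by blast
qed

text \<open>The product of varieties does not carry the product topology: its basic open sets are the
  non-vanishing loci of functions \<open>(x, y) \<mapsto> \<Sum>i<n. f i x * g i y\<close>, and its regular functions are
  locally quotients of such functions.\<close>

definition tensor_funs ::
  "'a fspace \<Rightarrow> 'b fspace \<Rightarrow> 'a set \<Rightarrow> 'b set \<Rightarrow> ('a \<times> 'b \<Rightarrow> complex) set" where
  "tensor_funs X Y U V =
     {(\<lambda>(x, y). \<Sum>i<n. f i x * g i y) | (n::nat) f g. \<forall>i<n. f i \<in> funs X U \<and> g i \<in> funs Y V}"

definition prod_alg :: "'a fspace \<Rightarrow> 'b fspace \<Rightarrow> ('a \<times> 'b) fspace" where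
  "prod_alg X Y =
     \<lparr>top_of = topology_generated_by {{z \<in> U \<times> V. r z \<noteq> 0} | U V r.
        openin (top_of X) U \<and> openin (top_of Y) V \<and> r \<in> tensor_funs X Y U V},
      funs = (\<lambda>W. {h. \<forall>z\<in>W. \<exists>U V. openin (top_of X) U \<and> openin (top_of Y) V \<and> z \<in> U \<times> V \<and>
        (\<exists>r \<in> tensor_funs X Y U V. \<exists>s \<in> tensor_funs X Y U V. r z \<noteq> 0 \<and>
           (\<forall>z' \<in> W \<inter> (U \<times> V). r z' \<noteq> 0 \<longrightarrow> h z' = s z' / r z'))})\<rparr>"

text \<open>Projective space with homogeneous coordinates indexed by the finite type \<open>'n\<close>, of dimension
  \<open>CARD('n) - 1\<close>.\<close>

definition proj_space :: "('n::finite \<Rightarrow> complex) set fspace" where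
  "proj_space = quotient_space (subspace_of (affine_alg UNIV) (UNIV - {\<lambda>_. 0}))
     (\<lambda>x. {(\<lambda>i. c * x i) | c. c \<noteq> 0})"

section \<open>Complex manifolds and complex analytic families\<close>

definition is_chart ::
  "nat \<Rightarrow> 'a fspace \<Rightarrow> 'a set \<Rightarrow> ('a \<Rightarrow> nat \<Rightarrow> complex) \<Rightarrow> ((nat \<Rightarrow> complex) \<Rightarrow> 'a) \<Rightarrow> bool" where
  "is_chart n X W \<phi> \<psi> \<longleftrightarrow> openin (top_of X) W \<and>
     (\<exists>S. openin (top_of (affine_an {..<n})) S \<and>
          isomorphism_pair (subspace_of X W) (subspace_of (affine_an {..<n}) S) \<phi> \<psi>)"

definition complex_manifold :: "nat \<Rightarrow> 'a fspace \<Rightarrow> bool" where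
  "complex_manifold n X \<longleftrightarrow> Hausdorff_space (top_of X) \<and> second_countable (top_of X) \<and>
     (\<forall>x \<in> points X. \<exists>W \<phi> \<psi>. x \<in> W \<and> is_chart n X W \<phi> \<psi>)"

text \<open>For a holomorphic map to the complex line, surjectivity of the differential at a point means
  that some partial derivative in a chart does not vanish.\<close>

definition submersion_to_line :: "nat \<Rightarrow> 'a fspace \<Rightarrow> ('a \<Rightarrow> complex) \<Rightarrow> bool" where
  "submersion_to_line n X f \<longleftrightarrow>
     (\<forall>x \<in> points X. \<exists>W \<phi> \<psi>. x \<in> W \<and> is_chart n X W \<phi> \<psi> \<and>
        (\<exists>i<n. deriv (\<lambda>z. f (\<psi> ((\<phi> x)(i := z)))) (\<phi> x i) \<noteq> 0))"

text \<open>The total space \<open>X\<close> with projection \<open>p\<close> is a family whose fiber over \<open>t\<close> is the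
  \<open>n\<close>-dimensional \<open>F t\<close>.\<close>

definition complex_analytic_family ::
  "nat \<Rightarrow> 'a fspace \<Rightarrow> ('a \<Rightarrow> complex) \<Rightarrow> (complex \<Rightarrow> 'b fspace) \<Rightarrow> bool" where
  "complex_analytic_family n X p F \<longleftrightarrow>
     complex_manifold (n + 1) X \<and>
     morphism X complex_line p \<and>
     proper_map (top_of X) euclidean p \<and>
     submersion_to_line (n + 1) X p \<and>
     p ` points X = UNIV \<and>
     (\<forall>t. isomorphic (subspace_of X {x \<in> points X. p x = t}) (F t))"

section \<open>Fans\<close>

text \<open>\<open>int^'d\<close> is the lattice, \<open>real^'d\<close> its scalar extension, and \<open>L\<close> a sublattice.\<close>

definition real_vec :: "int^'d \<Rightarrow> real^'d" where
  "real_vec v = (\<chi> i. real_of_int (v $ i))"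

definition cone_gen :: "(int^'d::finite) set \<Rightarrow> (real^'d) set" where
  "cone_gen S = convex_cone hull (real_vec ` S)"

definition lattice_basis :: "(int^'d::finite) set \<Rightarrow> (int^'d) set \<Rightarrow> bool" where
  "lattice_basis L B \<longleftrightarrow> finite B \<and> L = {(\<Sum>v\<in>B. c v *s v) | c. True} \<and>
     (\<forall>c. (\<Sum>v\<in>B. c v *s v) = 0 \<longrightarrow> (\<forall>v\<in>B. c v = 0))"

definition nonsingular_cone :: "(int^'d::finite) set \<Rightarrow> (real^'d) set \<Rightarrow> bool" where
  "nonsingular_cone L \<sigma> \<longleftrightarrow> (\<exists>B S. lattice_basis L B \<and> S \<subseteq> B \<and> \<sigma> = cone_gen S)"

definition fan :: "(int^'d::finite) set \<Rightarrow> (real^'d) set set \<Rightarrow> bool" where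
  "fan L \<Sigma> \<longleftrightarrow> finite \<Sigma> \<and> \<Sigma> \<noteq> {} \<and> (\<forall>\<sigma>\<in>\<Sigma>. nonsingular_cone L \<sigma>) \<and>
     (\<forall>\<sigma>\<in>\<Sigma>. \<forall>\<tau>. \<tau> face_of \<sigma> \<longrightarrow> \<tau> \<noteq> {} \<longrightarrow> \<tau> \<in> \<Sigma>) \<and>
     (\<forall>\<sigma>\<in>\<Sigma>. \<forall>\<tau>\<in>\<Sigma>. \<sigma> \<inter> \<tau> face_of \<sigma> \<and> \<sigma> \<inter> \<tau> face_of \<tau>)"

definition complete_fan :: "(int^'d::finite) set \<Rightarrow> (real^'d) set set \<Rightarrow> bool" where
  "complete_fan L \<Sigma> \<longleftrightarrow> fan L \<Sigma> \<and> \<Union>\<Sigma> = span (real_vec ` L)"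

text \<open>Primitivity is taken in \<open>int^'d\<close>; for the sublattices used below, which are cut out by the
  vanishing of coordinates, this agrees with primitivity in the sublattice.\<close>

definition primitive_vec :: "int^'d::finite \<Rightarrow> bool" where
  "primitive_vec v \<longleftrightarrow> v \<noteq> 0 \<and> (\<forall>k w. v = k *s w \<longrightarrow> \<bar>k\<bar> = 1)"

definition gens :: "(real^'d) set set \<Rightarrow> (int^'d::finite) set" where
  "gens \<Sigma> = {v. primitive_vec v \<and> cone_gen {v} \<in> \<Sigma>}"

definition cone_gens :: "(real^'d) set set \<Rightarrow> (real^'d) set \<Rightarrow> (int^'d::finite) set" where
  "cone_gens \<Sigma> \<sigma> = {v \<in> gens \<Sigma>. real_vec v \<in> \<sigma>}"

section \<open>Toric varieties in homogeneous coordinates\<close>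

text \<open>The Picard group of the nonsingular toric variety of \<open>\<Sigma>\<close>: torus-invariant divisors modulo
  the divisors of characters. Characters of the torus of a sublattice cut out by coordinates are
  restrictions of elements of the dual of \<open>int^'d\<close>, so the same formula applies to fans in such a
  sublattice.\<close>

definition torus_divisors :: "(real^'d) set set \<Rightarrow> (int^'d::finite \<Rightarrow> int) monoid" where
  "torus_divisors \<Sigma> = \<lparr>carrier = {D. \<forall>v. v \<notin> gens \<Sigma> \<longrightarrow> D v = 0},
     mult = (\<lambda>D E v. D v + E v), one = (\<lambda>v. 0)\<rparr>"

definition character_divisors :: "(real^'d) set set \<Rightarrow> (int^'d::finite \<Rightarrow> int) set" where
  "character_divisors \<Sigma> =
     {(\<lambda>v. if v \<in> gens \<Sigma> then \<Sum>i\<in>UNIV. m $ i * v $ i else 0) | m :: int^'d. True}"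

definition Pic :: "(real^'d) set set \<Rightarrow> (int^'d::finite \<Rightarrow> int) set monoid" where
  "Pic \<Sigma> = torus_divisors \<Sigma> Mod character_divisors \<Sigma>"

definition divisor_class :: "(real^'d) set set \<Rightarrow> int^'d::finite \<Rightarrow> (int^'d \<Rightarrow> int) set" where
  "divisor_class \<Sigma> v =
     character_divisors \<Sigma> #>\<^bsub>torus_divisors \<Sigma>\<^esub> (\<lambda>u. if u = v then 1 else 0)"

definition complex_units :: "complex monoid" where
  "complex_units = \<lparr>carrier = UNIV - {0}, mult = (*), one = 1\<rparr>"

definition hc_orbit :: "(real^'d) set set \<Rightarrow> (int^'d::finite \<Rightarrow> complex) \<Rightarrow> (int^'d \<Rightarrow> complex) set" where
  "hc_orbit \<Sigma> X = {(\<lambda>v. g (divisor_class \<Sigma> v) * X v) | g. g \<in> hom (Pic \<Sigma>) complex_units}"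

definition hc_chart ::
  "(real^'d) set set \<Rightarrow> (real^'d) set \<Rightarrow> (int^'d::finite \<Rightarrow> complex) set" where
  "hc_chart \<Sigma> \<sigma> = {X \<in> coord_space (gens \<Sigma>). (\<Prod>v \<in> gens \<Sigma> - cone_gens \<Sigma> \<sigma>. X v) \<noteq> 0}"

definition hc_domain :: "(real^'d) set set \<Rightarrow> (int^'d::finite \<Rightarrow> complex) set" where
  "hc_domain \<Sigma> = (\<Union>\<sigma>\<in>\<Sigma>. hc_chart \<Sigma> \<sigma>)"

type_synonym 'd tpoint = "(int^'d \<Rightarrow> complex) set"

definition toric_alg :: "(real^'d) set set \<Rightarrow> 'd::finite tpoint fspace" where
  "toric_alg \<Sigma> =
     quotient_space (subspace_of (affine_alg (gens \<Sigma>)) (hc_domain \<Sigma>)) (hc_orbit \<Sigma>)"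

definition toric_an :: "(real^'d) set set \<Rightarrow> 'd::finite tpoint fspace" where
  "toric_an \<Sigma> =
     quotient_space (subspace_of (affine_an (gens \<Sigma>)) (hc_domain \<Sigma>)) (hc_orbit \<Sigma>)"

definition prime_divisor :: "(real^'d) set set \<Rightarrow> int^'d::finite \<Rightarrow> 'd tpoint set" where
  "prime_divisor \<Sigma> v = hc_orbit \<Sigma> ` {X \<in> hc_domain \<Sigma>. X v = 0}"

section \<open>Toric bundles over the projective line\<close>

text \<open>Both for a toric variety and for a projective space, a point is a set of homogeneous
  coordinate vectors, the open torus consists of the points with nonvanishing coordinates, and
  its group law is multiplication of representatives.\<close>

definition torus_mult :: "('i \<Rightarrow> complex) set \<Rightarrow> ('i \<Rightarrow> complex) set \<Rightarrow> ('i \<Rightarrow> complex) set" where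
  "torus_mult A B = {(\<lambda>i. x i * y i) | x y. x \<in> A \<and> y \<in> B}"

definition torus_part :: "('i \<Rightarrow> complex) set fspace \<Rightarrow> 'i set \<Rightarrow> ('i \<Rightarrow> complex) set set" where
  "torus_part X I = {A \<in> points X. \<forall>x\<in>A. \<forall>i\<in>I. x i \<noteq> 0}"

definition toric_morphism_to_P1 ::
  "(real^'d) set set \<Rightarrow> ('d::finite tpoint \<Rightarrow> (bool \<Rightarrow> complex) set) \<Rightarrow> bool" where
  "toric_morphism_to_P1 \<Delta> p \<longleftrightarrow> morphism (toric_alg \<Delta>) proj_space p \<and>
     p ` torus_part (toric_alg \<Delta>) (gens \<Delta>) \<subseteq> torus_part proj_space UNIV \<and>
     (\<forall>A \<in> torus_part (toric_alg \<Delta>) (gens \<Delta>). \<forall>B \<in> torus_part (toric_alg \<Delta>) (gens \<Delta>).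
        p (torus_mult A B) = torus_mult (p A) (p B))"

text \<open>The toric variety of \<open>\<Delta>\<close> with the toric morphism \<open>p\<close> is a locally trivial bundle whose
  fiber is the toric variety of \<open>\<Delta>'\<close>; \<open>\<Delta>\<close> is a fan in the lattice \<open>L\<close> and \<open>\<Delta>'\<close> one in \<open>L'\<close>.\<close>

definition toric_bundle_over_P1 ::
  "(int^'d) set \<Rightarrow> (real^'d) set set \<Rightarrow> (int^'d) set \<Rightarrow> (real^'d) set set \<Rightarrow>
     ('d::finite tpoint \<Rightarrow> (bool \<Rightarrow> complex) set) \<Rightarrow> bool" where
  "toric_bundle_over_P1 L \<Delta> L' \<Delta>' p \<longleftrightarrow>
     complete_fan L \<Delta> \<and> complete_fan L' \<Delta>' \<and> toric_morphism_to_P1 \<Delta> p \<and>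
     (\<forall>s \<in> points proj_space. \<exists>W h. openin (top_of proj_space) W \<and> s \<in> W \<and>
        isomorphism (subspace_of (toric_alg \<Delta>) {x \<in> points (toric_alg \<Delta>). p x \<in> W})
                    (prod_alg (subspace_of proj_space W) (toric_alg \<Delta>')) h \<and>
        (\<forall>x \<in> points (toric_alg \<Delta>). p x \<in> W \<longrightarrow> fst (h x) = p x))"

section \<open>The patching\<close>

text \<open>The index type \<open>'d\<close> stands for \<open>{1, \<dots>, d}\<close> with \<open>d = CARD('d)\<close>; throughout, \<open>l\<close> is the last
  index \<open>d\<close> and \<open>i1\<close> is the index \<open>1\<close>. The vectors \<open>axis i 1\<close> with \<open>i \<noteq> l\<close> are
  \<open>e_1, \<dots>, e_{d-1}\<close>.\<close>

definition hyperplane_lattice :: "'d \<Rightarrow> (int^'d::finite) set" where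
  "hyperplane_lattice l = {v. v $ l = 0}"

definition basis_vecs :: "'d \<Rightarrow> (int^'d::finite) set" where
  "basis_vecs l = {axis i 1 | i. i \<noteq> l}"

definition upper_fan :: "'d \<Rightarrow> (real^'d::finite) set set \<Rightarrow> (real^'d) set set" where
  "upper_fan l \<Sigma> = {\<sigma>\<in>\<Sigma>. \<forall>x\<in>\<sigma>. x $ l \<ge> 0}"

definition lower_fan :: "'d \<Rightarrow> (real^'d::finite) set set \<Rightarrow> (real^'d) set set" where
  "lower_fan l \<Sigma> = {\<sigma>\<in>\<Sigma>. \<forall>x\<in>\<sigma>. x $ l \<le> 0}"

text \<open>The homogeneous coordinate vector of the \<open>(d-1)\<close>-fold with entry \<open>x i\<close> at the \<open>i\<close>-th basis
  vector and entry \<open>y j\<close> at \<open>a j\<close>.\<close>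

definition tilde_coords ::
  "'d \<Rightarrow> nat \<Rightarrow> (nat \<Rightarrow> int^'d) \<Rightarrow> ('d \<Rightarrow> complex) \<Rightarrow> (nat \<Rightarrow> complex) \<Rightarrow> (int^'d::finite \<Rightarrow> complex)" where
  "tilde_coords l r a x y = (THE H. (\<forall>i. i \<noteq> l \<longrightarrow> H (axis i 1) = x i) \<and>
     (\<forall>j\<in>{1..r}. H (a j) = y j) \<and> (\<forall>v. v \<notin> basis_vecs l \<union> a ` {1..r} \<longrightarrow> H v = 0))"

text \<open>Formulas in homogeneous coordinates are evaluated at an arbitrary representative of a point;
  the resulting point does not depend on it.\<close>

definition representative :: "'a set \<Rightarrow> 'a" where
  "representative A = (SOME x. x \<in> A)"

text \<open>The open subset of the toric variety of \<open>\<Sigma>'\<close> formed by the charts of the cones of the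
  subfan \<open>\<Sigma>t\<close>.\<close>

definition tilde_part :: "(real^'d) set set \<Rightarrow> (real^'d) set set \<Rightarrow> 'd::finite tpoint set" where
  "tilde_part \<Sigma>' \<Sigma>t = hc_orbit \<Sigma>' ` (\<Union>\<sigma>\<in>\<Sigma>t. hc_chart \<Sigma>' \<sigma>)"

definition plus_ident ::
  "'d \<Rightarrow> (real^'d) set set \<Rightarrow> nat \<Rightarrow> nat \<Rightarrow> (nat \<Rightarrow> int^'d) \<Rightarrow> (nat \<Rightarrow> int^'d) \<Rightarrow>
     'd::finite tpoint \<Rightarrow> 'd tpoint \<times> complex" where
  "plus_ident l \<Sigma>t r m a b p = (let X = representative p in
     (hc_orbit \<Sigma>t (tilde_coords l r a
        (\<lambda>i. X (axis i 1) * (\<Prod>j=2..m. X (b j) powi (b j $ i)))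
        (\<lambda>j. X (a j))),
      X (b 1) * (\<Prod>j=2..m. X (b j) powi (b j $ l))))"

definition minus_ident ::
  "'d \<Rightarrow> (real^'d) set set \<Rightarrow> nat \<Rightarrow> nat \<Rightarrow> (nat \<Rightarrow> int^'d) \<Rightarrow> (nat \<Rightarrow> int^'d) \<Rightarrow>
     'd::finite tpoint \<Rightarrow> 'd tpoint \<times> complex" where
  "minus_ident l \<Sigma>t r n a c p = (let X = representative p in
     (hc_orbit \<Sigma>t (tilde_coords l r a
        (\<lambda>i. X (axis i 1) * (\<Prod>j=2..n. X (c j) powi (c j $ i + c 1 $ i * c j $ l)))
        (\<lambda>j. X (a j))),
      X (c 1) * (\<Prod>j=2..n. X (c j) powi (- (c j $ l)))))"

definition patching_map ::
  "'d \<Rightarrow> 'd \<Rightarrow> (real^'d) set set \<Rightarrow> nat \<Rightarrow> (nat \<Rightarrow> int^'d) \<Rightarrow> (nat \<Rightarrow> int^'d) \<Rightarrow> nat \<Rightarrow> complex \<Rightarrow>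
     'd::finite tpoint \<times> complex \<Rightarrow> 'd tpoint \<times> complex" where
  "patching_map i1 l \<Sigma>t r a c k t = (\<lambda>(p, w). let H = representative p in
     (hc_orbit \<Sigma>t (tilde_coords l r a
        (\<lambda>i. if i = i1 then H (axis i1 1) * w powi (c 1 $ i1) + t * H (a 1) * w ^ k
             else H (axis i 1) * w powi (c 1 $ i))
        (\<lambda>j. H (a j))),
      1 / w))"

definition patching_relation ::
  "'d \<Rightarrow> 'd \<Rightarrow> (real^'d) set set \<Rightarrow> (real^'d) set set \<Rightarrow> nat \<Rightarrow> nat \<Rightarrow> nat \<Rightarrow>
     (nat \<Rightarrow> int^'d) \<Rightarrow> (nat \<Rightarrow> int^'d) \<Rightarrow> (nat \<Rightarrow> int^'d) \<Rightarrow> nat \<Rightarrow> complex \<Rightarrow>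
     ('d::finite tpoint \<times> 'd tpoint) set" where
  "patching_relation i1 l \<Sigma> \<Sigma>t r m n a b c k t =
     {(p, q). p \<in> tilde_part (upper_fan l \<Sigma>) \<Sigma>t \<and> q \<in> tilde_part (lower_fan l \<Sigma>) \<Sigma>t \<and>
        plus_ident l \<Sigma>t r m a b p =
          patching_map i1 l \<Sigma>t r a c k t (minus_ident l \<Sigma>t r n a c q)}"

definition patched_variety ::
  "'d \<Rightarrow> 'd \<Rightarrow> (real^'d) set set \<Rightarrow> (real^'d) set set \<Rightarrow> nat \<Rightarrow> nat \<Rightarrow> nat \<Rightarrow>
     (nat \<Rightarrow> int^'d) \<Rightarrow> (nat \<Rightarrow> int^'d) \<Rightarrow> (nat \<Rightarrow> int^'d) \<Rightarrow> nat \<Rightarrow> complex \<Rightarrow>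
     ('d::finite tpoint + 'd tpoint) set fspace" where
  "patched_variety i1 l \<Sigma> \<Sigma>t r m n a b c k t =
     patch (toric_an (upper_fan l \<Sigma>)) (toric_an (lower_fan l \<Sigma>))
       (patching_relation i1 l \<Sigma> \<Sigma>t r m n a b c k t)"

definition total_space ::
  "'d \<Rightarrow> 'd \<Rightarrow> (real^'d) set set \<Rightarrow> (real^'d) set set \<Rightarrow> nat \<Rightarrow> nat \<Rightarrow> nat \<Rightarrow>
     (nat \<Rightarrow> int^'d) \<Rightarrow> (nat \<Rightarrow> int^'d) \<Rightarrow> (nat \<Rightarrow> int^'d) \<Rightarrow> nat \<Rightarrow>
     (('d::finite tpoint \<times> complex) + ('d tpoint \<times> complex)) set fspace" where
  "total_space i1 l \<Sigma> \<Sigma>t r m n a b c k =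
     patch (prod_an (toric_an (upper_fan l \<Sigma>)) complex_line)
           (prod_an (toric_an (lower_fan l \<Sigma>)) complex_line)
       {((p, t), (q, t)) | p q t. (p, q) \<in> patching_relation i1 l \<Sigma> \<Sigma>t r m n a b c k t}"

definition family_parameter :: "(('a \<times> complex) + ('b \<times> complex)) set \<Rightarrow> complex" where
  "family_parameter C = (case representative C of Inl (p, t) \<Rightarrow> t | Inr (q, t) \<Rightarrow> t)"

end

theory Submission
 imports Defs "HOL-Computational_Algebra.Fundamental_Theorem_Algebra"
begin

text \<open>By Osgood's lemma, a continuous separately holomorphic function is holomorphic along
 holomorphic curves, so maps between the spaces involved can be tested on curves. The locus
 $\tilde V\times C^*$ in $V^+$ (resp. $V^-$) is where a global height function $z$ (resp. $w$) does
 not vanish. The patching map is a shear $x_1\mapsto x_1w^c+ty_1w^k$ in homogeneous coordinates; it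
 is well defined on $\tilde V$ because the first coordinate of $a_1$ is $-1$ and that of every
 generator other than $e_1$ and $a_1$ is $0$ (a Demazure root). For a bundle over $P^1$ this follows
 from a rational function with divisor $D_{e_1}-D_{a_1}$, which must be a multiple of a character. For
 $P^{d-1}$, a torus-invariant line is moved by transvections in a connected family, along which it can
 neither begin nor cease to meet an invariant divisor; as some member of the family meets it, so does
 the line, and this leaves room for only one generator besides the $e_i$.

 The family is proper because the sets $|z|\le 1$ and $|w|\le 1$ are compact and cover every fiber,
 and Hausdorff because $z=1/w$ on the overlap. For $t=0$ the gluing is the one of $V^+$ and $V^-$
 inside $V$.\<close>

section \<open>Complex analysis on spaces with functions: curves, quotients, products,
  gluing\<close>

section \<open>Continuous separately holomorphic functions\<close>

text \<open>The varieties are given by homogeneous coordinates modulo a group and are then glued, so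
  no construction hands out local coordinates. Regularity is therefore tested on holomorphic curves:
  the class of spaces whose functions are determined by such curves is stable under open subspaces,
  quotients, sums and products, and a map on a quotient is checked by a formula on its source.

  The second obstacle is that the hypothesis on the hypersurface is an abstract isomorphism of
  varieties, which need not respect tori. The deformation uses of it only the first coordinates of
  the generators, and these have to be read off from regular functions along explicit rational
  curves; the generator across the wall opposite \<open>e_1\<close> supplies the value -1.

  The two halves of the fan are treated at once by a sign \<open>eps\<close>, and the prescribed
  identifications with the product are one normalisation of homogeneous coordinates with respect to
  a lattice basis.\<close>

lemma diagonal_holomorphic:
 fixes F :: "complex => complex => complex"
 assumes N: "open N"
  and cont: "continuous_on (N \<times> N) (%(z, w). F z w)"
  and hol1: "\<And>w. w : N ==> (%z. F z w) holomorphic_on N"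
  and hol2: "\<And>z. z : N ==> F z holomorphic_on N"
 shows "(%z. F z z) holomorphic_on N" unfolding holomorphic_on_open[OF N]
proof
 fix z0 assume z0: "z0 : N"
 obtain r where r: "r > 0" "cball z0 r \<subseteq> N" using N z0 open_contains_cball by blast
 \<comment> \<open>The increment along the diagonal is \<open>F w w - F z0 w\<close> plus
   \<open>F z0 w - F z0 z0\<close>. By partial fractions, Cauchy's formula in the first variable
   turns the first difference quotient into the integral of \<open>g w\<close>, which has a limit
   because \<open>F\<close> is jointly continuous; the second is an ordinary derivative.\<close>
 define g where "g = (%w \<zeta>. F \<zeta> w / ((\<zeta> - w) * (\<zeta> - z0)))"
 have contg: "continuous_on (ball z0 r \<times> sphere z0 r) (%(w, \<zeta>). g w \<zeta>)"
 proof -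
  have "continuous_on (ball z0 r \<times> sphere z0 r) (%p. (%(z, w). F z w) (snd p, fst p))"
   by (rule continuous_on_compose2[OF cont]) (use r in \<open>auto intro!: continuous_intros\<close>)
  hence "continuous_on (ball z0 r \<times> sphere z0 r) (%(w, \<zeta>). F \<zeta> w)" by (simp add: split_beta)
  thus ?thesis unfolding g_def split_beta by (intro continuous_intros) (auto simp: dist_norm norm_minus_commute)
 qed
 have ulim: "uniform_limit (sphere z0 r) g (g z0) (at z0)" unfolding uniform_limit_iff
 proof (intro allI impI)
  fix e :: real assume e: "e > 0"
  obtain X0 where X0: "z0 : X0" "open X0"
   "ALL w:X0 \<inter> ball z0 r. ALL t:sphere z0 r. dist (g w t) (g z0 t) \<le> e/2"
   by (rule continuous_on_prod_compactE[OF contg, of z0 "e/2"]) (use r e in auto)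
  have "open (X0 \<inter> ball z0 r)" "z0 : X0 \<inter> ball z0 r" using X0 r by auto
  hence "\<forall>\<^sub>F w in at z0. w : X0 \<inter> ball z0 r" by (metis eventually_at_topological)
  thus "\<forall>\<^sub>F w in at z0. ALL t:sphere z0 r. dist (g w t) (g z0 t) < e"
  proof eventually_elim
   case (elim w)
   hence "dist (g w t) (g z0 t) \<le> e / 2" if "t : sphere z0 r" for t using X0(3) that by blast
   thus ?case using e by force
  qed
 qed
 have holc: "(%z. F z w) holomorphic_on cball z0 r" if "w : N" for w
  using hol1[OF that] r holomorphic_on_subset by blast
 have intg: "(g w has_contour_integral 2 * of_real pi * \<i> * ((F w w - F z0 w) / (w - z0))) (circlepath z0 r)"
  if w: "w : ball z0 r" "w ~= z0" for w
 proof -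
  have wN: "w : N" using w r by auto
  have a: "((%\<zeta>. F \<zeta> w / (\<zeta> - v)) has_contour_integral 2 * of_real pi * \<i> * F v w) (circlepath z0 r)"
   if "v : ball z0 r" for v
  proof (rule Cauchy_integral_circlepath)
   show "continuous_on (cball z0 r) (%z. F z w)" by (rule holomorphic_on_imp_continuous_on[OF holc[OF wN]])
   show "(%z. F z w) holomorphic_on ball z0 r" by (rule holomorphic_on_subset[OF holc[OF wN] ball_subset_cball])
   show "norm (v - z0) < r" using that by (simp add: dist_norm norm_minus_commute)
  qed
  have "((%\<zeta>. (F \<zeta> w / (\<zeta> - w) - F \<zeta> w / (\<zeta> - z0)) / (w - z0)) has_contour_integral
    (2 * of_real pi * \<i> * F w w - 2 * of_real pi * \<i> * F z0 w) / (w - z0)) (circlepath z0 r)"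
   by (intro has_contour_integral_div has_contour_integral_diff a) (use w r in auto)
  hence "((%\<zeta>. (F \<zeta> w / (\<zeta> - w) - F \<zeta> w / (\<zeta> - z0)) / (w - z0)) has_contour_integral
    2 * of_real pi * \<i> * ((F w w - F z0 w) / (w - z0))) (circlepath z0 r)" by (simp add: algebra_simps)
  moreover have "(F \<zeta> w / (\<zeta> - w) - F \<zeta> w / (\<zeta> - z0)) / (w - z0) = g w \<zeta>"
   if "\<zeta> : path_image (circlepath z0 r)" for \<zeta>
  proof -
   have "\<zeta> ~= w" "\<zeta> ~= z0" using that w r by auto
   hence "F \<zeta> w / (\<zeta> - w) - F \<zeta> w / (\<zeta> - z0) = F \<zeta> w * (w - z0) / ((\<zeta> - w) * (\<zeta> - z0))"
    by (simp add: divide_simps) (simp add: algebra_simps)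
   thus ?thesis using w unfolding g_def by simp
  qed
  ultimately show ?thesis by (rule has_contour_integral_eq)
 qed
 have evb: "\<forall>\<^sub>F w in at z0. w : ball z0 r & w ~= z0"
  using r unfolding eventually_at_topological by (intro exI[of _ "ball z0 r"]) auto
 have "((%w. contour_integral (circlepath z0 r) (g w)) \<longlongrightarrow> contour_integral (circlepath z0 r) (g z0)) (at z0)"
  by (rule contour_integral_uniform_limit_circlepath[OF _ ulim])
   (use evb r in \<open>auto elim!: eventually_mono intro: has_contour_integral_integrable[OF intg]\<close>)
 hence "((%w. contour_integral (circlepath z0 r) (g w) / (2 * of_real pi * \<i>)) \<longlongrightarrow>
   contour_integral (circlepath z0 r) (g z0) / (2 * of_real pi * \<i>)) (at z0)" by (intro tendsto_intros) auto
 moreover have "\<forall>\<^sub>F w in at z0. contour_integral (circlepath z0 r) (g w) / (2 * of_real pi * \<i>) = (F w w - F z0 w) / (w - z0)"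
  using evb by eventually_elim (simp add: contour_integral_unique[OF intg])
 ultimately have l1: "((%w. (F w w - F z0 w) / (w - z0)) \<longlongrightarrow>
   contour_integral (circlepath z0 r) (g z0) / (2 * of_real pi * \<i>)) (at z0)" by (rule Lim_transform_eventually)
 obtain d where "(F z0 has_field_derivative d) (at z0)" using hol2[OF z0] z0 N holomorphic_on_open by blast
 hence l2: "((%w. (F z0 w - F z0 z0) / (w - z0)) \<longlongrightarrow> d) (at z0)"
  by (simp add: has_field_derivative_iff)
 show "EX f'. ((%z. F z z) has_field_derivative f') (at z0)" unfolding has_field_derivative_iff
  using tendsto_add[OF l1 l2] by (auto simp: add_divide_distrib[symmetric])
qed

lemma openin_coord_spaceD:
 assumes "openin (top_of_set (coord_space I)) W" "finite K"
  and "continuous_on S m" "open S" "\<And>s. s : S ==> m s : coord_space I"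
 shows "open {s : S. m s : W}"
proof -
 obtain T where T: "open T" "W = coord_space I \<inter> T" using assms(1) by (auto simp: openin_open)
 have "{s : S. m s : W} = S \<inter> m -` T" using assms(5) T by auto
 thus ?thesis using continuous_open_preimage[OF assms(3,4) T(1)] by simp
qed

text \<open>Induction on the set of moving coordinates: a new coordinate receives its own variable
  \<open>w\<close> while the others follow \<open>z\<close>, and the function of two variables so
  obtained is restricted to its diagonal. Osgood's lemma enters only in this form.\<close>

lemma separately_holomorphic_along:
 fixes f :: "('i => complex) => complex" and gm :: "'i => complex => complex"
 assumes W: "openin (top_of_set (coord_space I)) W"
  and f: "f : funs (affine_an I) W"
  and J: "finite J" "J \<subseteq> I"
  and gm: "\<And>i. i : J ==> gm i holomorphic_on D"
  and D: "open D" and im: "\<And>z. z : D ==> (%i. if i : J then gm i z else x i) : W"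
 shows "(%z. f (%i. if i : J then gm i z else x i)) holomorphic_on D" using J gm D im
proof (induction J arbitrary: x D rule: finite_induct)
 case empty
 thus ?case by simp
next
 case (insert j J)
 have fc: "continuous_on W f" and
  fs: "\<And>x i. x : W ==> i : I ==> (%z. f (x(i := z))) field_differentiable at (x i)"
  using f by (auto simp: affine_an_def)
 define m where "m = (%z w i. if i = j then gm j w else if i : J then gm i z else x i)"
 define F where "F = (%z w. f (m z w))"
 have m_diag: "m z z = (%i. if i : insert j J then gm i z else x i)" for z by (auto simp: m_def)
 have xI: "x i = 0" if "i ~: I" "z : D" for i z
 proof -
  have "(%i. if i : insert j J then gm i z else x i) : coord_space I"
   using insert.prems(4)[OF that(2)] openin_imp_subset[OF W] by blast
  hence "(%i. if i : insert j J then gm i z else x i) i = 0"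
   using that(1) unfolding coord_space_def mem_Collect_eq by blast
  moreover have "i ~: insert j J" using insert.prems(1) that(1) by blast
  ultimately show ?thesis by simp
 qed
 have jI: "j : I" using insert.prems by simp
 have cm: "continuous_on (D \<times> D) (%p. m (fst p) (snd p))"
 proof (rule continuous_on_coordinatewise_then_product)
  fix i
  have c: "continuous_on D (gm k)" if "k : insert j J" for k
   by (rule holomorphic_on_imp_continuous_on[OF insert.prems(2)[OF that]])
  have c1: "continuous_on (D \<times> D) (%p. gm k (fst p))" if "k : insert j J" for k
   by (rule continuous_on_compose2[OF c[OF that] continuous_on_fst[OF continuous_on_id]]) auto
  have c2: "continuous_on (D \<times> D) (%p. gm k (snd p))" if "k : insert j J" for k
   by (rule continuous_on_compose2[OF c[OF that] continuous_on_snd[OF continuous_on_id]]) auto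
  show "continuous_on (D \<times> D) (%p. m (fst p) (snd p) i)"
   unfolding m_def using c1[of i] c2[of i] by (cases "i = j"; cases "i : J") simp_all
 qed
 have mI: "m z w : coord_space I" if "z : D" for z w
  using xI[OF _ that] insert.prems(1) by (auto simp: m_def coord_space_def)
 have op: "open {p : D \<times> D. m (fst p) (snd p) : W}"
  by (rule openin_coord_spaceD[OF W _ cm, of "{}"]) (use mI \<open>open D\<close> open_Times in auto)
 \<comment> \<open>Off the diagonal \<open>m z w\<close> may leave \<open>W\<close>; openness yields
   a small square around each diagonal point on which both variables can vary freely.\<close>
 have hol: "EX N. open N & z0 : N & (%z. F z z) holomorphic_on N" if z0: "z0 : D" for z0
 proof -
  have "(z0, z0) : {p : D \<times> D. m (fst p) (snd p) : W}" using z0 insert.prems(4)[OF z0] m_diag[of z0] by simp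
  then obtain A B where AB: "open A" "open B" "(z0, z0) : A \<times> B"
   "A \<times> B \<subseteq> {p : D \<times> D. m (fst p) (snd p) : W}" by (rule open_prod_elim[OF op])
  define N where "N = A \<inter> B"
  have N: "open N" "z0 : N" using AB(1-3) by (auto simp: N_def)
  have "(z, w) : {p : D \<times> D. m (fst p) (snd p) : W}" if "z : N" "w : N" for z w
   using AB(4) that unfolding N_def by blast
  hence mW: "\<And>z w. z : N ==> w : N ==> m z w : W" and ND: "N \<subseteq> D" by auto
  note N = N ND
  have "(%z. F z z) holomorphic_on N"
  proof (rule diagonal_holomorphic[OF N(1), where F = F])
   have "continuous_on (N \<times> N) (%p. f (m (fst p) (snd p)))"
   proof (rule continuous_on_compose2[OF fc, of "N \<times> N" "%p. m (fst p) (snd p)"])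
    show "continuous_on (N \<times> N) (%p. m (fst p) (snd p))"
     by (rule continuous_on_subset[OF cm]) (use N(3) in auto)
   qed (use mW in auto)
   thus "continuous_on (N \<times> N) (%(z, w). F z w)" by (simp add: F_def split_beta)
  next
   fix w assume w: "w : N"
   have mx: "m z w = (%i. if i : J then gm i z else (x(j := gm j w)) i)" for z using insert.hyps by (auto simp: m_def)
   have "(%z. f (%i. if i : J then gm i z else (x(j := gm j w)) i)) holomorphic_on N"
   proof (rule insert.IH)
    show "gm i holomorphic_on N" if "i : J" for i using insert.prems(2)[of i] that N(3) holomorphic_on_subset by blast
    show "(%i. if i : J then gm i z else (x(j := gm j w)) i) : W" if "z : N" for z using mW[OF that w] unfolding mx .
   qed (use insert.prems(1) N(1) in auto)
   thus "(%z. F z w) holomorphic_on N" unfolding F_def mx .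
  next
   fix z assume z: "z : N"
   show "F z holomorphic_on N" unfolding holomorphic_on_def
   proof
    fix w assume w: "w : N"
    have mu: "m z v = (m z w)(j := gm j v)" for v by (auto simp: m_def)
    have "(%\<zeta>. f ((m z w)(j := \<zeta>))) field_differentiable at (m z w j)" by (rule fs[OF mW[OF z w] jI])
    moreover have "m z w j = gm j w" by (simp add: m_def)
    moreover have "gm j field_differentiable at w"
     using insert.prems(2)[of j] insert.prems(3) w N(3) holomorphic_on_imp_differentiable_at by blast
    ultimately have "((%\<zeta>. f ((m z w)(j := \<zeta>))) \<circ> gm j) field_differentiable at w"
     by (intro field_differentiable_compose) simp_all
    moreover have "(%\<zeta>. f ((m z w)(j := \<zeta>))) \<circ> gm j = F z" unfolding F_def comp_def by (metis mu)
    ultimately show "F z field_differentiable at w within N" using field_differentiable_at_within by metis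
   qed
  qed
  thus ?thesis using N by blast
 qed
 have "(%z. F z z) holomorphic_on D" unfolding holomorphic_on_def
 proof
  fix z assume "z : D"
  then obtain N where "open N" "z : N" "(%z. F z z) holomorphic_on N" using hol by blast
  thus "(%z. F z z) field_differentiable at z within D"
   using holomorphic_on_imp_differentiable_at field_differentiable_at_within by blast
 qed
 thus ?case unfolding F_def m_diag .
qed

section \<open>Holomorphic curves determine the structure\<close>

abbreviation (input) "opn X \<equiv> openin (top_of X)"

definition curve :: "'a fspace => complex set => (complex => 'a) => bool" where
 "curve X D gm \<longleftrightarrow> open D & continuous_map (top_of_set D) (top_of X) gm &
   (ALL W g. opn X W --> g : funs X W --> (g \<circ> gm) holomorphic_on {z : D. gm z : W})"

text \<open>A stand-in for a manifold structure that makes sense before any chart is known, so it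
  can be carried through quotients and gluings. Nothing is lost on affine space, where it holds by
  Osgood's lemma.\<close>

definition curved :: "'a fspace => bool" where
 "curved X \<longleftrightarrow> (ALL W f. opn X W -->
   (f : funs X W \<longleftrightarrow> continuous_map (subtopology (top_of X) W) euclidean f &
    (ALL D gm. curve X D gm --> gm ` D \<subseteq> W --> (f \<circ> gm) holomorphic_on D)))"

lemma curve_in_points: "curve X D gm ==> z : D ==> gm z : points X" unfolding curve_def continuous_map_def by auto

lemma curve_open: "curve X D gm ==> open D"
 and curve_continuous: "curve X D gm ==> continuous_map (top_of_set D) (top_of X) gm"
 and curve_holomorphic: "curve X D gm ==> opn X W ==> g : funs X W ==>
   (g \<circ> gm) holomorphic_on {z : D. gm z : W}" by (simp_all add: curve_def)

lemma morphism_continuous: "morphism X Y f ==> continuous_map (top_of X) (top_of Y) f"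
 and morphism_funs: "morphism X Y f ==> opn Y W ==> g : funs Y W ==>
   g \<circ> f : funs X {x : points X. f x : W}" by (simp_all add: morphism_def)

lemma morphism_preimage:
 "morphism X Y f ==> opn Y W ==> opn X {x : points X. f x : W}"
 by (rule openin_continuous_map_preimage[OF morphism_continuous])

lemma curve_preimage_open:
 assumes "curve X D gm" "opn X W"
 shows "open {z : D. gm z : W}" using openin_continuous_map_preimage[of "top_of_set D" "top_of X" gm W] assms
 by (auto simp: curve_def openin_open_eq)

lemma curve_restrict:
 assumes "curve X D gm" "open E" "E \<subseteq> D"
 shows "curve X E gm" unfolding curve_def
proof (intro conjI allI impI)
 show "continuous_map (top_of_set E) (top_of X) gm"
  by (rule continuous_map_from_subtopology_mono[OF curve_continuous[OF assms(1)] assms(3)])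
 fix W g assume "opn X W" "g : funs X W"
 hence "(g \<circ> gm) holomorphic_on {z : D. gm z : W}" by (rule curve_holomorphic[OF assms(1)])
 thus "(g \<circ> gm) holomorphic_on {z : E. gm z : W}" by (rule holomorphic_on_subset) (use assms in auto)
qed (use assms in auto)

lemma curve_morphism:
 assumes "curve X D gm" "morphism X Y f"
 shows "curve Y D (f \<circ> gm)" unfolding curve_def
proof (intro conjI allI impI)
 show "open D" using assms by (simp add: curve_def)
 show "continuous_map (top_of_set D) (top_of Y) (f \<circ> gm)"
  by (rule continuous_map_compose[OF curve_continuous[OF assms(1)] morphism_continuous[OF assms(2)]])
 fix W g assume W: "opn Y W" and g: "g : funs Y W"
 have "opn X {x : points X. f x : W}" by (rule morphism_preimage[OF assms(2) W])
 moreover have "g \<circ> f : funs X {x : points X. f x : W}" by (rule morphism_funs[OF assms(2) W g])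
 ultimately have "((g \<circ> f) \<circ> gm) holomorphic_on {z : D. gm z : {x : points X. f x : W}}"
  by (rule curve_holomorphic[OF assms(1)])
 moreover have "{z : D. gm z : {x : points X. f x : W}} = {z : D. (f \<circ> gm) z : W}"
  using curve_in_points[OF assms(1)] by auto
 ultimately show "(g \<circ> (f \<circ> gm)) holomorphic_on {z : D. (f \<circ> gm) z : W}" by (simp add: comp_assoc)
qed

lemma curved_continuous:
 "curved X ==> opn X W ==> f : funs X W ==>
   continuous_map (subtopology (top_of X) W) euclidean f" unfolding curved_def by blast

lemma curved_holomorphic:
 "curved X ==> opn X W ==> f : funs X W ==> curve X D gm ==> gm ` D \<subseteq> W ==>
   (f \<circ> gm) holomorphic_on D" unfolding curved_def by blast

lemma curvedI:
 "curved X ==> opn X W ==> continuous_map (subtopology (top_of X) W) euclidean f ==>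
   (\<And>D gm. curve X D gm ==> gm ` D \<subseteq> W ==> (f \<circ> gm) holomorphic_on D) ==> f : funs X W"
 unfolding curved_def by blast

lemma curved_const: "curved X ==> opn X W ==> (%x. c) : funs X W" by (rule curvedI) (auto simp: comp_def)

lemma curved_cong:
 assumes "curved X" "opn X W" "f : funs X W" "\<And>x. x : W ==> f x = g x"
 shows "g : funs X W"
proof (rule curvedI[OF assms(1,2)])
 show "continuous_map (subtopology (top_of X) W) euclidean g"
  by (rule continuous_map_eq[OF curved_continuous[OF assms(1,2,3)]]) (use assms(4) in auto)
 fix D gm assume c: "curve X D gm" "gm ` D \<subseteq> W"
 show "(g \<circ> gm) holomorphic_on D"
  by (rule holomorphic_transform[OF curved_holomorphic[OF assms(1,2,3) c]]) (use assms(4) c(2) in auto)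
qed

lemma holomorphic_on_local:
 assumes "\<And>z. z : D ==> EX N. open N & z : N & f holomorphic_on N"
 shows "f holomorphic_on D" unfolding holomorphic_on_def
proof
 fix z assume "z : D"
 then obtain N where "open N" "z : N" "f holomorphic_on N" using assms by blast
 thus "f field_differentiable at z within D"
  using holomorphic_on_imp_differentiable_at field_differentiable_at_within by blast
qed

text \<open>Continuity and holomorphy along curves are both local, so the functions form a sheaf;
  the record \<open>fspace\<close> by itself does not ask for this.\<close>

lemma curved_local:
 assumes X: "curved X" and W: "opn X W"
  and loc: "\<And>x. x : W ==> EX W' g. opn X W' & x : W' & g : funs X W' &
    (ALL y:W \<inter> W'. f y = g y)"
 shows "f : funs X W"
proof (rule curvedI[OF X W])
 have Ws: "topspace (subtopology (top_of X) W) = W" using W openin_subset by fastforce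
 show "continuous_map (subtopology (top_of X) W) euclidean f" unfolding continuous_map_def
 proof (intro conjI allI impI)
  fix U :: "complex set" assume U: "openin euclidean U"
  show "openin (subtopology (top_of X) W) {x : topspace (subtopology (top_of X) W). f x : U}" unfolding Ws
  proof (subst openin_subopen, clarify)
   fix x assume x: "x : W" "f x : U"
   obtain W' g where g: "opn X W'" "x : W'" "g : funs X W'" "ALL y:W \<inter> W'. f y = g y"
    using loc[OF x(1)] by blast
   have Ws': "topspace (subtopology (top_of X) W') = W'" using g(1) openin_subset by fastforce
   have "openin (subtopology (top_of X) W') {y : W'. g y : U}"
    using openin_continuous_map_preimage[OF curved_continuous[OF X g(1) g(3)] U] unfolding Ws' .
   hence "opn X {y : W'. g y : U}" using g(1) openin_open_subtopology by blast
   hence "openin (subtopology (top_of X) W) (W \<inter> {y : W'. g y : U})" by (metis inf_commute openin_subtopology)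
   thus "EX T. openin (subtopology (top_of X) W) T & x : T & T \<subseteq> {x : W. f x : U}"
    using x g by (intro exI[of _ "W \<inter> {y : W'. g y : U}"]) auto
  qed
 qed auto
 fix D gm assume c: "curve X D gm" and im: "gm ` D \<subseteq> W"
 show "(f \<circ> gm) holomorphic_on D"
 proof (rule holomorphic_on_local)
  fix z assume z: "z : D"
  obtain W' g where g: "opn X W'" "gm z : W'" "g : funs X W'" "ALL y:W \<inter> W'. f y = g y"
   using loc[of "gm z"] z im by blast
  define N where "N = {z : D. gm z : W'}"
  have N: "open N" "z : N" using curve_preimage_open[OF c g(1)] z g(2) by (auto simp: N_def)
  have "(g \<circ> gm) holomorphic_on N" using c g(1,3) unfolding curve_def N_def by blast
  moreover have "(g \<circ> gm) y = (f \<circ> gm) y" if "y : N" for y using that g(4) im by (auto simp: N_def)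
  ultimately have "(f \<circ> gm) holomorphic_on N" using holomorphic_cong by metis
  thus "EX N. open N & z : N & (f \<circ> gm) holomorphic_on N" using N by blast
 qed
qed

lemma curved_restrict:
 assumes "curved X" "opn X W" "opn X W'" "W' \<subseteq> W" "f : funs X W"
 shows "f : funs X W'" by (rule curved_local[OF assms(1,3)]) (use assms in blast)

text \<open>Between such spaces the condition on pulled back functions becomes one on curves, which
  is easy to verify for explicit formulas.\<close>

lemma morphismI:
 assumes "curved X" "curved Y" "continuous_map (top_of X) (top_of Y) f"
  and "\<And>D gm. curve X D gm ==> curve Y D (f \<circ> gm)"
 shows "morphism X Y f" unfolding morphism_def
proof (intro conjI allI impI)
 fix W g assume W: "opn Y W" and g: "g : funs Y W"
 let ?V = "{x : points X. f x : W}"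
 have V: "opn X ?V" using assms(3) W openin_continuous_map_preimage by blast
 show "g \<circ> f : funs X ?V"
 proof (rule curvedI[OF assms(1) V])
  have "continuous_map (subtopology (top_of X) ?V) (subtopology (top_of Y) W) f"
   using assms(3) by (auto simp: continuous_map_in_subtopology continuous_map_from_subtopology)
  thus "continuous_map (subtopology (top_of X) ?V) euclidean (g \<circ> f)"
   using curved_continuous[OF assms(2) W g] continuous_map_compose by blast
  fix D gm assume c: "curve X D gm" "gm ` D \<subseteq> ?V"
  have "(g \<circ> (f \<circ> gm)) holomorphic_on D"
   by (rule curved_holomorphic[OF assms(2) W g assms(4)[OF c(1)]]) (use c in auto)
  thus "(g \<circ> f \<circ> gm) holomorphic_on D" by (simp add: comp_assoc)
 qed
qed (use assms in auto)

lemma morphism_compose: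
 assumes "morphism X Y f" "morphism Y Z g"
 shows "morphism X Z (g \<circ> f)" unfolding morphism_def
proof (intro conjI allI impI)
 show "continuous_map (top_of X) (top_of Z) (g \<circ> f)"
  by (rule continuous_map_compose[OF morphism_continuous[OF assms(1)] morphism_continuous[OF assms(2)]])
 fix W h assume W: "opn Z W" "h : funs Z W"
 have "(h \<circ> g) \<circ> f : funs X {x : points X. f x : {y : points Y. g y : W}}"
  by (rule morphism_funs[OF assms(1) morphism_preimage[OF assms(2) W(1)] morphism_funs[OF assms(2) W]])
 moreover have "{x : points X. f x : {y : points Y. g y : W}} = {x : points X. (g \<circ> f) x : W}"
  using assms(1) unfolding morphism_def continuous_map_def by auto
 ultimately show "h \<circ> (g \<circ> f) : funs X {x : points X. (g \<circ> f) x : W}" by (simp add: comp_assoc)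
qed

lemma morphism_in: "morphism X Y f ==> x : points X ==> f x : points Y"
 unfolding morphism_def continuous_map_def by auto

lemma morphism_cong:
 assumes "curved X" "curved Y" "morphism X Y f" "\<And>x. x : points X ==> f x = g x"
 shows "morphism X Y g"
proof (rule morphismI[OF assms(1,2)])
 show "continuous_map (top_of X) (top_of Y) g" using assms(3,4) continuous_map_eq unfolding morphism_def by blast
 fix D gm assume c: "curve X D gm"
 have fc: "curve Y D (f \<circ> gm)" using c assms(3) curve_morphism by blast
 have eq: "(f \<circ> gm) z = (g \<circ> gm) z" if "z : D" for z using curve_in_points[OF c that] assms(4) by simp
 show "curve Y D (g \<circ> gm)" unfolding curve_def
 proof (intro conjI allI impI)
  show "open D" using c by (simp add: curve_def)
  show "continuous_map (top_of_set D) (top_of Y) (g \<circ> gm)"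
   by (rule continuous_map_eq[of _ _ "f \<circ> gm"]) (use fc eq in \<open>auto simp: curve_def\<close>)
  fix W h assume "opn Y W" "h : funs Y W"
  hence "(h \<circ> (f \<circ> gm)) holomorphic_on {z : D. (f \<circ> gm) z : W}"
   using fc unfolding curve_def by blast
  moreover have "{z : D. (f \<circ> gm) z : W} = {z : D. (g \<circ> gm) z : W}" using eq by auto
  ultimately have "(h \<circ> (f \<circ> gm)) holomorphic_on {z : D. (g \<circ> gm) z : W}" by simp
  thus "(h \<circ> (g \<circ> gm)) holomorphic_on {z : D. (g \<circ> gm) z : W}"
   by (rule holomorphic_transform) (use eq in auto)
 qed
qed

subsection \<open>Basic spaces\<close>

lemma top_of_complex_line [simp]: "top_of complex_line = euclidean"
 and funs_complex_line: "funs complex_line W = {f. f holomorphic_on W}" by (simp_all add: complex_line_def)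

lemma curve_complex_line: "curve complex_line D gm \<longleftrightarrow> open D & gm holomorphic_on D"
proof
 assume c: "curve complex_line D gm"
 hence "(id \<circ> gm) holomorphic_on {z : D. gm z : UNIV}"
  by (rule curve_holomorphic) (auto simp: funs_complex_line holomorphic_on_id)
 thus "open D & gm holomorphic_on D" using c by (simp add: curve_def)
next
 assume a: "open D & gm holomorphic_on D"
 show "curve complex_line D gm" unfolding curve_def
 proof (intro conjI allI impI)
  fix W g assume "g : funs complex_line W"
  thus "(g \<circ> gm) holomorphic_on {z : D. gm z : W}"
   using a by (auto simp: funs_complex_line intro!: holomorphic_on_compose_gen[of _ _ _ W]
     intro: holomorphic_on_subset)
 qed (use a holomorphic_on_imp_continuous_on in auto)
qed

lemma curved_complex_line: "curved complex_line" unfolding curved_def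
proof (intro allI impI iffI conjI)
 fix W f assume W: "opn complex_line W" and f: "f : funs complex_line W"
 show "continuous_map (subtopology (top_of complex_line) W) euclidean f"
  using f holomorphic_on_imp_continuous_on by (auto simp: funs_complex_line)
 fix D gm assume "curve complex_line D gm" "gm ` D \<subseteq> W"
 thus "(f \<circ> gm) holomorphic_on D"
  using f by (auto simp: curve_complex_line funs_complex_line intro!: holomorphic_on_compose_gen[of _ _ _ W])
next
 fix W f assume W: "opn complex_line W"
  and f: "continuous_map (subtopology (top_of complex_line) W) euclidean f &
    (ALL D gm. curve complex_line D gm --> gm ` D \<subseteq> W --> (f \<circ> gm) holomorphic_on D)"
 have "curve complex_line W id" using W by (simp add: curve_complex_line holomorphic_on_id)
 moreover have "id ` W \<subseteq> W" by simp
 ultimately have "(f \<circ> id) holomorphic_on W" using f by blast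
 thus "f : funs complex_line W" by (simp add: funs_complex_line)
qed

lemma top_of_affine_an [simp]: "top_of (affine_an I) = top_of_set (coord_space I)" by (simp add: affine_an_def)

lemma coord_fun_affine_an: "i : I ==> (%x. x i) : funs (affine_an I) W"
proof -
 assume "i : I"
 have "(%z. (x(j := z)) i) field_differentiable at (x j)" for x :: "'a => complex" and j
  by (cases "i = j") (auto simp: field_differentiable_ident field_differentiable_const)
 moreover have "continuous_on W (%x. x i)" by (rule continuous_on_product_then_coordinatewise) (rule continuous_on_id)
 ultimately show ?thesis by (auto simp: affine_an_def)
qed

text \<open>The direction from right to left is Osgood's lemma: functions on affine space are only
  separately holomorphic by definition, and yet may be composed with a curve that moves all
  coordinates at once.\<close>

lemma curve_affine_an:
 fixes gm :: "complex => 'i => complex"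
 assumes "finite I"
 shows "curve (affine_an I) D gm \<longleftrightarrow>
  open D & (ALL z:D. gm z : coord_space I) & (ALL i:I. (%z. gm z i) holomorphic_on D)"
proof
 assume c: "curve (affine_an I) D gm"
 have "(%z. gm z i) holomorphic_on D" if "i : I" for i
 proof -
  have "opn (affine_an I) (coord_space I)" by simp
  hence "((%x. x i) \<circ> gm) holomorphic_on {z : D. gm z : coord_space I}"
   using c coord_fun_affine_an[OF that] unfolding curve_def by blast
  moreover have "{z : D. gm z : coord_space I} = D" using curve_in_points[OF c] by auto
  ultimately show ?thesis by (simp add: comp_def)
 qed
 moreover have "ALL z:D. gm z : coord_space I" using curve_in_points[OF c] by auto
 ultimately show "open D & (ALL z:D. gm z : coord_space I) & (ALL i:I. (%z. gm z i) holomorphic_on D)"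
  using c by (auto simp: curve_def)
next
 assume a: "open D & (ALL z:D. gm z : coord_space I) & (ALL i:I. (%z. gm z i) holomorphic_on D)"
 have g0: "gm z i = 0" if "z : D" "i ~: I" for z i using a that by (auto simp: coord_space_def)
 have cont: "continuous_on D gm"
 proof (rule continuous_on_coordinatewise_then_product)
  fix i show "continuous_on D (%z. gm z i)"
  proof (cases "i : I")
   case True thus ?thesis using a holomorphic_on_imp_continuous_on by blast
  next
   case False
   thus ?thesis using g0 continuous_on_cong[of D D "%z. gm z i" "%z. 0"] by auto
  qed
 qed
 show "curve (affine_an I) D gm" unfolding curve_def
 proof (intro conjI allI impI)
  show "continuous_map (top_of_set D) (top_of (affine_an I)) gm" using cont a by auto
  fix W f assume W: "opn (affine_an I) W" and f: "f : funs (affine_an I) W"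
  let ?E = "{z : D. gm z : W}"
  have W': "openin (top_of_set (coord_space I)) W" using W by simp
  have E: "open ?E" by (rule openin_coord_spaceD[OF W' _ cont, of "{}"]) (use a in auto)
  have eq: "(%i. if i : I then gm z i else 0) = gm z" if "z : D" for z using g0[OF that] by auto
  have "(%z. f (%i. if i : I then gm z i else (%_. 0) i)) holomorphic_on ?E"
  proof (rule separately_holomorphic_along[OF W' f assms order_refl _ E])
   show "(%z. gm z i) holomorphic_on ?E" if "i : I" for i using a that by (auto intro: holomorphic_on_subset)
  qed (use eq in auto)
  thus "(f \<circ> gm) holomorphic_on ?E" by (rule holomorphic_transform) (use eq in auto)
 qed (use a in auto)
qed

text \<open>Moving a single coordinate is a holomorphic curve, so the test on curves contains
  separate holomorphy.\<close>

lemma curved_affine_an: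
 fixes I :: "'i set"
 assumes "finite I"
 shows "curved (affine_an I)" unfolding curved_def
proof (intro allI impI iffI conjI)
 fix W and f :: "('i => complex) => complex"
 assume W: "opn (affine_an I) W" and f: "f : funs (affine_an I) W"
 have Ws: "W \<subseteq> coord_space I" using W openin_imp_subset by auto
 thus "continuous_map (subtopology (top_of (affine_an I)) W) euclidean f"
  using f by (auto simp: affine_an_def subtopology_subtopology Int_absorb1)
 fix D gm assume c: "curve (affine_an I) D gm" "gm ` D \<subseteq> W"
 hence "(f \<circ> gm) holomorphic_on {z : D. gm z : W}" using W f unfolding curve_def by blast
 moreover have "{z : D. gm z : W} = D" using c by auto
 ultimately show "(f \<circ> gm) holomorphic_on D" by simp
next
 fix W and f :: "('i => complex) => complex"
 assume W: "opn (affine_an I) W"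
  and f: "continuous_map (subtopology (top_of (affine_an I)) W) euclidean f &
    (ALL D gm. curve (affine_an I) D gm --> gm ` D \<subseteq> W --> (f \<circ> gm) holomorphic_on D)"
 have Ws: "W \<subseteq> coord_space I" using W openin_imp_subset by auto
 hence "continuous_on W f" using f by (auto simp: subtopology_subtopology Int_absorb1)
 moreover have "(%z. f (x(i := z))) field_differentiable at (x i)" if x: "x : W" and i: "i : I" for x i
 proof -
  have xi: "x(i := z) : coord_space I" for z using x Ws i by (auto simp: coord_space_def)
  define E where "E = {z : UNIV. x(i := z) : W}"
  have "continuous_on UNIV (%z. if j = i then z else x j)" for j
   by (cases "j = i") (simp_all add: continuous_on_id continuous_on_const)
  hence "continuous_on UNIV (%z j. if j = i then z else x j)" by (rule continuous_on_coordinatewise_then_product)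
  hence cu: "continuous_on UNIV (%z. x(i := z))" by (simp add: fun_upd_def)
  have E: "open E" unfolding E_def by (rule openin_coord_spaceD[OF _ _ cu, of I W "{}"]) (use W xi in auto)
  have "(%z. (x(i := z)) j) holomorphic_on E" for j
   by (cases "j = i") (simp_all add: holomorphic_on_ident holomorphic_on_const)
  hence "curve (affine_an I) E (%z. x(i := z))" using E xi by (auto simp: curve_affine_an[OF assms])
  hence "(f \<circ> (%z. x(i := z))) holomorphic_on E" using f by (auto simp: E_def)
  moreover have "x i : E" using x by (simp add: E_def)
  ultimately show ?thesis using E holomorphic_on_imp_differentiable_at[of _ E "x i"] by (simp add: comp_def)
 qed
 ultimately show "f : funs (affine_an I) W" by (auto simp: affine_an_def)
qed

section \<open>Constructions on spaces with functions\<close>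

subsection \<open>Subspaces\<close>

lemma top_of_subspace [simp]: "top_of (subspace_of X S) = subtopology (top_of X) S" by (simp add: subspace_of_def)

lemma funs_subspace_open:
 assumes "curved X" "opn X W" "W \<subseteq> S"
 shows "funs (subspace_of X S) W = funs X W"
proof
 show "funs X W \<subseteq> funs (subspace_of X S) W" unfolding subspace_of_def using assms(2) by auto
 show "funs (subspace_of X S) W \<subseteq> funs X W"
 proof
  fix f assume "f : funs (subspace_of X S) W"
  hence "ALL x:W. EX W' g. opn X W' & x : W' & g : funs X W' & (ALL y:W \<inter> W'. f y = g y)"
   by (simp add: subspace_of_def)
  thus "f : funs X W" by (intro curved_local[OF assms(1,2)]) blast
 qed
qed

lemma openin_subspace_open:
 "opn X S ==> opn (subspace_of X S) W \<longleftrightarrow> opn X W & W \<subseteq> S"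
 by (simp add: openin_open_subtopology)

lemma points_subspace_open:
 "opn X S ==> points (subspace_of X S) = S" using openin_subset[of "top_of X" S] by auto

lemma curve_subspace:
 assumes "curved X" "opn X S"
 shows "curve (subspace_of X S) D gm \<longleftrightarrow> curve X D gm & gm ` D \<subseteq> S"
proof
 assume c: "curve (subspace_of X S) D gm"
 have cm: "continuous_map (top_of_set D) (top_of X) gm" "gm ` D \<subseteq> S"
  using curve_continuous[OF c] by (auto simp: continuous_map_in_subtopology)
 moreover have "(g \<circ> gm) holomorphic_on {z : D. gm z : W}"
  if W: "opn X W" and g: "g : funs X W" for W g
 proof -
  have o: "opn X (W \<inter> S)" using W assms(2) by blast
  have "g : funs X (W \<inter> S)" by (rule curved_restrict[OF assms(1) W o _ g]) simp
  hence "g : funs (subspace_of X S) (W \<inter> S)" using funs_subspace_open[OF assms(1) o] by simp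
  moreover have "opn (subspace_of X S) (W \<inter> S)" using o assms(2) openin_subspace_open by blast
  ultimately have "(g \<circ> gm) holomorphic_on {z : D. gm z : W \<inter> S}" by (intro curve_holomorphic[OF c])
  moreover have "{z : D. gm z : W \<inter> S} = {z : D. gm z : W}" using cm(2) by auto
  ultimately show ?thesis by simp
 qed
 ultimately show "curve X D gm & gm ` D \<subseteq> S" using curve_open[OF c] by (simp add: curve_def)
next
 assume c: "curve X D gm & gm ` D \<subseteq> S"
 show "curve (subspace_of X S) D gm" unfolding curve_def
 proof (intro conjI allI impI)
  show "open D" using c curve_open by blast
  show "continuous_map (top_of_set D) (top_of (subspace_of X S)) gm"
   using c by (auto simp: continuous_map_in_subtopology curve_def)
  fix W g assume W: "opn (subspace_of X S) W" "g : funs (subspace_of X S) W"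
  hence "opn X W" "W \<subseteq> S" using openin_subspace_open[OF assms(2)] by blast+
  thus "(g \<circ> gm) holomorphic_on {z : D. gm z : W}"
   using W(2) c funs_subspace_open[OF assms(1)] by (intro curve_holomorphic[of X]) auto
 qed
qed

lemma curved_subspace:
 assumes "curved X" "opn X S"
 shows "curved (subspace_of X S)" unfolding curved_def
proof (intro allI impI)
 fix W f assume "opn (subspace_of X S) W"
 hence W: "opn X W" "W \<subseteq> S" using openin_subspace_open[OF assms(2)] by blast+
 have "subtopology (subtopology (top_of X) S) W = subtopology (top_of X) W"
  using W(2) by (simp add: subtopology_subtopology Int_absorb1)
 moreover have "curve (subspace_of X S) D gm & gm ` D \<subseteq> W \<longleftrightarrow> curve X D gm & gm ` D \<subseteq> W" for D gm
  using curve_subspace[OF assms] W(2) by blast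
 ultimately show "f : funs (subspace_of X S) W \<longleftrightarrow>
   continuous_map (subtopology (top_of (subspace_of X S)) W) euclidean f &
   (ALL D gm. curve (subspace_of X S) D gm --> gm ` D \<subseteq> W --> (f \<circ> gm) holomorphic_on D)"
  using funs_subspace_open[OF assms(1) W] assms(1)[unfolded curved_def] W(1) by simp metis
qed

lemma morphism_subspace_incl:
 assumes "curved X" "opn X S"
 shows "morphism (subspace_of X S) X (%x. x)"
proof (rule morphismI[OF curved_subspace[OF assms] assms(1)])
 show "continuous_map (top_of (subspace_of X S)) (top_of X) (%x. x)" by (simp add: continuous_map_from_subtopology)
qed (simp add: curve_subspace[OF assms] comp_def)

text \<open>The set \<open>S\<close> is arbitrary because the target may be a closed fiber of the
  family, whose functions are local restrictions from the total space.\<close>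

lemma morphism_into_subspace:
 assumes "curved X" "morphism X Z f" "f ` points X \<subseteq> S"
 shows "morphism X (subspace_of Z S) f" unfolding morphism_def
proof (intro conjI allI impI)
 show "continuous_map (top_of X) (top_of (subspace_of Z S)) f"
  using assms morphism_continuous by (auto simp: continuous_map_in_subtopology)
 fix W g assume W: "opn (subspace_of Z S) W" and g: "g : funs (subspace_of Z S) W"
 obtain V where V: "opn Z V" "W = V \<inter> S" using W by (auto simp: openin_subtopology)
 let ?U = "{x : points X. f x : W}"
 have "?U = {x : points X. f x : V}" using assms(3) V by auto
 hence U: "opn X ?U" using morphism_preimage[OF assms(2) V(1)] by simp
 show "g \<circ> f : funs X ?U"
 proof (rule curved_local[OF assms(1) U])
  fix x assume x: "x : ?U"
  have "ALL y:W. EX W' h. opn Z W' & y : W' & h : funs Z W' & (ALL y:W \<inter> W'. g y = h y)"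
   using g by (simp add: subspace_of_def)
  then obtain W' h where h: "opn Z W'" "f x : W'" "h : funs Z W'" "ALL y:W \<inter> W'. g y = h y" using x by blast
  show "EX W' ga. opn X W' & x : W' & ga : funs X W' & (ALL y:?U \<inter> W'. (g \<circ> f) y = ga y)"
   by (rule exI[of _ "{x : points X. f x : W'}"], rule exI[of _ "h \<circ> f"])
    (use morphism_preimage[OF assms(2) h(1)] morphism_funs[OF assms(2) h(1,3)] x h(2,4) in auto)
 qed
qed

lemma subspace_subspace:
 assumes "curved X" "opn X S" "opn X T" "T \<subseteq> S"
 shows "morphism (subspace_of X T) (subspace_of (subspace_of X S) T) (%x. x)"
  and "morphism (subspace_of (subspace_of X S) T) (subspace_of X T) (%x. x)"
proof -
 have o: "opn (subspace_of X S) T" using assms openin_subspace_open by blast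
 note c = curved_subspace[OF assms(1,2)] curved_subspace[OF assms(1,3)]
  curved_subspace[OF curved_subspace[OF assms(1,2)] o]
 have eq: "subtopology (subtopology (top_of X) S) T = subtopology (top_of X) T"
  using assms(4) by (simp add: subtopology_subtopology Int_absorb1)
 have ceq: "curve (subspace_of (subspace_of X S) T) D gm \<longleftrightarrow> curve (subspace_of X T) D gm" for D gm
  unfolding curve_subspace[OF c(1) o] curve_subspace[OF assms(1,2)] curve_subspace[OF assms(1,3)]
  using assms(4) by fast
 show "morphism (subspace_of X T) (subspace_of (subspace_of X S) T) (%x. x)"
  by (rule morphismI[OF c(2,3)]) (simp_all add: eq ceq comp_def)
 show "morphism (subspace_of (subspace_of X S) T) (subspace_of X T) (%x. x)"
  by (rule morphismI[OF c(3,2)]) (simp_all add: eq ceq comp_def)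
qed

subsection \<open>Final structures: quotients and sums\<close>

text \<open>The quotient structure along an arbitrary map, isolated from
  \<open>quotient_space\<close> so that orbit maps, their products with a factor, gluings and
  coverings by open embeddings are all instances.\<close>

definition final_map :: "'a fspace => 'b fspace => ('a => 'b) => bool" where
 "final_map E Z \<pi> \<longleftrightarrow> points Z = \<pi> ` points E &
   (ALL W. W \<subseteq> points Z --> opn Z W \<longleftrightarrow> opn E {e : points E. \<pi> e : W}) &
   (ALL W h. opn Z W --> h : funs Z W \<longleftrightarrow> h \<circ> \<pi> : funs E {e : points E. \<pi> e : W})"

lemma final_map_points: "final_map E Z \<pi> ==> points Z = \<pi> ` points E"
 and final_map_openin: "final_map E Z \<pi> ==> W \<subseteq> points Z ==>
   opn Z W \<longleftrightarrow> opn E {e : points E. \<pi> e : W}"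
 and final_map_funs: "final_map E Z \<pi> ==> opn Z W ==>
   h : funs Z W \<longleftrightarrow> h \<circ> \<pi> : funs E {e : points E. \<pi> e : W}"
 by (simp_all add: final_map_def)

lemma final_map_continuous:
 assumes "final_map E Z \<pi>"
 shows "continuous_map (top_of E) (top_of Z) \<pi>" unfolding continuous_map_def
proof (intro conjI allI impI)
 fix U assume U: "opn Z U"
 show "opn E {x : points E. \<pi> x : U}" using final_map_openin[OF assms openin_subset[OF U]] U by simp
qed (simp add: final_map_points[OF assms])

lemma final_map_morphism:
 assumes "final_map E Z \<pi>"
 shows "morphism E Z \<pi>"
 unfolding morphism_def using final_map_continuous[OF assms] final_map_funs[OF assms] by simp

text \<open>Curves of \<open>E\<close> project to curves of \<open>Z\<close>, so a function on
  \<open>Z\<close> that passes the test on all curves has a pullback passing the test on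
  \<open>E\<close>, hence is a function of the quotient. Curves of \<open>Z\<close> are never
  lifted.\<close>

lemma curved_final:
 assumes E: "curved E" and F: "final_map E Z \<pi>"
 shows "curved Z" unfolding curved_def
proof (intro allI impI)
 fix W f assume W: "opn Z W"
 let ?V = "{e : points E. \<pi> e : W}"
 have Ws: "W \<subseteq> points Z" using W openin_subset by blast
 have V: "opn E ?V" using W Ws final_map_openin[OF F] by blast
 have tV: "topspace (subtopology (top_of E) ?V) = ?V" and tW: "topspace (subtopology (top_of Z) W) = W"
  using Ws by auto
 have \<pi>V: "continuous_map (subtopology (top_of E) ?V) (subtopology (top_of Z) W) \<pi>"
  using final_map_continuous[OF F] by (auto simp: continuous_map_in_subtopology continuous_map_from_subtopology)
 show "f : funs Z W \<longleftrightarrow> continuous_map (subtopology (top_of Z) W) euclidean f &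
    (ALL D gm. curve Z D gm --> gm ` D \<subseteq> W --> (f \<circ> gm) holomorphic_on D)"
 proof (intro iffI conjI allI impI)
  assume f: "f : funs Z W"
  hence c: "continuous_map (subtopology (top_of E) ?V) euclidean (f \<circ> \<pi>)"
   using curved_continuous[OF E V] final_map_funs[OF F W] by blast
  show "continuous_map (subtopology (top_of Z) W) euclidean f" unfolding continuous_map_def
  proof (intro conjI allI impI)
   fix U :: "complex set" assume U: "openin euclidean U"
   have "openin (subtopology (top_of E) ?V) {e : ?V. (f \<circ> \<pi>) e : U}"
    using openin_continuous_map_preimage[OF c U] unfolding tV .
   hence "opn E {e : ?V. (f \<circ> \<pi>) e : U}" using V openin_open_subtopology by blast
   moreover have "{e : ?V. (f \<circ> \<pi>) e : U} = {e : points E. \<pi> e : {x : W. f x : U}}" by auto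
   ultimately have "opn Z {x : W. f x : U}" using final_map_openin[OF F, of "{x : W. f x : U}"] Ws by auto
   thus "openin (subtopology (top_of Z) W) {x : topspace (subtopology (top_of Z) W). f x : U}"
    unfolding tW using W openin_open_subtopology by blast
  qed simp
  fix D gm assume c: "curve Z D gm" "gm ` D \<subseteq> W"
  have "(f \<circ> gm) holomorphic_on {z : D. gm z : W}" by (rule curve_holomorphic[OF c(1) W f])
  moreover have "{z : D. gm z : W} = D" using c(2) by auto
  ultimately show "(f \<circ> gm) holomorphic_on D" by simp
 next
  assume f: "continuous_map (subtopology (top_of Z) W) euclidean f &
    (ALL D gm. curve Z D gm --> gm ` D \<subseteq> W --> (f \<circ> gm) holomorphic_on D)"
  have "f \<circ> \<pi> : funs E ?V"
  proof (rule curvedI[OF E V])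
   show "continuous_map (subtopology (top_of E) ?V) euclidean (f \<circ> \<pi>)"
    using f \<pi>V continuous_map_compose by blast
   fix D gm assume c: "curve E D gm" "gm ` D \<subseteq> ?V"
   have "curve Z D (\<pi> \<circ> gm)" by (rule curve_morphism[OF c(1) final_map_morphism[OF F]])
   moreover have "(\<pi> \<circ> gm) ` D \<subseteq> W" using c(2) by auto
   ultimately show "(f \<circ> \<pi> \<circ> gm) holomorphic_on D" using f by (simp add: comp_assoc)
  qed
  thus "f : funs Z W" using final_map_funs[OF F W] by blast
 qed
qed

lemma morphism_final:
 assumes F: "final_map E Z \<pi>" and h: "morphism E Y (h \<circ> \<pi>)"
 shows "morphism Z Y h" unfolding morphism_def
proof (intro conjI allI impI)
 have pre: "opn Z {x : points Z. h x : W}"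
  "{e : points E. \<pi> e : {x : points Z. h x : W}} = {e : points E. (h \<circ> \<pi>) e : W}"
  if "opn Y W" for W
 proof -
  show eq: "{e : points E. \<pi> e : {x : points Z. h x : W}} = {e : points E. (h \<circ> \<pi>) e : W}"
   using final_map_points[OF F] by auto
  have "opn E {e : points E. (h \<circ> \<pi>) e : W}" by (rule morphism_preimage[OF h that])
  thus "opn Z {x : points Z. h x : W}" using final_map_openin[OF F, of "{x : points Z. h x : W}"] eq by simp
 qed
 have "h x : points Y" if "x : points Z" for x using that final_map_points[OF F] morphism_in[OF h] by auto
 thus "continuous_map (top_of Z) (top_of Y) h" unfolding continuous_map_def using pre(1) by blast
 fix W g assume W: "opn Y W" "g : funs Y W"
 show "g \<circ> h : funs Z {x : points Z. h x : W}" unfolding final_map_funs[OF F pre(1)[OF W(1)]] pre(2)[OF W(1)]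
  using morphism_funs[OF h W] by (simp add: comp_assoc)
qed

lemma final_map_restrict:
 assumes E: "curved E" and F: "final_map E Z \<pi>" and S: "opn Z S"
 shows "final_map (subspace_of E {e : points E. \<pi> e : S}) (subspace_of Z S) \<pi>"
proof -
 let ?T = "{e : points E. \<pi> e : S}"
 note Z = curved_final[OF E F]
 have Ss: "S \<subseteq> points Z" using S openin_subset by blast
 have T: "opn E ?T" using S Ss final_map_openin[OF F] by blast
 note p = points_subspace_open[OF T] points_subspace_open[OF S]
 show ?thesis unfolding final_map_def p
 proof (intro conjI allI impI)
  show "S = \<pi> ` ?T" using Ss final_map_points[OF F] by auto
  fix W assume W: "W \<subseteq> S"
  have eq: "{e : ?T. \<pi> e : W} = {e : points E. \<pi> e : W}" using W by auto
  have "opn (subspace_of Z S) W \<longleftrightarrow> opn E {e : points E. \<pi> e : W}"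
   unfolding openin_subspace_open[OF S] using final_map_openin[OF F] W Ss by blast
  also have "\<dots> \<longleftrightarrow> opn (subspace_of E ?T) {e : ?T. \<pi> e : W}"
   unfolding openin_subspace_open[OF T] eq using W by blast
  finally show "opn (subspace_of Z S) W \<longleftrightarrow>
    opn (subspace_of E ?T) {e : ?T. \<pi> e : W}" .
 next
  fix W h assume "opn (subspace_of Z S) W"
  hence W: "opn Z W" "W \<subseteq> S" using openin_subspace_open[OF S] by blast+
  have eq: "{e : ?T. \<pi> e : W} = {e : points E. \<pi> e : W}" using W by auto
  have o: "opn E {e : points E. \<pi> e : W}" using final_map_openin[OF F] W Ss by blast
  have "{e : points E. \<pi> e : W} \<subseteq> ?T" using W by auto
  thus "h : funs (subspace_of Z S) W \<longleftrightarrow> h \<circ> \<pi> : funs (subspace_of E ?T) {e : ?T. \<pi> e : W}"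
   unfolding eq funs_subspace_open[OF Z W]  by (simp only: funs_subspace_open[OF E o] final_map_funs[OF F W(1)])
 qed
qed

lemma top_of_quotient: "opn (quotient_space X q) W \<longleftrightarrow>
  W \<subseteq> q ` points X & opn X {x : points X. q x : W}"
 unfolding quotient_space_def by (simp add: istopology_quotient_space)

lemma points_quotient: "points (quotient_space X q) = q ` points X"
proof
 show "points (quotient_space X q) \<subseteq> q ` points X"
  using top_of_quotient[of X q "points (quotient_space X q)"] by simp
 have "{x : points X. q x : q ` points X} = points X" by auto
 hence "opn (quotient_space X q) (q ` points X)" by (simp add: top_of_quotient)
 thus "q ` points X \<subseteq> points (quotient_space X q)" using openin_subset by blast
qed

lemma final_map_quotient: "final_map X (quotient_space X q) q" unfolding final_map_def points_quotient
 by (simp add: top_of_quotient) (simp add: quotient_space_def)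

lemma openin_sum: "opn (sum_space X Y) W \<longleftrightarrow>
  opn X (Inl -` W) & opn Y (Inr -` W)" unfolding sum_space_def by (simp add: istopology_sum_space)

lemma points_sum: "points (sum_space X Y) = Inl ` points X \<union> Inr ` points Y"
proof
 show "points (sum_space X Y) \<subseteq> Inl ` points X \<union> Inr ` points Y"
 proof
  fix z assume z: "z : points (sum_space X Y)"
  have "opn X (Inl -` points (sum_space X Y))" "opn Y (Inr -` points (sum_space X Y))"
   using openin_sum openin_topspace by blast+
  thus "z : Inl ` points X \<union> Inr ` points Y" using z by (cases z) (auto dest: openin_subset)
 qed
 have "Inl -` (Inl ` A \<union> Inr ` B) = A" "Inr -` (Inl ` A \<union> Inr ` B) = B" for A :: "'a set" and B :: "'b set"
  by auto
 hence "opn (sum_space X Y) (Inl ` points X \<union> Inr ` points Y)" unfolding openin_sum by simp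
 thus "Inl ` points X \<union> Inr ` points Y \<subseteq> points (sum_space X Y)" using openin_subset by blast
qed

lemma funs_sum: "f : funs (sum_space X Y) W \<longleftrightarrow> f \<circ> Inl : funs X (Inl -` W) & f \<circ> Inr : funs Y (Inr -` W)"
 unfolding sum_space_def by simp

lemma morphism_Inl: "morphism X (sum_space X Y) Inl"
proof -
 have "{x : points X. Inl x : W} = Inl -` W" if "opn (sum_space X Y) W" for W
  using that openin_subset unfolding openin_sum by blast
 thus ?thesis unfolding morphism_def continuous_map_def by (auto simp: points_sum openin_sum funs_sum)
qed

lemma morphism_Inr: "morphism Y (sum_space X Y) Inr"
proof -
 have "{x : points Y. Inr x : W} = Inr -` W" if "opn (sum_space X Y) W" for W
  using that openin_subset unfolding openin_sum by blast
 thus ?thesis unfolding morphism_def continuous_map_def by (auto simp: points_sum openin_sum funs_sum)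
qed

lemma morphism_sum:
 assumes "morphism X Z f" "morphism Y Z g"
 shows "morphism (sum_space X Y) Z (case_sum f g)"
proof -
 have v: "Inl -` {s : points (sum_space X Y). case_sum f g s : W} = {x : points X. f x : W}"
  "Inr -` {s : points (sum_space X Y). case_sum f g s : W} = {x : points Y. g x : W}" for W by (auto simp: points_sum)
 have c: "case_sum f g \<circ> Inl = f" "case_sum f g \<circ> Inr = g" by auto
 show ?thesis unfolding morphism_def continuous_map_def
 proof (intro conjI allI impI)
  show "case_sum f g : points (sum_space X Y) \<rightarrow> points Z"
   using morphism_in[OF assms(1)] morphism_in[OF assms(2)] by (auto simp: points_sum)
  show "opn (sum_space X Y) {x : points (sum_space X Y). case_sum f g x : U}"
   if "opn Z U" for U
   unfolding openin_sum v using morphism_preimage[OF assms(1) that] morphism_preimage[OF assms(2) that] by simp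
  show "h \<circ> case_sum f g : funs (sum_space X Y) {x : points (sum_space X Y). case_sum f g x : W}"
   if "opn Z W" "h : funs Z W" for W h
   unfolding funs_sum v comp_assoc c using morphism_funs[OF assms(1) that] morphism_funs[OF assms(2) that] by blast
 qed
qed

lemma curved_sum:
 assumes X: "curved X" and Y: "curved Y"
 shows "curved (sum_space X Y)" unfolding curved_def
proof (intro allI impI iffI)
 fix W and f :: "'a + 'b => complex"
 assume W: "opn (sum_space X Y) W"
 hence WX: "opn X (Inl -` W)" and WY: "opn Y (Inr -` W)" by (auto simp: openin_sum)
 have Ws: "W \<subseteq> points (sum_space X Y)" using W openin_subset by blast
 { assume f: "f : funs (sum_space X Y) W"
  hence fX: "f \<circ> Inl : funs X (Inl -` W)" and fY: "f \<circ> Inr : funs Y (Inr -` W)" by (auto simp: funs_sum)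
  have t: "topspace (subtopology (top_of X) (Inl -` W)) = Inl -` W"
   "topspace (subtopology (top_of Y) (Inr -` W)) = Inr -` W"
   "topspace (subtopology (top_of (sum_space X Y)) W) = W" using WX WY W openin_subset by fastforce+
  have "continuous_map (subtopology (top_of (sum_space X Y)) W) euclidean f" unfolding continuous_map_def t
  proof (intro conjI allI impI)
   fix U :: "complex set" assume U: "openin euclidean U"
   have "opn X {x : Inl -` W. (f \<circ> Inl) x : U}"
    using openin_continuous_map_preimage[OF curved_continuous[OF X WX fX] U] WX
    unfolding t openin_open_subtopology[OF WX] by blast
   moreover have "opn Y {x : Inr -` W. (f \<circ> Inr) x : U}"
    using openin_continuous_map_preimage[OF curved_continuous[OF Y WY fY] U] WY
    unfolding t openin_open_subtopology[OF WY] by blast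
   moreover have "Inl -` {x : W. f x : U} = {x : Inl -` W. (f \<circ> Inl) x : U}"
    "Inr -` {x : W. f x : U} = {x : Inr -` W. (f \<circ> Inr) x : U}" by auto
   ultimately have "opn (sum_space X Y) {x : W. f x : U}" unfolding openin_sum by simp
   thus "openin (subtopology (top_of (sum_space X Y)) W) {x : W. f x : U}"
    unfolding openin_open_subtopology[OF W] by blast
  qed simp
  moreover have "(f \<circ> gm) holomorphic_on D" if c: "curve (sum_space X Y) D gm" "gm ` D \<subseteq> W" for D gm
  proof -
   have "(f \<circ> gm) holomorphic_on {z : D. gm z : W}" by (rule curve_holomorphic[OF c(1) W f])
   moreover have "{z : D. gm z : W} = D" using c(2) by auto
   ultimately show ?thesis by simp
  qed
  ultimately show "continuous_map (subtopology (top_of (sum_space X Y)) W) euclidean f &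
    (ALL D gm. curve (sum_space X Y) D gm --> gm ` D \<subseteq> W --> (f \<circ> gm) holomorphic_on D)" by blast }
 { assume f: "continuous_map (subtopology (top_of (sum_space X Y)) W) euclidean f &
    (ALL D gm. curve (sum_space X Y) D gm --> gm ` D \<subseteq> W --> (f \<circ> gm) holomorphic_on D)"
  have "f \<circ> Inl : funs X (Inl -` W)"
  proof (rule curvedI[OF X WX])
   have "continuous_map (subtopology (top_of X) (Inl -` W)) (subtopology (top_of (sum_space X Y)) W) Inl"
    using morphism_continuous[OF morphism_Inl]
    by (auto simp: continuous_map_in_subtopology intro: continuous_map_from_subtopology)
   thus "continuous_map (subtopology (top_of X) (Inl -` W)) euclidean (f \<circ> Inl)"
    using f continuous_map_compose by blast
   fix D gm assume c: "curve X D gm" "gm ` D \<subseteq> Inl -` W"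
   have "curve (sum_space X Y) D (Inl \<circ> gm)" by (rule curve_morphism[OF c(1) morphism_Inl])
   thus "(f \<circ> Inl \<circ> gm) holomorphic_on D" using f c(2) by (auto simp: comp_assoc image_subset_iff)
  qed
  moreover have "f \<circ> Inr : funs Y (Inr -` W)"
  proof (rule curvedI[OF Y WY])
   have "continuous_map (subtopology (top_of Y) (Inr -` W)) (subtopology (top_of (sum_space X Y)) W) Inr"
    using morphism_continuous[OF morphism_Inr]
    by (auto simp: continuous_map_in_subtopology intro: continuous_map_from_subtopology)
   thus "continuous_map (subtopology (top_of Y) (Inr -` W)) euclidean (f \<circ> Inr)"
    using f continuous_map_compose by blast
   fix D gm assume c: "curve Y D gm" "gm ` D \<subseteq> Inr -` W"
   have "curve (sum_space X Y) D (Inr \<circ> gm)" by (rule curve_morphism[OF c(1) morphism_Inr])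
   thus "(f \<circ> Inr \<circ> gm) holomorphic_on D" using f c(2) by (auto simp: comp_assoc image_subset_iff)
  qed
  ultimately show "f : funs (sum_space X Y) W" by (simp add: funs_sum) }
qed

text \<open>A quotient structure is determined by its source and by the fibers of the map. This will
  compare an abstract gluing with a variety covered by the same two pieces.\<close>

lemma final_map_isomorphic:
 assumes F: "final_map E Z \<pi>" and F': "final_map E Z' \<pi>'"
  and ker: "\<And>e e'. e : points E ==> e' : points E ==> \<pi> e = \<pi> e' \<longleftrightarrow> \<pi>' e = \<pi>' e'"
  and E: "curved E"
 shows "isomorphic Z Z'"
proof -
 define f where "f = (%z. \<pi>' (SOME e. e : points E & \<pi> e = z))"
 define g where "g = (%z. \<pi> (SOME e. e : points E & \<pi>' e = z))"
 have f: "f (\<pi> e) = \<pi>' e" if "e : points E" for e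
 proof -
  let ?s = "SOME e'. e' : points E & \<pi> e' = \<pi> e"
  have "?s : points E & \<pi> ?s = \<pi> e" by (rule someI[of _ e]) (use that in auto)
  thus ?thesis unfolding f_def using ker[of ?s e] that by simp
 qed
 have g: "g (\<pi>' e) = \<pi> e" if "e : points E" for e
 proof -
  let ?s = "SOME e'. e' : points E & \<pi>' e' = \<pi>' e"
  have "?s : points E & \<pi>' ?s = \<pi>' e" by (rule someI[of _ e]) (use that in auto)
  thus ?thesis unfolding g_def using ker[of ?s e] that by simp
 qed
 note c = curved_final[OF E F] curved_final[OF E F']
 have "morphism E Z' (f \<circ> \<pi>)" by (rule morphism_cong[OF E c(2) final_map_morphism[OF F']]) (simp add: f)
 hence 1: "morphism Z Z' f" by (rule morphism_final[OF F])
 have "morphism E Z (g \<circ> \<pi>')" by (rule morphism_cong[OF E c(1) final_map_morphism[OF F]]) (simp add: g)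
 hence 2: "morphism Z' Z g" by (rule morphism_final[OF F'])
 show ?thesis unfolding isomorphic_def isomorphism_def isomorphism_pair_def
  using 1 2 f g final_map_points[OF F] final_map_points[OF F'] by (intro exI[of _ f] exI[of _ g]) auto
qed

subsection \<open>Products\<close>

lemma top_of_prod_an [simp]: "top_of (prod_an X Y) = prod_topology (top_of X) (top_of Y)" by (simp add: prod_an_def)

lemma funs_prod_an: "f : funs (prod_an X Y) W \<longleftrightarrow>
  continuous_map (subtopology (prod_topology (top_of X) (top_of Y)) W) euclidean f &
    (ALL y:points Y. (%x. f (x, y)) : funs X {x : points X. (x, y) : W}) &
    (ALL x:points X. (%y. f (x, y)) : funs Y {y : points Y. (x, y) : W})" by (simp add: prod_an_def)

lemma slices_open:
 assumes "openin (prod_topology T U) W"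
 shows "y : topspace U ==> openin T {x : topspace T. (x, y) : W}"
  and "x : topspace T ==> openin U {y : topspace U. (x, y) : W}"
proof -
 assume "y : topspace U"
 hence "continuous_map T (prod_topology T U) (%x. (x, y))" by (simp add: continuous_map_pairedI)
 thus "openin T {x : topspace T. (x, y) : W}" using assms by (rule openin_continuous_map_preimage)
next
 assume "x : topspace T"
 hence "continuous_map U (prod_topology T U) (%y. (x, y))" by (simp add: continuous_map_pairedI)
 thus "openin U {y : topspace U. (x, y) : W}" using assms by (rule openin_continuous_map_preimage)
qed

lemma morphism_fst:
 assumes "curved X" "curved Y"
 shows "morphism (prod_an X Y) X fst" unfolding morphism_def
proof (intro conjI allI impI)
 show "continuous_map (top_of (prod_an X Y)) (top_of X) fst" by (simp add: continuous_map_fst)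
 fix W g assume W: "opn X W" and g: "g : funs X W"
 let ?V = "{p : points (prod_an X Y). fst p : W}"
 have "continuous_map (subtopology (prod_topology (top_of X) (top_of Y)) ?V) (subtopology (top_of X) W) fst"
  by (auto simp: continuous_map_in_subtopology continuous_map_fst continuous_map_from_subtopology)
 hence 1: "continuous_map (subtopology (prod_topology (top_of X) (top_of Y)) ?V) euclidean (g \<circ> fst)"
  using curved_continuous[OF assms(1) W g] continuous_map_compose by blast
 have Ws: "W \<subseteq> points X" using W openin_subset by blast
 have 2: "(%x. (g \<circ> fst) (x, y)) : funs X {x : points X. (x, y) : ?V}" if "y : points Y" for y
 proof -
  have "{x : points X. (x, y) : ?V} = W" using that Ws by auto
  thus ?thesis using g by simp
 qed
 have 3: "(%y. (g \<circ> fst) (x, y)) : funs Y {y : points Y. (x, y) : ?V}" if "x : points X" for x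
 proof -
  have "{y : points Y. (x, y) : ?V} = (if x : W then points Y else {})" using that by auto
  thus ?thesis using curved_const[OF assms(2)] by simp
 qed
 show "g \<circ> fst : funs (prod_an X Y) ?V" unfolding funs_prod_an using 1 2 3 by blast
qed

lemma morphism_snd:
 assumes "curved X" "curved Y"
 shows "morphism (prod_an X Y) Y snd" unfolding morphism_def
proof (intro conjI allI impI)
 show "continuous_map (top_of (prod_an X Y)) (top_of Y) snd" by (simp add: continuous_map_snd)
 fix W g assume W: "opn Y W" and g: "g : funs Y W"
 let ?V = "{p : points (prod_an X Y). snd p : W}"
 have "continuous_map (subtopology (prod_topology (top_of X) (top_of Y)) ?V) (subtopology (top_of Y) W) snd"
  by (auto simp: continuous_map_in_subtopology continuous_map_snd continuous_map_from_subtopology)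
 hence 1: "continuous_map (subtopology (prod_topology (top_of X) (top_of Y)) ?V) euclidean (g \<circ> snd)"
  using curved_continuous[OF assms(2) W g] continuous_map_compose by blast
 have Ws: "W \<subseteq> points Y" using W openin_subset by blast
 have 2: "(%y. (g \<circ> snd) (x, y)) : funs Y {y : points Y. (x, y) : ?V}" if "x : points X" for x
 proof -
  have "{y : points Y. (x, y) : ?V} = W" using that Ws by auto
  thus ?thesis using g by simp
 qed
 have 3: "(%x. (g \<circ> snd) (x, y)) : funs X {x : points X. (x, y) : ?V}" if "y : points Y" for y
 proof -
  have "{x : points X. (x, y) : ?V} = (if y : W then points X else {})" using that by auto
  thus ?thesis using curved_const[OF assms(1)] by simp
 qed
 show "g \<circ> snd : funs (prod_an X Y) ?V" unfolding funs_prod_an using 1 2 3 by blast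
qed

text \<open>Functions on a product are only asked to be continuous and separately holomorphic; along
  a pair of curves they become a function of two variables, and its diagonal is holomorphic.\<close>

lemma curved_prod_pair:
 assumes X: "curved X" and Y: "curved Y"
  and W: "opn (prod_an X Y) W" and f: "f : funs (prod_an X Y) W"
  and c1: "curve X D gm" and c2: "curve Y D \<delta>" and im: "\<And>z. z : D ==> (gm z, \<delta> z) : W"
 shows "(%z. f (gm z, \<delta> z)) holomorphic_on D"
proof (rule holomorphic_on_local)
 fix z0 assume z0: "z0 : D"
 have "continuous_map (top_of_set (D \<times> D)) (top_of_set D) fst"
  "continuous_map (top_of_set (D \<times> D)) (top_of_set D) snd" by (auto intro: continuous_intros)
 from continuous_map_compose[OF this(1) curve_continuous[OF c1]]
  continuous_map_compose[OF this(2) curve_continuous[OF c2]]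
 have cc: "continuous_map (top_of_set (D \<times> D)) (top_of (prod_an X Y)) (%p. (gm (fst p), \<delta> (snd p)))"
  by (simp add: continuous_map_pairedI comp_def)
 have "openin (top_of_set (D \<times> D)) {p : D \<times> D. (gm (fst p), \<delta> (snd p)) : W}"
  using openin_continuous_map_preimage[OF cc W] by simp
 hence op: "open {p : D \<times> D. (gm (fst p), \<delta> (snd p)) : W}" (is "open ?O")
  using curve_open[OF c1] open_Times openin_open_trans by blast
 have "(z0, z0) : ?O" using z0 im by auto
 then obtain A B where AB: "open A" "open B" "(z0, z0) : A \<times> B" "A \<times> B \<subseteq> ?O"
  by (rule open_prod_elim[OF op])
 define N where "N = A \<inter> B"
 have N: "open N" "z0 : N" using AB(1-3) by (auto simp: N_def)
 have "(z, w) : ?O" if "z : N" "w : N" for z w using AB(4) that unfolding N_def by blast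
 hence NW: "\<And>z w. z : N ==> w : N ==> (gm z, \<delta> w) : W" and ND: "N \<subseteq> D" by auto
 have "(%z. f (gm z, \<delta> z)) holomorphic_on N"
 proof (rule diagonal_holomorphic[OF N(1), where F = "%z w. f (gm z, \<delta> w)"])
  have "continuous_map (top_of_set (N \<times> N)) (top_of (prod_an X Y)) (%p. (gm (fst p), \<delta> (snd p)))"
   by (rule continuous_map_from_subtopology_mono[OF cc]) (use ND in auto)
  hence "continuous_map (top_of_set (N \<times> N)) (subtopology (top_of (prod_an X Y)) W) (%p. (gm (fst p), \<delta> (snd p)))"
   using NW by (auto simp: continuous_map_in_subtopology)
  moreover have "continuous_map (subtopology (top_of (prod_an X Y)) W) euclidean f"
   using f by (simp add: funs_prod_an)
  ultimately have "continuous_map (top_of_set (N \<times> N)) euclidean (f \<circ> (%p. (gm (fst p), \<delta> (snd p))))"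
   by (rule continuous_map_compose)
  thus "continuous_on (N \<times> N) (%(z, w). f (gm z, \<delta> w))" by (simp add: comp_def split_beta)
  have W': "openin (prod_topology (top_of X) (top_of Y)) W" using W by simp
  show "(%z. f (gm z, \<delta> w)) holomorphic_on N" if w: "w : N" for w
  proof -
   have yw: "\<delta> w : points Y" using curve_in_points[OF c2] w ND by blast
   have "(%x. f (x, \<delta> w)) : funs X {x : points X. (x, \<delta> w) : W}"
    using f yw unfolding funs_prod_an by blast
   hence "((%x. f (x, \<delta> w)) \<circ> gm) holomorphic_on N"
    by (rule curved_holomorphic[OF X slices_open(1)[OF W' yw] _ curve_restrict[OF c1 N(1) ND]])
     (use NW[OF _ w] curve_in_points[OF c1] ND in auto)
   thus ?thesis by (simp add: comp_def)
  qed
  show "(%w. f (gm z, \<delta> w)) holomorphic_on N" if z: "z : N" for z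
  proof -
   have xz: "gm z : points X" using curve_in_points[OF c1] z ND by blast
   have "(%y. f (gm z, y)) : funs Y {y : points Y. (gm z, y) : W}" using f xz unfolding funs_prod_an by blast
   hence "((%y. f (gm z, y)) \<circ> \<delta>) holomorphic_on N"
    by (rule curved_holomorphic[OF Y slices_open(2)[OF W' xz] _ curve_restrict[OF c2 N(1) ND]])
     (use NW[OF z] curve_in_points[OF c2] ND in auto)
   thus ?thesis by (simp add: comp_def)
  qed
 qed
 thus "EX N. open N & z0 : N & (%z. f (gm z, \<delta> z)) holomorphic_on N" using N by blast
qed

lemma curve_pair:
 assumes X: "curved X" and Y: "curved Y" and c1: "curve X D gm" and c2: "curve Y D \<delta>"
 shows "curve (prod_an X Y) D (%z. (gm z, \<delta> z))" unfolding curve_def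
proof (intro conjI allI impI)
 show "open D" using c1 curve_open by blast
 show cm: "continuous_map (top_of_set D) (top_of (prod_an X Y)) (%z. (gm z, \<delta> z))"
  using curve_continuous[OF c1] curve_continuous[OF c2] by (simp add: continuous_map_pairedI)
 fix W g assume W: "opn (prod_an X Y) W" and g: "g : funs (prod_an X Y) W"
 let ?E = "{z : D. (gm z, \<delta> z) : W}"
 have "openin (top_of_set D) ?E" using openin_continuous_map_preimage[OF cm W] by simp
 hence E: "open ?E" using curve_open[OF c1] openin_open_trans by blast
 have "(%z. g (gm z, \<delta> z)) holomorphic_on ?E"
  by (rule curved_prod_pair[OF X Y W g]) (use curve_restrict[OF c1 E] curve_restrict[OF c2 E] in auto)
 thus "(g \<circ> (%z. (gm z, \<delta> z))) holomorphic_on ?E" by (simp add: comp_def)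
qed

lemma curve_const: "curved X ==> open D ==> x : points X ==> curve X D (%z. x)"
 unfolding curve_def by (auto simp: comp_def)

lemma curved_prod:
 assumes X: "curved X" and Y: "curved Y"
 shows "curved (prod_an X Y)" unfolding curved_def
proof (intro allI impI iffI conjI)
 fix W f assume W: "opn (prod_an X Y) W" and f: "f : funs (prod_an X Y) W"
 show "continuous_map (subtopology (top_of (prod_an X Y)) W) euclidean f" using f by (simp add: funs_prod_an)
 fix D gm assume c: "curve (prod_an X Y) D gm" "gm ` D \<subseteq> W"
 have "(f \<circ> gm) holomorphic_on {z : D. gm z : W}" by (rule curve_holomorphic[OF c(1) W f])
 moreover have "{z : D. gm z : W} = D" using c(2) by auto
 ultimately show "(f \<circ> gm) holomorphic_on D" by simp
next
 fix W f assume W: "opn (prod_an X Y) W"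
  and f: "continuous_map (subtopology (top_of (prod_an X Y)) W) euclidean f &
   (ALL D gm. curve (prod_an X Y) D gm --> gm ` D \<subseteq> W --> (f \<circ> gm) holomorphic_on D)"
 have W': "openin (prod_topology (top_of X) (top_of Y)) W" using W by simp
 have "(%x. f (x, y)) : funs X {x : points X. (x, y) : W}" if y: "y : points Y" for y
 proof (rule curvedI[OF X slices_open(1)[OF W' y]])
  have "continuous_map (subtopology (top_of X) {x : points X. (x, y) : W})
    (subtopology (top_of (prod_an X Y)) W) (%x. (x, y))"
   using y by (auto simp: continuous_map_in_subtopology continuous_map_pairedI continuous_map_from_subtopology)
  thus "continuous_map (subtopology (top_of X) {x : points X. (x, y) : W}) euclidean (%x. f (x, y))"
   using f continuous_map_compose[of _ _ "%x. (x, y)" _ f] by (simp add: comp_def)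
  fix D gm assume c: "curve X D gm" "gm ` D \<subseteq> {x : points X. (x, y) : W}"
  have "curve (prod_an X Y) D (%z. (gm z, y))"
   by (rule curve_pair[OF X Y c(1) curve_const[OF Y curve_open[OF c(1)] y]])
  moreover have "(%z. (gm z, y)) ` D \<subseteq> W" using c(2) by auto
  ultimately have "(f \<circ> (%z. (gm z, y))) holomorphic_on D" using f by blast
  thus "((%x. f (x, y)) \<circ> gm) holomorphic_on D" by (simp add: comp_def)
 qed
 moreover have "(%y. f (x, y)) : funs Y {y : points Y. (x, y) : W}" if x: "x : points X" for x
 proof (rule curvedI[OF Y slices_open(2)[OF W' x]])
  have "continuous_map (subtopology (top_of Y) {y : points Y. (x, y) : W})
    (subtopology (top_of (prod_an X Y)) W) (%y. (x, y))"
   using x by (auto simp: continuous_map_in_subtopology continuous_map_pairedI continuous_map_from_subtopology)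
  thus "continuous_map (subtopology (top_of Y) {y : points Y. (x, y) : W}) euclidean (%y. f (x, y))"
   using f continuous_map_compose[of _ _ "%y. (x, y)" _ f] by (simp add: comp_def)
  fix D gm assume c: "curve Y D gm" "gm ` D \<subseteq> {y : points Y. (x, y) : W}"
  have "curve (prod_an X Y) D (%z. (x, gm z))"
   by (rule curve_pair[OF X Y curve_const[OF X curve_open[OF c(1)] x] c(1)])
  moreover have "(%z. (x, gm z)) ` D \<subseteq> W" using c(2) by auto
  ultimately have "(f \<circ> (%z. (x, gm z))) holomorphic_on D" using f by blast
  thus "((%y. f (x, y)) \<circ> gm) holomorphic_on D" by (simp add: comp_def)
 qed
 ultimately show "f : funs (prod_an X Y) W" using f unfolding funs_prod_an by simp
qed

lemma morphism_pair:
 assumes X: "curved X" and Y: "curved Y" and Z: "curved Z"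
  and g: "morphism Z X g" and h: "morphism Z Y h"
 shows "morphism Z (prod_an X Y) (%z. (g z, h z))"
proof (rule morphismI[OF Z curved_prod[OF X Y]])
 show "continuous_map (top_of Z) (top_of (prod_an X Y)) (%z. (g z, h z))"
  using morphism_continuous[OF g] morphism_continuous[OF h] by (simp add: continuous_map_pairedI)
 show "curve (prod_an X Y) D ((%z. (g z, h z)) \<circ> gm)" if "curve Z D gm" for D gm
  using curve_pair[OF X Y curve_morphism[OF that g] curve_morphism[OF that h]] by (simp add: comp_def)
qed

lemma morphism_map_prod:
 assumes X: "curved X" and Y: "curved Y" and X': "curved X'" and Y': "curved Y'"
  and g: "morphism X X' g" and h: "morphism Y Y' h"
 shows "morphism (prod_an X Y) (prod_an X' Y') (map_prod g h)"
 using morphism_pair[OF X' Y' curved_prod[OF X Y] morphism_compose[OF morphism_fst[OF X Y] g]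
   morphism_compose[OF morphism_snd[OF X Y] h]] by (simp add: comp_def map_prod_def case_prod_unfold)

lemma morphism_id: "curved X ==> morphism X X (%x. x)" by (rule morphismI) (simp_all add: comp_def)

lemma morphism_const: "curved X ==> curved Y ==> y : points Y ==> morphism X Y (%x. y)"
 by (rule morphismI) (simp_all add: comp_def curve_const curve_open)

text \<open>The product of a quotient map with an identity is not a quotient map in general.
  Openness of \<open>q\<close>, which orbit maps of groups have, makes the product map open and
  repairs this.\<close>

lemma final_map_prod:
 assumes X: "curved X" and Y: "curved Y" and F: "final_map X Q q"
  and op: "open_map (top_of X) (top_of Q) q"
 shows "final_map (prod_an X Y) (prod_an Q Y) (map_prod q id)"
proof -
 note Q = curved_final[OF X F]
 have m: "morphism (prod_an X Y) (prod_an Q Y) (map_prod q id)"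
  using morphism_map_prod[OF X Y Q Y final_map_morphism[OF F] morphism_id[OF Y]] by (simp add: id_def)
 have om: "open_map (top_of (prod_an X Y)) (top_of (prod_an Q Y)) (map_prod q id)"
  unfolding open_map_def top_of_prod_an
 proof (intro allI impI)
  fix U assume U: "openin (prod_topology (top_of X) (top_of Y)) U"
  show "openin (prod_topology (top_of Q) (top_of Y)) (map_prod q id ` U)" unfolding openin_prod_topology_alt
  proof (intro allI impI)
   fix x y assume "(x, y) : map_prod q id ` U"
   then obtain x' where x': "(x', y) : U" "x = q x'" by auto
   then obtain A B where AB: "opn X A" "opn Y B" "x' : A" "y : B" "A \<times> B \<subseteq> U"
    using U unfolding openin_prod_topology_alt by meson
   have "opn Q (q ` A)" using op AB(1) unfolding open_map_def by blast
   moreover have "q ` A \<times> B \<subseteq> map_prod q id ` U" using AB(5) by force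
   ultimately show "EX A B. opn Q A & opn Y B & x : A & y : B & A \<times> B \<subseteq> map_prod q id ` U"
    using AB x'(2) by blast
  qed
 qed
 have pt: "points (prod_an Q Y) = map_prod q id ` points (prod_an X Y)"
  using final_map_points[OF F] by (force simp: image_iff)
 have op': "opn (prod_an Q Y) W"
  if W: "W \<subseteq> points (prod_an Q Y)" "opn (prod_an X Y) {e : points (prod_an X Y). map_prod q id e : W}" for W
 proof -
  have "opn (prod_an Q Y) (map_prod q id ` {e : points (prod_an X Y). map_prod q id e : W})"
   using om W(2) unfolding open_map_def by blast
  moreover have "map_prod q id ` {e : points (prod_an X Y). map_prod q id e : W} = W"
  proof
   show "W \<subseteq> map_prod q id ` {e : points (prod_an X Y). map_prod q id e : W}"
   proof
    fix w assume w: "w : W"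
    then obtain e where "e : points (prod_an X Y)" "w = map_prod q id e" using W(1) unfolding pt by auto
    thus "w : map_prod q id ` {e : points (prod_an X Y). map_prod q id e : W}" using w by blast
   qed
  qed auto
  ultimately show ?thesis by simp
 qed
 show ?thesis unfolding final_map_def
 proof (intro conjI allI impI)
  fix W h assume W: "opn (prod_an Q Y) W"
  let ?V = "{e : points (prod_an X Y). map_prod q id e : W}"
  have V: "opn (prod_an X Y) ?V" by (rule morphism_preimage[OF m W])
  have Ws: "W \<subseteq> points (prod_an Q Y)" using W openin_subset by blast
  show "h : funs (prod_an Q Y) W \<longleftrightarrow> h \<circ> map_prod q id : funs (prod_an X Y) ?V"
  proof
   assume f: "h \<circ> map_prod q id : funs (prod_an X Y) ?V"
   have t: "topspace (subtopology (top_of (prod_an Q Y)) W) = W"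
    "topspace (subtopology (top_of (prod_an X Y)) ?V) = ?V" using Ws by auto
   have "continuous_map (subtopology (top_of (prod_an Q Y)) W) euclidean h" unfolding continuous_map_def
   proof (intro conjI allI impI)
    fix U :: "complex set" assume U: "openin euclidean U"
    have "openin (subtopology (top_of (prod_an X Y)) ?V) {e : ?V. (h \<circ> map_prod q id) e : U}"
     using openin_continuous_map_preimage[OF curved_continuous[OF curved_prod[OF X Y] V f] U] unfolding t .
    hence "opn (prod_an X Y) {e : ?V. (h \<circ> map_prod q id) e : U}" using V openin_open_subtopology by blast
    moreover have "{e : ?V. (h \<circ> map_prod q id) e : U} =
      {e : points (prod_an X Y). map_prod q id e : {x : W. h x : U}}" by auto
    ultimately have "opn (prod_an Q Y) {x : W. h x : U}" by (intro op') (use Ws in auto)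
    thus "openin (subtopology (top_of (prod_an Q Y)) W) {x : topspace (subtopology (top_of (prod_an Q Y)) W). h x : U}"
     unfolding t using W openin_open_subtopology by blast
   qed simp
   moreover have "(%x. h (x, y)) : funs Q {x : points Q. (x, y) : W}" if y: "y : points Y" for y
   proof -
    have o: "opn Q {x : points Q. (x, y) : W}" using W y by (intro slices_open) auto
    have "(%x. (h \<circ> map_prod q id) (x, y)) : funs X {x : points X. (x, y) : ?V}"
     using f y unfolding funs_prod_an by blast
    moreover have "{x : points X. (x, y) : ?V} = {x : points X. q x : {x : points Q. (x, y) : W}}"
     using y morphism_in[OF final_map_morphism[OF F]] by auto
    ultimately show ?thesis using final_map_funs[OF F o] by (simp add: comp_def)
   qed
   moreover have "(%y. h (x, y)) : funs Y {y : points Y. (x, y) : W}" if x: "x : points Q" for x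
   proof -
    obtain x' where x': "x' : points X" "x = q x'" using x final_map_points[OF F] by auto
    have "(%y. (h \<circ> map_prod q id) (x', y)) : funs Y {y : points Y. (x', y) : ?V}"
     using f x'(1) unfolding funs_prod_an by blast
    moreover have "{y : points Y. (x', y) : ?V} = {y : points Y. (x, y) : W}" using x' by auto
    ultimately show ?thesis using x'(2) by simp
   qed
   ultimately show "h : funs (prod_an Q Y) W" unfolding funs_prod_an by simp
  next
   assume "h : funs (prod_an Q Y) W"
   thus "h \<circ> map_prod q id : funs (prod_an X Y) ?V" by (rule morphism_funs[OF m W])
  qed
 next
  fix W assume "W \<subseteq> points (prod_an Q Y)"
  thus "opn (prod_an Q Y) W =
    opn (prod_an X Y) {e : points (prod_an X Y). map_prod q id e : W}"
   using op' morphism_preimage[OF m, of W] by (intro iffI)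
 qed (rule pt)
qed


subsection \<open>Open embeddings\<close>

text \<open>The inverse is part of the data, since a chart needs its coordinate map;
  \<open>g\<close> is asked to be regular on the image only.\<close>

definition open_emb :: "'a fspace => 'b fspace => ('a => 'b) => ('b => 'a) => bool" where
 "open_emb X Z f g \<longleftrightarrow> opn Z (f ` points X) & morphism X Z f &
   morphism (subspace_of Z (f ` points X)) X g & (ALL x:points X. g (f x) = x)"

lemma open_embD:
 assumes "open_emb X Z f g"
 shows "opn Z (f ` points X)" "morphism X Z f"
  "morphism (subspace_of Z (f ` points X)) X g" "\<And>x. x : points X ==> g (f x) = x"
 using assms unfolding open_emb_def by blast+

lemma open_emb_inj:
 "open_emb X Z f g ==> x : points X ==> y : points X ==> f x = f y \<longleftrightarrow> x = y"
 by (metis open_embD(4))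

lemma open_emb_image:
 assumes e: "open_emb X Z f g" and W: "opn X W"
 shows "opn Z (f ` W)"
proof -
 have Ws: "W \<subseteq> points X" using W openin_subset by blast
 have "opn (subspace_of Z (f ` points X)) {z : points (subspace_of Z (f ` points X)). g z : W}"
  by (rule morphism_preimage[OF open_embD(3)[OF e] W])
 hence "opn Z {z : f ` points X. g z : W}"
  unfolding openin_subspace_open[OF open_embD(1)[OF e]] points_subspace_open[OF open_embD(1)[OF e]] by blast
 moreover have "{z : f ` points X. g z : W} = f ` W" using Ws open_embD(4)[OF e] by auto
 ultimately show ?thesis by simp
qed

lemma open_emb_restrict:
 assumes X: "curved X" and Z: "curved Z" and e: "open_emb X Z f g" and S: "opn X S"
 shows "open_emb (subspace_of X S) Z f g" unfolding open_emb_def points_subspace_open[OF S]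
proof (intro conjI ballI)
 have Ss: "S \<subseteq> points X" using S openin_subset by blast
 show o: "opn Z (f ` S)" by (rule open_emb_image[OF e S])
 show "morphism (subspace_of X S) Z f"
  using morphism_compose[OF morphism_subspace_incl[OF X S] open_embD(2)[OF e]] by (simp add: comp_def)
 have "f ` S \<subseteq> f ` points X" using Ss by blast
 note ss = subspace_subspace(1)[OF Z open_embD(1)[OF e] o this]
 have o': "opn (subspace_of Z (f ` points X)) (f ` S)" using o Ss openin_subspace_open[OF open_embD(1)[OF e]] by blast
 note cZ = curved_subspace[OF Z open_embD(1)[OF e]]
 have "morphism (subspace_of Z (f ` S)) X (g \<circ> (%x. x) \<circ> (%x. x))"
  by (intro morphism_compose[OF ss] morphism_compose[OF morphism_subspace_incl[OF cZ o']] open_embD(3)[OF e])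
 thus "morphism (subspace_of Z (f ` S)) (subspace_of X S) g"
  by (intro morphism_into_subspace[OF curved_subspace[OF Z o]])
   (use points_subspace_open[OF o] open_embD(4)[OF e] Ss in \<open>auto simp: comp_def\<close>)
 fix x assume "x : S"
 thus "g (f x) = x" using open_embD(4)[OF e] Ss by blast
qed

lemma open_emb_compose:
 assumes Y: "curved Y" and Z: "curved Z" and e: "open_emb X Y f f'" and e': "open_emb Y Z g g'"
 shows "open_emb X Z (g \<circ> f) (f' \<circ> g')"
proof -
 have r: "open_emb (subspace_of Y (f ` points X)) Z g g'" by (rule open_emb_restrict[OF Y Z e' open_embD(1)[OF e]])
 have im: "(g \<circ> f) ` points X = g ` points (subspace_of Y (f ` points X))"
  using points_subspace_open[OF open_embD(1)[OF e]] by auto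
 have "(f' \<circ> g') ((g \<circ> f) x) = x" if "x : points X" for x
  using that open_embD(4)[OF e] open_embD(4)[OF e'] morphism_in[OF open_embD(2)[OF e]] by simp
 thus ?thesis unfolding open_emb_def im
  using open_embD(1)[OF r] morphism_compose[OF open_embD(2)[OF e] open_embD(2)[OF e']]
   morphism_compose[OF open_embD(3)[OF r] open_embD(3)[OF e]] by blast
qed

lemma open_emb_prod:
 assumes X: "curved X" and Y: "curved Y" and Z: "curved Z" and e: "open_emb X Z f g"
 shows "open_emb (prod_an X Y) (prod_an Z Y) (map_prod f id) (map_prod g id)"
proof -
 let ?U = "f ` points X"
 let ?V = "map_prod f id ` points (prod_an X Y)"
 note cP = curved_prod[OF Z Y]
 have V: "?V = ?U \<times> points Y" by (force simp: image_iff)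
 have o: "opn (prod_an Z Y) ?V" unfolding V using open_embD(1)[OF e] by (simp add: openin_prod_Times_iff)
 have "morphism (subspace_of (prod_an Z Y) ?V) Z (fst \<circ> (%x. x))"
  by (rule morphism_compose[OF morphism_subspace_incl[OF cP o] morphism_fst[OF Z Y]])
 hence 1: "morphism (subspace_of (prod_an Z Y) ?V) (subspace_of Z ?U) (fst \<circ> (%x. x))"
  by (rule morphism_into_subspace[OF curved_subspace[OF cP o]])
   (use points_subspace_open[OF o] V in auto)
 have 2: "morphism (subspace_of (prod_an Z Y) ?V) Y (snd \<circ> (%x. x))"
  by (rule morphism_compose[OF morphism_subspace_incl[OF cP o] morphism_snd[OF Z Y]])
 have "morphism (subspace_of (prod_an Z Y) ?V) (prod_an X Y) (map_prod g id)"
  using morphism_pair[OF X Y curved_subspace[OF cP o] morphism_compose[OF 1 open_embD(3)[OF e]] 2]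
  by (simp add: comp_def map_prod_def case_prod_unfold)
 moreover have "morphism (prod_an X Y) (prod_an Z Y) (map_prod f id)"
  using morphism_map_prod[OF X Y Z Y open_embD(2)[OF e] morphism_id[OF Y]] by (simp add: id_def)
 ultimately show ?thesis unfolding open_emb_def using o open_embD(4)[OF e] by auto
qed

lemma open_emb_chart:
 assumes e: "open_emb (affine_an {..<n}) X ps ph" and X: "curved X"
 shows "is_chart n X (ps ` points (affine_an {..<n})) ph ps"
proof -
 let ?C = "affine_an {..<n} :: (nat => complex) fspace"
 have C: "curved ?C" by (simp add: curved_affine_an)
 have o: "opn ?C (points ?C)" by blast
 note oX = open_embD(1)[OF e]
 have 1: "morphism (subspace_of X (ps ` points ?C)) (subspace_of ?C (points ?C)) ph"
  by (rule morphism_into_subspace[OF curved_subspace[OF X oX] open_embD(3)[OF e]])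
   (use morphism_in[OF open_embD(3)[OF e]] in auto)
 have "morphism (subspace_of ?C (points ?C)) X (ps \<circ> (%x. x))"
  by (rule morphism_compose[OF morphism_subspace_incl[OF C o] open_embD(2)[OF e]])
 hence 2: "morphism (subspace_of ?C (points ?C)) (subspace_of X (ps ` points ?C)) ps"
  by (intro morphism_into_subspace[OF curved_subspace[OF C o]]) (auto simp: comp_def)
 have "isomorphism_pair (subspace_of X (ps ` points ?C)) (subspace_of ?C (points ?C)) ph ps"
  unfolding isomorphism_pair_def points_subspace_open[OF oX] points_subspace_open[OF o]
  using 1 2 open_embD(4)[OF e] by auto
 thus ?thesis unfolding is_chart_def using oX o by blast
qed

lemma morphism_sum_open:
 assumes X: "curved X" and Y: "curved Y" and Z: "curved Z"
  and A: "opn X A" and B: "opn Y B"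
  and f: "morphism (subspace_of X A) Z f" and g: "morphism (subspace_of Y B) Z g"
 shows "morphism (subspace_of (sum_space X Y) (Inl ` A \<union> Inr ` B)) Z (case_sum f g)"
proof -
 let ?E = "Inl ` A \<union> Inr ` B"
 note cS = curved_sum[OF X Y]
 have vE: "Inl -` ?E = A" "Inr -` ?E = B" by auto
 have o: "opn (sum_space X Y) ?E" unfolding openin_sum vE using A B by blast
 have v: "Inl -` {s : ?E. case_sum f g s : W} = {x : A. f x : W}"
  "Inr -` {s : ?E. case_sum f g s : W} = {x : B. g x : W}" for W by auto
 have c: "case_sum f g \<circ> Inl = f" "case_sum f g \<circ> Inr = g" by auto
 note p = points_subspace_open[OF o] points_subspace_open[OF A] points_subspace_open[OF B]
 have oo: "opn X {x : A. f x : U}" "opn Y {x : B. g x : U}"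
  "opn (sum_space X Y) {s : ?E. case_sum f g s : U}"
  if "opn Z U" for U
 proof -
  show 1: "opn X {x : A. f x : U}" "opn Y {x : B. g x : U}"
   using morphism_preimage[OF f that] morphism_preimage[OF g that]
   unfolding p openin_subspace_open[OF A] openin_subspace_open[OF B] by blast+
  show "opn (sum_space X Y) {s : ?E. case_sum f g s : U}" unfolding openin_sum v using 1 by simp
 qed
 show ?thesis unfolding morphism_def continuous_map_def p
 proof (intro conjI allI impI)
  show "case_sum f g : ?E \<rightarrow> points Z" using morphism_in[OF f] morphism_in[OF g] unfolding p by auto
  show "opn (subspace_of (sum_space X Y) ?E) {x : ?E. case_sum f g x : U}"
   if "opn Z U" for U unfolding openin_subspace_open[OF o] using oo(3)[OF that] by auto
  show "h \<circ> case_sum f g : funs (subspace_of (sum_space X Y) ?E) {x : ?E. case_sum f g x : W}"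
   if W: "opn Z W" "h : funs Z W" for W h
  proof -
   have "{x : ?E. case_sum f g x : W} \<subseteq> ?E" "{x : A. f x : W} \<subseteq> A" "{x : B. g x : W} \<subseteq> B" by auto
   note fs = funs_subspace_open[OF cS oo(3)[OF W(1)] this(1)] funs_subspace_open[OF X oo(1)[OF W(1)] this(2)]
    funs_subspace_open[OF Y oo(2)[OF W(1)] this(3)]
   show ?thesis unfolding fs(1) funs_sum v comp_assoc c
    using morphism_funs[OF f W] morphism_funs[OF g W] unfolding p fs(2,3) by blast
  qed
 qed
qed

text \<open>Openness lets preimages be pushed forward again, and the two inverses give local
  formulas for a function on \<open>Z\<close> in terms of its pullbacks.\<close>

lemma final_map_of_open_emb:
 assumes X: "curved X" and Y: "curved Y" and Z: "curved Z"
  and e: "open_emb X Z f f'" and e': "open_emb Y Z g g'"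
  and cov: "points Z = f ` points X \<union> g ` points Y"
 shows "final_map (sum_space X Y) Z (case_sum f g)"
proof -
 have m: "morphism (sum_space X Y) Z (case_sum f g)" by (rule morphism_sum[OF open_embD(2)[OF e] open_embD(2)[OF e']])
 have v: "Inl -` {s : points (sum_space X Y). case_sum f g s : W} = {x : points X. f x : W}"
  "Inr -` {s : points (sum_space X Y). case_sum f g s : W} = {x : points Y. g x : W}" for W by (auto simp: points_sum)
 have c: "case_sum f g \<circ> Inl = f" "case_sum f g \<circ> Inr = g" by auto
 show ?thesis unfolding final_map_def
 proof (intro conjI allI impI)
  show "points Z = case_sum f g ` points (sum_space X Y)" unfolding cov points_sum by (simp add: image_Un image_image)
  show "opn Z W \<longleftrightarrow> opn (sum_space X Y) {s : points (sum_space X Y). case_sum f g s : W}"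
   if W: "W \<subseteq> points Z" for W
  proof
   assume "opn (sum_space X Y) {s : points (sum_space X Y). case_sum f g s : W}"
   hence o: "opn X {x : points X. f x : W}" "opn Y {x : points Y. g x : W}" unfolding openin_sum v by blast+
   have "opn Z (f ` {x : points X. f x : W} \<union> g ` {x : points Y. g x : W})"
    by (intro openin_Un open_emb_image[OF e] open_emb_image[OF e'] o)
   moreover have "f ` {x : points X. f x : W} \<union> g ` {x : points Y. g x : W} = W" using W unfolding cov by blast
   ultimately show "opn Z W" by simp
  qed (erule morphism_preimage[OF m])
  show "h : funs Z W \<longleftrightarrow>
    h \<circ> case_sum f g : funs (sum_space X Y) {s : points (sum_space X Y). case_sum f g s : W}"
   if W: "opn Z W" for W h
  proof
   assume "h \<circ> case_sum f g : funs (sum_space X Y) {s : points (sum_space X Y). case_sum f g s : W}"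
   hence h: "h \<circ> f : funs X {x : points X. f x : W}" "h \<circ> g : funs Y {x : points Y. g x : W}"
    unfolding funs_sum v comp_assoc c by blast+
   show "h : funs Z W"
   proof (rule curved_local[OF Z W])
    fix z assume "z : W"
    hence "z : f ` points X \<union> g ` points Y" using W openin_subset cov by blast
    thus "EX W' k. opn Z W' & z : W' & k : funs Z W' & (ALL y:W \<inter> W'. h y = k y)"
    proof
     assume "z : f ` points X"
     then obtain x where x: "x : points X" "z = f x" by blast
     note oF = open_embD(1)[OF e]
     let ?W = "W \<inter> f ` points X"
     have oW: "opn Z ?W" using W oF by blast
     have "(h \<circ> f) \<circ> f' : funs (subspace_of Z (f ` points X))
       {z : points (subspace_of Z (f ` points X)). f' z : {x : points X. f x : W}}"
      by (rule morphism_funs[OF open_embD(3)[OF e] morphism_preimage[OF open_embD(2)[OF e] W] h(1)])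
     moreover have "{z : points (subspace_of Z (f ` points X)). f' z : {x : points X. f x : W}} = ?W"
      unfolding points_subspace_open[OF oF] using open_embD(4)[OF e] by auto
     ultimately have "(h \<circ> f) \<circ> f' : funs Z ?W"
      using funs_subspace_open[OF Z oW, of "f ` points X"] by simp
     moreover have "ALL y:W \<inter> ?W. h y = ((h \<circ> f) \<circ> f') y" using open_embD(4)[OF e] by auto
     ultimately show ?thesis using oW x \<open>z : W\<close> by blast
    next
     assume "z : g ` points Y"
     then obtain x where x: "x : points Y" "z = g x" by blast
     note oF = open_embD(1)[OF e']
     let ?W = "W \<inter> g ` points Y"
     have oW: "opn Z ?W" using W oF by blast
     have "(h \<circ> g) \<circ> g' : funs (subspace_of Z (g ` points Y))
       {z : points (subspace_of Z (g ` points Y)). g' z : {x : points Y. g x : W}}"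
      by (rule morphism_funs[OF open_embD(3)[OF e'] morphism_preimage[OF open_embD(2)[OF e'] W] h(2)])
     moreover have "{z : points (subspace_of Z (g ` points Y)). g' z : {x : points Y. g x : W}} = ?W"
      unfolding points_subspace_open[OF oF] using open_embD(4)[OF e'] by auto
     ultimately have "(h \<circ> g) \<circ> g' : funs Z ?W"
      using funs_subspace_open[OF Z oW, of "g ` points Y"] by simp
     moreover have "ALL y:W \<inter> ?W. h y = ((h \<circ> g) \<circ> g') y" using open_embD(4)[OF e'] by auto
     ultimately show ?thesis using oW x \<open>z : W\<close> by blast
    qed
   qed
  qed (erule morphism_funs[OF m W])
 qed
qed

subsection \<open>Patching\<close>

text \<open>When the relation is the graph of a bijection between subsets, every second gluing step
  returns to the start. So a class has at most two members and the closure in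
  \<open>patch_class\<close> disappears.\<close>

lemma patch_class_bi_unique:
 assumes R: "\<And>x y y'. (x, y) : R ==> (x, y') : R ==> y = y'"
  and R': "\<And>x x' y. (x, y) : R ==> (x', y) : R ==> x = x'"
 shows "patch_class R (Inl x) = insert (Inl x) (Inr ` {y. (x, y) : R})"
  and "patch_class R (Inr y) = insert (Inr y) (Inl ` {x. (x, y) : R})"
proof -
 define T where "T = {(Inl x, Inr y) | x y. (x, y) : R} \<union> {(Inl x, Inr y) | x y. (x, y) : R}\<inverse>"
 have pc: "patch_class R z = T\<^sup>* `` {z}" for z unfolding patch_class_def T_def Let_def by simp
 have T: "(u, v) : T \<longleftrightarrow> (EX x y. (x, y) : R & (u = Inl x & v = Inr y \<or> u = Inr y & v = Inl x))" for u v
  unfolding T_def by auto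
 have st: "(u, w) : T\<^sup>* \<longleftrightarrow> w = u \<or> (u, w) : T" for u w
 proof
  assume "(u, w) : T\<^sup>*"
  thus "w = u \<or> (u, w) : T"
  proof (induction rule: rtrancl_induct)
   case (step y z)
   thus ?case unfolding T using R R' by blast
  qed simp
 qed auto
 show "patch_class R (Inl x) = insert (Inl x) (Inr ` {y. (x, y) : R})" unfolding pc by (auto simp: st T)
 show "patch_class R (Inr y) = insert (Inr y) (Inl ` {x. (x, y) : R})" unfolding pc by (auto simp: st T)
qed

lemma patch_class_eq:
 assumes R: "\<And>x y y'. (x, y) : R ==> (x, y') : R ==> y = y'"
  and R': "\<And>x x' y. (x, y) : R ==> (x', y) : R ==> x = x'"
 shows "patch_class R (Inl x) = patch_class R (Inl x') \<longleftrightarrow> x = x'"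
  and "patch_class R (Inr y) = patch_class R (Inr y') \<longleftrightarrow> y = y'"
  and "patch_class R (Inl x) = patch_class R (Inr y) \<longleftrightarrow> (x, y) : R"
proof -
 have pc: "patch_class R (Inl x) = insert (Inl x) (Inr ` {y. (x, y) : R})"
  "patch_class R (Inr y) = insert (Inr y) (Inl ` {x. (x, y) : R})" for x y
  by (rule patch_class_bi_unique; use R R' in blast)+
 show "patch_class R (Inl x) = patch_class R (Inl x') \<longleftrightarrow> x = x'" unfolding pc by auto
 show "patch_class R (Inr y) = patch_class R (Inr y') \<longleftrightarrow> y = y'" unfolding pc by auto
 show "patch_class R (Inl x) = patch_class R (Inr y) \<longleftrightarrow> (x, y) : R" unfolding pc
 proof
  assume eq: "insert (Inl x) (Inr ` {y. (x, y) : R}) = insert (Inr y) (Inl ` {x. (x, y) : R})"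
  have "Inl x : insert (Inr y) (Inl ` {x. (x, y) : R})" unfolding eq[symmetric] by simp
  thus "(x, y) : R" by auto
 next
  assume xy: "(x, y) : R"
  hence "{y. (x, y) : R} = {y}" "{x. (x, y) : R} = {x}" using R R' by blast+
  thus "insert (Inl x) (Inr ` {y. (x, y) : R}) = insert (Inr y) (Inl ` {x. (x, y) : R})" by auto
 qed
qed

lemma final_map_patch: "final_map (sum_space X Y) (patch X Y R) (patch_class R)"
 unfolding patch_def by (rule final_map_quotient)

locale patching =
 fixes X :: "'a fspace" and Y :: "'b fspace" and A B \<theta> \<theta>' and R :: "('a \<times> 'b) set"
 assumes X: "curved X" and Y: "curved Y"
  and A: "opn X A" and B: "opn Y B"
  and \<theta>: "morphism (subspace_of X A) (subspace_of Y B) \<theta>"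
  and \<theta>': "morphism (subspace_of Y B) (subspace_of X A) \<theta>'"
  and inv1: "\<And>x. x : A ==> \<theta>' (\<theta> x) = x" and inv2: "\<And>y. y : B ==> \<theta> (\<theta>' y) = y"
  and R: "\<And>x y. (x, y) : R \<longleftrightarrow> x : A & y = \<theta> x"
begin

definition "inl = (%x. patch_class R (Inl x))"
definition "inr = (%y. patch_class R (Inr y))"
definition "P = patch X Y R"

lemma \<theta>_in: "x : A ==> \<theta> x : B" and \<theta>'_in: "y : B ==> \<theta>' y : A"
 using morphism_in[OF \<theta>] morphism_in[OF \<theta>']
 unfolding points_subspace_open[OF A] points_subspace_open[OF B] by blast+

lemma R': "(x, y) : R \<longleftrightarrow> y : B & x = \<theta>' y"
 using R \<theta>_in \<theta>'_in inv1 inv2 by metis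

lemma inl_eq: "inl x = inl x' \<longleftrightarrow> x = x'"
 and inr_eq: "inr y = inr y' \<longleftrightarrow> y = y'"
 and inl_inr_eq: "inl x = inr y \<longleftrightarrow> (x, y) : R" unfolding inl_def inr_def
 by (rule patch_class_eq; use R R' in metis)+

lemma curved_patch: "curved P" unfolding P_def by (rule curved_final[OF curved_sum[OF X Y] final_map_patch])

lemma points_patch: "points P = inl ` points X \<union> inr ` points Y"
 unfolding P_def final_map_points[OF final_map_patch] points_sum inl_def inr_def by (simp add: image_Un image_image)

lemma morphism_inl: "morphism X P inl" using morphism_compose[OF morphism_Inl final_map_morphism[OF final_map_patch]]
 unfolding P_def inl_def comp_def .

lemma morphism_inr: "morphism Y P inr" using morphism_compose[OF morphism_Inr final_map_morphism[OF final_map_patch]]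
 unfolding P_def inr_def comp_def .

definition "inl' = (%z. THE x. inl x = z)"
definition "inr' = (%z. THE y. inr y = z)"

lemma inl'_inl [simp]: "inl' (inl x) = x" and inr'_inr [simp]: "inr' (inr y) = y"
 unfolding inl'_def inr'_def by (auto simp: inl_eq inr_eq)

lemma As: "A \<subseteq> points X" and Bs: "B \<subseteq> points Y" using A B openin_subset by blast+

text \<open>The preimage of the first copy in the disjoint sum is all of \<open>X\<close> together
  with \<open>B\<close>, and there the inverse is the identity on \<open>X\<close> and
  \<open>\<theta>'\<close> on \<open>B\<close>. Regularity of the transition map is what makes the
  inverse regular.\<close>

lemma open_emb_inl: "open_emb X P inl inl'"
proof -
 let ?S = "inl ` points X"
 have pre: "{e : points (sum_space X Y). patch_class R e : ?S} = Inl ` points X \<union> Inr ` B"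
 proof -
  have 1: "inr y : ?S \<longleftrightarrow> y : B" for y
  proof
   assume "inr y : ?S"
   then obtain x where "inl x = inr y" by auto
   thus "y : B" using inl_inr_eq R' by blast
  next
   assume y: "y : B"
   hence "inl (\<theta>' y) = inr y" using inl_inr_eq R' by blast
   thus "inr y : ?S" using \<theta>'_in[OF y] As by (metis image_eqI subsetD)
  qed
  have 1: "patch_class R (Inr y) : ?S \<longleftrightarrow> y : B" for y using 1[of y] by (simp add: inr_def)
  have "inl x : ?S \<longleftrightarrow> x : points X" for x using inl_eq by auto
  hence 2: "patch_class R (Inl x) : ?S \<longleftrightarrow> x : points X" for x using inl_def by metis
  have "e : {e : points (sum_space X Y). patch_class R e : ?S} \<longleftrightarrow> e : Inl ` points X \<union> Inr ` B" for e
   using Bs by (cases e) (auto simp: points_sum 1 2)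
  thus ?thesis by blast
 qed
 have v: "Inl -` (Inl ` points X \<union> Inr ` B) = points X" "Inr -` (Inl ` points X \<union> Inr ` B) = B" by auto
 have oE: "opn (sum_space X Y) (Inl ` points X \<union> Inr ` B)" unfolding openin_sum v using B by simp
 have Ss: "?S \<subseteq> points P" using points_patch by blast
 have o: "opn P ?S" using final_map_openin[OF final_map_patch, of ?S X Y R] Ss oE unfolding P_def pre by blast
 note fin = final_map_restrict[OF curved_sum[OF X Y] final_map_patch, of R ?S, folded P_def, OF o, unfolded pre]
 have oX: "opn X (points X)" by blast
 have m1: "morphism (subspace_of X (points X)) X (%x. x)" by (rule morphism_subspace_incl[OF X oX])
 have m2: "morphism (subspace_of Y B) X \<theta>'"
  using morphism_compose[OF \<theta>' morphism_subspace_incl[OF X A]] by (simp add: comp_def)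
 have "morphism (subspace_of (sum_space X Y) (Inl ` points X \<union> Inr ` B)) X (case_sum (%x. x) \<theta>')"
  by (rule morphism_sum_open[OF X Y X oX B m1 m2])
 hence "morphism (subspace_of (sum_space X Y) (Inl ` points X \<union> Inr ` B)) X (inl' \<circ> patch_class R)"
 proof (rule morphism_cong[OF curved_subspace[OF curved_sum[OF X Y] oE] X])
  fix e assume "e : points (subspace_of (sum_space X Y) (Inl ` points X \<union> Inr ` B))"
  hence "e : Inl ` points X \<union> Inr ` B" using points_subspace_open[OF oE] by blast
  moreover have "inl' (inr y) = \<theta>' y" if "y : B" for y
   using inl_inr_eq[of "\<theta>' y" y] R' that inl'_inl by metis
  ultimately show "case_sum (%x. x) \<theta>' e = (inl' \<circ> patch_class R) e"
   by (auto simp: inl_def[symmetric] inr_def[symmetric] fun_cong[OF inl_def, symmetric] fun_cong[OF inr_def, symmetric])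
 qed
 from morphism_final[OF fin this] show ?thesis unfolding open_emb_def using o morphism_inl by simp
qed

lemma open_emb_inr: "open_emb Y P inr inr'"
proof -
 let ?S = "inr ` points Y"
 have pre: "{e : points (sum_space X Y). patch_class R e : ?S} = Inl ` A \<union> Inr ` points Y"
 proof -
  have 1: "inl x : ?S \<longleftrightarrow> x : A" for x
  proof
   assume "inl x : ?S"
   then obtain y where "inl x = inr y" by auto
   thus "x : A" using inl_inr_eq R by blast
  next
   assume x: "x : A"
   hence "inl x = inr (\<theta> x)" using inl_inr_eq R by blast
   thus "inl x : ?S" using \<theta>_in[OF x] Bs by (metis image_eqI subsetD)
  qed
  show ?thesis unfolding points_sum using As 1[unfolded inl_def] by (auto simp: inr_def)
 qed
 have v: "Inl -` (Inl ` A \<union> Inr ` points Y) = A" "Inr -` (Inl ` A \<union> Inr ` points Y) = points Y" by auto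
 have oE: "opn (sum_space X Y) (Inl ` A \<union> Inr ` points Y)" unfolding openin_sum v using A by simp
 have Ss: "?S \<subseteq> points P" using points_patch by blast
 have o: "opn P ?S" using final_map_openin[OF final_map_patch, of ?S X Y R] Ss oE unfolding P_def pre by blast
 note fin = final_map_restrict[OF curved_sum[OF X Y] final_map_patch, of R ?S, folded P_def, OF o, unfolded pre]
 have oY: "opn Y (points Y)" by blast
 have m1: "morphism (subspace_of Y (points Y)) Y (%x. x)" by (rule morphism_subspace_incl[OF Y oY])
 have m2: "morphism (subspace_of X A) Y \<theta>"
  using morphism_compose[OF \<theta> morphism_subspace_incl[OF Y B]] by (simp add: comp_def)
 have "morphism (subspace_of (sum_space X Y) (Inl ` A \<union> Inr ` points Y)) Y (case_sum \<theta> (%x. x))"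
  by (rule morphism_sum_open[OF X Y Y A oY m2 m1])
 hence "morphism (subspace_of (sum_space X Y) (Inl ` A \<union> Inr ` points Y)) Y (inr' \<circ> patch_class R)"
 proof (rule morphism_cong[OF curved_subspace[OF curved_sum[OF X Y] oE] Y])
  fix e assume "e : points (subspace_of (sum_space X Y) (Inl ` A \<union> Inr ` points Y))"
  hence "e : Inl ` A \<union> Inr ` points Y" using points_subspace_open[OF oE] by blast
  moreover have "inr' (inl x) = \<theta> x" if "x : A" for x
   using inl_inr_eq[of x "\<theta> x"] R that inr'_inr by metis
  ultimately show "case_sum \<theta> (%x. x) e = (inr' \<circ> patch_class R) e"
   by (auto simp: fun_cong[OF inl_def, symmetric] fun_cong[OF inr_def, symmetric])
 qed
 from morphism_final[OF fin this] show ?thesis unfolding open_emb_def using o morphism_inr by simp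
qed

end

section \<open>Convex geometry of nonsingular fans\<close>

section \<open>Nonsingular cones and fans\<close>

definition pairing :: "int^'d => int^'d::finite => int" where
 "pairing m v = (\<Sum>i\<in>UNIV. m $ i * v $ i)"

lemma pairing_scale: "pairing m (k *s x) = k * pairing m x" by (simp add: pairing_def sum_distrib_left algebra_simps)

lemma pairing_axis: "pairing (axis i 1) v = v $ i"
 by (simp add: pairing_def axis_def if_distrib[of "%x. x * _"] cong: if_cong)

lemma real_vec_nth [simp]: "real_vec v $ i = real_of_int (v $ i)" by (simp add: real_vec_def)

lemma real_vec_eq_iff [simp]: "real_vec v = real_vec w \<longleftrightarrow> v = w" by (simp add: vec_eq_iff)

lemma inner_real_vec: "real_vec m \<bullet> real_vec v = real_of_int (pairing m v)"
 by (simp add: inner_vec_def pairing_def)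

lemma real_vec_sum: "real_vec (\<Sum>v\<in>B. c v *s v) = (\<Sum>v\<in>B. real_of_int (c v) *\<^sub>R real_vec v)"
 by (simp add: vec_eq_iff)

text \<open>For sublattices cut out by vanishing coordinates, functionals on \<open>L\<close> extend
  by zero to the whole lattice, so dual bases can be sought in \<open>int^'d\<close> for both
  fans.\<close>

definition coordinate_lattice :: "(int^'d::finite) set => bool" where
 "coordinate_lattice L \<longleftrightarrow> (ALL i. axis i 1 : L \<or> (ALL x:L. x $ i = 0))"

lemma coordinate_lattice_UNIV: "coordinate_lattice UNIV" by (simp add: coordinate_lattice_def)

lemma coordinate_lattice_hyperplane: "coordinate_lattice (hyperplane_lattice l)"
 by (auto simp: coordinate_lattice_def hyperplane_lattice_def axis_def)

lemma lattice_basis_subset: "lattice_basis L B ==> B \<subseteq> L"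
proof
 fix w assume B: "lattice_basis L B" and w: "w : B"
 have fB: "finite B" using B by (simp add: lattice_basis_def)
 have "(\<Sum>v\<in>B. (if v = w then 1 else 0) *s v) = (\<Sum>v\<in>B. if v = w then w else 0)"
  by (intro sum.cong) auto
 also have "\<dots> = w" using w fB by simp
 finally have w: "w = (\<Sum>v\<in>B. (if v = w then 1 else 0) *s v)" by (rule sym)
 have LB: "L = {(\<Sum>v\<in>B. c v *s v) | c. True}" using B by (simp add: lattice_basis_def)
 show "w : L" unfolding LB mem_Collect_eq by (intro exI conjI, rule w, rule TrueI)
qed

lemma dual_basis:
 fixes B :: "(int^'d::finite) set"
 assumes B: "lattice_basis L B" and L: "coordinate_lattice L"
 obtains m where "\<And>v w. v : B ==> w : B ==> pairing (m v) w = (if v = w then 1 else 0)"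
  and "\<And>x. x : L ==> x = (\<Sum>v\<in>B. pairing (m v) x *s v)"
proof -
 have fB: "finite B" and LB: "L = {(\<Sum>v\<in>B. c v *s v) | c. True}"
  and indep: "\<And>c. (\<Sum>v\<in>B. c v *s v) = 0 ==> ALL v:B. c v = 0"
  using B unfolding lattice_basis_def by blast+
 have "ALL i. EX c. axis i 1 : L --> axis i 1 = (\<Sum>v\<in>B. c v *s v)" using LB by blast
 then obtain C where C: "\<And>i. axis i 1 : L ==> axis i 1 = (\<Sum>v\<in>B. C i v *s v)" by metis
 \<comment> \<open>At indices \<open>i\<close> with \<open>axis i 1\<close> outside \<open>L\<close>
   the value of \<open>C i v\<close> is arbitrary; it is multiplied by \<open>x $ i\<close>, which
   is 0 on \<open>L\<close>.\<close>
 define m where "m = (%v. \<chi> i. C i v)"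
 have exp: "x = (\<Sum>v\<in>B. pairing (m v) x *s v)" if x: "x : L" for x
 proof -
  have "x = (\<Sum>i\<in>UNIV. x $ i *s axis i 1)"
   by (simp add: vec_eq_iff axis_def if_distrib[of "%y. _ * y"] cong: if_cong)
  also have "\<dots> = (\<Sum>i\<in>UNIV. x $ i *s (\<Sum>v\<in>B. C i v *s v))"
  proof (rule sum.cong)
   fix i :: 'd
   show "x $ i *s axis i 1 = x $ i *s (\<Sum>v\<in>B. C i v *s v)"
    using L x C[of i] unfolding coordinate_lattice_def by (cases "axis i (1::int) : L") auto
  qed simp
  also have "\<dots> = (\<Sum>i\<in>UNIV. \<Sum>v\<in>B. (x $ i * C i v) *s v)"
   by (simp add: vec_eq_iff sum_distrib_left mult.assoc)
  also have "\<dots> = (\<Sum>v\<in>B. \<Sum>i\<in>UNIV. (x $ i * C i v) *s v)" by (rule sum.swap)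
  also have "\<dots> = (\<Sum>v\<in>B. pairing (m v) x *s v)"
   by (simp add: vec_eq_iff pairing_def m_def sum_distrib_left sum_distrib_right mult_ac)
  finally show ?thesis .
 qed
 have "pairing (m v) w = (if v = w then 1 else 0)" if v: "v : B" and w: "w : B" for v w
 proof -
  have "(\<Sum>u\<in>B. (pairing (m u) w - (if u = w then 1 else 0)) *s u) =
    (\<Sum>u\<in>B. pairing (m u) w *s u) - (\<Sum>u\<in>B. (if u = w then 1 else 0) *s u)"
   by (simp add: vec.scale_left_diff_distrib sum_subtractf)
  also have "(\<Sum>u\<in>B. (if u = w then 1 else 0) *s u) = (\<Sum>u\<in>B. if u = w then w else 0)"
   by (intro sum.cong) auto
  also have "\<dots> = w" using w fB by simp
  also have "(\<Sum>u\<in>B. pairing (m u) w *s u) = w" using exp[of w] lattice_basis_subset[OF B] w by auto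
  finally have "(\<Sum>u\<in>B. (pairing (m u) w - (if u = w then 1 else 0)) *s u) = 0" by simp
  from indep[OF this] v show ?thesis by fastforce
 qed
 with exp that show ?thesis by blast
qed

lemma cone_gen_eq:
 assumes "finite S"
 shows "cone_gen S = {(\<Sum>v\<in>S. a v *\<^sub>R real_vec v) | a. ALL v:S. 0 \<le> a v}" (is "_ = ?C")
proof
 have "0 : ?C" by (auto intro!: exI[of _ "%v. 0"])
 have "x + y : ?C" if xy: "x : ?C" "y : ?C" for x y
 proof -
  obtain a b where "x = (\<Sum>v\<in>S. a v *\<^sub>R real_vec v)" "ALL v:S. 0 \<le> a v"
   "y = (\<Sum>v\<in>S. b v *\<^sub>R real_vec v)" "ALL v:S. 0 \<le> b v" using xy by blast
  thus ?thesis by (auto intro!: exI[of _ "%v. a v + b v"] simp: scaleR_add_left sum.distrib)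
 qed
 moreover have "k *\<^sub>R x : ?C" if x: "x : ?C" "k \<ge> 0" for x k
 proof -
  obtain a where "x = (\<Sum>v\<in>S. a v *\<^sub>R real_vec v)" "ALL v:S. 0 \<le> a v" using x by blast
  thus ?thesis using x(2) by (auto intro!: exI[of _ "%v. k * a v"] simp: scaleR_sum_right)
 qed
 ultimately have "convex_cone ?C" unfolding convex_cone_def convex_def conic_def using \<open>0 : ?C\<close> by auto
 moreover have "real_vec ` S \<subseteq> ?C"
 proof clarify
  fix w assume w: "w : S"
  have "(\<Sum>v\<in>S. (if v = w then 1 else 0) *\<^sub>R real_vec v) = (\<Sum>v\<in>S. if v = w then real_vec w else 0)"
   by (intro sum.cong) auto
  also have "\<dots> = real_vec w" using w assms by simp
  finally show "EX a. real_vec w = (\<Sum>v\<in>S. a v *\<^sub>R real_vec v) & (ALL v:S. 0 \<le> a v)"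
   by (intro exI[of _ "%v. if v = w then 1 else 0"]) simp
 qed
 ultimately show "cone_gen S \<subseteq> ?C" unfolding cone_gen_def by (intro hull_minimal)
 have "(\<Sum>v\<in>T. a v *\<^sub>R real_vec v) : cone_gen S" if "T \<subseteq> S" "ALL v:S. 0 \<le> a v" for T a
  using finite_subset[OF that(1) assms] that(1)
 proof (induction T rule: finite_induct)
  case empty
  thus ?case by (simp add: cone_gen_def convex_cone_hull_contains_0)
 next
  case (insert w T)
  hence "a w *\<^sub>R real_vec w : cone_gen S"
   unfolding cone_gen_def using that(2) by (intro convex_cone_hull_mul hull_inc) auto
  thus ?case using insert unfolding cone_gen_def by (simp add: convex_cone_hull_add)
 qed
 thus "?C \<subseteq> cone_gen S" by blast
qed

lemma zero_in_cone_gen: "0 : cone_gen S" by (simp add: cone_gen_def convex_cone_hull_contains_0)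

lemma gen_in_cone_gen: "v : S ==> real_vec v : cone_gen S" by (simp add: cone_gen_def hull_inc)

lemma cone_gen_mono: "S \<subseteq> T ==> cone_gen S \<subseteq> cone_gen T"
 unfolding cone_gen_def by (intro hull_mono image_mono)

lemma cone_gen_add: "x : cone_gen S ==> y : cone_gen S ==> x + y : cone_gen S"
 and cone_gen_scale: "x : cone_gen S ==> 0 \<le> k ==> k *\<^sub>R x : cone_gen S"
 by (simp_all add: cone_gen_def convex_cone_hull_add convex_cone_hull_mul)

lemma cone_gen_sum:
 "finite T ==> (\<And>v. v : T ==> real_vec v : cone_gen S & 0 \<le> a v) ==>
   (\<Sum>v\<in>T. a v *\<^sub>R real_vec v) : cone_gen S"
 by (induction T rule: finite_induct) (auto simp: zero_in_cone_gen cone_gen_add cone_gen_scale)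

text \<open>An integral dual system witnesses that \<open>S\<close> is part of a lattice basis;
  membership in the cone over \<open>S\<close> and in its faces becomes a matter of signs of the
  functionals \<open>m v\<close>.\<close>

definition dual_to :: "(int^'d::finite) set => (int^'d => int^'d) => bool" where
 "dual_to S m \<longleftrightarrow> finite S & (ALL v:S. ALL w:S. pairing (m v) w = (if v = w then 1 else 0))"

lemma dual_to_coeff:
 assumes "dual_to S m" "v : S"
 shows "real_vec (m v) \<bullet> (\<Sum>w\<in>S. a w *\<^sub>R real_vec w) = a v"
proof -
 have "real_vec (m v) \<bullet> (\<Sum>w\<in>S. a w *\<^sub>R real_vec w) = (\<Sum>w\<in>S. a w * real_of_int (pairing (m v) w))"
  by (simp add: inner_sum_right inner_real_vec)
 also have "\<dots> = (\<Sum>w\<in>S. if w = v then a v else 0)"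
  using assms by (intro sum.cong) (auto simp: dual_to_def)
 also have "\<dots> = a v" using assms by (simp add: dual_to_def)
 finally show ?thesis .
qed

lemma dual_to_cone_gen:
 assumes "dual_to S m"
 shows "x : cone_gen S \<longleftrightarrow> x = (\<Sum>v\<in>S. (real_vec (m v) \<bullet> x) *\<^sub>R real_vec v) &
  (ALL v:S. 0 \<le> real_vec (m v) \<bullet> x)"
proof -
 have fS: "finite S" using assms by (simp add: dual_to_def)
 show ?thesis
 proof
  assume "x : cone_gen S"
  then obtain a where a: "x = (\<Sum>v\<in>S. a v *\<^sub>R real_vec v)" "ALL v:S. 0 \<le> a v"
   using cone_gen_eq[OF fS] by blast
  have "real_vec (m v) \<bullet> x = a v" if "v : S" for v unfolding a(1) by (rule dual_to_coeff[OF assms that])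
  thus "x = (\<Sum>v\<in>S. (real_vec (m v) \<bullet> x) *\<^sub>R real_vec v) & (ALL v:S. 0 \<le> real_vec (m v) \<bullet> x)"
   using a by simp
 next
  assume x: "x = (\<Sum>v\<in>S. (real_vec (m v) \<bullet> x) *\<^sub>R real_vec v) & (ALL v:S. 0 \<le> real_vec (m v) \<bullet> x)"
  hence "(\<Sum>v\<in>S. (real_vec (m v) \<bullet> x) *\<^sub>R real_vec v) : cone_gen S"
   by (intro cone_gen_sum[OF fS]) (simp add: gen_in_cone_gen)
  thus "x : cone_gen S" using x by simp
 qed
qed

lemma dual_to_subset: "dual_to S m ==> T \<subseteq> S ==> dual_to T m"
 unfolding dual_to_def using finite_subset by blast

lemma dual_to_notin_span:
 assumes "dual_to S m" "T \<subseteq> S" "v : S - T" "x : cone_gen T"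
 shows "real_vec (m v) \<bullet> x = 0"
proof -
 have fT: "finite T" using assms finite_subset unfolding dual_to_def by blast
 obtain a where "x = (\<Sum>v\<in>T. a v *\<^sub>R real_vec v)" using assms(4) cone_gen_eq[OF fT] by blast
 thus ?thesis using assms by (auto simp: inner_sum_right inner_real_vec dual_to_def subset_eq intro!: sum.neutral)
qed

lemma face_of_cone_gen:
 assumes "dual_to S m" "T \<subseteq> S"
 shows "cone_gen T face_of cone_gen S" unfolding face_of_def
proof (intro conjI ballI impI)
 show "cone_gen T \<subseteq> cone_gen S" by (rule cone_gen_mono[OF assms(2)])
 show "convex (cone_gen T)" by (simp add: cone_gen_def convex_convex_cone_hull)
 fix a b x assume a: "a : cone_gen S" and b: "b : cone_gen S" and x: "x : cone_gen T"
  and seg: "x : open_segment a b"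
 obtain u where u: "0 < u" "u < 1" "x = (1 - u) *\<^sub>R a + u *\<^sub>R b" using seg by (auto simp: in_segment)
 have z: "real_vec (m v) \<bullet> a = 0 & real_vec (m v) \<bullet> b = 0" if v: "v : S - T" for v
 proof -
  have "(1 - u) * (real_vec (m v) \<bullet> a) + u * (real_vec (m v) \<bullet> b) = real_vec (m v) \<bullet> x"
   unfolding u(3) by (simp add: inner_add_right)
  also have "\<dots> = 0" by (rule dual_to_notin_span[OF assms v x])
  finally have eq: "(1 - u) * (real_vec (m v) \<bullet> a) + u * (real_vec (m v) \<bullet> b) = 0" .
  have "0 \<le> real_vec (m v) \<bullet> a" "0 \<le> real_vec (m v) \<bullet> b"
   using a b v dual_to_cone_gen[OF assms(1)] by blast+
  thus ?thesis using eq u(1,2) by (smt (verit, ccfv_SIG) mult_pos_pos mult_nonneg_nonneg zero_less_mult_iff)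
 qed
 have "y : cone_gen T" if y: "y : cone_gen S" "\<And>v. v : S - T ==> real_vec (m v) \<bullet> y = 0" for y
 proof -
  have "y = (\<Sum>v\<in>S. (real_vec (m v) \<bullet> y) *\<^sub>R real_vec v)" "ALL v:S. 0 \<le> real_vec (m v) \<bullet> y"
   using y(1) dual_to_cone_gen[OF assms(1)] by blast+
  moreover have "(\<Sum>v\<in>S. (real_vec (m v) \<bullet> y) *\<^sub>R real_vec v) = (\<Sum>v\<in>T. (real_vec (m v) \<bullet> y) *\<^sub>R real_vec v)"
   by (rule sum.mono_neutral_right) (use assms y(2) in \<open>auto simp: dual_to_def\<close>)
  ultimately show ?thesis unfolding dual_to_cone_gen[OF dual_to_subset[OF assms]] using assms(2) by auto
 qed
 with z a b show "a : cone_gen T" "b : cone_gen T" by blast+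
qed

lemma face_of_cone_summand:
 assumes F: "F face_of C" and C: "\<And>x k. x : C ==> 0 \<le> k ==> k *\<^sub>R x : C"
  and x: "x : C" and y: "y : C" and xy: "x + y : F"
 shows "x : F"
proof -
 \<comment> \<open>Faces are defined through open segments, which degenerate when the two summands
   agree; then \<open>2 z\<close> has to be seen as the midpoint of \<open>z\<close> and
   \<open>3 z\<close>.\<close>
 have d: "z : F" if "2 *\<^sub>R z : F" "z : C" for z
 proof (cases "z = 0")
  case False
  have "(1 - 1/2) *\<^sub>R z + (1/2) *\<^sub>R (3 *\<^sub>R z) = ((1 - 1/2) + 3/2) *\<^sub>R z"
   by (simp only: scaleR_add_left scaleR_scaleR) simp
  moreover have "z ~= 3 *\<^sub>R z"
  proof
   assume "z = 3 *\<^sub>R z"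
   hence "1 *\<^sub>R z = 3 *\<^sub>R z" by simp
   thus False using False by (simp only: scaleR_cancel_right) simp
  qed
  ultimately have "2 *\<^sub>R z : open_segment z (3 *\<^sub>R z)"
   unfolding in_segment by (intro conjI exI[of _ "1/2"]) simp_all
  thus ?thesis using F that C[of z 3] unfolding face_of_def by auto
 qed (use that in simp)
 show ?thesis
 proof (cases "x = y")
  case True
  thus ?thesis using d[of x] x xy by (simp add: scaleR_2)
 next
  case False
  have "x + y : open_segment (2 *\<^sub>R x) (2 *\<^sub>R y)"
   unfolding in_segment using False by (auto intro!: exI[of _ "1/2"])
  hence "2 *\<^sub>R x : F" using F xy C[OF x, of 2] C[OF y, of 2] unfolding face_of_def by auto
  thus ?thesis using d x by blast
 qed
qed

lemma face_of_cone_gen_sum: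
 assumes F: "F face_of cone_gen S" and T: "finite T" "T \<subseteq> S" and pos: "\<And>v. v : T ==> 0 < a v"
  and sum: "(\<Sum>v\<in>T. a v *\<^sub>R real_vec v) : F" and w: "w : T"
 shows "real_vec w : F"
proof -
 have wS: "real_vec w : cone_gen S" using w T gen_in_cone_gen by blast
 have "(\<Sum>v\<in>T. a v *\<^sub>R real_vec v) = a w *\<^sub>R real_vec w + (\<Sum>v\<in>T - {w}. a v *\<^sub>R real_vec v)"
  using T(1) w by (rule sum.remove)
 moreover have "(\<Sum>v\<in>T - {w}. a v *\<^sub>R real_vec v) : cone_gen S"
  by (rule cone_gen_sum) (use T pos in \<open>auto intro: less_imp_le gen_in_cone_gen\<close>)
 ultimately have 1: "a w *\<^sub>R real_vec w : F"
  using face_of_cone_summand[OF F, of "a w *\<^sub>R real_vec w" "\<Sum>v\<in>T - {w}. a v *\<^sub>R real_vec v"]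
   sum cone_gen_scale wS pos[OF w] by auto
 have "conic F" using face_of_conic[OF _ F] by (simp add: cone_gen_def conic_convex_cone_hull)
 hence "(1 / a w) *\<^sub>R (a w *\<^sub>R real_vec w) : F"
  using 1 pos[OF w] unfolding conic_def by (meson less_imp_le zero_le_divide_1_iff)
 thus ?thesis using pos[OF w] by simp
qed

lemma closed_cone_gen:
 assumes "dual_to S m"
 shows "closed (cone_gen S)"
proof -
 have "cone_gen S = {x. x = (\<Sum>v\<in>S. (real_vec (m v) \<bullet> x) *\<^sub>R real_vec v)} \<inter>
   (\<Inter>v\<in>S. {x. 0 \<le> real_vec (m v) \<bullet> x})" using dual_to_cone_gen[OF assms] by blast
 moreover have "closed {x. x = (\<Sum>v\<in>S. (real_vec (m v) \<bullet> x) *\<^sub>R real_vec v)}"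
  by (intro closed_Collect_eq continuous_intros)
 moreover have "closed (\<Inter>v\<in>S. {x. 0 \<le> real_vec (m v) \<bullet> x})"
  by (intro closed_INT ballI closed_Collect_le continuous_intros)
 ultimately show ?thesis by (simp add: closed_Int)
qed

subsection \<open>The generators of the cones of a fan\<close>

lemma fanD:
 assumes "fan L Fn"
 shows "finite Fn" "Fn ~= {}" "\<And>cn. cn : Fn ==> nonsingular_cone L cn"
  "\<And>cn tn. cn : Fn ==> tn face_of cn ==> tn ~= {} ==> tn : Fn"
  "\<And>cn tn. cn : Fn ==> tn : Fn ==> cn \<inter> tn face_of cn"
  "\<And>cn tn. cn : Fn ==> tn : Fn ==> cn \<inter> tn face_of tn" using assms unfolding fan_def by blast+

lemma primitive_of_dual:
 assumes "dual_to S m" "v : S"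
 shows "primitive_vec v" unfolding primitive_vec_def
proof (intro conjI allI impI)
 have p: "pairing (m v) v = 1" using assms by (simp add: dual_to_def)
 thus "v ~= 0" by (auto simp: pairing_def)
 fix k w assume "v = k *s w"
 hence "k * pairing (m v) w = 1" using p pairing_scale by metis
 thus "\<bar>k\<bar> = 1" using abs_zmult_eq_1[of k "pairing (m v) w"] by simp
qed

text \<open>A ray of the fan inside the cone is a face of it, so it contains every element of
  \<open>S\<close> that occurs with positive coefficient in the primitive vector of the ray;
  primitivity then identifies the two.\<close>

lemma cone_gens_cone_gen:
 assumes F: "fan L Fn" and cn: "cone_gen S : Fn" and S: "dual_to S m"
 shows "cone_gens Fn (cone_gen S) = S"
proof
 have fS: "finite S" using S by (simp add: dual_to_def)
 have ray: "cone_gen {v} : Fn" if "v : S" for v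
  by (rule fanD(4)[OF F cn face_of_cone_gen[OF S]]) (use that zero_in_cone_gen in blast)+
 thus "S \<subseteq> cone_gens Fn (cone_gen S)"
  unfolding cone_gens_def gens_def using primitive_of_dual[OF S] gen_in_cone_gen by blast
 show "cone_gens Fn (cone_gen S) \<subseteq> S"
 proof
  fix v assume "v : cone_gens Fn (cone_gen S)"
  hence v: "primitive_vec v" "cone_gen {v} : Fn" "real_vec v : cone_gen S" unfolding cone_gens_def gens_def by blast+
  have "cone_gen {v} \<subseteq> cone_gen S"
   using v(3) cone_gen_scale unfolding cone_gen_eq[of "{v}", simplified] by auto
  hence face: "cone_gen {v} face_of cone_gen S" using fanD(6)[OF F v(2) cn] by (simp add: Int_absorb2)
  define a where "a = (%w. real_vec (m w) \<bullet> real_vec v)"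
  have a: "real_vec v = (\<Sum>w\<in>S. a w *\<^sub>R real_vec w)" "ALL w:S. 0 \<le> a w"
   using v(3) dual_to_cone_gen[OF S] unfolding a_def by blast+
  have "EX s:S. a s ~= 0"
  proof (rule ccontr)
   assume "\<not> (EX s:S. a s ~= 0)"
   hence "real_vec v = 0" using a(1) by simp
   hence "v = 0" by (simp add: vec_eq_iff)
   thus False using v(1) by (simp add: primitive_vec_def)
  qed
  then obtain s where s: "s : S" "a s > 0" using a(2) by fastforce
  define T where "T = {w : S. a w ~= 0}"
  have "(\<Sum>w\<in>T. a w *\<^sub>R real_vec w) = real_vec v"
   unfolding a(1) T_def by (rule sum.mono_neutral_left) (use fS in auto)
  hence "real_vec s : cone_gen {v}" by (intro face_of_cone_gen_sum[OF face, of T a])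
    (use fS a(2) s gen_in_cone_gen[of v "{v}"] in \<open>auto simp: T_def less_le\<close>)
  then obtain bt where bt: "real_vec s = bt *\<^sub>R real_vec v" "bt \<ge> 0"
   unfolding cone_gen_eq[of "{v}", simplified] by auto
  define k where "k = pairing (m s) v"
  have "1 = bt * real_of_int k"
  proof -
   have "real_vec (m s) \<bullet> real_vec s = bt * (real_vec (m s) \<bullet> real_vec v)" unfolding bt(1) by simp
   thus ?thesis using S s(1) unfolding inner_real_vec k_def dual_to_def by simp
  qed
  hence k0: "k ~= 0" by auto
  with \<open>1 = bt * real_of_int k\<close> have bk: "bt = 1 / real_of_int k" by (simp add: field_simps)
  have "real_of_int (k * s $ i) = real_of_int (v $ i)" for i
  proof -
   have "real_of_int (s $ i) = bt * real_of_int (v $ i)" using arg_cong[OF bt(1), of "%x. x $ i"] by simp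
   thus ?thesis using bk k0 by simp
  qed
  hence "v = k *s s" unfolding vec_eq_iff vector_smult_component using of_int_eq_iff by metis
  moreover from this have "\<bar>k\<bar> = 1" using v(1) unfolding primitive_vec_def by blast
  moreover have "k > 0" using bk bt(2) k0 by (simp add: zero_le_divide_iff)
  ultimately show "v : S" using s(1) by simp
 qed
qed

locale nonsingular_fan =
 fixes L :: "(int^'d::finite) set" and Fn :: "(real^'d) set set"
 assumes fan: "fan L Fn" and L: "coordinate_lattice L"
begin
abbreviation "G \<equiv> gens Fn"
abbreviation "cg \<equiv> cone_gens Fn"

lemma cone:
 assumes "cn : Fn"
 obtains B m where "lattice_basis L B" "dual_to B m" "cg cn \<subseteq> B"
  "cn = cone_gen (cg cn)" "\<And>x. x : L ==> x = (\<Sum>v\<in>B. pairing (m v) x *s v)"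
proof -
 obtain B S where B: "lattice_basis L B" "S \<subseteq> B" "cn = cone_gen S"
  using fanD(3)[OF fan assms] unfolding nonsingular_cone_def by blast
 obtain m where m: "\<And>v w. v : B ==> w : B ==> pairing (m v) w = (if v = w then 1 else 0)"
  "\<And>x. x : L ==> x = (\<Sum>v\<in>B. pairing (m v) x *s v)" by (rule dual_basis[OF B(1) L]) (rule that)
 hence d: "dual_to B m" using B(1) by (simp add: dual_to_def lattice_basis_def)
 have "cg cn = S"
  unfolding B(3) by (rule cone_gens_cone_gen[OF fan _ dual_to_subset[OF d B(2)]]) (use assms B in simp)
 thus ?thesis using that B d m by blast
qed

lemma cone_dual:
 assumes "cn : Fn"
 obtains m where "dual_to (cg cn) m" "cn = cone_gen (cg cn)" using cone[OF assms] dual_to_subset by metis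

lemma finite_cone_gens: "cn : Fn ==> finite (cg cn)" using cone_dual unfolding dual_to_def by metis

lemma subcone:
 assumes "cn : Fn" "T \<subseteq> cg cn"
 shows "cone_gen T : Fn" "cg (cone_gen T) = T"
proof -
 obtain m where m: "dual_to (cg cn) m" "cn = cone_gen (cg cn)" using cone_dual[OF assms(1)] .
 have "cone_gen T face_of cn" by (subst m(2)) (rule face_of_cone_gen[OF m(1) assms(2)])
 thus T: "cone_gen T : Fn" using fanD(4)[OF fan assms(1)] zero_in_cone_gen by blast
 show "cg (cone_gen T) = T" by (rule cone_gens_cone_gen[OF fan T dual_to_subset[OF m(1) assms(2)]])
qed

lemma inter_cone:
 assumes "cn : Fn" "tn : Fn"
 shows "cn \<inter> tn = cone_gen (cg cn \<inter> cg tn)"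
proof -
 have "0 : cn \<inter> tn" using cone_dual[OF assms(1)] cone_dual[OF assms(2)] zero_in_cone_gen by (metis IntI)
 hence "cn \<inter> tn : Fn" using fanD(4)[OF fan assms(1) fanD(5)[OF fan assms]] by blast
 hence "cn \<inter> tn = cone_gen (cg (cn \<inter> tn))" using cone_dual by metis
 moreover have "cg (cn \<inter> tn) = cg cn \<inter> cg tn" unfolding cone_gens_def by blast
 ultimately show ?thesis by simp
qed

lemma gens_ray: "v : G ==> cone_gen {v} : Fn & v : cg (cone_gen {v})"
 unfolding cone_gens_def gens_def using gen_in_cone_gen by blast

lemma finite_gens: "finite G"
proof (rule finite_subset)
 show "G \<subseteq> (\<Union>cn\<in>Fn. cg cn)" using gens_ray by blast
 show "finite (\<Union>cn\<in>Fn. cg cn)" using fanD(1)[OF fan] finite_cone_gens by blast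
qed

lemma gens_ray_eq: "v : G ==> cg (cone_gen {v}) = {v}" using subcone(2)[of "cone_gen {v}" "{v}"] gens_ray by blast

text \<open>Two cones of a fan meet in a face of each, and a face that contains a positive
  combination contains its terms.\<close>

lemma sum_in_cone:
 assumes "cn : Fn" "\<zeta> : Fn" "Z \<subseteq> cg \<zeta>" "\<And>v. v : Z ==> 0 < a v"
  "(\<Sum>v\<in>Z. a v *\<^sub>R real_vec v) : cn"
 shows "Z \<subseteq> cg cn"
proof
 fix w assume w: "w : Z"
 have fZ: "finite Z" using finite_cone_gens[OF assms(2)] assms(3) finite_subset by blast
 obtain m where m: "\<zeta> = cone_gen (cg \<zeta>)" using cone_dual[OF assms(2)] by metis
 have f: "cn \<inter> \<zeta> face_of cone_gen (cg \<zeta>)" using fanD(6)[OF fan assms(1,2)] m by simp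
 have "(\<Sum>v\<in>Z. a v *\<^sub>R real_vec v) : cone_gen (cg \<zeta>)"
  by (rule cone_gen_sum[OF fZ]) (use assms(3,4) gen_in_cone_gen less_imp_le in blast)
 hence "(\<Sum>v\<in>Z. a v *\<^sub>R real_vec v) : cn \<inter> \<zeta>" using assms(5) m by simp
 from face_of_cone_gen_sum[OF f fZ assms(3,4) this w]
 have "real_vec w : cn" by blast
 thus "w : cg cn" using w assms(3) unfolding cone_gens_def by blast
qed

text \<open>Finitely many cones catch the points \<open>u + s w\<close>, so one of them contains
  infinitely many; its linear conditions then hold for the direction \<open>w\<close>, which is
  interior to the cone over \<open>Z\<close>. Seen from far out along \<open>w\<close>, the vector
  \<open>u\<close> thus lies in the star of \<open>Z\<close>. The same device gives wall crossing
  and the compactness estimate.\<close>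

lemma eventually_in_cone:
 assumes \<T>: "\<T> \<subseteq> Fn" and \<zeta>: "\<zeta> : Fn" and Z: "Z \<subseteq> cg \<zeta>"
  and w: "w = (\<Sum>v\<in>Z. real_vec v)"
  and cov: "\<And>s::nat. s \<ge> s0 ==> u + real s *\<^sub>R w : \<Union>\<T>"
 obtains cn where "cn : \<T>" "Z \<subseteq> cg cn" "infinite {s::nat. u + real s *\<^sub>R w : cn}"
proof -
 have "ALL s:{s0..}. EX cn. cn : \<T> & u + real s *\<^sub>R w : cn" using cov by auto
 then obtain F where F: "\<And>s. s \<ge> s0 ==> F s : \<T> & u + real s *\<^sub>R w : F s" by (metis atLeast_iff)
 have "finite (F ` {s0..})" by (rule finite_subset[OF _ finite_subset[OF \<T> fanD(1)[OF fan]]]) (use F in auto)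
 then obtain s1 where s1: "s1 : {s0..}" "infinite {s : {s0..}. F s = F s1}"
  using pigeonhole_infinite[of "{s0..}" F] infinite_Ici by auto
 define cn where "cn = F s1"
 have cn: "cn : \<T>" "cn : Fn" using F s1(1) \<T> by (auto simp: cn_def)
 have "{s : {s0..}. F s = F s1} \<subseteq> {s::nat. u + real s *\<^sub>R w : cn}" using F cn_def by auto
 hence inf: "infinite {s::nat. u + real s *\<^sub>R w : cn}" using s1(2) infinite_super by blast
 obtain m where m: "dual_to (cg cn) m" "cn = cone_gen (cg cn)" using cone_dual[OF cn(2)] .
 let ?S = "cg cn"
 define P where "P = (%x. \<Sum>v\<in>?S. (real_vec (m v) \<bullet> x) *\<^sub>R real_vec v)"
 have P_lin: "P (x + k *\<^sub>R y) = P x + k *\<^sub>R P y" for x y k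
  by (simp add: P_def inner_add_right scaleR_add_left sum.distrib scaleR_sum_right)
 have mem: "x : cn \<longleftrightarrow> x = P x & (ALL v:?S. 0 \<le> real_vec (m v) \<bullet> x)" for x
  using dual_to_cone_gen[OF m(1), of x] m(2) unfolding P_def by simp
 obtain p q where pq: "u + real p *\<^sub>R w : cn" "u + real q *\<^sub>R w : cn" "p < q"
 proof -
  obtain p where p: "u + real p *\<^sub>R w : cn" using inf not_finite_existsD by auto
  obtain q where "q > p" "u + real q *\<^sub>R w : cn" using inf unfolding infinite_nat_iff_unbounded by blast
  thus ?thesis using p that by blast
 qed
 have "w = P w"
 proof -
  have "u + real p *\<^sub>R w = P u + real p *\<^sub>R P w" "u + real q *\<^sub>R w = P u + real q *\<^sub>R P w"
   using pq mem P_lin by metis+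
  hence "(real q - real p) *\<^sub>R w = (real q - real p) *\<^sub>R P w"
   by (simp add: scaleR_left_diff_distrib) (metis add_diff_cancel_left)
  thus ?thesis using pq(3) by simp
 qed
 moreover have "0 \<le> real_vec (m v) \<bullet> w" if v: "v : ?S" for v
 proof (rule ccontr)
  assume neg: "\<not> 0 \<le> real_vec (m v) \<bullet> w"
  define c where "c = - (real_vec (m v) \<bullet> w)"
  have c: "c > 0" using neg by (simp add: c_def)
  obtain N :: nat where N: "real N > (real_vec (m v) \<bullet> u) / c" using reals_Archimedean2 by blast
  obtain s where s: "s > N" "u + real s *\<^sub>R w : cn" using inf unfolding infinite_nat_iff_unbounded by blast
  have "0 \<le> real_vec (m v) \<bullet> (u + real s *\<^sub>R w)" using s(2) mem v by blast
  moreover have "real_vec (m v) \<bullet> (u + real s *\<^sub>R w) = real_vec (m v) \<bullet> u - real s * c"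
   by (simp add: inner_add_right c_def)
  moreover have "real N * c < real s * c" using s(1) c by simp
  moreover have "real_vec (m v) \<bullet> u < real N * c" using N c by (simp add: field_simps)
  ultimately show False by linarith
 qed
 ultimately have "w : cn" using mem by blast
 hence "(\<Sum>v\<in>Z. 1 *\<^sub>R real_vec v) : cn" using w by simp
 hence "Z \<subseteq> cg cn" by (intro sum_in_cone[OF cn(2) \<zeta> Z, of "%_. 1"]) auto
 thus ?thesis using that cn(1) inf by blast
qed

text \<open>The separation lemma for cones of a fan in its strict form. The vectors of one cone are
  reversed, so that both strict inequalities become positivity on a compact convex set
  \<open>K\<close>, which is separated from the linear span \<open>M\<close> of the common
  generators.\<close>

lemma separating_functional:
 assumes "cn : Fn" "tn : Fn"
 obtains m where "\<And>v. v : cg cn - cg tn ==> 0 < m \<bullet> real_vec v"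
  "\<And>v. v : cg tn - cg cn ==> m \<bullet> real_vec v < 0"
  "\<And>v. v : cg cn \<inter> cg tn ==> m \<bullet> real_vec v = 0"
proof -
 define S T where "S = cg cn" and "T = cg tn"
 obtain mS where mS: "dual_to S mS" "cn = cone_gen S" using cone_dual[OF assms(1)] S_def by metis
 obtain mT where mT: "dual_to T mT" "tn = cone_gen T" using cone_dual[OF assms(2)] T_def by metis
 have fS: "finite S" "finite T" using mS mT by (auto simp: dual_to_def)
 have int: "cone_gen S \<inter> cone_gen T = cone_gen (S \<inter> T)"
  using inter_cone[OF assms, folded S_def T_def] by (simp only: mS(2)[symmetric] mT(2)[symmetric])
 define f where "f = (%v. if v : S then real_vec v else - real_vec v)"
 define I where "I = (S - T) \<union> (T - S)"
 define K where "K = convex hull (f ` I)"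
 define M where "M = span (real_vec ` (S \<inter> T))"
 have fI: "finite I" using fS by (simp add: I_def)
 have disj: "x ~: K" if x: "x : M" for x
 proof
  assume "x : K"
  moreover have "K \<subseteq> {\<Sum>v\<in>I. \<alpha> v *\<^sub>R f v | \<alpha>. (ALL v:I. 0 \<le> \<alpha> v) & sum \<alpha> I = 1}" (is "_ \<subseteq> ?C")
   unfolding K_def
  proof (rule hull_minimal)
   show "f ` I \<subseteq> ?C"
   proof clarify
    fix v assume v: "v : I"
    have "f v = (\<Sum>u\<in>I. (if u = v then 1 else 0) *\<^sub>R f u)"
     using fI v by (simp add: if_distrib[of "%a. a *\<^sub>R _"] cong: if_cong)
    thus "EX \<alpha>. f v = (\<Sum>v\<in>I. \<alpha> v *\<^sub>R f v) & (ALL v:I. 0 \<le> \<alpha> v) & sum \<alpha> I = 1"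
     using fI v by (intro exI[of _ "%u. if u = v then 1 else 0"]) auto
   qed
   show "convex ?C" unfolding convex_def
   proof clarify
    fix a b :: "int^'d => real" and u w :: real
    assume "ALL v:I. 0 \<le> a v" "ALL v:I. 0 \<le> b v" "sum a I = 1" "sum b I = 1" "0 \<le> u" "0 \<le> w" "u + w = 1"
    thus "EX \<alpha>. u *\<^sub>R (\<Sum>v\<in>I. a v *\<^sub>R f v) + w *\<^sub>R (\<Sum>v\<in>I. b v *\<^sub>R f v) = (\<Sum>v\<in>I. \<alpha> v *\<^sub>R f v) &
      (ALL v:I. 0 \<le> \<alpha> v) & sum \<alpha> I = 1" by (intro exI[of _ "%v. u * a v + w * b v"])
      (simp add: scaleR_left_distrib sum.distrib scaleR_sum_right flip: sum_distrib_left)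
   qed
  qed
  ultimately obtain \<alpha> where \<alpha>: "x = (\<Sum>v\<in>I. \<alpha> v *\<^sub>R f v)" "ALL v:I. 0 \<le> \<alpha> v" "sum \<alpha> I = 1" by blast
  obtain g where "x = (\<Sum>y\<in>real_vec ` (S \<inter> T). g y *\<^sub>R y)"
   using x span_finite[of "real_vec ` (S \<inter> T)"] fS unfolding M_def by auto
  hence gm: "x = (\<Sum>v\<in>S \<inter> T. g (real_vec v) *\<^sub>R real_vec v)" by (subst (asm) sum.reindex) (auto simp: inj_on_def)
  \<comment> \<open>A common point of \<open>K\<close> and \<open>M\<close> is rewritten by
    splitting its coefficients on the common generators into positive and negative parts. This gives
    one vector lying in both cones, hence in their common face, and all coefficients outside that
    face vanish.\<close>
  define a where "a = (%v. if v : T then max 0 (- g (real_vec v)) else \<alpha> v)"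
  define b where "b = (%v. if v : S then max 0 (g (real_vec v)) else \<alpha> v)"
  have split: "(\<Sum>v\<in>P. h v) = (\<Sum>v\<in>P - Q. h v) + (\<Sum>v\<in>P \<inter> Q. h v)" if "finite P" for P Q and h :: "int^'d => real^'d"
   using sum.Int_Diff[OF that, of h Q] by simp
  have "(\<Sum>v\<in>I. \<alpha> v *\<^sub>R f v) = (\<Sum>v\<in>S - T. a v *\<^sub>R real_vec v) - (\<Sum>v\<in>T - S. b v *\<^sub>R real_vec v)"
   unfolding I_def using fS by (subst sum.union_disjoint) (auto simp: a_def b_def f_def sum_negf intro!: sum.cong)
  moreover have "(\<Sum>v\<in>S \<inter> T. b v *\<^sub>R real_vec v) - (\<Sum>v\<in>S \<inter> T. a v *\<^sub>R real_vec v) = x"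
   unfolding gm sum_subtractf[symmetric] scaleR_left_diff_distrib[symmetric]
   by (intro sum.cong) (auto simp: a_def b_def max_def)
  ultimately have ab: "(\<Sum>v\<in>S. a v *\<^sub>R real_vec v) = (\<Sum>v\<in>T. b v *\<^sub>R real_vec v)" (is "?p = ?q")
   unfolding split[OF fS(1), of _ T] split[OF fS(2), of _ S] using \<alpha>(1) by (simp add: algebra_simps Int_commute)
  have "?p : cone_gen S" "?q : cone_gen T"
   using \<alpha>(2) fS by (auto intro!: cone_gen_sum simp: gen_in_cone_gen a_def b_def I_def)
  hence p: "?p : cone_gen (S \<inter> T)" unfolding int[symmetric] using ab by simp
  have "a v = 0" if v: "v : S - T" for v
   using dual_to_notin_span[OF mS(1) _ _ p, of v] dual_to_coeff[OF mS(1), of v a] v by auto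
  moreover have "b v = 0" if v: "v : T - S" for v
   using dual_to_notin_span[OF mT(1) _ _ p, of v] dual_to_coeff[OF mT(1), of v b] v ab by auto
  ultimately have "\<alpha> v = 0" if "v : I" for v using that by (auto simp: I_def a_def b_def)
  thus False using \<alpha>(3) by simp
 qed
 show ?thesis
 proof (cases "K = {}")
  case True
  thus ?thesis using that[of 0] unfolding K_def I_def S_def T_def by auto
 next
  case False
  have "closed M" "convex M" "compact K" "convex K"
   unfolding M_def K_def using fI by (auto simp: closed_span subspace_imp_convex intro!: finite_imp_compact_convex_hull)
  then obtain a b where ab: "ALL x:M. a \<bullet> x < b" "ALL x:K. b < a \<bullet> x"
   using separating_hyperplane_closed_compact[of M K] False disj by blast
  have b0: "b > 0" using ab(1) span_zero[of "real_vec ` (S \<inter> T)"] unfolding M_def by fastforce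
  have pos: "0 < a \<bullet> f v" if "v : I" for v
  proof -
   have "f v : K" unfolding K_def using that by (intro hull_inc) blast
   thus ?thesis using ab(2) b0 by fastforce
  qed
  show ?thesis
  proof (rule that[of a])
   show "0 < a \<bullet> real_vec v" if "v : cg cn - cg tn" for v
    using pos[of v] that by (auto simp: I_def f_def S_def T_def)
   show "a \<bullet> real_vec v < 0" if "v : cg tn - cg cn" for v
    using pos[of v] that by (auto simp: I_def f_def S_def T_def)
   fix v assume "v : cg cn \<inter> cg tn"
   hence M: "c *\<^sub>R real_vec v : M" for c unfolding M_def S_def T_def by (intro span_scale span_base) blast
   show "a \<bullet> real_vec v = 0"
   proof (rule ccontr)
    assume "a \<bullet> real_vec v ~= 0"
    \<comment> \<open>The functional is bounded above on the linear space \<open>M\<close>, so it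
      vanishes there; this multiple of the vector would attain the bound.\<close>
    thus False using ab(1) M[of "b / (a \<bullet> real_vec v)"] by fastforce
   qed
  qed
 qed
qed

end

text \<open>The union of the full-dimensional cones is closed, and its complement is an open set
  covered by finitely many cones lying in hyperplanes. An open set of measure zero is empty.\<close>

lemma complete_fan_full_cones:
 assumes "complete_fan UNIV Fn"
 shows "\<Union>{cn : Fn. lattice_basis UNIV (cone_gens Fn cn)} = (UNIV :: (real^'d::finite) set)"
proof -
 interpret nonsingular_fan UNIV Fn using assms by unfold_locales (auto simp: complete_fan_def coordinate_lattice_UNIV)
 let ?T = "{cn : Fn. lattice_basis UNIV (cone_gens Fn cn)}"
 have fin: "finite Fn" by (rule fanD(1)[OF fan])
 have cl: "closed cn" if cn: "cn : Fn" for cn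
 proof -
  obtain m where "dual_to (cone_gens Fn cn) m" "cn = cone_gen (cone_gens Fn cn)" using cone_dual[OF cn] .
  thus ?thesis using closed_cone_gen by metis
 qed
 have "closed (\<Union>?T)" using fin cl by (intro closed_Union) auto
 hence op: "open (UNIV - \<Union>?T)" by (simp add: open_Diff)
 have "axis i 1 : real_vec ` UNIV" for i :: 'd by (rule image_eqI[of _ _ "axis i 1"]) (auto simp: vec_eq_iff axis_def)
 hence "Basis \<subseteq> range (real_vec :: int^'d => _)" by (auto simp: Basis_vec_def)
 hence "span (range (real_vec :: int^'d => _)) = UNIV" using span_mono span_Basis by (metis top.extremum_uniqueI)
 hence U: "\<Union>Fn = UNIV" using assms by (simp add: complete_fan_def)
 have neg: "negligible cn" if cn: "cn : Fn - ?T" for cn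
 proof -
  obtain B m where B: "lattice_basis UNIV B" "dual_to B m" "cone_gens Fn cn \<subseteq> B"
   "cn = cone_gen (cone_gens Fn cn)" by (rule cone[of cn]) (use cn in auto)
  have "cone_gens Fn cn ~= B" using cn B(1) by auto
  then obtain v where v: "v : B - cone_gens Fn cn" using B(3) by auto
  have "cn \<subseteq> {x. real_vec (m v) \<bullet> x = 0}" using dual_to_notin_span[OF B(2,3) v] B(4) by auto
  moreover have "real_vec (m v) ~= 0"
  proof
   assume "real_vec (m v) = 0"
   hence "real_vec (m v) \<bullet> real_vec v = 0" by simp
   thus False using B(2) v unfolding inner_real_vec dual_to_def by simp
  qed
  ultimately show ?thesis using negligible_hyperplane[of "real_vec (m v)" 0] negligible_subset by blast
 qed
 have "negligible (\<Union>(Fn - ?T))" using fin neg by (intro negligible_Union) auto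
 moreover have "UNIV - \<Union>?T \<subseteq> \<Union>(Fn - ?T)" using U by blast
 ultimately have "negligible (UNIV - \<Union>?T)" using negligible_subset by blast
 hence "UNIV - \<Union>?T = {}" using open_not_negligible[OF op] by blast
 thus ?thesis by blast
qed

section \<open>Functions on curved spaces\<close>

lemma continuous_map_complex_mult:
 fixes f g :: "'a => complex"
 assumes "continuous_map T euclidean f" "continuous_map T euclidean g"
 shows "continuous_map T euclidean (%x. f x * g x)"
proof -
 have "continuous_map T euclidean (%x. (f x, g x))"
  using continuous_map_pairedI[OF assms] by (simp flip: euclidean_product_topology)
 moreover have "continuous_map euclidean euclidean (%p::complex \<times> complex. fst p * snd p)"
  by (simp add: continuous_on_fst continuous_on_snd continuous_on_mult continuous_on_id)
 ultimately have "continuous_map T euclidean ((%p. fst p * snd p) \<circ> (%x. (f x, g x)))"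
  by (rule continuous_map_compose)
 thus ?thesis by (simp add: comp_def)
qed

lemma continuous_map_complex_add:
 fixes f g :: "'a => complex"
 assumes "continuous_map T euclidean f" "continuous_map T euclidean g"
 shows "continuous_map T euclidean (%x. f x + g x)"
proof -
 have "continuous_map T euclidean (%x. (f x, g x))"
  using continuous_map_pairedI[OF assms] by (simp flip: euclidean_product_topology)
 moreover have "continuous_map euclidean euclidean (%p::complex \<times> complex. fst p + snd p)"
  by (simp add: continuous_on_fst continuous_on_snd continuous_on_add continuous_on_id)
 ultimately have "continuous_map T euclidean ((%p. fst p + snd p) \<circ> (%x. (f x, g x)))"
  by (rule continuous_map_compose)
 thus ?thesis by (simp add: comp_def)
qed

context
 fixes X :: "'a fspace" and W :: "'a set"
 assumes X: "curved X" and W: "opn X W"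
begin

lemma funs_mult:
 assumes "f : funs X W" "g : funs X W"
 shows "(%x. f x * g x) : funs X W"
proof (rule curvedI[OF X W])
 show "continuous_map (subtopology (top_of X) W) euclidean (%x. f x * g x)"
  by (intro continuous_map_complex_mult curved_continuous[OF X W] assms)
 fix D gm assume c: "curve X D gm" "gm ` D \<subseteq> W"
 show "((%x. f x * g x) \<circ> gm) holomorphic_on D"
  using holomorphic_on_mult[OF curved_holomorphic[OF X W assms(1) c] curved_holomorphic[OF X W assms(2) c]]
  by (simp add: comp_def)
qed

lemma funs_add:
 assumes "f : funs X W" "g : funs X W"
 shows "(%x. f x + g x) : funs X W"
proof (rule curvedI[OF X W])
 show "continuous_map (subtopology (top_of X) W) euclidean (%x. f x + g x)"
  by (intro continuous_map_complex_add curved_continuous[OF X W] assms)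
 fix D gm assume c: "curve X D gm" "gm ` D \<subseteq> W"
 show "((%x. f x + g x) \<circ> gm) holomorphic_on D"
  using holomorphic_on_add[OF curved_holomorphic[OF X W assms(1) c] curved_holomorphic[OF X W assms(2) c]]
  by (simp add: comp_def)
qed

lemma funs_compose_holomorphic:
 assumes f: "f : funs X W" and g: "g holomorphic_on U" "open U" and im: "\<And>x. x : W ==> f x : U"
 shows "(%x. g (f x)) : funs X W"
proof (rule curvedI[OF X W])
 have "continuous_map (subtopology (top_of X) W) (top_of_set U) f"
  using curved_continuous[OF X W f] im by (auto simp: continuous_map_in_subtopology)
 moreover have "continuous_map (top_of_set U) euclidean g" using g holomorphic_on_imp_continuous_on by auto
 ultimately have "continuous_map (subtopology (top_of X) W) euclidean (g \<circ> f)" by (rule continuous_map_compose)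
 thus "continuous_map (subtopology (top_of X) W) euclidean (%x. g (f x))" by (simp add: comp_def)
 fix D gm assume c: "curve X D gm" "gm ` D \<subseteq> W"
 have "(g \<circ> (f \<circ> gm)) holomorphic_on D"
  by (rule holomorphic_on_compose_gen[OF curved_holomorphic[OF X W f c] g(1)]) (use im c in auto)
 thus "((%x. g (f x)) \<circ> gm) holomorphic_on D" by (simp add: comp_def)
qed

lemma funs_power_int:
 assumes "f : funs X W" "\<And>x. x : W ==> f x ~= 0"
 shows "(%x. f x powi k) : funs X W" by (rule funs_compose_holomorphic[OF assms(1), of _ "- {0}"])
  (use assms(2) in \<open>auto intro!: holomorphic_on_power_int holomorphic_intros\<close>)

lemma funs_power:
 assumes "f : funs X W"
 shows "(%x. f x ^ k) : funs X W"
 by (rule funs_compose_holomorphic[OF assms(1), of _ UNIV]) (auto intro!: holomorphic_intros)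

lemma funs_prod:
 assumes "finite I" "\<And>i. i : I ==> f i : funs X W"
 shows "(%x. \<Prod>i\<in>I. f i x) : funs X W"
 using assms by (induction I rule: finite_induct) (simp_all add: curved_const[OF X W] funs_mult)

end

lemma morphism_into_affine:
 assumes X: "curved X" and I: "finite I" and f: "\<And>x. x : points X ==> f x : coord_space I"
  and fi: "\<And>i. i : I ==> (%x. f x i) : funs X (points X)"
 shows "morphism X (affine_an I) f"
proof (rule morphismI[OF X curved_affine_an[OF I]])
 have oX: "opn X (points X)" by blast
 have "continuous_map (top_of X) euclidean (%x. f x i)" for i
 proof (cases "i : I")
  case True
  thus ?thesis using curved_continuous[OF X oX fi[OF True]] by simp
 next
  case False
  hence "\<And>x. x : points X ==> f x i = 0" using f by (auto simp: coord_space_def)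
  thus ?thesis using continuous_map_eq[of "top_of X" euclidean "%x. 0" "%x. f x i"] by simp
 qed
 hence "continuous_map (top_of X) (product_topology (%i. euclidean) UNIV) f"
  by (simp add: continuous_map_componentwise_UNIV)
 thus "continuous_map (top_of X) (top_of (affine_an I)) f"
  using f by (auto simp: continuous_map_in_subtopology euclidean_product_topology)
 fix D gm assume c: "curve X D gm"
 have "((%x. f x i) \<circ> gm) holomorphic_on D" if "i : I" for i
  by (rule curved_holomorphic[OF X oX fi[OF that] c]) (use curve_in_points[OF c] in auto)
 thus "curve (affine_an I) D (f \<circ> gm)"
  unfolding curve_affine_an[OF I] using curve_open[OF c] f curve_in_points[OF c] by (simp add: comp_def)
qed

lemma coord_fun_subspace:
 assumes "finite I" "opn (affine_an I) S"
 shows "(%x. x v) : funs (subspace_of (affine_an I) S) S"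
proof (cases "v : I")
 case True
 thus ?thesis by (simp add: funs_subspace_open[OF curved_affine_an[OF assms(1)] assms(2)] coord_fun_affine_an)
next
 case False
 have o: "opn (subspace_of (affine_an I) S) S" using assms(2) openin_subspace_open by blast
 show ?thesis by (rule curved_cong[OF curved_subspace[OF curved_affine_an[OF assms(1)] assms(2)] o
     curved_const[OF curved_subspace[OF curved_affine_an[OF assms(1)] assms(2)] o, of 0]])
   (use False assms(2) openin_imp_subset in \<open>fastforce simp: coord_space_def\<close>)
qed

section \<open>Toric varieties as quotients of homogeneous coordinates\<close>

section \<open>The group acting on homogeneous coordinates\<close>

text \<open>The homomorphisms from \<open>Pic\<close> to the nonzero complex numbers, in
  coordinates: the Picard group is free on the generators modulo the characters, and each standard
  character contributes one product relation. Values off \<open>G\<close> are left free; they only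
  multiply coordinates that are 0.\<close>

definition tgroup :: "(int^'d::finite) set => (int^'d => complex) set" where
 "tgroup G = {h. (ALL v:G. h v ~= 0) & (ALL i. (\<Prod>v\<in>G. h v powi (v $ i)) = 1)}"

definition act :: "('i => complex) => ('i => complex) => 'i => complex" where
 "act h X = (%v. h v * X v)"

lemma power_int_sum:
 fixes x :: complex
 assumes "finite I" "x ~= 0"
 shows "x powi (\<Sum>i\<in>I. k i) = (\<Prod>i\<in>I. x powi k i)"
 using assms(1) by (induction I rule: finite_induct) (simp_all add: power_int_add assms(2))

lemma power_int_prod:
 fixes f :: "'i => complex"
 shows "(\<Prod>i\<in>I. f i) powi k = (\<Prod>i\<in>I. f i powi k)"
 by (induction I rule: infinite_finite_induct) (simp_all add: power_int_mult_distrib)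

lemma tgroup_nonzero: "h : tgroup G ==> v : G ==> h v ~= 0"
 and tgroup_prod: "h : tgroup G ==> (\<Prod>v\<in>G. h v powi (v $ i)) = 1" by (simp_all add: tgroup_def)

lemma tgroup_pairing:
 assumes "h : tgroup G"
 shows "(\<Prod>v\<in>G. h v powi pairing m v) = 1"
proof -
 have "(\<Prod>v\<in>G. h v powi pairing m v) = (\<Prod>v\<in>G. \<Prod>i\<in>UNIV. (h v powi (v $ i)) powi (m $ i))"
  unfolding pairing_def
  by (intro prod.cong) (auto simp: power_int_sum tgroup_nonzero[OF assms] power_int_mult mult.commute)
 also have "\<dots> = (\<Prod>i\<in>UNIV. (\<Prod>v\<in>G. h v powi (v $ i)) powi (m $ i))"
  by (subst prod.swap) (simp add: power_int_prod)
 also have "\<dots> = 1" by (simp add: tgroup_prod[OF assms])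
 finally show ?thesis .
qed

lemma tgroup_one: "(%v. 1) : tgroup G" by (simp add: tgroup_def)

lemma tgroup_mult: "h : tgroup G ==> k : tgroup G ==> act h k : tgroup G"
 by (auto simp: tgroup_def act_def power_int_mult_distrib prod.distrib)

lemma tgroup_inverse: "h : tgroup G ==> (%v. inverse (h v)) : tgroup G"
proof -
 assume h: "h : tgroup G"
 have "(\<Prod>v\<in>G. inverse (h v) powi (v $ i)) = inverse (\<Prod>v\<in>G. h v powi (v $ i))" for i
  using prod_inversef[of "%v. h v powi (v $ i)" G] by (simp add: comp_def power_int_inverse)
 thus ?thesis using h by (simp add: tgroup_def)
qed

text \<open>Logarithms make the integral relations linear, so they hold for real functionals as
  well. The separating functionals of cones are real.\<close>

lemma tgroup_norm_powr:
 assumes h: "h : tgroup G" and G: "finite G"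
 shows "(\<Prod>v\<in>G. norm (h v) powr (\<mu> \<bullet> real_vec v)) = 1"
proof -
 have ln0: "(\<Sum>v\<in>G. real_of_int (v $ i) * ln (norm (h v))) = 0" for i
 proof -
  have pos: "norm (h v) powi (v $ i) > 0" if "v : G" for v
   using tgroup_nonzero[OF h that] by (simp add: zero_less_power_int)
  have "(\<Prod>v\<in>G. norm (h v) powi (v $ i)) = norm (\<Prod>v\<in>G. h v powi (v $ i))"
   by (simp add: prod_norm[symmetric] norm_power_int)
  also have "\<dots> = 1" using tgroup_prod[OF h] by simp
  finally have "ln (\<Prod>v\<in>G. norm (h v) powi (v $ i)) = 0" by simp
  moreover have "ln (\<Prod>v\<in>G. norm (h v) powi (v $ i)) = (\<Sum>v\<in>G. ln (norm (h v) powi (v $ i)))"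
   by (rule ln_prod) (use pos G tgroup_nonzero[OF h] in auto)
  moreover have "ln (norm (h v) powi (v $ i)) = real_of_int (v $ i) * ln (norm (h v))" if "v : G" for v
   using tgroup_nonzero[OF h that] by (simp add: powr_real_of_int'[symmetric] ln_powr)
  ultimately show ?thesis by simp
 qed
 have "(\<Prod>v\<in>G. norm (h v) powr (\<mu> \<bullet> real_vec v)) = (\<Prod>v\<in>G. exp ((\<mu> \<bullet> real_vec v) * ln (norm (h v))))"
  by (intro prod.cong) (auto simp: powr_def tgroup_nonzero[OF h])
 also have "\<dots> = exp (\<Sum>v\<in>G. (\<mu> \<bullet> real_vec v) * ln (norm (h v)))" by (simp add: exp_sum G)
 also have "(\<Sum>v\<in>G. (\<mu> \<bullet> real_vec v) * ln (norm (h v))) =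
   (\<Sum>i\<in>UNIV. \<mu> $ i * (\<Sum>v\<in>G. real_of_int (v $ i) * ln (norm (h v))))"
  by (subst sum_distrib_left, subst sum.swap) (simp add: inner_vec_def sum_distrib_right mult.assoc)
 also have "\<dots> = 0" by (simp add: ln0)
 finally show ?thesis by simp
qed

lemma group_torus_divisors: "comm_group (torus_divisors Fn)"
proof (rule comm_groupI)
 fix D assume "D : carrier (torus_divisors Fn)"
 thus "EX E:carrier (torus_divisors Fn). E \<otimes>\<^bsub>torus_divisors Fn\<^esub> D = \<one>\<^bsub>torus_divisors Fn\<^esub>"
  by (intro bexI[of _ "%v. - D v"]) (auto simp: torus_divisors_def)
qed (auto simp: torus_divisors_def add.assoc)

lemma subgroup_character_divisors:
 fixes Fn :: "(real^'d::finite) set set"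
 shows "subgroup (character_divisors Fn) (torus_divisors Fn)"
proof -
 interpret comm_group "torus_divisors Fn :: (int^'d => int) monoid" by (rule group_torus_divisors)
 define c where "c = (%(m :: int^'d) v. if v : gens Fn then \<Sum>i\<in>UNIV. m $ i * v $ i else 0)"
 have cd: "character_divisors Fn = range c" unfolding character_divisors_def c_def by auto
 have add: "(%v. c m v + c m' v) = c (m + m')" for m m' by (auto simp: c_def distrib_right sum.distrib)
 have neg: "(%v. - c m v) = c (- m)" for m by (auto simp: c_def sum_negf)
 have car: "c m : carrier (torus_divisors Fn)" for m by (simp add: torus_divisors_def c_def)
 show ?thesis
 proof (rule subgroupI)
  show "character_divisors Fn \<subseteq> carrier (torus_divisors Fn)" using cd car by auto
  show "character_divisors Fn ~= {}" using cd by auto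
  fix D assume "D : character_divisors Fn"
  then obtain m where m: "D = c m" using cd by auto
  have "inv\<^bsub>torus_divisors Fn\<^esub> D = (%v. - D v)"
   by (rule inv_equality) (use car m in \<open>auto simp: torus_divisors_def c_def\<close>)
  thus "inv\<^bsub>torus_divisors Fn\<^esub> D : character_divisors Fn" using m neg cd by auto
 next
  fix D E assume "D : character_divisors Fn" "E : character_divisors Fn"
  thus "D \<otimes>\<^bsub>torus_divisors Fn\<^esub> E : character_divisors Fn"
   using add cd by (auto simp: torus_divisors_def)
 qed
qed

lemma normal_character_divisors: "character_divisors Fn \<lhd> torus_divisors Fn"
 by (rule comm_group.subgroup_imp_normal[OF group_torus_divisors subgroup_character_divisors])

text \<open>A homomorphism is determined by its values on the classes of prime divisors. Both sides
  are restricted to \<open>gens Fn\<close> because for other vectors \<open>divisor_class\<close> is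
  not an element of the Picard group.\<close>

lemma hom_Pic_iff_tgroup:
 fixes Fn :: "(real^'d::finite) set set"
 assumes fin: "finite (gens Fn)"
 shows "{restrict (%v. g (divisor_class Fn v)) (gens Fn) | g. g : hom (Pic Fn) complex_units} =
  (%h. restrict h (gens Fn)) ` tgroup (gens Fn)"
proof -
 let ?D = "torus_divisors Fn :: (int^'d => int) monoid"
 let ?N = "character_divisors Fn :: (int^'d => int) set"
 let ?G = "gens Fn :: (int^'d) set"
 interpret D: comm_group ?D by (rule group_torus_divisors)
 interpret N: normal ?N ?D by (rule normal_character_divisors)
 interpret U: group complex_units by (rule groupI) (auto simp: complex_units_def intro!: bexI[of _ "inverse _"])
 define \<delta> where "\<delta> = (%v u :: int^'d. if u = v then 1 else 0 :: int)"
 have \<delta>: "\<delta> v : carrier ?D" if "v : ?G" for v using that by (simp add: torus_divisors_def \<delta>_def)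
 have dc: "divisor_class Fn v = ?N #>\<^bsub>?D\<^esub> \<delta> v" for v by (simp add: divisor_class_def \<delta>_def)
 have "restrict (%v. g (divisor_class Fn v)) ?G : (%h. restrict h ?G) ` tgroup ?G"
  if g: "g : hom (Pic Fn) complex_units" for g
 proof -
  define F where "F = (%D. g (?N #>\<^bsub>?D\<^esub> D))"
  have car: "?N #>\<^bsub>?D\<^esub> D : carrier (Pic Fn)" if "D : carrier ?D" for D
   using that by (simp add: Pic_def FactGroup_def D.rcosetsI N.subset)
  have F0: "F D ~= 0" if "D : carrier ?D" for D using g car[OF that] by (auto simp: F_def hom_def complex_units_def)
  have Fadd: "F (%v. D v + E v) = F D * F E" if "D : carrier ?D" "E : carrier ?D" for D E
  proof -
   have "(?N #>\<^bsub>?D\<^esub> D) \<otimes>\<^bsub>Pic Fn\<^esub> (?N #>\<^bsub>?D\<^esub> E) = ?N #>\<^bsub>?D\<^esub> (D \<otimes>\<^bsub>?D\<^esub> E)"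
    using that by (simp add: Pic_def FactGroup_def N.rcos_sum)
   moreover have "g ((?N #>\<^bsub>?D\<^esub> D) \<otimes>\<^bsub>Pic Fn\<^esub> (?N #>\<^bsub>?D\<^esub> E)) = F D * F E"
    using g car[OF that(1)] car[OF that(2)] unfolding F_def hom_def complex_units_def by simp
   moreover have "D \<otimes>\<^bsub>?D\<^esub> E = (%v. D v + E v)" by (simp add: torus_divisors_def)
   ultimately show ?thesis unfolding F_def by simp
  qed
  have N1: "F D = 1" if "D : ?N" for D
  proof -
   have Dc: "D : carrier ?D" using that N.subset by blast
   have e: "?N #>\<^bsub>?D\<^esub> D = ?N #>\<^bsub>?D\<^esub> (%v. D v + D v)"
   proof -
    have "(%v. D v + D v) : ?N" using N.m_closed[OF that that] by (simp add: torus_divisors_def)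
    thus ?thesis using that N.rcos_const by (metis D.is_group)
   qed
   have "F D = F D * F D" using Fadd[OF Dc Dc] e unfolding F_def by simp
   thus ?thesis using F0[OF Dc] by simp
  qed
  have zero: "(%v. 0) : carrier ?D" by (simp add: torus_divisors_def)
  have F00: "F (%v. 0) = 1" using Fadd[OF zero zero] F0[OF zero] by simp
  have Fk: "F (%u. if u = v then k else 0) = F (\<delta> v) powi k" if v: "v : ?G" for v k
  proof -
   have c: "(%u. if u = v then j else 0) : carrier ?D" for j using v by (simp add: torus_divisors_def)
   have step: "F (%u. if u = v then j + 1 else 0) = F (%u. if u = v then j else 0) * F (\<delta> v)" for j
   proof -
    have "(%u. if u = v then j + 1 else 0) = (%u. (if u = v then j else 0) + \<delta> v u)" by (auto simp: \<delta>_def)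
    thus ?thesis using Fadd[OF c[of j] \<delta>[OF v]] by simp
   qed
   show ?thesis
   proof (induction k rule: int_induct[where k = 0])
    case base
    thus ?case using F00 by simp
   next
    case (step1 i)
    thus ?case using step[of i] F0[OF \<delta>[OF v]] by (simp add: power_int_add)
   next
    case (step2 i)
    have "F (%u. if u = v then i else 0) = F (%u. if u = v then i - 1 else 0) * F (\<delta> v)"
     using step[of "i - 1"] unfolding diff_add_cancel .
    hence "F (%u. if u = v then i - 1 else 0) = F (\<delta> v) powi i / F (\<delta> v)"
     using step2 F0[OF \<delta>[OF v]] by (simp add: field_simps)
    thus ?case using F0[OF \<delta>[OF v]] by (simp add: power_int_diff)
   qed
  qed
  have Fsum: "F (%u. if u : T then D u else 0) = (\<Prod>v\<in>T. F (\<delta> v) powi D v)" if T: "T \<subseteq> ?G" for T D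
   using finite_subset[OF T fin] T
  proof (induction T rule: finite_induct)
   case (insert v T)
   have "(%u. if u : insert v T then D u else 0) =
     (%u. (if u = v then D v else 0) + (if u : T then D u else 0))" using insert.hyps by auto
   moreover have "F (%u. (if u = v then D v else 0) + (if u : T then D u else 0)) =
     F (%u. if u = v then D v else 0) * F (%u. if u : T then D u else 0)"
    by (rule Fadd) (use insert.prems in \<open>auto simp: torus_divisors_def\<close>)
   ultimately show ?case using insert Fk by simp
  qed (simp add: F00)
  define h where "h = (%v. F (\<delta> v))"
  have "h : tgroup ?G" unfolding tgroup_def
  proof (intro CollectI conjI ballI allI)
   fix v assume "v : ?G" thus "h v ~= 0" using F0 \<delta> by (simp add: h_def)
  next
   fix i
   have "(%v. if v : ?G then \<Sum>j\<in>UNIV. axis i 1 $ j * v $ j else 0) : ?N"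
    unfolding character_divisors_def by blast
   hence "(%v. if v : ?G then v $ i else 0) : ?N" unfolding pairing_axis[unfolded pairing_def] .
   from N1[OF this] show "(\<Prod>v\<in>?G. h v powi (v $ i)) = 1"
    using Fsum[OF order_refl, of "%v. v $ i"] by (simp add: h_def)
  qed
  moreover have "h v = g (divisor_class Fn v)" for v by (simp add: h_def F_def dc)
  ultimately show ?thesis by (intro image_eqI[of _ _ h]) auto
 qed
 moreover have "EX g. g : hom (Pic Fn) complex_units & restrict h ?G = restrict (%v. g (divisor_class Fn v)) ?G"
  if h: "h : tgroup ?G" for h
 proof -
  define F where "F = (%D. \<Prod>v\<in>?G. h v powi D v)"
  have F0: "F D ~= 0" for D using h fin by (simp add: F_def tgroup_def)
  have Fadd: "F (%v. D v + E v) = F D * F E" for D E unfolding F_def prod.distrib[symmetric]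
   by (intro prod.cong) (use tgroup_nonzero[OF h] in \<open>auto simp: power_int_add\<close>)
  have FN: "F D = 1" if DN: "D : ?N" for D
  proof -
   obtain m where m: "D = (%v. if v : ?G then \<Sum>i\<in>UNIV. m $ i * v $ i else 0)"
    using DN unfolding character_divisors_def by blast
   have "F D = (\<Prod>v\<in>?G. h v powi pairing m v)"
    unfolding F_def by (intro prod.cong) (auto simp: m pairing_def)
   thus ?thesis using tgroup_pairing[OF h] by simp
  qed
  \<comment> \<open>Any member of the class may be evaluated, since \<open>F\<close> is trivial on
    divisors of characters.\<close>
  define g where "g = (%C. F (SOME D. D : C))"
  have gF: "g (?N #>\<^bsub>?D\<^esub> D) = F D" if D: "D : carrier ?D" for D
  proof -
   have "(SOME E. E : ?N #>\<^bsub>?D\<^esub> D) : ?N #>\<^bsub>?D\<^esub> D"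
    using D.rcos_self[OF D N.is_subgroup] some_in_eq by blast
   then obtain E where E: "E : ?N" "(SOME E. E : ?N #>\<^bsub>?D\<^esub> D) = (%v. E v + D v)"
    unfolding r_coset_def by (auto simp: torus_divisors_def)
   show ?thesis unfolding g_def E(2) Fadd FN[OF E(1)] by simp
  qed
  have "g : hom (Pic Fn) complex_units" unfolding hom_def
  proof (intro CollectI conjI ballI)
   show "g : carrier (Pic Fn) \<rightarrow> carrier complex_units" using F0 by (auto simp: g_def complex_units_def)
   fix A B assume "A : carrier (Pic Fn)" "B : carrier (Pic Fn)"
   then obtain D E where DE: "D : carrier ?D" "E : carrier ?D" "A = ?N #>\<^bsub>?D\<^esub> D" "B = ?N #>\<^bsub>?D\<^esub> E"
    by (auto simp: Pic_def FactGroup_def RCOSETS_def)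
   have "A \<otimes>\<^bsub>Pic Fn\<^esub> B = ?N #>\<^bsub>?D\<^esub> (D \<otimes>\<^bsub>?D\<^esub> E)"
    using DE by (simp add: Pic_def FactGroup_def N.rcos_sum)
   moreover have "D \<otimes>\<^bsub>?D\<^esub> E = (%v. D v + E v)" by (simp add: torus_divisors_def)
   ultimately show "g (A \<otimes>\<^bsub>Pic Fn\<^esub> B) = g A \<otimes>\<^bsub>complex_units\<^esub> g B"
    using gF DE D.m_closed[OF DE(1,2)] by (simp add: Fadd complex_units_def)
  qed
  moreover have "g (divisor_class Fn v) = h v" if v: "v : ?G" for v
  proof -
   have "g (divisor_class Fn v) = F (\<delta> v)" unfolding dc by (rule gF[OF \<delta>[OF v]])
   also have "\<dots> = (\<Prod>u\<in>?G. if u = v then h v else 1)"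
    unfolding F_def \<delta>_def by (intro prod.cong) auto
   also have "\<dots> = h v" using v fin by simp
   finally show ?thesis .
  qed
  ultimately show ?thesis by (intro exI[of _ g]) auto
 qed
 ultimately show ?thesis by blast
qed

lemma hc_orbit_eq:
 assumes fin: "finite (gens Fn)" and X: "X : coord_space (gens Fn)"
 shows "hc_orbit Fn X = (%h. act h X) ` tgroup (gens Fn)"
proof
 have X0: "X v = 0" if "v ~: gens Fn" for v using X that by (simp add: coord_space_def)
 show "hc_orbit Fn X \<subseteq> (%h. act h X) ` tgroup (gens Fn)"
 proof
  fix Y assume "Y : hc_orbit Fn X"
  then obtain g where g: "g : hom (Pic Fn) complex_units" "Y = (%v. g (divisor_class Fn v) * X v)"
   unfolding hc_orbit_def by blast
  hence "restrict (%v. g (divisor_class Fn v)) (gens Fn) : (%h. restrict h (gens Fn)) ` tgroup (gens Fn)"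
   using hom_Pic_iff_tgroup[OF fin] by blast
  then obtain h where h: "h : tgroup (gens Fn)"
   "restrict (%v. g (divisor_class Fn v)) (gens Fn) = restrict h (gens Fn)" by blast
  have "Y v = act h X v" for v
   using fun_cong[OF h(2), of v] X0[of v] unfolding g(2) act_def by (cases "v : gens Fn") auto
  thus "Y : (%h. act h X) ` tgroup (gens Fn)" using h(1) by blast
 qed
 show "(%h. act h X) ` tgroup (gens Fn) \<subseteq> hc_orbit Fn X"
 proof clarify
  fix h assume "h : tgroup (gens Fn)"
  hence "restrict h (gens Fn) : {restrict (%v. g (divisor_class Fn v)) (gens Fn) | g. g : hom (Pic Fn) complex_units}"
   using hom_Pic_iff_tgroup[OF fin] by blast
  then obtain g where g: "g : hom (Pic Fn) complex_units"
   "restrict h (gens Fn) = restrict (%v. g (divisor_class Fn v)) (gens Fn)" by blast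
  have "act h X = (%v. g (divisor_class Fn v) * X v)"
  proof
   fix v show "act h X v = g (divisor_class Fn v) * X v"
    using fun_cong[OF g(2), of v] X0[of v] unfolding act_def by (cases "v : gens Fn") auto
  qed
  thus "act h X : hc_orbit Fn X" unfolding hc_orbit_def using g(1) by blast
 qed
qed


section \<open>Toric varieties\<close>

lemma full_dual:
 assumes "lattice_basis UNIV B"
 obtains m where "dual_to B m" "\<And>x. x = (\<Sum>v\<in>B. pairing (m v) x *s v)"
proof -
 obtain m where m: "\<And>v w. v : B ==> w : B ==> pairing (m v) w = (if v = w then 1 else 0)"
  "\<And>x. x : UNIV ==> x = (\<Sum>v\<in>B. pairing (m v) x *s v)"
  by (rule dual_basis[OF assms coordinate_lattice_UNIV]) (rule that)
 have "dual_to B m" using m(1) assms by (simp add: dual_to_def lattice_basis_def)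
 thus ?thesis using m(2)[OF UNIV_I] by (rule that)
qed

lemma continuous_on_coordinate: "continuous_on S (%x :: 'i => complex. x v)"
 by (rule continuous_on_product_then_coordinatewise) (rule continuous_on_id)

lemma act_in_coord_space: "X : coord_space I ==> act h X : coord_space I" by (simp add: coord_space_def act_def)

lemma act_one: "act (%v. 1) X = X" by (simp add: act_def)

lemma act_act: "act h (act k X) = act (act h k) X" by (simp add: act_def mult.assoc)

text \<open>The representative of the orbit whose coordinates on \<open>Z\<close> are 1. The
  exponents are forced: expanding \<open>u\<close> in the basis \<open>B\<close> shows how
  multipliers at \<open>B\<close> compensate the factor \<open>1 / X u\<close> in every character.
  For the basis of the \<open>e_i\<close> with \<open>b_1\<close> or \<open>c_1\<close> this is the
  identification prescribed in the statement.\<close>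

definition norm_coords ::
 "(int^'d) set => (int^'d => int^'d) => (int^'d) set => (int^'d => complex) => int^'d::finite => complex" where
 "norm_coords B m Z X = (%v. if v : B then X v * (\<Prod>u\<in>Z. X u powi pairing (m v) u)
   else if v : Z then 1 else X v)"

locale toric = nonsingular_fan L Fn for L :: "(int^'d::finite) set" and Fn :: "(real^'d) set set"
begin

abbreviation "orb \<equiv> hc_orbit Fn"
abbreviation "hcd \<equiv> hc_domain Fn"
abbreviation "chart \<equiv> hc_chart Fn"
abbreviation "TV \<equiv> toric_an Fn"
abbreviation "AV \<equiv> toric_alg Fn"
abbreviation "HC \<equiv> subspace_of (affine_an G) (hcd)"

lemma hc_chart_iff:
 "X : chart cn \<longleftrightarrow> X : coord_space G & (ALL v:G - cg cn. X v ~= 0)"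
 unfolding hc_chart_def using finite_gens by auto

lemma open_nonzero:
 "openin (top_of_set (coord_space I)) {X : coord_space I. ALL v:Z. X v ~= 0}" if "finite Z" for Z :: "'i set"
proof -
 have "open {X :: 'i => complex. X v ~= 0}" for v
  by (intro open_Collect_neq continuous_on_coordinate continuous_on_const)
 hence "open (\<Inter>v\<in>Z. {X :: 'i => complex. X v ~= 0})" using that by (intro open_INT) auto
 moreover have "{X : coord_space I. ALL v:Z. X v ~= 0} = coord_space I \<inter> (\<Inter>v\<in>Z. {X. X v ~= 0})" by auto
 ultimately show ?thesis by (simp add: openin_open_Int)
qed

lemma open_hc_chart: "opn (affine_an G) (chart cn)"
proof -
 have "chart cn = {X : coord_space G. ALL v:G - cg cn. X v ~= 0}" by (simp add: set_eq_iff hc_chart_iff)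
 thus ?thesis using open_nonzero[of "G - cg cn" G] finite_gens by simp
qed

lemma open_hc_domain: "opn (affine_an G) (hcd)" unfolding hc_domain_def using open_hc_chart by blast

lemma hc_domain_coord: "X : hcd ==> X : coord_space G" by (auto simp: hc_domain_def hc_chart_iff)

lemma hc_domain_iff:
 "X : hcd \<longleftrightarrow> X : coord_space G & (EX cn:Fn. {v : G. X v = 0} \<subseteq> cg cn)"
 unfolding hc_domain_def UN_iff hc_chart_iff by auto

lemma curved_affine: "curved (affine_an G)" by (rule curved_affine_an[OF finite_gens])

lemma curved_HC: "curved HC" by (rule curved_subspace[OF curved_affine open_hc_domain])

lemma points_HC: "points HC = hcd" by (rule points_subspace_open[OF open_hc_domain])

lemma final_toric: "final_map HC TV (orb)" unfolding toric_an_def by (rule final_map_quotient)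

lemma curved_toric: "curved TV" by (rule curved_final[OF curved_HC final_toric])

lemma points_toric: "points TV = orb ` hcd" using final_map_points[OF final_toric] points_HC by simp

lemma act_hc_chart:
 "h : tgroup G ==> X : chart cn ==> act h X : chart cn"
 unfolding hc_chart_iff using act_in_coord_space by (auto simp: act_def tgroup_nonzero)

lemma orbit_self: "X : coord_space G ==> X : orb X"
 unfolding hc_orbit_eq[OF finite_gens] using tgroup_one act_one by (metis image_eqI)

lemma orbit_act:
 assumes "X : coord_space G" "h : tgroup G"
 shows "orb (act h X) = orb X"
proof -
 note e = hc_orbit_eq[OF finite_gens assms(1)] hc_orbit_eq[OF finite_gens act_in_coord_space[OF assms(1)]]
 have "act k (act h X) : (%h. act h X) ` tgroup G" if "k : tgroup G" for k
  unfolding act_act using tgroup_mult[OF that assms(2)] by blast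
 moreover have "act k X : (%k. act k (act h X)) ` tgroup G" if k: "k : tgroup G" for k
 proof -
  define k' where "k' = act k (%v. inverse (h v))"
  have "k' : tgroup G" unfolding k'_def by (intro tgroup_mult k tgroup_inverse assms)
  moreover have "act k X = act k' (act h X)"
  proof
   fix v show "act k X v = act k' (act h X) v"
    using assms by (cases "v : G") (auto simp: act_def k'_def tgroup_nonzero coord_space_def)
  qed
  ultimately show ?thesis by blast
 qed
 ultimately show ?thesis unfolding e by blast
qed

lemma orbit_eq_iff:
 assumes "X : coord_space G" "Y : coord_space G"
 shows "orb X = orb Y \<longleftrightarrow> (EX h:tgroup G. Y = act h X)"
proof
 assume "orb X = orb Y"
 hence "Y : orb X" using orbit_self[OF assms(2)] by simp
 thus "EX h:tgroup G. Y = act h X" unfolding hc_orbit_eq[OF finite_gens assms(1)] by blast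
qed (use orbit_act[OF assms(1)] in auto)

lemma representative_orbit:
 assumes "X : coord_space G"
 obtains h where "h : tgroup G" "representative (orb X) = act h X"
proof -
 have "representative (orb X) : orb X" unfolding representative_def using orbit_self[OF assms] some_in_eq by blast
 thus ?thesis using that unfolding hc_orbit_eq[OF finite_gens assms] by blast
qed

text \<open>The saturation of an open set is the union of its translates by the group. Openness is
  what later permits products of the quotient with a line.\<close>

lemma open_orbit_map: "open_map (top_of HC) (top_of TV) (orb)" unfolding open_map_def
proof (intro allI impI)
 fix U assume "opn HC U"
 hence U: "opn (affine_an G) U" "U \<subseteq> hcd" using openin_subspace_open[OF open_hc_domain] by blast+
 obtain T where T: "open T" "U = coord_space G \<inter> T" using U(1) by (auto simp: openin_open)
 have "opn (affine_an G) {X : coord_space G. act h X : U}" for h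
 proof -
  have "continuous_on UNIV (act h)" unfolding act_def by (rule continuous_on_coordinatewise_then_product)
    (intro continuous_on_mult continuous_on_const continuous_on_coordinate)
  hence "open (act h -` T)" using T(1) open_vimage by blast
  moreover have "{X : coord_space G. act h X : U} = coord_space G \<inter> (act h -` T)"
   using T(2) act_in_coord_space[of _ G h] by auto
  ultimately show ?thesis by (simp add: openin_open_Int)
 qed
 hence "opn (affine_an G) (\<Union>h\<in>tgroup G. {X : coord_space G. act h X : U})" by blast
 moreover have "{X : hcd. orb X : orb ` U} =
   hcd \<inter> (\<Union>h\<in>tgroup G. {X : coord_space G. act h X : U})"
 proof (rule equalityI; rule subsetI)
  fix X assume "X : {X : hcd. orb X : orb ` U}"
  then obtain Y where Y: "X : hcd" "Y : U" "orb X = orb Y" by auto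
  have "X : coord_space G" "Y : coord_space G" using Y(1,2) U(2) hc_domain_coord by blast+
  thus "X : hcd \<inter> (\<Union>h\<in>tgroup G. {X : coord_space G. act h X : U})" using Y orbit_eq_iff by auto
 next
  fix X assume "X : hcd \<inter> (\<Union>h\<in>tgroup G. {X : coord_space G. act h X : U})"
  then obtain h where h: "X : hcd" "h : tgroup G" "X : coord_space G" "act h X : U" by blast
  hence "orb X = orb (act h X)" using orbit_act by simp
  thus "X : {X : hcd. orb X : orb ` U}" using h by blast
 qed
 ultimately have "opn HC {X : points HC. orb X : orb ` U}"
  unfolding points_HC openin_subspace_open[OF open_hc_domain] using open_hc_domain by auto
 moreover have "orb ` U \<subseteq> points TV" using U(2) points_toric by blast
 ultimately show "opn TV (orb ` U)" using final_map_openin[OF final_toric] by blast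
qed

lemma norm_coords_group:
 assumes B: "B \<subseteq> G" "finite B" and exp: "\<And>x. x = (\<Sum>v\<in>B. pairing (m v) x *s v)"
  and Z: "Z \<subseteq> G - B" and X: "\<And>u. u : Z ==> X u ~= 0"
 shows "norm_coords B m Z X : (%h. act h X) ` tgroup G"
proof -
 have fZ: "finite Z" using Z finite_gens finite_subset by blast
 define h where "h = (%v. if v : B then \<Prod>u\<in>Z. X u powi pairing (m v) u else if v : Z then 1 / X v else 1)"
 have "norm_coords B m Z X v = act h X v" for v using X[of v] by (auto simp: norm_coords_def act_def h_def)
 hence eq: "norm_coords B m Z X = act h X" by blast
 have h0: "h v ~= 0" for v using X fZ by (auto simp: h_def)
 have "(\<Prod>v\<in>G. h v powi (v $ i)) = 1" for i
 proof -
  have "(\<Prod>v\<in>G. h v powi (v $ i)) = (\<Prod>v\<in>B \<union> Z. h v powi (v $ i))"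
   by (rule prod.mono_neutral_right) (use finite_gens B Z in \<open>auto simp: h_def\<close>)
  also have "\<dots> = (\<Prod>v\<in>B. h v powi (v $ i)) * (\<Prod>v\<in>Z. h v powi (v $ i))"
   by (rule prod.union_disjoint) (use B fZ Z in auto)
  also have "(\<Prod>v\<in>B. h v powi (v $ i)) = (\<Prod>v\<in>B. \<Prod>u\<in>Z. X u powi (pairing (m v) u * v $ i))"
   by (intro prod.cong) (auto simp: h_def power_int_prod power_int_mult)
  also have "\<dots> = (\<Prod>u\<in>Z. \<Prod>v\<in>B. X u powi (pairing (m v) u * v $ i))" by (rule prod.swap)
  also have "\<dots> = (\<Prod>u\<in>Z. X u powi (u $ i))"
  proof (rule prod.cong)
   fix u assume u: "u : Z"
   have "(\<Prod>v\<in>B. X u powi (pairing (m v) u * v $ i)) = X u powi (\<Sum>v\<in>B. pairing (m v) u * v $ i)"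
    using power_int_sum[OF B(2) X[OF u]] by simp
   also have "(\<Sum>v\<in>B. pairing (m v) u * v $ i) = u $ i" using arg_cong[OF exp[of u], of "%x. x $ i"] by simp
   finally show "(\<Prod>v\<in>B. X u powi (pairing (m v) u * v $ i)) = X u powi (u $ i)" .
  qed simp
  also have "(\<Prod>v\<in>Z. h v powi (v $ i)) = (\<Prod>u\<in>Z. inverse (X u powi (u $ i)))"
   using Z by (intro prod.cong) (auto simp: h_def power_int_inverse divide_inverse)
  also have "(\<Prod>u\<in>Z. X u powi (u $ i)) * \<dots> = 1"
   unfolding prod.distrib[symmetric] using X by (intro prod.neutral) simp
  finally show ?thesis .
 qed
 hence "h : tgroup G" using h0 by (simp add: tgroup_def)
 thus ?thesis using eq by blast
qed

text \<open>Pair the relations with the functional dual to \<open>v\<close>: inside \<open>B\<close>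
  only \<open>v\<close> itself contributes. The hypothesis is on powers, so \<open>h u\<close> may
  be anything where this functional vanishes.\<close>

lemma tgroup_eq_one:
 assumes h: "h : tgroup G" and B: "dual_to B m" "B \<subseteq> G" and v: "v : B"
  and one: "\<And>u. u : G - B ==> h u powi pairing (m v) u = 1"
 shows "h v = 1"
proof -
 have "1 = (\<Prod>u\<in>G. h u powi pairing (m v) u)" using tgroup_pairing[OF h] by simp
 also have "\<dots> = (\<Prod>u\<in>G. if u = v then h v else 1)"
 proof (rule prod.cong)
  fix u assume u: "u : G"
  show "h u powi pairing (m v) u = (if u = v then h v else 1)"
   using one[of u] u B(1) v by (cases "u : B") (auto simp: dual_to_def)
 qed simp
 also have "\<dots> = h v" using v B finite_gens by auto
 finally show ?thesis by simp
qed

lemma norm_coords_morphism: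
 assumes A: "opn (affine_an G) A" and Z: "finite Z"
  and nz: "\<And>X u. X : A ==> u : Z ==> X u ~= 0"
 shows "(%X. norm_coords B m Z X v) : funs (subspace_of (affine_an G) A) A"
proof -
 note cA = curved_subspace[OF curved_affine A]
 have oA: "opn (subspace_of (affine_an G) A) A" using A openin_subspace_open by blast
 have c: "(%X. X v) : funs (subspace_of (affine_an G) A) A" for v by (rule coord_fun_subspace[OF finite_gens A])
 have "(%X. X v * (\<Prod>u\<in>Z. X u powi pairing (m v) u)) : funs (subspace_of (affine_an G) A) A"
  by (intro funs_mult[OF cA oA] funs_prod[OF cA oA] funs_power_int[OF cA oA] c Z) (use nz in blast)
 thus ?thesis using c[of v] curved_const[OF cA oA, of 1] unfolding norm_coords_def
  by (cases "v : B"; cases "v : Z") simp_all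
qed

text \<open>For a full-dimensional cone, setting the coordinates outside it to 1 gives a slice of
  the action: \<open>norm_coords\<close> moves every orbit of the chart into the slice, and
  \<open>tgroup_eq_one\<close> shows that the slice is met only once.\<close>

lemma toric_chart:
 assumes tn: "tn : Fn" and m: "dual_to (cg tn) m"
  and exp: "\<And>x. x = (\<Sum>v\<in>cg tn. pairing (m v) x *s v)"
 defines "B \<equiv> cg tn"
 defines "ps \<equiv> %x. orb (%v. if v : B then x v else if v : G then 1 else 0)"
 defines "ph \<equiv> %p v. if v : B then norm_coords B m (G - B) (representative p) v else 0"
 shows "open_emb (affine_an B) TV ps ph" "ps ` points (affine_an B) = orb ` chart tn"
  "\<And>X. X : chart tn ==> ph (orb X) = (%v. if v : B then norm_coords B m (G - B) X v else 0)"
  "\<And>X. X : chart tn ==>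
   ps (%v. if v : B then norm_coords B m (G - B) X v else 0) = orb X"
proof -
 have BG: "B \<subseteq> G" unfolding B_def cone_gens_def by blast
 have fB: "finite B" using m by (simp add: B_def dual_to_def)
 define s where "s = (%x v. if v : B then x v else if v : G then 1 else 0 :: complex)"
 have ps: "ps x = orb (s x)" for x unfolding ps_def s_def ..
 define N where "N = norm_coords B m (G - B)"
 define ph0 where "ph0 = (%X v. if v : B then N X v else 0)"
 have nz: "X u ~= 0" if "X : chart tn" "u : G - B" for X u using that unfolding hc_chart_iff B_def by blast
 have Xc: "X : coord_space G" if "X : chart tn" for X using that hc_chart_iff by blast
 have stn: "s x : chart tn" for x unfolding hc_chart_iff s_def coord_space_def using BG unfolding B_def by auto
 have N_eq: "N X v = 1" if "v : G - B" for X v using that by (simp add: N_def norm_coords_def)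
 have N_orbit: "EX h:tgroup G. N X = act h X" if X: "X : chart tn" for X
  using norm_coords_group[OF BG fB, of m "G - B" X] exp nz[OF X] unfolding N_def B_def by blast
 have N_inv: "N (act h X) v = N X v" if X: "X : chart tn" and h: "h : tgroup G" and v: "v : B" for X h v
 proof -
  obtain k where k: "k : tgroup G" "N X = act k X" using N_orbit[OF X] by blast
  obtain k' where k': "k' : tgroup G" "N (act h X) = act k' (act h X)" using N_orbit[OF act_hc_chart[OF h X]] by blast
  define g where "g = act (act k' h) (%v. inverse (k v))"
  have g: "g : tgroup G" unfolding g_def by (intro tgroup_mult k' h tgroup_inverse k)
  have NN: "N (act h X) w = g w * N X w" if "w : G" for w
   unfolding k'(2) k(2) using tgroup_nonzero[OF k(1) that] by (simp add: g_def act_def)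
  have "g w = 1" if "w : G - B" for w using NN[of w] N_eq[OF that] that by simp
  hence "g v = 1" using tgroup_eq_one[OF g m[folded B_def] BG v] by simp
  thus ?thesis using NN[of v] v BG by auto
 qed
 have ph_orb: "ph (orb X) = ph0 X" if X: "X : chart tn" for X
 proof -
  obtain h where h: "h : tgroup G" "representative (orb X) = act h X" using representative_orbit[OF Xc[OF X]] .
  show ?thesis unfolding ph_def ph0_def h(2) using N_inv[OF X h(1)] by (auto simp: N_def)
 qed
 thus "\<And>X. X : chart tn ==> ph (orb X) = (%v. if v : B then norm_coords B m (G - B) X v else 0)"
  unfolding ph0_def N_def by blast
 have sph0: "s (ph0 X) = N X" if X: "X : chart tn" for X
 proof
  fix v show "s (ph0 X) v = N X v"
   using Xc[OF X] BG by (auto simp: s_def ph0_def N_def norm_coords_def coord_space_def)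
 qed
 have psph0: "ps (ph0 X) = orb X" if X: "X : chart tn" for X
  unfolding ps sph0[OF X] using N_orbit[OF X] orbit_act[OF Xc[OF X]] by auto
 thus "\<And>X. X : chart tn ==>
   ps (%v. if v : B then norm_coords B m (G - B) X v else 0) = orb X" unfolding ph0_def N_def .
 have Ns: "N (s x) v = x v" if "v : B" for x v using that by (simp add: N_def norm_coords_def s_def)
 have im: "ps ` points (affine_an B) = orb ` chart tn"
 proof
  show "ps ` points (affine_an B) \<subseteq> orb ` chart tn" using ps stn by blast
  show "orb ` chart tn \<subseteq> ps ` points (affine_an B)"
  proof clarify
   fix X assume X: "X : chart tn"
   have "ph0 X : coord_space B" by (simp add: ph0_def coord_space_def)
   thus "orb X : ps ` points (affine_an B)" using psph0[OF X] by (metis image_eqI top_of_affine_an topspace_euclidean_subtopology)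
  qed
 qed
 thus "ps ` points (affine_an B) = orb ` chart tn" .
 have ch: "chart tn \<subseteq> hcd" unfolding hc_domain_def using tn by blast
 have oc: "opn HC (chart tn)" using open_hc_chart ch openin_subspace_open[OF open_hc_domain] by blast
 have o: "opn TV (orb ` chart tn)" using open_orbit_map oc unfolding open_map_def by blast
 have "morphism (affine_an B) (affine_an G) s"
 proof (rule morphism_into_affine[OF curved_affine_an[OF fB] finite_gens])
  show "s x : coord_space G" for x using BG by (auto simp: s_def coord_space_def)
  have oB: "opn (affine_an B) (points (affine_an B))" by blast
  show "(%x. s x v) : funs (affine_an B) (points (affine_an B))" for v
   using coord_fun_affine_an[of v B] curved_const[OF curved_affine_an[OF fB] oB]
   by (cases "v : B"; cases "v : G") (simp_all add: s_def)
 qed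
 hence "morphism (affine_an B) HC s"
  by (rule morphism_into_subspace[OF curved_affine_an[OF fB]]) (use stn ch in blast)
 from morphism_compose[OF this final_map_morphism[OF final_toric]]
 have 1: "morphism (affine_an B) TV ps" by (simp add: comp_def ps[abs_def])
 have pre: "{X : points HC. orb X : orb ` chart tn} = chart tn"
 proof
  show "{X : points HC. orb X : orb ` chart tn} \<subseteq> chart tn"
  proof clarify
   fix X Y assume a: "X : points HC" "orb X = orb Y" "Y : chart tn"
   hence "X : coord_space G" using hc_domain_coord points_HC by blast
   then obtain h where "h : tgroup G" "X = act h Y" using orbit_eq_iff[OF Xc[OF a(3)]] a(2) by metis
   thus "X : chart tn" using act_hc_chart a(3) by blast
  qed
 qed (use ch points_HC in blast)
 note fin = final_map_restrict[OF curved_HC final_toric o, unfolded pre]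
 have ss: "morphism (subspace_of HC (chart tn)) (subspace_of (affine_an G) (chart tn)) (%x. x)"
  by (rule subspace_subspace(2)[OF curved_affine open_hc_domain open_hc_chart ch])
 have "morphism (subspace_of (affine_an G) (chart tn)) (affine_an B) ph0"
 proof (rule morphism_into_affine[OF curved_subspace[OF curved_affine open_hc_chart] fB])
  show "ph0 X : coord_space B" for X by (simp add: ph0_def coord_space_def)
  fix v assume v: "v : B"
  have "(%X. N X v) : funs (subspace_of (affine_an G) (chart tn)) (chart tn)"
   unfolding N_def by (rule norm_coords_morphism[OF open_hc_chart]) (use finite_gens nz in auto)
  thus "(%X. ph0 X v) : funs (subspace_of (affine_an G) (chart tn))
    (points (subspace_of (affine_an G) (chart tn)))"
   using v points_subspace_open[OF open_hc_chart] by (simp add: ph0_def)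
 qed
 from morphism_compose[OF ss this]
 have "morphism (subspace_of HC (chart tn)) (affine_an B) ph0" by (simp add: comp_def)
 hence "morphism (subspace_of HC (chart tn)) (affine_an B) (ph \<circ> orb)"
  by (rule morphism_cong[OF curved_subspace[OF curved_HC oc] curved_affine_an[OF fB]])
   (use ph_orb points_subspace_open[OF oc] in simp)
 from morphism_final[OF fin this]
 have 2: "morphism (subspace_of TV (orb ` chart tn)) (affine_an B) ph" .
 have 3: "ph (ps x) = x" if "x : points (affine_an B)" for x
 proof
  fix v show "ph (ps x) v = x v" unfolding ps ph_orb[OF stn] using that Ns by (auto simp: ph0_def coord_space_def)
 qed
 show "open_emb (affine_an B) TV ps ph" unfolding open_emb_def im using o 1 2 3 by blast
qed


subsection \<open>The Hausdorff property\<close>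

lemma continuous_on_prod_powr:
 assumes I: "finite I" and c: "\<And>v. v : I ==> (ALL X:A. X v ~= 0) \<or> 0 < c v"
 shows "continuous_on A (%X :: 'i => complex. \<Prod>v\<in>I. norm (X v) powr c v)"
proof (rule continuous_on_prod)
 fix v assume "v : I"
 thus "continuous_on A (%X. norm (X v) powr c v)"
  using c[of v] by (intro continuous_on_powr' continuous_on_norm continuous_on_coordinate continuous_on_const) auto
qed

text \<open>Points of one full-dimensional chart are separated there. Otherwise the separating
  functional of two cones gives a monomial in absolute values, invariant under the group, that
  vanishes at one point while its reciprocal is finite at the other.\<close>

lemma Hausdorff_toric:
 assumes full: "\<And>X. X : hcd ==> EX tn:Fn. X : chart tn & lattice_basis UNIV (cg tn)"
 shows "Hausdorff_space (top_of TV)" unfolding Hausdorff_space_def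
proof (intro allI impI)
 fix p q assume pq: "p : points TV & q : points TV & p ~= q"
 then obtain X Y where XY: "X : hcd" "p = orb X" "Y : hcd" "q = orb Y" unfolding points_toric by blast
 obtain cn where cn: "cn : Fn" "X : chart cn" using XY(1) unfolding hc_domain_def by blast
 obtain tn where tn: "tn : Fn" "Y : chart tn" "lattice_basis UNIV (cg tn)" using full[OF XY(3)] by blast
 show "EX U V. opn TV U & opn TV V & p : U & q : V & disjnt U V"
 proof (cases "X : chart tn")
  case True
  let ?B = "cg tn"
  obtain m where d: "dual_to ?B m" and m: "\<And>x. x = (\<Sum>v\<in>?B. pairing (m v) x *s v)"
   by (rule full_dual[OF tn(3)]) (rule that)
  obtain ps ph where e: "open_emb (affine_an ?B) TV ps ph"
   and im: "ps ` points (affine_an ?B) = orb ` chart tn" using toric_chart(1,2)[OF tn(1) d m] by blast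
  obtain x y where xy: "x : points (affine_an ?B)" "p = ps x" "y : points (affine_an ?B)" "q = ps y"
  proof -
   have "p : ps ` points (affine_an ?B)" "q : ps ` points (affine_an ?B)"
    unfolding im XY(2,4) using True tn(2) by auto
   thus ?thesis using that by (elim imageE)
  qed
  have "Hausdorff_space (top_of (affine_an ?B))" by (simp add: Hausdorff_space_subtopology)
  moreover have "x ~= y" using xy pq by blast
  ultimately obtain U V where UV: "opn (affine_an ?B) U" "opn (affine_an ?B) V"
   "x : U" "y : V" "disjnt U V" using xy unfolding Hausdorff_space_def by metis
  have "disjnt (ps ` U) (ps ` V)"
  proof -
   have "U \<subseteq> points (affine_an ?B)" "V \<subseteq> points (affine_an ?B)" using UV openin_subset by blast+
   thus ?thesis using UV(5) open_emb_inj[OF e] unfolding disjnt_def by blast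
  qed
  thus ?thesis using open_emb_image[OF e UV(1)] open_emb_image[OF e UV(2)] UV(3,4) xy(2,4) by blast
 next
  case False
  let ?S = "cg cn" and ?T = "cg tn"
  obtain \<mu> where \<mu>: "\<And>v. v : ?S - ?T ==> 0 < \<mu> \<bullet> real_vec v"
   "\<And>v. v : ?T - ?S ==> \<mu> \<bullet> real_vec v < 0" "\<And>v. v : ?S \<inter> ?T ==> \<mu> \<bullet> real_vec v = 0"
   using separating_functional[OF cn(1) tn(1)] by metis
  \<comment> \<open>Common generators have exponent 0, but \<open>0 powr 0\<close> is 0, so their
    factors must be left out instead of being kept as trivial ones.\<close>
  define D where "D = G - ?S \<inter> ?T"
  have fD: "finite D" using finite_gens by (simp add: D_def)
  define M where "M = (%X :: int^'d => complex. \<Prod>v\<in>D. norm (X v) powr (\<mu> \<bullet> real_vec v))"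
  define M' where "M' = (%X :: int^'d => complex. \<Prod>v\<in>D. norm (X v) powr (- (\<mu> \<bullet> real_vec v)))"
  have cM: "continuous_on (chart cn) M" unfolding M_def
  proof (rule continuous_on_prod_powr[OF fD])
   fix v assume "v : D"
   thus "(ALL X:chart cn. X v ~= 0) \<or> 0 < \<mu> \<bullet> real_vec v"
    using \<mu>(1)[of v] by (cases "v : ?S") (auto simp: hc_chart_iff D_def)
  qed
  have cM': "continuous_on (chart tn) M'" unfolding M'_def
  proof (rule continuous_on_prod_powr[OF fD])
   fix v assume "v : D"
   thus "(ALL X:chart tn. X v ~= 0) \<or> 0 < - (\<mu> \<bullet> real_vec v)"
    using \<mu>(2)[of v] by (cases "v : ?T") (auto simp: hc_chart_iff D_def)
  qed
  have M0: "M X = 0"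
  proof -
   obtain v where v: "v : G - ?T" "X v = 0" using False cn(2) unfolding hc_chart_iff by blast
   hence "v : D" by (auto simp: D_def)
   moreover have "norm (X v) powr (\<mu> \<bullet> real_vec v) = 0" using v by simp
   ultimately show ?thesis unfolding M_def using fD by (metis prod_zero)
  qed
  define C where "C = M' Y + 1"
  have C: "C > 0" unfolding C_def M'_def by (intro add_nonneg_pos prod_nonneg) auto
  define A where "A = {X : chart cn. M X < 1 / C}"
  define E where "E = {X : chart tn. M' X < C}"
  have XA: "X : A" "Y : E" using cn(2) tn(2) M0 C by (auto simp: A_def E_def C_def)
  have op: "opn HC {X : chart \<rho>. f X < c}"
   if "continuous_on (chart \<rho>) f" "\<rho> : Fn" for \<rho> c and f :: "(int^'d => complex) => real"
  proof -
   have "openin (top_of_set (chart \<rho>)) (chart \<rho> \<inter> f -` {..<c})"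
    by (rule continuous_openin_preimage_gen[OF that(1)]) simp
   moreover have "chart \<rho> \<inter> f -` {..<c} = {X : chart \<rho>. f X < c}" by auto
   ultimately have "opn (affine_an G) {X : chart \<rho>. f X < c}"
    using openin_trans[OF _ open_hc_chart[of \<rho>, simplified]] by simp
   moreover have "{X : chart \<rho>. f X < c} \<subseteq> hcd" using that(2) unfolding hc_domain_def by blast
   ultimately show ?thesis unfolding openin_subspace_open[OF open_hc_domain] by blast
  qed
  have oA: "opn TV (orb ` A)" and oE: "opn TV (orb ` E)"
   using open_orbit_map op[OF cM cn(1)] op[OF cM' tn(1)] unfolding open_map_def A_def E_def by blast+
  have "disjnt (orb ` A) (orb ` E)"
  proof (rule ccontr)
   assume "\<not> disjnt (orb ` A) (orb ` E)"
   then obtain P Q where PQ: "P : A" "Q : E" "orb P = orb Q" unfolding disjnt_def by blast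
   have "P : coord_space G" "Q : coord_space G" using PQ(1,2) by (auto simp: A_def E_def hc_chart_iff)
   then obtain h where h: "h : tgroup G" "Q = act h P" using orbit_eq_iff PQ(3) by blast
   have Qcn: "Q : chart cn" using act_hc_chart[OF h(1)] PQ(1) h(2) by (simp add: A_def)
   have Qnz: "Q v ~= 0" if "v : D" for v using Qcn PQ(2) that by (auto simp: E_def hc_chart_iff D_def)
   have "M Q * M' Q = (\<Prod>v\<in>D. 1)" unfolding M_def M'_def prod.distrib[symmetric]
    by (rule prod.cong) (use Qnz in \<open>auto simp: powr_minus field_simps\<close>)
   hence MM': "M Q * M' Q = 1" by simp
   have "(\<Prod>v\<in>D. norm (h v) powr (\<mu> \<bullet> real_vec v)) = (\<Prod>v\<in>G. norm (h v) powr (\<mu> \<bullet> real_vec v))"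
    by (rule prod.mono_neutral_left) (use finite_gens \<mu>(3) tgroup_nonzero[OF h(1)] in \<open>auto simp: D_def\<close>)
   hence Mh: "(\<Prod>v\<in>D. norm (h v) powr (\<mu> \<bullet> real_vec v)) = 1" using tgroup_norm_powr[OF h(1) finite_gens] by simp
   have "M Q = (\<Prod>v\<in>D. norm (h v) powr (\<mu> \<bullet> real_vec v)) * M P"
    unfolding M_def h(2) act_def prod.distrib[symmetric] by (simp add: norm_mult powr_mult)
   hence "M Q < 1 / C" using Mh PQ(1) by (simp add: A_def)
   moreover have "M' Q < C" using PQ(2) by (simp add: E_def)
   moreover have "M Q \<ge> 0" "M' Q \<ge> 0" unfolding M_def M'_def by (auto intro: prod_nonneg)
   ultimately have "M Q * M' Q < (1 / C) * C" using C by (intro mult_strict_mono) auto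
   thus False using MM' C by simp
  qed
  thus ?thesis using oA oE XA XY(2,4) by blast
 qed
qed

end

section \<open>The two halves of the fan and their position in the whole variety\<close>

section \<open>The neighbourhood of the common hypersurface\<close>

lemma pairing_diff_left: "pairing (x - k *s y) v = pairing x v - k * pairing y v"
 by (simp add: pairing_def left_diff_distrib sum_subtractf sum_distrib_left mult.assoc)

lemma pairing_scale_left: "pairing (k *s y) v = k * pairing y v"
 by (simp add: pairing_def sum_distrib_left mult.assoc)

abbreviation punctured_line :: "complex fspace" where
 "punctured_line \<equiv> subspace_of complex_line (UNIV - {0})"

lemma open_punctured: "opn complex_line (UNIV - {0})" by (simp add: open_delete)

lemma curved_punctured_line: "curved punctured_line" by (rule curved_subspace[OF curved_complex_line open_punctured])

lemma points_punctured_line: "points punctured_line = UNIV - {0}" by (rule points_subspace_open[OF open_punctured])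

lemma morphism_complex_line:
 assumes "curved X"
 shows "morphism X complex_line f \<longleftrightarrow> f : funs X (points X)"
proof
 assume f: "morphism X complex_line f"
 have "id \<circ> f : funs X {x : points X. f x : UNIV}"
  by (rule morphism_funs[OF f]) (auto simp: funs_complex_line holomorphic_on_id)
 thus "f : funs X (points X)" by simp
next
 assume f: "f : funs X (points X)"
 have o: "opn X (points X)" by blast
 show "morphism X complex_line f"
 proof (rule morphismI[OF assms curved_complex_line])
  show "continuous_map (top_of X) (top_of complex_line) f" using curved_continuous[OF assms o f] by simp
  fix D gm assume c: "curve X D gm"
  have "(f \<circ> gm) holomorphic_on D"
   by (rule curved_holomorphic[OF assms o f c]) (use curve_in_points[OF c] in auto)
  thus "curve complex_line D (f \<circ> gm)" using curve_open[OF c] by (simp add: curve_complex_line)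
 qed
qed

lemma morphism_punctured_line:
 assumes "curved X" "f : funs X (points X)" "\<And>x. x : points X ==> f x ~= 0"
 shows "morphism X punctured_line f"
 by (rule morphism_into_subspace[OF assms(1)]) (use assms morphism_complex_line in auto)

lemma funs_pullback:
 assumes "morphism X Y f" "g : funs Y (points Y)"
 shows "(%x. g (f x)) : funs X (points X)"
proof -
 have o: "opn Y (points Y)" by blast
 have "{x : points X. f x : points Y} = points X" using morphism_in[OF assms(1)] by auto
 thus ?thesis using morphism_funs[OF assms(1) o assms(2)] by (simp add: comp_def)
qed

lemma open_emb_iso:
 assumes "curved X" "curved Z" "morphism X Z f" "morphism Z X g"
  "\<And>x. x : points X ==> g (f x) = x" "\<And>z. z : points Z ==> f (g z) = z"
 shows "open_emb X Z f g" "f ` points X = points Z"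
proof -
 show im: "f ` points X = points Z"
 proof
  show "f ` points X \<subseteq> points Z" using morphism_in[OF assms(3)] by blast
  show "points Z \<subseteq> f ` points X" using morphism_in[OF assms(4)] assms(6) by (metis image_eqI subsetI)
 qed
 have o: "opn Z (points Z)" by blast
 have "morphism (subspace_of Z (points Z)) X g"
  using morphism_compose[OF morphism_subspace_incl[OF assms(2) o] assms(4)] by (simp add: comp_def)
 thus "open_emb X Z f g" unfolding open_emb_def im using o assms by blast
qed

definition dual_basis_of :: "(int^'d::finite) set => int^'d => int^'d" where
 "dual_basis_of B = (SOME m. dual_to B m & (ALL x. x = (\<Sum>v\<in>B. pairing (m v) x *s v)))"

lemma dual_basis_of:
 assumes "lattice_basis UNIV B"
 shows "dual_to B (dual_basis_of B)" "x = (\<Sum>v\<in>B. pairing (dual_basis_of B v) x *s v)"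
proof -
 obtain m where "dual_to B m" "\<And>x. x = (\<Sum>v\<in>B. pairing (m v) x *s v)"
  by (rule full_dual[OF assms]) (rule that)
 hence "EX m. dual_to B m & (ALL x. x = (\<Sum>v\<in>B. pairing (m v) x *s v))" by blast
 hence "dual_to B (dual_basis_of B) & (ALL x. x = (\<Sum>v\<in>B. pairing (dual_basis_of B v) x *s v))"
  unfolding dual_basis_of_def by (rule someI_ex)
 thus "dual_to B (dual_basis_of B)" "x = (\<Sum>v\<in>B. pairing (dual_basis_of B v) x *s v)" by blast+
qed

lemma card_lattice_basis:
 fixes B :: "(int^'d::finite) set"
 assumes "lattice_basis UNIV B"
 shows "card B = CARD('d)"
proof -
 note m = dual_basis_of[OF assms]
 have fB: "finite B" using m(1) by (simp add: dual_to_def)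
 have inj: "inj_on real_vec B" by (simp add: inj_on_def)
 have ind: "independent (real_vec ` B)"
 proof (rule independent_if_scalars_zero)
  show "finite (real_vec ` B)" using fB by simp
  fix f x assume s: "(\<Sum>x\<in>real_vec ` B. f x *\<^sub>R x) = 0" and x: "x : real_vec ` B"
  obtain v where v: "v : B" "x = real_vec v" using x by blast
  have "(\<Sum>v\<in>B. f (real_vec v) *\<^sub>R real_vec v) = 0" using s by (simp add: sum.reindex[OF inj])
  thus "f x = 0" using dual_to_coeff[OF m(1) v(1), of "%v. f (real_vec v)"] v(2) by simp
 qed
 have "axis i 1 : span (real_vec ` B)" for i :: 'd
 proof -
  have "axis i 1 = real_vec (axis i 1)" by (simp add: vec_eq_iff axis_def)
  also have "\<dots> = (\<Sum>v\<in>B. real_of_int (pairing (dual_basis_of B v) (axis i 1)) *\<^sub>R real_vec v)"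
   by (subst m(2)) (rule real_vec_sum)
  also have "\<dots> : span (real_vec ` B)" by (intro span_sum span_scale span_base) auto
  finally show ?thesis .
 qed
 hence "Basis \<subseteq> span (real_vec ` B)" by (auto simp: Basis_vec_def)
 hence "span (real_vec ` B) = UNIV" by (metis span_Basis span_span span_mono top.extremum_uniqueI)
 hence "card (real_vec ` B) = dim (UNIV :: (real^'d) set)" using ind dim_eq_card[of "real_vec ` B" UNIV] by simp
 thus ?thesis using card_image[OF inj] by (simp add: dim_UNIV)
qed

text \<open>Charts of a manifold are indexed by initial segments of the natural numbers: the fiber
  coordinates are enumerated by \<open>e\<close>, and the parameter is appended at index
  \<open>n\<close>.\<close>

lemma open_emb_reindex:
 assumes B: "finite B" and e: "bij_betw e {..<n} B"
 defines "f \<equiv> %x :: nat => complex. ((%v. if v : B then x (inv_into {..<n} e v) else 0), x n)"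
 defines "g \<equiv> %(y, t) i. if i < n then y (e i) else if i = n then t else 0 :: complex"
 shows "open_emb (affine_an {..<n + 1}) (prod_an (affine_an B) complex_line) f g"
  "f ` points (affine_an {..<n + 1}) = points (prod_an (affine_an B) complex_line)"
proof -
 let ?A = "affine_an {..<n + 1} :: (nat => complex) fspace"
 let ?P = "prod_an (affine_an B) complex_line"
 have cA: "curved ?A" by (simp add: curved_affine_an)
 note cB = curved_affine_an[OF B]
 note cP = curved_prod[OF cB curved_complex_line]
 have inv: "inv_into {..<n} e v < n" "e (inv_into {..<n} e v) = v" if "v : B" for v
  using e that bij_betw_inv_into_right[OF e that] by (auto simp: bij_betw_def intro: inv_into_into[of v e "{..<n}", simplified])
 have "morphism ?A (affine_an B) (%x v. if v : B then x (inv_into {..<n} e v) else 0)"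
 proof (rule morphism_into_affine[OF cA B])
  fix v assume v: "v : B"
  hence "inv_into {..<n} e v : {..<n + 1}" using inv(1) by fastforce
  thus "(%x. if v : B then x (inv_into {..<n} e v) else 0) : funs ?A (points ?A)"
   using v coord_fun_affine_an[of "inv_into {..<n} e v" "{..<n + 1}" "points ?A"] by simp
 qed (simp add: coord_space_def)
 moreover have "morphism ?A complex_line (%x. x n)"
  unfolding morphism_complex_line[OF cA] by (rule coord_fun_affine_an) simp
 ultimately have 1: "morphism ?A ?P f" unfolding f_def by (rule morphism_pair[OF cB curved_complex_line cA])
 have oP: "opn ?P (points ?P)" by blast
 have "morphism ?P ?A g"
 proof (rule morphism_into_affine[OF cP])
  show "g p : coord_space {..<n + 1}" for p by (auto simp: g_def coord_space_def split: prod.splits)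
  fix i assume i: "i : {..<n + 1}"
  show "(%p. g p i) : funs ?P (points ?P)"
  proof (cases "i < n")
   case True
   hence "e i : B" using e by (auto simp: bij_betw_def)
   hence "(%p. fst p (e i)) : funs ?P (points ?P)"
    by (intro funs_pullback[OF morphism_fst[OF cB curved_complex_line], of "%y. y (e i)"] coord_fun_affine_an)
   thus ?thesis using True by (simp add: g_def case_prod_unfold)
  next
   case False
   have "(%p. snd p) : funs ?P (points ?P)"
    using morphism_snd[OF cB curved_complex_line] morphism_complex_line[OF cP] by (simp add: eta_contract_eq)
   thus ?thesis using False i by (simp add: g_def case_prod_unfold)
  qed
 qed simp
 moreover have "g (f x) = x" if "x : points ?A" for x
 proof
  fix i show "g (f x) i = x i" using that e bij_betw_inv_into_left[OF e, of i]
   by (auto simp: g_def f_def coord_space_def bij_betw_def)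
 qed
 moreover have "f (g p) = p" if "p : points ?P" for p
  using that inv by (auto simp: g_def f_def coord_space_def split: prod.splits)
 ultimately show "open_emb ?A ?P f g" "f ` points ?A = points ?P" using open_emb_iso[OF cA cP 1] by blast+
qed

lemma second_countable_open_cover:
 assumes "countable I" "\<And>i. i : I ==> openin T (U i)" "\<And>i. i : I ==> second_countable (subtopology T (U i))"
  and cov: "topspace T \<subseteq> (\<Union>i\<in>I. U i)"
 shows "second_countable T"
proof -
 have "ALL i:I. EX \<B>. countable \<B> & (ALL V:\<B>. openin (subtopology T (U i)) V) &
   (ALL W x. openin (subtopology T (U i)) W & x : W --> (EX V:\<B>. x : V & V \<subseteq> W))"
  using assms(3) unfolding second_countable_def by blast
 then obtain \<B> where \<B>: "\<And>i. i : I ==> countable (\<B> i)"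
  "\<And>i V. i : I ==> V : \<B> i ==> openin (subtopology T (U i)) V"
  "\<And>i W x. i : I ==> openin (subtopology T (U i)) W ==> x : W ==> EX V:\<B> i. x : V & V \<subseteq> W" by metis
 show ?thesis unfolding second_countable_def
 proof (intro exI[of _ "\<Union>i\<in>I. \<B> i"] conjI ballI allI impI)
  show "countable (\<Union>i\<in>I. \<B> i)" using assms(1) \<B>(1) by auto
  show "openin T V" if "V : (\<Union>i\<in>I. \<B> i)" for V
   using that \<B>(2) assms(2) openin_open_subtopology by blast
  fix W x assume W: "openin T W & x : W"
  then obtain i where i: "i : I" "x : U i" using cov openin_subset by blast
  have "openin (subtopology T (U i)) (W \<inter> U i)" using W by (auto simp: openin_subtopology)
  then obtain V where "V : \<B> i" "x : V" "V \<subseteq> W \<inter> U i" using \<B>(3)[OF i(1), of "W \<inter> U i" x] W i by blast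
  thus "EX V:\<Union>i\<in>I. \<B> i. x : V & V \<subseteq> W" using i(1) by blast
 qed
qed

lemma second_countable_affine: "second_countable (top_of (affine_an (I :: nat set)))"
proof -
 obtain \<B> :: "(nat => complex) set set" where \<B>: "countable \<B>" "topological_basis \<B>"
  using ex_countable_basis by blast
 have "second_countable (euclidean :: (nat => complex) topology)" unfolding second_countable_def
  by (rule exI[of _ \<B>]) (use \<B> topological_basis_open topological_basisE in \<open>metis open_openin\<close>)
 thus ?thesis by (simp add: second_countable_subtopology)
qed

lemma second_countable_open_emb:
 assumes e: "open_emb X Z f g" and X: "second_countable (top_of X)"
 shows "second_countable (subtopology (top_of Z) (f ` points X))"
proof (rule second_countable_open_map_image[OF _ _ _ X])
 show "continuous_map (top_of X) (subtopology (top_of Z) (f ` points X)) f"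
  using morphism_continuous[OF open_embD(2)[OF e]] by (auto simp: continuous_map_in_subtopology)
 show "open_map (top_of X) (subtopology (top_of Z) (f ` points X)) f" unfolding open_map_def
 proof (intro allI impI)
  fix U assume U: "opn X U"
  have "f ` U \<subseteq> f ` points X" using openin_subset[OF U] by blast
  thus "openin (subtopology (top_of Z) (f ` points X)) (f ` U)"
   unfolding openin_open_subtopology[OF open_embD(1)[OF e]] using open_emb_image[OF e U] by blast
 qed
 show "f ` topspace (top_of X) = topspace (subtopology (top_of Z) (f ` points X))"
  using morphism_in[OF open_embD(2)[OF e]] by auto
qed

declare One_nat_def [simp del]

text \<open>One locale for both halves: \<open>eps\<close> is 1 with \<open>bt = b\<close>, and -1
  with \<open>bt = c\<close>. Multiplication by \<open>eps\<close> makes the last coordinates of the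
  generators off the hypersurface positive, so height function, normalisation and compactness
  estimate are written once.\<close>

locale half = U: toric UNIV Fn' + T: toric "hyperplane_lattice l" Fnt
 for l :: "'d::finite" and Fn' Fnt :: "(real^'d) set set" +
 fixes bt :: "nat => int^'d" and M :: nat and eps :: int
 assumes M: "1 \<le> M" and inj: "inj_on bt {1..M}"
  and disj: "bt ` {1..M} \<inter> gens Fnt = {}" and gens_eq: "gens Fn' = bt ` {1..M} \<union> gens Fnt"
  and basis: "basis_vecs l \<subseteq> gens Fnt" and hyp: "\<And>v. v : gens Fnt ==> v $ l = 0"
  and eps: "eps = 1 \<or> eps = - 1" and bt1: "bt 1 $ l = eps"
  and pos: "\<And>j. j : {1..M} ==> eps * bt j $ l > 0"
  and sub: "\<And>tn. tn : Fnt ==> tn : Fn' & cone_gens Fn' tn = cone_gens Fnt tn"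
  and res: "\<And>cn. cn : Fn' ==> cone_gens Fn' cn \<subseteq> gens Fnt ==> cn : Fnt"
  and cover: "\<And>x. 0 \<le> of_int eps * x $ l ==> EX cn:Fn'. lattice_basis UNIV (cone_gens Fn' cn) & x : cn"
begin

abbreviation "Gt \<equiv> T.G"
abbreviation "Gb \<equiv> bt ` {1..M}"

definition "B0 = insert (bt 1) (basis_vecs l)"
definition "Z0 = bt ` {2..M}"
text \<open>The dual basis of \<open>B0\<close>: the functional at \<open>e_i\<close> is the i-th
  coordinate, corrected so as to vanish on \<open>bt 1\<close>. For the lower half its value at
  \<open>c_j\<close> is \<open>c_{j,i} + c_{1,i} c_{j,d}\<close>, the exponent of the prescribed
  identification.\<close>

definition "m0 = (%v. if v = bt 1 then eps *s axis l 1 else v - (eps * pairing v (bt 1)) *s axis l 1)"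

lemma epseps: "eps * eps = 1" using eps by auto

lemma bt1_in: "bt 1 : Gb" using M by auto

lemma bt1_notin: "bt 1 ~: Gt" using bt1_in disj by blast

lemma bt1_Z0: "bt 1 ~: Z0"
proof
 assume "bt 1 : Z0"
 then obtain j where "j : {2..M}" "bt 1 = bt j" by (auto simp: Z0_def)
 thus False using inj_onD[OF inj, of 1 j] M by auto
qed

lemma finite_Z0: "finite Z0" by (simp add: Z0_def)

lemma Gb_eq: "Gb = insert (bt 1) Z0"
proof -
 have "{1..M} = insert 1 {2..M}" using M by auto
 thus ?thesis by (simp add: Z0_def)
qed

lemma Z0_notin: "v : Z0 ==> v ~: Gt" using Gb_eq disj by blast

lemma B0_sub: "B0 \<subseteq> U.G" unfolding B0_def using gens_eq basis bt1_in by blast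

lemma Z0_sub: "Z0 \<subseteq> U.G - B0" unfolding B0_def using Gb_eq gens_eq basis Z0_notin bt1_Z0 by blast

lemma m0_bt1: "pairing (m0 (bt 1)) v = eps * v $ l" by (simp add: m0_def pairing_scale_left pairing_axis)

lemma m0_axis: "i ~= l ==> pairing (m0 (axis i 1)) v = v $ i - eps * bt 1 $ i * v $ l"
proof -
 assume i: "i ~= l"
 hence "axis i 1 : Gt" using basis by (auto simp: basis_vecs_def)
 hence "axis i 1 ~= bt 1" using bt1_notin by metis
 thus ?thesis by (simp add: m0_def pairing_diff_left pairing_axis)
qed

lemma basis_vecs_eq: "basis_vecs l = (%i. axis i 1) ` (UNIV - {l})" by (auto simp: basis_vecs_def)

lemma inj_axis: "inj_on (%i. axis i (1::int)) S" by (auto simp: inj_on_def axis_eq_axis)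

lemma finite_basis_vecs: "finite (basis_vecs l)" unfolding basis_vecs_eq by simp

lemma m0_exp: "x = (\<Sum>v\<in>B0. pairing (m0 v) x *s v)"
proof -
 have n: "bt 1 ~: basis_vecs l" using basis bt1_notin by blast
 have "(\<Sum>v\<in>basis_vecs l. pairing (m0 v) x *s v) = (\<Sum>i\<in>UNIV - {l}. pairing (m0 (axis i 1)) x *s axis i 1)"
  unfolding basis_vecs_eq by (subst sum.reindex[OF inj_axis]) simp
 also have "\<dots> = (\<Sum>i\<in>UNIV - {l}. (x $ i - eps * bt 1 $ i * x $ l) *s axis i 1)"
  by (intro sum.cong) (auto simp: m0_axis)
 finally have s: "(\<Sum>v\<in>B0. pairing (m0 v) x *s v) =
   (eps * x $ l) *s bt 1 + (\<Sum>i\<in>UNIV - {l}. (x $ i - eps * bt 1 $ i * x $ l) *s axis i 1)"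
  unfolding B0_def using n finite_basis_vecs by (simp add: m0_bt1)
 have "(\<Sum>i\<in>UNIV - {l}. (x $ i - eps * bt 1 $ i * x $ l) *s axis i 1) $ j =
   (if j = l then 0 else x $ j - eps * bt 1 $ j * x $ l)" for j
 proof -
  have "(\<Sum>i\<in>UNIV - {l}. (x $ i - eps * bt 1 $ i * x $ l) *s axis i 1) $ j =
    (\<Sum>i\<in>UNIV - {l}. if i = j then x $ j - eps * bt 1 $ j * x $ l else 0)"
   unfolding sum_component by (intro sum.cong) (auto simp: axis_def)
  thus ?thesis by simp
 qed
 hence "(\<Sum>v\<in>B0. pairing (m0 v) x *s v) $ j = x $ j" for j
  unfolding s using eps by (cases "j = l") (auto simp: bt1)
 thus ?thesis by (simp add: vec_eq_iff)
qed

lemma dual_m0: "dual_to B0 m0" unfolding dual_to_def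
proof (intro conjI ballI)
 show "finite B0" by (simp add: B0_def finite_basis_vecs)
 fix v w assume vw: "v : B0" "w : B0"
 have bl: "u $ l = 0" if "u : basis_vecs l" for u using hyp basis that by blast
 show "pairing (m0 v) w = (if v = w then 1 else 0)"
 proof (cases "v = bt 1")
  case True
  have "bt 1 ~: basis_vecs l" using basis bt1_notin by blast
  thus ?thesis using vw(2) bl[of w] True by (auto simp: B0_def m0_bt1 bt1 epseps)
 next
  case False
  then obtain i where i: "i ~= l" "v = axis i 1" using vw by (auto simp: B0_def basis_vecs_def)
  show ?thesis
  proof (cases "w = bt 1")
   case True
   thus ?thesis using False eps unfolding i(2) m0_axis[OF i(1)] by (auto simp: bt1)
  next
   case False
   then obtain j where j: "j ~= l" "w = axis j 1" using vw by (auto simp: B0_def basis_vecs_def)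
   have "axis i 1 = axis j (1::int) \<longleftrightarrow> i = j" by (simp add: axis_eq_axis)
   thus ?thesis unfolding i(2) m0_axis[OF i(1)] j(2) using i(1) j(1) by (simp add: axis_def)
  qed
 qed
qed

definition "N = norm_coords B0 m0 Z0"
definition "rs = (%X v. if v : Gt then X v else 0 :: complex)"
definition "At = (\<Union>cn\<in>Fnt. U.chart cn)"
definition "A = U.orb ` At"
text \<open>Normalising the coordinates of \<open>Z0\<close> leaves exactly those of the
  hypersurface and the one at \<open>bt 1\<close>. Both \<open>J\<close> and its inverse evaluate
  arbitrary representatives; \<open>orbit_N_iff\<close> and \<open>J'_orbit\<close> justify
  this.\<close>

definition "J = (%p. let X = representative p in (T.orb (rs (N X)), N X (bt 1)))"
definition "lift = (%H z v. if v : Gt then H v else if v = bt 1 then z else if v : Gb then 1 else 0 :: complex)"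
definition "J' = (%(s, z). U.orb (lift (representative s) z))"

lemma A_eq: "A = tilde_part Fn' Fnt" by (simp add: A_def At_def tilde_part_def)

text \<open>If no coordinate of \<open>Gb\<close> vanishes, the zero set lies in \<open>Gt\<close>,
  and by \<open>res\<close> the face it spans belongs to the fan of the hypersurface.\<close>

lemma At_iff: "X : At \<longleftrightarrow> X : U.hcd & (ALL u:Gb. X u ~= 0)"
proof
 assume "X : At"
 then obtain cn where cn: "cn : Fnt" "X : U.chart cn" by (auto simp: At_def)
 have "U.cg cn \<subseteq> Gt" using sub[OF cn(1)] by (auto simp: cone_gens_def)
 hence "Gb \<subseteq> U.G - U.cg cn" using disj gens_eq by blast
 hence "ALL u:Gb. X u ~= 0" using cn(2) unfolding U.hc_chart_iff by blast
 moreover have "X : U.hcd" unfolding hc_domain_def using cn sub[OF cn(1)] by blast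
 ultimately show "X : U.hcd & (ALL u:Gb. X u ~= 0)" by blast
next
 assume X: "X : U.hcd & (ALL u:Gb. X u ~= 0)"
 then obtain cn where cn: "cn : Fn'" "{v : U.G. X v = 0} \<subseteq> U.cg cn" "X : coord_space U.G"
  using U.hc_domain_iff by blast
 define Z where "Z = {v : U.G. X v = 0}"
 have Z: "Z \<subseteq> Gt" using X gens_eq by (auto simp: Z_def)
 note sc = U.subcone[OF cn(1) cn(2)[folded Z_def]]
 have "cone_gen Z : Fnt" by (rule res[OF sc(1)]) (use sc(2) Z in simp)
 moreover have "X : U.chart (cone_gen Z)" using cn(3) sc(2) by (auto simp: U.hc_chart_iff Z_def)
 ultimately show "X : At" by (auto simp: At_def)
qed

lemma At_dom: "X : At ==> X : U.hcd" and At_coord: "X : At ==> X : coord_space U.G"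
 and At_nz: "X : At ==> u : Gb ==> X u ~= 0" using At_iff U.hc_domain_coord by blast+

lemma open_At: "opn (affine_an U.G) At" unfolding At_def using U.open_hc_chart by blast

lemma act_At: "h : tgroup U.G ==> X : At ==> act h X : At" unfolding At_def using U.act_hc_chart by blast

lemma N_act: "X : At ==> EX h:tgroup U.G. N X = act h X"
 using U.norm_coords_group[OF B0_sub _ _ Z0_sub, of m0 X] m0_exp dual_m0 At_nz Gb_eq
 unfolding N_def dual_to_def by auto

lemma N_Z0: "u : Z0 ==> N X u = 1" using Z0_sub by (auto simp: N_def norm_coords_def)

lemma N_At: "X : At ==> N X : At" using N_act act_At by metis

lemma rs_dom: "X : At ==> rs X : T.hcd"
proof -
 assume X: "X : At"
 then obtain cn where cn: "cn : Fnt" "X : U.chart cn" by (auto simp: At_def)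
 have "rs X : T.chart cn"
  using cn(2) sub[OF cn(1)] gens_eq unfolding U.hc_chart_iff T.hc_chart_iff by (auto simp: rs_def coord_space_def)
 thus ?thesis using cn(1) by (auto simp: hc_domain_def)
qed

text \<open>The functional dual to \<open>bt 1\<close> is a multiple of the last coordinate, which
  vanishes on \<open>Gt\<close>; so the value at \<open>bt 1\<close> is forced, and what remains
  satisfies the relations of the smaller group.\<close>

lemma tgroup_restrict:
 assumes g: "g : tgroup U.G" and Z: "\<And>u. u : Z0 ==> g u = 1"
 shows "g (bt 1) = 1" "g : tgroup Gt"
proof -
 have "g u powi pairing (m0 (bt 1)) u = 1" if "u : U.G - B0" for u
  using that gens_eq Gb_eq Z hyp by (auto simp: m0_bt1 B0_def)
 thus 1: "g (bt 1) = 1" by (intro U.tgroup_eq_one[OF g dual_m0 B0_sub]) (auto simp: B0_def)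
 have "(\<Prod>v\<in>Gt. g v powi (v $ i)) = (\<Prod>v\<in>U.G. g v powi (v $ i))" for i
  by (rule prod.mono_neutral_left) (use U.finite_gens gens_eq Gb_eq 1 Z finite_Z0 in auto)
 thus "g : tgroup Gt" using g gens_eq by (auto simp: tgroup_def)
qed

lemma tgroup_extend:
 assumes "h : tgroup Gt"
 shows "(%v. if v : Gt then h v else 1) : tgroup U.G"
proof -
 have "(\<Prod>v\<in>U.G. (if v : Gt then h v else 1) powi (v $ i)) = (\<Prod>v\<in>Gt. h v powi (v $ i))" for i
  by (rule prod.mono_neutral_cong_right) (use U.finite_gens gens_eq in auto)
 thus ?thesis using assms by (auto simp: tgroup_def)
qed

text \<open>Points normalised on \<open>Z0\<close> are related only by elements that are 1 on
  \<open>Z0\<close> and at \<open>bt 1\<close>, that is, by the group of the hypersurface. One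
  direction makes \<open>J\<close> well defined, the other makes it injective.\<close>

lemma orbit_N_iff:
 assumes X: "X : At" and Y: "Y : At"
 shows "U.orb X = U.orb Y \<longleftrightarrow>
  T.orb (rs (N X)) = T.orb (rs (N Y)) & N X (bt 1) = N Y (bt 1)"
proof -
 obtain k where k: "k : tgroup U.G" "N X = act k X" using N_act[OF X] by blast
 obtain k' where k': "k' : tgroup U.G" "N Y = act k' Y" using N_act[OF Y] by blast
 have o: "U.orb (N X) = U.orb X" "U.orb (N Y) = U.orb Y"
  unfolding k(2) k'(2) using U.orbit_act At_coord X Y k(1) k'(1) by blast+
 note cN = At_coord[OF N_At[OF X]] At_coord[OF N_At[OF Y]]
 note ct = T.hc_domain_coord[OF rs_dom[OF N_At[OF X]]] T.hc_domain_coord[OF rs_dom[OF N_At[OF Y]]]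
 show ?thesis
 proof
  assume "U.orb X = U.orb Y"
  then obtain g where g: "g : tgroup U.G" "N Y = act g (N X)" using o U.orbit_eq_iff[OF cN] by auto
  have "g u = 1" if "u : Z0" for u using fun_cong[OF g(2), of u] N_Z0[OF that] by (simp add: act_def)
  note g1 = tgroup_restrict[OF g(1) this]
  have "rs (N Y) = act g (rs (N X))" using g(2) by (auto simp: rs_def act_def)
  hence "T.orb (rs (N X)) = T.orb (rs (N Y))" using T.orbit_eq_iff[OF ct] g1(2) by blast
  moreover have "N X (bt 1) = N Y (bt 1)" using fun_cong[OF g(2), of "bt 1"] g1(1) by (simp add: act_def)
  ultimately show "T.orb (rs (N X)) = T.orb (rs (N Y)) & N X (bt 1) = N Y (bt 1)" ..
 next
  assume a: "T.orb (rs (N X)) = T.orb (rs (N Y)) & N X (bt 1) = N Y (bt 1)"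
  then obtain h where h: "h : tgroup Gt" "rs (N Y) = act h (rs (N X))" using T.orbit_eq_iff[OF ct] by auto
  have "N Y v = act (%v. if v : Gt then h v else 1) (N X) v" for v
  proof (cases "v : Gt")
   case True
   thus ?thesis using fun_cong[OF h(2), of v] by (simp add: rs_def act_def)
  next
   case False
   thus ?thesis using a cN N_Z0[of v] gens_eq Gb_eq by (cases "v : U.G") (auto simp: act_def coord_space_def)
  qed
  hence "U.orb (N X) = U.orb (N Y)" using U.orbit_eq_iff[OF cN] tgroup_extend[OF h(1)] by blast
  thus "U.orb X = U.orb Y" using o by simp
 qed
qed

lemma J_orbit: "X : At ==> J (U.orb X) = (T.orb (rs (N X)), N X (bt 1))"
proof -
 assume X: "X : At"
 obtain h where h: "h : tgroup U.G" "representative (U.orb X) = act h X"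
  using U.representative_orbit[OF At_coord[OF X]] .
 show ?thesis using orbit_N_iff[OF act_At[OF h(1) X] X] U.orbit_act[OF At_coord[OF X] h(1)]
  unfolding J_def h(2) Let_def by simp
qed

lemma lift_At:
 assumes H: "H : T.hcd" and z: "z ~= 0"
 shows "lift H z : At" "N (lift H z) = lift H z" "rs (lift H z) = H"
proof -
 have Hc: "H : coord_space Gt" using T.hc_domain_coord[OF H] .
 obtain cn where cn: "cn : Fnt" "H : T.chart cn" using H by (auto simp: hc_domain_def)
 have "lift H z : U.chart cn"
  unfolding U.hc_chart_iff using cn(2) sub[OF cn(1)] gens_eq z bt1_in unfolding T.hc_chart_iff
  by (auto simp: lift_def coord_space_def)
 thus "lift H z : At" using cn(1) by (auto simp: At_def)
 have "lift H z u = 1" if "u : Z0" for u using that Z0_notin Gb_eq bt1_Z0 by (auto simp: lift_def)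
 thus "N (lift H z) = lift H z" by (auto simp: N_def norm_coords_def)
 show "rs (lift H z) = H" using Hc by (auto simp: rs_def lift_def coord_space_def)
qed

lemma lift_rs: "X : At ==> lift (rs (N X)) (N X (bt 1)) = N X"
 using N_Z0 At_coord[OF N_At] gens_eq Gb_eq by (fastforce simp: lift_def rs_def coord_space_def)

lemma J'_orbit:
 assumes H: "H : T.hcd" and z: "z ~= 0"
 shows "J' (T.orb H, z) = U.orb (lift H z)"
proof -
 obtain h where h: "h : tgroup Gt" "representative (T.orb H) = act h H"
  using T.representative_orbit[OF T.hc_domain_coord[OF H]] .
 have eq: "lift (act h H) z = act (%v. if v : Gt then h v else 1) (lift H z)" by (auto simp: lift_def act_def)
 show ?thesis
  using U.orbit_act[OF At_coord[OF lift_At(1)[OF H z]] tgroup_extend[OF h(1)]] by (simp add: J'_def h(2) eq)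
qed

lemma J_in: "p : A ==> J p : points (prod_an T.TV punctured_line)"
 and J'_J: "p : A ==> J' (J p) = p"
proof -
 assume "p : A"
 then obtain X where X: "X : At" "p = U.orb X" by (auto simp: A_def)
 have nz: "N X (bt 1) ~= 0" using At_nz[OF N_At[OF X(1)] bt1_in] .
 show "J p : points (prod_an T.TV punctured_line)" unfolding X(2) J_orbit[OF X(1)] using rs_dom[OF N_At[OF X(1)]] nz
  by (auto simp: T.points_toric points_punctured_line)
 show "J' (J p) = p" unfolding X(2) J_orbit[OF X(1)] J'_orbit[OF rs_dom[OF N_At[OF X(1)]] nz] lift_rs[OF X(1)]
  using N_act[OF X(1)] U.orbit_act[OF At_coord[OF X(1)]] by auto
qed

lemma J'_in: "s : points (prod_an T.TV punctured_line) ==> J' s : A"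
 and J_J': "s : points (prod_an T.TV punctured_line) ==> J (J' s) = s"
proof -
 assume "s : points (prod_an T.TV punctured_line)"
 then obtain H z where H: "H : T.hcd" "z ~= 0" "s = (T.orb H, z)" by (auto simp: T.points_toric points_punctured_line)
 note L = lift_At[OF H(1,2)]
 show "J' s : A" unfolding H(3) J'_orbit[OF H(1,2)] using L(1) by (auto simp: A_def)
 show "J (J' s) = s"
  unfolding H(3) J'_orbit[OF H(1,2)] J_orbit[OF L(1)] L(2,3) using bt1_notin by (simp add: lift_def)
qed

lemma At_sub: "At \<subseteq> U.hcd" using At_dom by blast

lemma open_At_HC: "opn U.HC At" using open_At At_sub openin_subspace_open[OF U.open_hc_domain] by blast

lemma open_A: "opn U.TV A" unfolding A_def using U.open_orbit_map open_At_HC unfolding open_map_def by blast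

lemma preimage_A: "{X : points U.HC. U.orb X : A} = At"
proof
 show "{X : points U.HC. U.orb X : A} \<subseteq> At"
 proof clarify
  fix X assume X: "X : points U.HC" "U.orb X : A"
  then obtain Y where Y: "Y : At" "U.orb Y = U.orb X" by (auto simp: A_def)
  have "X : coord_space U.G" using X U.points_HC U.hc_domain_coord by blast
  then obtain h where "h : tgroup U.G" "X = act h Y" using U.orbit_eq_iff[OF At_coord[OF Y(1)]] Y(2) by blast
  thus "X : At" using act_At Y(1) by blast
 qed
 show "At \<subseteq> {X : points U.HC. U.orb X : A}" using At_sub U.points_HC by (auto simp: A_def)
qed

lemma final_A: "final_map (subspace_of U.HC At) (subspace_of U.TV A) (U.orb)"
 using final_map_restrict[OF U.curved_HC U.final_toric open_A] unfolding preimage_A .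

lemma curved_tilde: "curved (prod_an T.TV punctured_line)"
 by (rule curved_prod[OF T.curved_toric curved_punctured_line])

lemma morphism_J: "morphism (subspace_of U.TV A) (prod_an T.TV punctured_line) J"
proof (rule morphism_final[OF final_A])
 let ?E = "subspace_of (affine_an U.G) At"
 note cE = curved_subspace[OF U.curved_affine open_At]
 note cE' = curved_subspace[OF U.curved_HC open_At_HC]
 have pE: "points ?E = At" by (rule points_subspace_open[OF open_At])
 have c: "(%X. N X v) : funs ?E At" for v
  unfolding N_def by (rule U.norm_coords_morphism[OF open_At]) (use At_nz Gb_eq in \<open>auto simp: Z0_def\<close>)
 have c': "(%X. rs (N X) v) : funs ?E (points ?E)" for v
  using c[of v] curved_const[OF cE, of At] openin_topspace[of "top_of ?E"] unfolding pE
  by (cases "v : Gt") (simp_all add: rs_def)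
 have "morphism ?E (affine_an Gt) (%X. rs (N X))"
 proof (rule morphism_into_affine[OF cE T.finite_gens])
  show "rs (N X) : coord_space Gt" for X by (simp add: rs_def coord_space_def)
  show "(%X. rs (N X) v) : funs ?E (points ?E)" for v by (rule c')
 qed
 hence "morphism ?E T.HC (%X. rs (N X))"
  by (rule morphism_into_subspace[OF cE]) (use rs_dom N_At in \<open>auto simp: pE\<close>)
 from morphism_compose[OF this final_map_morphism[OF T.final_toric]]
 have 1: "morphism ?E T.TV (%X. T.orb (rs (N X)))" by (simp add: comp_def)
 have 2: "morphism ?E punctured_line (%X. N X (bt 1))"
  by (rule morphism_punctured_line[OF cE]) (use c At_nz[OF N_At bt1_in] pE in auto)
 note 3 = morphism_pair[OF T.curved_toric curved_punctured_line cE 1 2]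
 have ss: "morphism (subspace_of U.HC At) ?E (%x. x)"
  by (rule subspace_subspace(2)[OF U.curved_affine U.open_hc_domain open_At At_sub])
 from morphism_compose[OF ss 3]
 show "morphism (subspace_of U.HC At) (prod_an T.TV punctured_line) (J \<circ> U.orb)"
  by (rule morphism_cong[OF cE' curved_tilde]) (use J_orbit points_subspace_open[OF open_At_HC] in simp)
qed

lemma final_tilde:
 "final_map (prod_an T.HC punctured_line) (prod_an T.TV punctured_line) (map_prod (T.orb) id)"
 by (rule final_map_prod[OF T.curved_HC curved_punctured_line T.final_toric T.open_orbit_map])

lemma morphism_J': "morphism (prod_an T.TV punctured_line) (subspace_of U.TV A) J'"
proof -
 let ?E = "prod_an T.HC punctured_line"
 note cE = curved_prod[OF T.curved_HC curved_punctured_line]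
 have pE: "points ?E = T.hcd \<times> (UNIV - {0})" using T.points_HC points_punctured_line by simp
 have oE: "opn ?E (points ?E)" by blast
 have h: "(%x. fst x v) : funs ?E (points ?E)" for v
  by (rule funs_pullback[OF morphism_fst[OF T.curved_HC curved_punctured_line], of "%x. x v"])
   (use coord_fun_subspace[OF T.finite_gens T.open_hc_domain] T.points_HC in simp)
 have z: "snd : funs ?E (points ?E)"
 proof -
  have "(%z. z) : funs punctured_line (points punctured_line)" using morphism_complex_line[OF curved_punctured_line]
    morphism_subspace_incl[OF curved_complex_line open_punctured] by blast
  from funs_pullback[OF morphism_snd[OF T.curved_HC curved_punctured_line] this] show ?thesis by simp
 qed
 have "morphism ?E (affine_an U.G) (%x. lift (fst x) (snd x))"
 proof (rule morphism_into_affine[OF cE U.finite_gens])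
  show "lift (fst x) (snd x) : coord_space U.G" for x using gens_eq bt1_in by (auto simp: lift_def coord_space_def)
  fix v
  have "(%x. lift (fst x) (snd x) v) = (if v : Gt then (%x. fst x v) else if v = bt 1 then snd
    else if v : Gb then (%x. 1) else (%x. 0))" by (auto simp: lift_def)
  thus "(%x. lift (fst x) (snd x) v) : funs ?E (points ?E)" using h z curved_const[OF cE oE] by simp
 qed
 hence "morphism ?E U.HC (%x. lift (fst x) (snd x))"
  by (rule morphism_into_subspace[OF cE]) (use lift_At(1) At_dom pE in auto)
 from morphism_compose[OF this final_map_morphism[OF U.final_toric]]
 have "morphism ?E U.TV (%x. U.orb (lift (fst x) (snd x)))" by (simp add: comp_def)
 hence "morphism ?E U.TV (J' \<circ> map_prod (T.orb) id)"
  by (rule morphism_cong[OF cE U.curved_toric]) (use J'_orbit pE in auto)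
 from morphism_final[OF final_tilde this]
 show ?thesis by (rule morphism_into_subspace[OF curved_tilde]) (use J'_in in blast)
qed

subsection \<open>The height function and compactness\<close>

text \<open>The monomial of the character \<open>eps\<close> times the last coordinate. On this half
  its exponents are positive on \<open>Gb\<close> and 0 elsewhere, so it is regular everywhere and
  vanishes exactly outside the part identified with the product, where it is the coordinate on the
  punctured line.\<close>

definition "zc = (%X. \<Prod>v\<in>Gb. X v ^ nat (eps * v $ l) :: complex)"
definition "zf = (%p. zc (representative p))"

lemma zc_act:
 assumes h: "h : tgroup U.G"
 shows "zc (act h X) = zc X"
proof -
 have "(\<Prod>v\<in>Gb. h v ^ nat (eps * v $ l)) = (\<Prod>v\<in>Gb. h v powi pairing (m0 (bt 1)) v)"
 proof (rule prod.cong)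
  fix v assume "v : Gb"
  hence "eps * v $ l \<ge> 0" using pos by force
  thus "h v ^ nat (eps * v $ l) = h v powi pairing (m0 (bt 1)) v" unfolding m0_bt1 by (simp add: power_int_def)
 qed simp
 also have "\<dots> = (\<Prod>v\<in>U.G. h v powi pairing (m0 (bt 1)) v)"
  by (rule prod.mono_neutral_left) (use U.finite_gens gens_eq hyp in \<open>auto simp: m0_bt1\<close>)
 also have "\<dots> = 1" by (rule tgroup_pairing[OF h])
 finally show ?thesis by (simp add: zc_def act_def power_mult_distrib prod.distrib)
qed

lemma zf_orbit: "X : coord_space U.G ==> zf (U.orb X) = zc X"
 unfolding zf_def using U.representative_orbit zc_act by metis

lemma zc_eq_0: "zc X = 0 \<longleftrightarrow> (EX v:Gb. X v = 0)"
proof -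
 have "nat (eps * v $ l) > 0" if "v : Gb" for v using that pos by force
 thus ?thesis by (auto simp: zc_def)
qed

lemma zf_eq_0: "p : points U.TV ==> zf p ~= 0 \<longleftrightarrow> p : A"
proof -
 assume "p : points U.TV"
 then obtain X where X: "X : U.hcd" "p = U.orb X" by (auto simp: U.points_toric)
 have "zf p ~= 0 \<longleftrightarrow> X : At" using X zf_orbit[OF U.hc_domain_coord[OF X(1)]] zc_eq_0 At_iff by auto
 also have "\<dots> \<longleftrightarrow> p : A" using preimage_A X U.points_HC by blast
 finally show ?thesis .
qed

lemma zf_J: "p : A ==> snd (J p) = zf p"
proof -
 assume "p : A"
 then obtain X where X: "X : At" "p = U.orb X" by (auto simp: A_def)
 obtain h where h: "h : tgroup U.G" "N X = act h X" using N_act[OF X(1)] by blast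
 have "zf p = zc (N X)" unfolding X(2) zf_orbit[OF At_coord[OF X(1)]] h(2) zc_act[OF h(1)] ..
 also have "\<dots> = N X (bt 1)" unfolding zc_def Gb_eq using bt1_Z0 N_Z0 bt1 epseps by (simp add: Z0_def)
 finally show ?thesis unfolding X(2) J_orbit[OF X(1)] by simp
qed

lemma morphism_zf: "morphism U.TV complex_line zf"
proof (rule morphism_final[OF U.final_toric])
 have o: "opn U.HC (U.hcd)" using U.points_HC openin_topspace by metis
 have "zc : funs U.HC (U.hcd)" unfolding zc_def by (intro funs_prod[OF U.curved_HC o] funs_power[OF U.curved_HC o]
    coord_fun_subspace[OF U.finite_gens U.open_hc_domain]) simp
 hence "morphism U.HC complex_line zc" using morphism_complex_line[OF U.curved_HC] U.points_HC by simp
 thus "morphism U.HC complex_line (zf \<circ> U.orb)" by (rule morphism_cong[OF U.curved_HC curved_complex_line])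
   (use zf_orbit U.hc_domain_coord U.points_HC in simp)
qed

text \<open>Negative logarithms of absolute values turn the point into the vector \<open>u\<close>,
  and \<open>s w\<close> with large \<open>s\<close> replaces the infinite entries at vanishing
  coordinates. The bound on the height puts \<open>u + s w\<close> into the half space covered by
  the fan. In the cone that contains it, the coefficient at a generator with nonzero coordinate is
  minus the logarithm of the normalised coordinate, so its sign is the desired bound.\<close>

lemma full_chart:
 assumes X: "X : U.hcd" and z: "norm (zc X) \<le> 1"
 obtains cn where "cn : Fn'" "lattice_basis UNIV (U.cg cn)" "X : U.chart cn"
  "\<And>v. v : U.cg cn ==> norm (norm_coords (U.cg cn)
    (dual_basis_of (U.cg cn)) (U.G - U.cg cn) X v) \<le> 1"
proof -
 obtain \<zeta> where \<zeta>: "\<zeta> : Fn'" "{v : U.G. X v = 0} \<subseteq> U.cg \<zeta>" using X U.hc_domain_iff by blast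
 have Xc: "X : coord_space U.G" using U.hc_domain_coord[OF X] .
 define Z where "Z = {v : U.G. X v = 0}"
 have fZ: "finite Z" using U.finite_gens by (simp add: Z_def)
 define w where "w = (\<Sum>v\<in>Z. real_vec v)"
 define u where "u = (\<Sum>v\<in>U.G - Z. (- ln (norm (X v))) *\<^sub>R real_vec v)"
 define \<T> where "\<T> = {cn : Fn'. lattice_basis UNIV (U.cg cn)}"
 have epos: "real_of_int eps * real_of_int (v $ l) \<ge> 0" if "v : U.G" for v
  using that pos hyp gens_eq by (force simp flip: of_int_mult)
 have wl: "of_int eps * w $ l = (\<Sum>v\<in>Z. real_of_int eps * real_of_int (v $ l))"
  by (simp add: w_def sum_distrib_left)
 \<comment> \<open>If the height function vanishes, \<open>w\<close> points strictly into the half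
   space and a large \<open>s\<close> suffices. Otherwise \<open>w\<close> lies in the hyperplane
   and \<open>eps\<close> times the last coordinate of \<open>u\<close> is minus the logarithm of
   the norm of \<open>zc X\<close>.\<close>
 obtain s0 :: nat where s0: "\<And>s. s \<ge> s0 ==> 0 \<le> of_int eps * (u + real s *\<^sub>R w) $ l"
 proof (cases "zc X = 0")
  case True
  then obtain v0 where v0: "v0 : Gb" "X v0 = 0" using zc_eq_0 by blast
  hence "v0 : Z" "eps * v0 $ l \<ge> 1" using gens_eq pos by (force simp: Z_def)+
  hence "(\<Sum>v\<in>Z. real_of_int eps * real_of_int (v $ l)) \<ge> real_of_int eps * real_of_int (v0 $ l)"
   using fZ epos by (intro member_le_sum) (auto simp: Z_def)
  moreover have "real_of_int eps * real_of_int (v0 $ l) \<ge> 1"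
   using \<open>eps * v0 $ l \<ge> 1\<close> by (simp flip: of_int_mult)
  ultimately have w1: "of_int eps * w $ l \<ge> 1" unfolding wl by linarith
  obtain s0 :: nat where s0: "real s0 \<ge> - (of_int eps * u $ l)" using real_arch_simple by blast
  have "0 \<le> of_int eps * (u + real s *\<^sub>R w) $ l" if "s \<ge> s0" for s
  proof -
   have "real s * 1 \<le> real s * (of_int eps * w $ l)" using w1 by (intro mult_left_mono) auto
   moreover have "of_int eps * (u + real s *\<^sub>R w) $ l = of_int eps * u $ l + real s * (of_int eps * w $ l)"
    by (simp add: algebra_simps)
   ultimately show ?thesis using s0 that by simp
  qed
  thus ?thesis using that by blast
 next
  case False
  hence ZGt: "Z \<subseteq> Gt" using zc_eq_0 gens_eq by (auto simp: Z_def)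
  hence w0: "of_int eps * w $ l = 0" unfolding wl using hyp by (intro sum.neutral) auto
  have "of_int eps * u $ l = - ln (norm (zc X))"
  proof -
   have nz: "X v ~= 0" if "v : Gb" for v using False zc_eq_0 that by blast
   have "of_int eps * u $ l = (\<Sum>v\<in>U.G - Z. - (real_of_int eps * real_of_int (v $ l) * ln (norm (X v))))"
    by (simp add: u_def sum_distrib_left mult_ac)
   also have "\<dots> = (\<Sum>v\<in>Gb. - (real_of_int eps * real_of_int (v $ l) * ln (norm (X v))))"
    by (rule sum.mono_neutral_right) (use U.finite_gens gens_eq hyp ZGt disj in auto)
   also have "\<dots> = - (\<Sum>v\<in>Gb. ln (norm (X v) ^ nat (eps * v $ l)))" unfolding sum_negf
   proof (intro arg_cong[where f = uminus] sum.cong)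
    fix v assume v: "v : Gb"
    hence "real (nat (eps * v $ l)) = real_of_int eps * real_of_int (v $ l)" using pos by force
    thus "real_of_int eps * real_of_int (v $ l) * ln (norm (X v)) = ln (norm (X v) ^ nat (eps * v $ l))"
     using nz[OF v] by (simp add: ln_realpow)
   qed simp
   also have "(\<Sum>v\<in>Gb. ln (norm (X v) ^ nat (eps * v $ l))) = ln (\<Prod>v\<in>Gb. norm (X v) ^ nat (eps * v $ l))"
    by (rule ln_prod[symmetric]) (use nz in auto)
   also have "(\<Prod>v\<in>Gb. norm (X v) ^ nat (eps * v $ l)) = norm (zc X)"
    by (simp add: zc_def prod_norm[symmetric] norm_power)
   finally show ?thesis .
  qed
  moreover have "- ln (norm (zc X)) \<ge> 0" using z False by (simp add: ln_le_zero_iff)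
  ultimately have "0 \<le> of_int eps * u $ l + real s * (of_int eps * w $ l)" for s
   by (simp only: w0 mult_zero_right add_0_right)
  moreover have "of_int eps * (u + real s *\<^sub>R w) $ l = of_int eps * u $ l + real s * (of_int eps * w $ l)" for s
   by (simp add: algebra_simps)
  ultimately have "0 \<le> of_int eps * (u + real s *\<^sub>R w) $ l" for s by simp
  thus ?thesis by (rule that)
 qed
 have cov: "u + real s *\<^sub>R w : \<Union>\<T>" if "s \<ge> s0" for s
  using cover[OF s0[OF that]] by (auto simp: \<T>_def)
 have "\<T> \<subseteq> Fn'" by (auto simp: \<T>_def)
 from U.eventually_in_cone[OF this \<zeta>(1) \<zeta>(2)[folded Z_def] w_def cov]
 obtain cn where cn: "cn : \<T>" "Z \<subseteq> U.cg cn" "infinite {s::nat. u + real s *\<^sub>R w : cn}" by metis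
 let ?B = "U.cg cn"
 have cn1: "cn : Fn'" "lattice_basis UNIV ?B" using cn(1) by (auto simp: \<T>_def)
 define m where "m = dual_basis_of ?B"
 have m: "dual_to ?B m" unfolding m_def by (rule dual_basis_of(1)[OF cn1(2)])
 have cneq: "cn = cone_gen ?B" using U.cone_dual[OF cn1(1)] by metis
 have BG: "?B \<subseteq> U.G" by (auto simp: cone_gens_def)
 have fB: "finite ?B" using m by (simp add: dual_to_def)
 obtain s where s: "u + real s *\<^sub>R w : cn" using cn(3) not_finite_existsD by auto
 have ch: "X : U.chart cn" using Xc cn(2) by (auto simp: U.hc_chart_iff Z_def)
 have "norm (norm_coords ?B m (U.G - ?B) X v) \<le> 1" if v: "v : ?B" for v
 proof (cases "v : Z")
  case True
  thus ?thesis using v by (simp add: norm_coords_def Z_def)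
 next
  case False
  \<comment> \<open>The zero set lies in \<open>?B\<close>, so the functional dual to a generator
    outside it does not see the shift by \<open>w\<close>.\<close>
  have mw: "real_vec (m v) \<bullet> w = 0" unfolding w_def inner_sum_right inner_real_vec
   using m v False cn(2) by (intro sum.neutral) (auto simp: dual_to_def subset_eq)
  have "0 \<le> real_vec (m v) \<bullet> (u + real s *\<^sub>R w)" using s cneq dual_to_cone_gen[OF m] v by blast
  hence "0 \<le> real_vec (m v) \<bullet> u" using mw by (simp add: inner_add_right)
  also have "real_vec (m v) \<bullet> u = (\<Sum>x\<in>U.G - Z. - ln (norm (X x)) * of_int (pairing (m v) x))"
   by (simp add: u_def inner_sum_right inner_real_vec)
  also have "\<dots> = (\<Sum>x\<in>insert v (U.G - ?B). - ln (norm (X x)) * of_int (pairing (m v) x))"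
   by (rule sum.mono_neutral_right)
    (use U.finite_gens BG v False cn(2) m(1) in \<open>auto simp: dual_to_def\<close>)
  also have "\<dots> = - (ln (norm (X v)) + (\<Sum>x\<in>U.G - ?B. ln (norm (X x)) * of_int (pairing (m v) x)))"
   using U.finite_gens v m(1) by (simp add: dual_to_def sum_negf)
  finally have le: "ln (norm (X v)) + (\<Sum>x\<in>U.G - ?B. ln (norm (X x)) * of_int (pairing (m v) x)) \<le> 0"
   by simp
  have nz: "X x ~= 0" if "x : U.G - ?B" for x using ch that by (auto simp: U.hc_chart_iff)
  have vz: "X v ~= 0" using False v BG by (auto simp: Z_def)
  let ?P = "\<Prod>x\<in>U.G - ?B. norm (X x) powi pairing (m v) x"
  have Pp: "norm (X x) powi pairing (m v) x > 0" if "x : U.G - ?B" for x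
   using nz[OF that] by (simp add: zero_less_power_int)
  have lnP: "ln ?P = (\<Sum>x\<in>U.G - ?B. ln (norm (X x)) * of_int (pairing (m v) x))"
  proof -
   have "ln ?P = (\<Sum>x\<in>U.G - ?B. ln (norm (X x) powi pairing (m v) x))"
    by (rule ln_prod) (use Pp U.finite_gens nz in auto)
   also have "\<dots> = (\<Sum>x\<in>U.G - ?B. ln (norm (X x)) * of_int (pairing (m v) x))"
    using nz by (intro sum.cong) (auto simp: powr_real_of_int'[symmetric] ln_powr)
   finally show ?thesis .
  qed
  have PP: "?P > 0" using Pp by (intro prod_pos) auto
  have "norm (norm_coords ?B m (U.G - ?B) X v) = norm (X v) * ?P"
   using v by (simp add: norm_coords_def norm_mult prod_norm[symmetric] norm_power_int)
  moreover have "ln (norm (X v) * ?P) \<le> 0" using le lnP PP vz by (simp add: ln_mult)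
  ultimately show ?thesis using PP vz by (simp add: ln_le_zero_iff)
 qed
 thus ?thesis using that[of cn] cn1 ch unfolding m_def by blast
qed

lemma compact_polydisc:
 assumes "finite B"
 shows "compactin (top_of (affine_an B)) {x : coord_space B. ALL v:B. norm (x v) \<le> 1}"
proof -
 have "compactin (product_topology (%i. euclidean) UNIV) (PiE UNIV (%v. if v : B then cball 0 1 else {0 :: complex}))"
  unfolding compactin_PiE by auto
 moreover have "PiE UNIV (%v. if v : B then cball 0 1 else {0}) = {x : coord_space B. ALL v:B. norm (x v) \<le> (1::real)}"
  by (auto simp: coord_space_def PiE_iff split: if_splits)
 ultimately show ?thesis by (simp add: compactin_subtopology euclidean_product_topology)
qed



lemma finite_fan: "finite Fn'" by (rule fanD(1)[OF U.fan])

text \<open>Replace all nonzero coordinates by 1: the zero set is unchanged and the height is at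
  most 1 in norm, so \<open>full_chart\<close> becomes available for every point.\<close>

lemma full_cover:
 assumes X: "X : U.hcd"
 shows "EX cn:Fn'. X : U.chart cn & lattice_basis UNIV (U.cg cn)"
proof -
 define Y where "Y = (%v. if v : U.G & X v ~= 0 then 1 else 0 :: complex)"
 have Y0: "Y v = 0 \<longleftrightarrow> X v = 0" if "v : U.G" for v using that by (simp add: Y_def)
 have Yc: "Y : coord_space U.G" by (simp add: Y_def coord_space_def)
 have "{v : U.G. Y v = 0} = {v : U.G. X v = 0}" using Y0 by auto
 hence Y: "Y : U.hcd" using X Yc unfolding U.hc_domain_iff by simp
 have "norm (Y v ^ k) \<le> 1" for v k by (simp add: Y_def norm_power power_le_one)
 hence "norm (zc Y) \<le> 1" unfolding zc_def prod_norm[symmetric] by (intro prod_le_1) auto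
 then obtain cn where cn: "cn : Fn'" "lattice_basis UNIV (U.cg cn)" "Y : U.chart cn"
  by (rule full_chart[OF Y]) (rule that)
 have "X : U.chart cn" using cn(3) Y0 U.hc_domain_coord[OF X] unfolding U.hc_chart_iff by auto
 thus ?thesis using cn by blast
qed

lemma Hausdorff: "Hausdorff_space (top_of U.TV)" by (rule U.Hausdorff_toric[OF full_cover])

text \<open>By \<open>full_chart\<close> every point of the set lies in the image of the closed unit
  polydisc of some full-dimensional chart, and there are finitely many such charts.\<close>

lemma compact_sublevel:
 "compactin (top_of U.TV) {p : points U.TV. norm (zf p) \<le> 1}"
proof -
 let ?T = "top_of U.TV"
 let ?F = "{cn : Fn'. lattice_basis UNIV (U.cg cn)}"
 have "ALL cn:?F. EX K. compactin ?T K & (ALL X:U.chart cn. (ALL v:U.cg cn. norm (norm_coords (U.cg cn)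
    (dual_basis_of (U.cg cn)) (U.G - U.cg cn) X v) \<le> 1) --> U.orb X : K)"
 proof
  fix cn assume cn: "cn : ?F"
  let ?B = "U.cg cn"
  have cn1: "cn : Fn'" "lattice_basis UNIV ?B" using cn by auto
  note tc = U.toric_chart[OF cn1(1) dual_basis_of[OF cn1(2)]]
  have fB: "finite ?B" by (rule U.finite_cone_gens[OF cn1(1)])
  define ps where "ps = (%x. U.orb (%v. if v : ?B then x v else if v : U.G then 1 else 0))"
  define P where "P = {x : coord_space ?B. ALL v:?B. norm (x v) \<le> (1::real)}"
  have "compactin ?T (ps ` P)"
   unfolding P_def by (rule image_compactin[OF compact_polydisc[OF fB] morphism_continuous])
    (use open_embD(2)[OF tc(1)] in \<open>simp add: ps_def\<close>)
  moreover have "U.orb X : ps ` P"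
   if X: "X : U.chart cn" "ALL v:?B. norm (norm_coords ?B (dual_basis_of ?B) (U.G - ?B) X v) \<le> 1" for X
  proof -
   let ?x = "%v. if v : ?B then norm_coords ?B (dual_basis_of ?B) (U.G - ?B) X v else 0"
   have "?x : P" using X(2) by (simp add: P_def coord_space_def)
   moreover have "U.orb X = ps ?x" using tc(4)[OF X(1)] unfolding ps_def by simp
   ultimately show ?thesis by blast
  qed
  ultimately show "EX K. compactin ?T K & (ALL X:U.chart cn. (ALL v:?B. norm (norm_coords ?B
    (dual_basis_of ?B) (U.G - ?B) X v) \<le> 1) --> U.orb X : K)" by blast
 qed
 from bchoice[OF this] obtain K where K: "ALL cn:?F. compactin ?T (K cn) & (ALL X:U.chart cn.
   (ALL v:U.cg cn. norm (norm_coords (U.cg cn)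
    (dual_basis_of (U.cg cn)) (U.G - U.cg cn) X v) \<le> 1) --> U.orb X : K cn)" ..
 have comp: "compactin ?T (\<Union>(K ` ?F))" using K finite_fan by (intro compactin_Union) auto
 have "{p : points U.TV. norm (zf p) \<le> 1} \<subseteq> \<Union>(K ` ?F)"
 proof clarify
  fix p assume p: "p : points U.TV" "norm (zf p) \<le> 1"
  then obtain X where X: "X : U.hcd" "p = U.orb X" by (auto simp: U.points_toric)
  have "norm (zc X) \<le> 1" using p(2) zf_orbit[OF U.hc_domain_coord[OF X(1)]] X(2) by simp
  then obtain cn where cn: "cn : Fn'" "lattice_basis UNIV (U.cg cn)" "X : U.chart cn"
   "\<And>v. v : U.cg cn ==> norm (norm_coords (U.cg cn)
     (dual_basis_of (U.cg cn)) (U.G - U.cg cn) X v) \<le> 1" by (rule full_chart[OF X(1)]) (rule that)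
  hence "cn : ?F" "U.orb X : K cn" using K by blast+
  thus "p : \<Union>(K ` ?F)" using X(2) by blast
 qed
 moreover have "closedin ?T {p : points U.TV. norm (zf p) \<le> 1}"
 proof -
  have "closedin ?T {p : topspace ?T. zf p : cball 0 1}"
   by (rule closedin_continuous_map_preimage[OF morphism_continuous[OF morphism_zf]]) simp
  thus ?thesis by simp
 qed
 ultimately show ?thesis using closed_compactin comp by blast
qed

text \<open>The parameter sits at index \<open>CARD('d)\<close>, after the fiber coordinates. The
  last clause remembers the cone, so that one chart per cone can be selected.\<close>

lemma product_chart:
 assumes X: "X : U.hcd"
 obtains ps ph where "open_emb (affine_an {..<CARD('d) + 1}) (prod_an U.TV complex_line) ps ph"
  "\<And>t. (U.orb X, t) : ps ` points (affine_an {..<CARD('d) + 1})"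
  "\<And>x. snd (ps x) = x CARD('d)"
  "EX cn:Fn'. lattice_basis UNIV (U.cg cn) &
   ps ` points (affine_an {..<CARD('d) + 1}) = (U.orb ` U.chart cn) \<times> UNIV"
proof -
 obtain cn where cn: "cn : Fn'" "X : U.chart cn" "lattice_basis UNIV (U.cg cn)" using full_cover[OF X] by blast
 let ?B = "U.cg cn"
 have fB: "finite ?B" by (rule U.finite_cone_gens[OF cn(1)])
 obtain e where e: "bij_betw e {..<CARD('d)} ?B"
  using ex_bij_betw_nat_finite[OF fB] card_lattice_basis[OF cn(3)] by (auto simp: atLeast0LessThan)
 obtain ps1 ph1 where c: "open_emb (affine_an ?B) U.TV ps1 ph1"
  "ps1 ` points (affine_an ?B) = U.orb ` U.chart cn"
  using U.toric_chart(1,2)[OF cn(1) dual_basis_of[OF cn(3)]] by blast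
 let ?f = "%x :: nat => complex. ((%v. if v : ?B then x (inv_into {..<CARD('d)} e v) else 0), x CARD('d))"
 let ?g = "%(y, t) i. if i < CARD('d) then y (e i) else if i = CARD('d) then t else 0 :: complex"
 note r = open_emb_reindex[OF fB e]
 note cB = curved_affine_an[OF fB]
 have E: "open_emb (affine_an {..<CARD('d) + 1}) (prod_an U.TV complex_line)
   (map_prod ps1 id \<circ> ?f) (?g \<circ> map_prod ph1 id)"
  by (rule open_emb_compose[OF curved_prod[OF cB curved_complex_line] curved_prod[OF U.curved_toric curved_complex_line]
     r(1) open_emb_prod[OF cB curved_complex_line U.curved_toric c(1)]])
 have im: "(map_prod ps1 id \<circ> ?f) ` points (affine_an {..<CARD('d) + 1}) = (U.orb ` U.chart cn) \<times> UNIV"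
  unfolding image_comp[symmetric] r(2) using c(2) by (simp add: map_prod_surj_on)
 show ?thesis by (rule that[OF E]) (use im cn in auto)
qed

end

section \<open>The toric variety of a subfan\<close>

text \<open>The basis \<open>B\<close> consists of generators of the subfan, so the additional
  coordinates of the big fan, nonzero on the open part, can be normalised to 1; the elements
  preserving that normalisation act as the group of the subfan.\<close>

locale subfan = U: toric UNIV Fn' + S: toric UNIV Fn
 for Fn' Fn :: "(real^'d::finite) set set" +
 fixes B :: "(int^'d) set" and m :: "int^'d => int^'d"
 assumes gens_sub: "gens Fn' \<subseteq> gens Fn"
  and sub: "\<And>tn. tn : Fn' ==> tn : Fn & cone_gens Fn tn = cone_gens Fn' tn"
  and res: "\<And>cn. cn : Fn ==> cone_gens Fn cn \<subseteq> gens Fn' ==> cn : Fn'"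
  and B_sub: "B \<subseteq> gens Fn'" and B: "dual_to B m"
  and m_exp: "\<And>x. x = (\<Sum>v\<in>B. pairing (m v) x *s v)"
begin

definition "Zx = S.G - U.G"
definition "N = norm_coords B m Zx"
definition "rs = (%X v. if v : U.G then X v else 0 :: complex)"
definition "ext = (%X v. if v : U.G then X v else if v : S.G then 1 else 0 :: complex)"
definition "Dm = (\<Union>cn\<in>Fn'. S.chart cn)"
definition "\<iota> = (%p. S.orb (ext (representative p)))"
definition "\<iota>' = (%q. U.orb (rs (N (representative q))))"

lemma Dm_iff: "X : Dm \<longleftrightarrow> X : S.hcd & (ALL u:Zx. X u ~= 0)"
proof
 assume "X : Dm"
 then obtain cn where cn: "cn : Fn'" "X : S.chart cn" by (auto simp: Dm_def)
 have "S.cg cn \<subseteq> U.G" using sub[OF cn(1)] by (auto simp: cone_gens_def)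
 hence "Zx \<subseteq> S.G - S.cg cn" by (auto simp: Zx_def)
 hence "ALL u:Zx. X u ~= 0" using cn(2) unfolding S.hc_chart_iff by blast
 moreover have "X : S.hcd" unfolding hc_domain_def using cn sub[OF cn(1)] by blast
 ultimately show "X : S.hcd & (ALL u:Zx. X u ~= 0)" by blast
next
 assume X: "X : S.hcd & (ALL u:Zx. X u ~= 0)"
 then obtain cn where cn: "cn : Fn" "{v : S.G. X v = 0} \<subseteq> S.cg cn" "X : coord_space S.G"
  using S.hc_domain_iff by blast
 define Z where "Z = {v : S.G. X v = 0}"
 have Z: "Z \<subseteq> U.G" using X by (auto simp: Z_def Zx_def)
 note sc = S.subcone[OF cn(1) cn(2)[folded Z_def]]
 have "cone_gen Z : Fn'" by (rule res[OF sc(1)]) (use sc(2) Z in simp)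
 moreover have "X : S.chart (cone_gen Z)" using cn(3) sc(2) by (auto simp: S.hc_chart_iff Z_def)
 ultimately show "X : Dm" by (auto simp: Dm_def)
qed

lemma Dm_dom: "X : Dm ==> X : S.hcd" and Dm_coord: "X : Dm ==> X : coord_space S.G"
 and Dm_nz: "X : Dm ==> u : Zx ==> X u ~= 0" using Dm_iff S.hc_domain_coord by blast+

lemma open_Dm: "opn (affine_an S.G) Dm" unfolding Dm_def using S.open_hc_chart by blast

lemma act_Dm: "h : tgroup S.G ==> X : Dm ==> act h X : Dm" unfolding Dm_def using S.act_hc_chart by blast

lemma Zx_sub: "Zx \<subseteq> S.G - B" using B_sub by (auto simp: Zx_def)

lemma N_act: "X : Dm ==> EX h:tgroup S.G. N X = act h X"
 using S.norm_coords_group[OF subset_trans[OF B_sub gens_sub] _ m_exp Zx_sub, of X] B Dm_nz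
 unfolding N_def dual_to_def by auto

lemma N_Zx: "u : Zx ==> N X u = 1" using Zx_sub by (auto simp: N_def norm_coords_def)

lemma N_Dm: "X : Dm ==> N X : Dm" using N_act act_Dm by metis

lemma rs_dom: "X : Dm ==> rs X : U.hcd"
proof -
 assume X: "X : Dm"
 then obtain cn where cn: "cn : Fn'" "X : S.chart cn" by (auto simp: Dm_def)
 have "rs X : U.chart cn"
  using cn(2) sub[OF cn(1)] gens_sub unfolding U.hc_chart_iff S.hc_chart_iff by (auto simp: rs_def coord_space_def)
 thus ?thesis using cn(1) by (auto simp: hc_domain_def)
qed

lemma tgroup_restrict:
 assumes g: "g : tgroup S.G" and Z: "\<And>u. u : Zx ==> g u = 1"
 shows "g : tgroup U.G"
proof -
 have "(\<Prod>v\<in>U.G. g v powi (v $ i)) = (\<Prod>v\<in>S.G. g v powi (v $ i))" for i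
  by (rule prod.mono_neutral_left) (use S.finite_gens gens_sub Z in \<open>auto simp: Zx_def\<close>)
 thus ?thesis using g gens_sub by (auto simp: tgroup_def)
qed

lemma tgroup_extend:
 assumes "h : tgroup U.G"
 shows "(%v. if v : U.G then h v else 1) : tgroup S.G"
proof -
 have "(\<Prod>v\<in>S.G. (if v : U.G then h v else 1) powi (v $ i)) = (\<Prod>v\<in>U.G. h v powi (v $ i))" for i
  by (rule prod.mono_neutral_cong_right) (use S.finite_gens gens_sub in auto)
 thus ?thesis using assms by (auto simp: tgroup_def)
qed

lemma orbit_N_iff:
 assumes X: "X : Dm" and Y: "Y : Dm"
 shows "S.orb X = S.orb Y \<longleftrightarrow> U.orb (rs (N X)) = U.orb (rs (N Y))"
proof -
 obtain k where k: "k : tgroup S.G" "N X = act k X" using N_act[OF X] by blast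
 obtain k' where k': "k' : tgroup S.G" "N Y = act k' Y" using N_act[OF Y] by blast
 have o: "S.orb (N X) = S.orb X" "S.orb (N Y) = S.orb Y"
  unfolding k(2) k'(2) using S.orbit_act Dm_coord X Y k(1) k'(1) by blast+
 note cN = Dm_coord[OF N_Dm[OF X]] Dm_coord[OF N_Dm[OF Y]]
 note ct = U.hc_domain_coord[OF rs_dom[OF N_Dm[OF X]]] U.hc_domain_coord[OF rs_dom[OF N_Dm[OF Y]]]
 show ?thesis
 proof
  assume "S.orb X = S.orb Y"
  then obtain g where g: "g : tgroup S.G" "N Y = act g (N X)" using o S.orbit_eq_iff[OF cN] by auto
  have "g u = 1" if "u : Zx" for u using fun_cong[OF g(2), of u] N_Zx[OF that] by (simp add: act_def)
  note g1 = tgroup_restrict[OF g(1) this]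
  have "rs (N Y) = act g (rs (N X))" using g(2) by (auto simp: rs_def act_def)
  thus "U.orb (rs (N X)) = U.orb (rs (N Y))" using U.orbit_eq_iff[OF ct] g1 by blast
 next
  assume "U.orb (rs (N X)) = U.orb (rs (N Y))"
  then obtain h where h: "h : tgroup U.G" "rs (N Y) = act h (rs (N X))" using U.orbit_eq_iff[OF ct] by auto
  have "N Y v = act (%v. if v : U.G then h v else 1) (N X) v" for v
  proof (cases "v : U.G")
   case True
   thus ?thesis using fun_cong[OF h(2), of v] by (simp add: rs_def act_def)
  next
   case False
   thus ?thesis using cN N_Zx[of v] by (cases "v : S.G") (auto simp: act_def coord_space_def Zx_def)
  qed
  hence "S.orb (N X) = S.orb (N Y)" using S.orbit_eq_iff[OF cN] tgroup_extend[OF h(1)] by blast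
  thus "S.orb X = S.orb Y" using o by simp
 qed
qed

lemma ext_Dm:
 assumes H: "H : U.hcd"
 shows "ext H : Dm" "N (ext H) = ext H" "rs (ext H) = H"
proof -
 have Hc: "H : coord_space U.G" using U.hc_domain_coord[OF H] .
 obtain cn where cn: "cn : Fn'" "H : U.chart cn" using H by (auto simp: hc_domain_def)
 have "ext H : S.chart cn" unfolding S.hc_chart_iff using cn(2) sub[OF cn(1)] gens_sub unfolding U.hc_chart_iff
  by (auto simp: ext_def coord_space_def)
 thus "ext H : Dm" using cn(1) by (auto simp: Dm_def)
 have "ext H u = 1" if "u : Zx" for u using that by (auto simp: ext_def Zx_def)
 thus "N (ext H) = ext H" by (auto simp: N_def norm_coords_def)
 show "rs (ext H) = H" using Hc by (auto simp: rs_def ext_def coord_space_def)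
qed

lemma ext_rs: "X : Dm ==> ext (rs (N X)) = N X"
 using N_Zx Dm_coord[OF N_Dm] by (fastforce simp: ext_def rs_def coord_space_def Zx_def)

lemma \<iota>_orbit:
 assumes H: "H : U.hcd"
 shows "\<iota> (U.orb H) = S.orb (ext H)"
proof -
 obtain h where h: "h : tgroup U.G" "representative (U.orb H) = act h H"
  using U.representative_orbit[OF U.hc_domain_coord[OF H]] .
 have eq: "ext (act h H) = act (%v. if v : U.G then h v else 1) (ext H)" by (auto simp: ext_def act_def)
 show ?thesis
  using S.orbit_act[OF Dm_coord[OF ext_Dm(1)[OF H]] tgroup_extend[OF h(1)]] by (simp add: \<iota>_def h(2) eq)
qed

lemma \<iota>'_orbit: "X : Dm ==> \<iota>' (S.orb X) = U.orb (rs (N X))"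
proof -
 assume X: "X : Dm"
 obtain h where h: "h : tgroup S.G" "representative (S.orb X) = act h X"
  using S.representative_orbit[OF Dm_coord[OF X]] .
 show ?thesis using orbit_N_iff[OF act_Dm[OF h(1) X] X] S.orbit_act[OF Dm_coord[OF X] h(1)]
  unfolding \<iota>'_def h(2) by simp
qed

lemma \<iota>_image: "\<iota> ` points U.TV = S.orb ` Dm"
proof
 show "\<iota> ` points U.TV \<subseteq> S.orb ` Dm" using \<iota>_orbit ext_Dm(1) by (auto simp: U.points_toric)
 show "S.orb ` Dm \<subseteq> \<iota> ` points U.TV"
 proof clarify
  fix X assume X: "X : Dm"
  have r: "rs (N X) : U.hcd" by (rule rs_dom[OF N_Dm[OF X]])
  have "S.orb X = S.orb (N X)" using N_act[OF X] S.orbit_act[OF Dm_coord[OF X]] by auto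
  also have "\<dots> = \<iota> (U.orb (rs (N X)))" using \<iota>_orbit[OF r] ext_rs[OF X] by simp
  finally show "S.orb X : \<iota> ` points U.TV" using r by (auto simp: U.points_toric)
 qed
qed

lemma open_emb_\<iota>: "open_emb U.TV S.TV \<iota> \<iota>'"
proof -
 have Ds: "Dm \<subseteq> S.hcd" using Dm_dom by blast
 have oHC: "opn S.HC Dm" using open_Dm Ds openin_subspace_open[OF S.open_hc_domain] by blast
 have o: "opn S.TV (S.orb ` Dm)" using S.open_orbit_map oHC unfolding open_map_def by blast
 have pre: "{X : points S.HC. S.orb X : S.orb ` Dm} = Dm"
 proof
  show "{X : points S.HC. S.orb X : S.orb ` Dm} \<subseteq> Dm"
  proof clarify
   fix X Y assume a: "X : points S.HC" "S.orb X = S.orb Y" "Y : Dm"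
   have "X : coord_space S.G" using a S.points_HC S.hc_domain_coord by blast
   then obtain h where "h : tgroup S.G" "X = act h Y" using S.orbit_eq_iff[OF Dm_coord[OF a(3)]] a(2) by metis
   thus "X : Dm" using act_Dm a(3) by blast
  qed
  show "Dm \<subseteq> {X : points S.HC. S.orb X : S.orb ` Dm}" using Ds S.points_HC by auto
 qed
 note fin = final_map_restrict[OF S.curved_HC S.final_toric o, unfolded pre]
 let ?E = "subspace_of (affine_an S.G) Dm"
 note cE = curved_subspace[OF S.curved_affine open_Dm]
 have pE: "points ?E = Dm" by (rule points_subspace_open[OF open_Dm])
 have c: "(%X. N X v) : funs ?E Dm" for v
  unfolding N_def by (rule S.norm_coords_morphism[OF open_Dm]) (use Dm_nz S.finite_gens in \<open>auto simp: Zx_def\<close>)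
 have c': "(%X. rs (N X) v) : funs ?E (points ?E)" for v
  using c[of v] curved_const[OF cE, of Dm] openin_topspace[of "top_of ?E"] unfolding pE
  by (cases "v : U.G") (simp_all add: rs_def)
 have "morphism ?E (affine_an U.G) (%X. rs (N X))"
 proof (rule morphism_into_affine[OF cE U.finite_gens])
  show "rs (N X) : coord_space U.G" for X by (simp add: rs_def coord_space_def)
  show "(%X. rs (N X) v) : funs ?E (points ?E)" for v by (rule c')
 qed
 hence "morphism ?E U.HC (%X. rs (N X))"
  by (rule morphism_into_subspace[OF cE]) (use rs_dom N_Dm in \<open>auto simp: pE\<close>)
 from morphism_compose[OF this final_map_morphism[OF U.final_toric]]
 have 1: "morphism ?E U.TV (%X. U.orb (rs (N X)))" by (simp add: comp_def)
 have ss: "morphism (subspace_of S.HC Dm) ?E (%x. x)"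
  by (rule subspace_subspace(2)[OF S.curved_affine S.open_hc_domain open_Dm Ds])
 from morphism_compose[OF ss 1]
 have "morphism (subspace_of S.HC Dm) U.TV (\<iota>' \<circ> S.orb)"
  by (rule morphism_cong[OF curved_subspace[OF S.curved_HC oHC] U.curved_toric])
   (use \<iota>'_orbit points_subspace_open[OF oHC] in simp)
 from morphism_final[OF fin this]
 have m1: "morphism (subspace_of S.TV (S.orb ` Dm)) U.TV \<iota>'" .
 have oU: "opn U.HC (points U.HC)" by blast
 have cf: "(%X. X v) : funs U.HC (points U.HC)" for v
  using coord_fun_subspace[OF U.finite_gens U.open_hc_domain] U.points_HC by simp
 have "morphism U.HC (affine_an S.G) ext"
 proof (rule morphism_into_affine[OF U.curved_HC S.finite_gens])
  show "ext X : coord_space S.G" for X using gens_sub by (auto simp: ext_def coord_space_def)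
  show "(%X. ext X v) : funs U.HC (points U.HC)" for v using cf[of v] curved_const[OF U.curved_HC oU]
   by (cases "v : U.G"; cases "v : S.G") (simp_all add: ext_def)
 qed
 hence "morphism U.HC S.HC ext"
  by (rule morphism_into_subspace[OF U.curved_HC]) (use ext_Dm(1) Ds U.points_HC in auto)
 from morphism_compose[OF this final_map_morphism[OF S.final_toric]]
 have "morphism U.HC S.TV (\<iota> \<circ> U.orb)"
  by (rule morphism_cong[OF U.curved_HC S.curved_toric]) (use \<iota>_orbit U.points_HC in simp)
 from morphism_final[OF U.final_toric this]
 have m2: "morphism U.TV S.TV \<iota>" .
 have inv: "\<iota>' (\<iota> p) = p" if p: "p : points U.TV" for p
 proof -
  obtain H where H: "H : U.hcd" "p = U.orb H" using p by (auto simp: U.points_toric)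
  show ?thesis unfolding H(2) \<iota>_orbit[OF H(1)] \<iota>'_orbit[OF ext_Dm(1)[OF H(1)]] ext_Dm(2,3)[OF H(1)] ..
 qed
 show ?thesis unfolding open_emb_def \<iota>_image using o m1 m2 inv by blast
qed

end

section \<open>Splitting a complete fan along a hyperplane\<close>

locale split_fan = S: toric UNIV Fn + T: toric "hyperplane_lattice l" Fnt
 for l :: "'d::finite" and Fn Fnt :: "(real^'d) set set" +
 assumes complete: "complete_fan UNIV Fn" and complete_t: "complete_fan (hyperplane_lattice l) Fnt"
  and sub: "Fnt \<subseteq> Fn"
begin

lemma span_hyperplane: "span (real_vec ` hyperplane_lattice l) = {x :: real^'d. x $ l = 0}"
proof
 have "real_vec ` hyperplane_lattice l \<subseteq> {x :: real^'d. x $ l = 0}" by (auto simp: hyperplane_lattice_def)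
 moreover have "subspace {x :: real^'d. x $ l = 0}" by (simp add: subspace_def)
 ultimately show "span (real_vec ` hyperplane_lattice l) \<subseteq> {x :: real^'d. x $ l = 0}" by (rule span_minimal)
 show "{x :: real^'d. x $ l = 0} \<subseteq> span (real_vec ` hyperplane_lattice l)"
 proof clarify
  fix x :: "real^'d" assume x: "x $ l = 0"
  have "x = (\<Sum>i\<in>UNIV. (x $ i) *\<^sub>R axis i 1)"
   by (simp add: vec_eq_iff axis_def if_distrib[of "%y. _ * y"] cong: if_cong)
  also have "\<dots> = (\<Sum>i\<in>UNIV. (x $ i) *\<^sub>R (if i = l then 0 else axis i 1))"
   using x by (intro sum.cong) auto
  also have "\<dots> : span (real_vec ` hyperplane_lattice l)"
  proof (intro span_sum span_scale)
   fix i :: 'd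
   have "axis i 1 = real_vec (axis i 1)" by (simp add: vec_eq_iff axis_def)
   moreover have "i ~= l ==> axis i 1 : hyperplane_lattice l" by (simp add: hyperplane_lattice_def axis_def)
   ultimately show "(if i = l then 0 else axis i 1) : span (real_vec ` hyperplane_lattice l)"
    by (auto simp: span_zero intro: span_base)
  qed
  finally show "x : span (real_vec ` hyperplane_lattice l)" .
 qed
qed

lemma cover_t: "\<Union>Fnt = {x. x $ l = 0}" using complete_t span_hyperplane unfolding complete_fan_def by blast

lemma cone_gens_t: "tn : Fnt ==> S.cg tn = T.cg tn"
proof -
 assume tn: "tn : Fnt"
 obtain m where m: "dual_to (T.cg tn) m" "tn = cone_gen (T.cg tn)" by (rule T.cone_dual[OF tn]) (rule that)
 have "cone_gen (T.cg tn) : Fn" using tn sub m(2) by auto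
 from cone_gens_cone_gen[OF S.fan this m(1)] show ?thesis using m(2) by simp
qed

lemma gens_t_sub: "T.G \<subseteq> S.G" using sub by (auto simp: gens_def)

lemma gens_t_hyp: "v : T.G ==> v $ l = 0"
proof -
 assume v: "v : T.G"
 hence "cone_gen {v} : Fnt" by (simp add: gens_def)
 moreover have "real_vec v : cone_gen {v}" by (rule gen_in_cone_gen) simp
 ultimately have "real_vec v : {x. x $ l = 0}" using cover_t by blast
 thus ?thesis by simp
qed

text \<open>The sum of the generators is an interior point of the cone and lies in the hyperplane,
  hence in a cone of the complete fan \<open>Fnt\<close>. That cone contains all generators, and the
  given cone is a face of it.\<close>

lemma tilde_cone:
 assumes cn: "cn : Fn" and l: "\<And>v. v : S.cg cn ==> v $ l = 0"
 shows "cn : Fnt"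
proof -
 let ?S = "S.cg cn"
 have "(\<Sum>v\<in>?S. 1 *\<^sub>R real_vec v) : {x. x $ l = 0}" using l by simp
 then obtain tn where tn: "tn : Fnt" "(\<Sum>v\<in>?S. 1 *\<^sub>R real_vec v) : tn" using cover_t by blast
 have "?S \<subseteq> S.cg tn" by (rule S.sum_in_cone[OF _ cn order_refl _ tn(2)]) (use tn sub in auto)
 hence "?S \<subseteq> T.cg tn" using cone_gens_t[OF tn(1)] by simp
 from T.subcone(1)[OF tn(1) this] show ?thesis using S.cone_dual[OF cn] by metis
qed

lemma gens_hyp: "v : S.G ==> v $ l = 0 ==> v : T.G"
proof -
 assume v: "v : S.G" "v $ l = 0"
 have "cone_gen {v} : Fnt" by (rule tilde_cone) (use S.gens_ray[OF v(1)] S.gens_ray_eq[OF v(1)] v(2) in auto)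
 thus "v : T.G" using v(1) by (simp add: gens_def)
qed

text \<open>Generators strictly on both sides would have a positive combination in the hyperplane.
  It lies in a cone of \<open>Fnt\<close>, which would then contain both. Completeness of the subfan
  is what keeps cones from crossing the hyperplane.\<close>

lemma cone_sign:
 assumes cn: "cn : Fn" and v: "v : S.cg cn" "v $ l > 0" and w: "w : S.cg cn"
 shows "w $ l \<ge> 0"
proof (rule ccontr)
 assume neg: "\<not> w $ l \<ge> 0"
 hence vw: "v ~= w" using v by auto
 define a where "a = (%u. if u = v then - real_of_int (w $ l) else real_of_int (v $ l))"
 have av: "a v = - real_of_int (w $ l)" "a w = real_of_int (v $ l)" using vw by (auto simp: a_def)
 have "(\<Sum>u\<in>{v, w}. a u *\<^sub>R real_vec u) $ l = a v * of_int (v $ l) + a w * of_int (w $ l)"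
  using vw by (simp del: of_int_mult)
 also have "\<dots> = 0" unfolding av by (simp add: mult.commute)
 finally have "(\<Sum>u\<in>{v, w}. a u *\<^sub>R real_vec u) : {x. x $ l = 0}" by blast
 then obtain tn where tn: "tn : Fnt" "(\<Sum>u\<in>{v, w}. a u *\<^sub>R real_vec u) : tn" using cover_t by blast
 have tn': "tn : Fn" using tn(1) sub by blast
 have vw': "{v, w} \<subseteq> S.cg cn" using v(1) w by simp
 have pos: "0 < a u" if "u : {v, w}" for u using that v(2) neg by (auto simp: a_def)
 have "{v, w} \<subseteq> S.cg tn" by (rule S.sum_in_cone[OF tn' cn vw' pos tn(2)])
 hence "v : T.G" using cone_gens_t[OF tn(1)] by (auto simp: cone_gens_def)
 thus False using gens_t_hyp v(2) by force
qed

definition "half_fan eps = {cn : Fn. ALL x:cn. 0 \<le> of_int eps * x $ l}"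

lemma upper_fan_eq: "upper_fan l Fn = half_fan 1" by (simp add: upper_fan_def half_fan_def)

lemma lower_fan_eq: "lower_fan l Fn = half_fan (- 1)" by (simp add: lower_fan_def half_fan_def)

lemma half_fan_iff: "cn : half_fan eps \<longleftrightarrow> cn : Fn & (ALL v:S.cg cn. 0 \<le> eps * v $ l)"
proof
 assume "cn : half_fan eps"
 hence cn: "cn : Fn" "ALL x:cn. 0 \<le> of_int eps * x $ l" by (auto simp: half_fan_def)
 have "0 \<le> eps * v $ l" if "v : S.cg cn" for v
 proof -
  have "0 \<le> of_int eps * real_vec v $ l" using cn(2) that unfolding cone_gens_def by blast
  thus ?thesis by (simp flip: of_int_mult)
 qed
 thus "cn : Fn & (ALL v:S.cg cn. 0 \<le> eps * v $ l)" using cn(1) by blast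
next
 assume a: "cn : Fn & (ALL v:S.cg cn. 0 \<le> eps * v $ l)"
 have "0 \<le> of_int eps * x $ l" if x: "x : cn" for x
 proof -
  have "cn = cone_gen (S.cg cn)" using S.cone_dual a by metis
  then obtain c where c: "x = (\<Sum>v\<in>S.cg cn. c v *\<^sub>R real_vec v)" "ALL v:S.cg cn. 0 \<le> c v"
   using x cone_gen_eq[OF S.finite_cone_gens] a by blast
  have "of_int eps * x $ l = (\<Sum>v\<in>S.cg cn. c v * of_int (eps * v $ l))"
   by (simp add: c(1) sum_distrib_left mult_ac)
  also have "\<dots> \<ge> 0"
  proof (intro sum_nonneg mult_nonneg_nonneg)
   fix v assume v: "v : S.cg cn"
   show "0 \<le> c v" using c(2) v by blast
   show "0 \<le> real_of_int (eps * v $ l)" using a v of_int_0_le_iff by blast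
  qed
  finally show ?thesis .
 qed
 thus "cn : half_fan eps" using a by (simp add: half_fan_def)
qed

lemma tilde_sub_half: "Fnt \<subseteq> half_fan eps"
proof
 fix cn assume cn: "cn : Fnt"
 have "x $ l = 0" if "x : cn" for x using that cn cover_t by blast
 thus "cn : half_fan eps" using cn sub by (auto simp: half_fan_def)
qed

lemma toric_half: "toric UNIV (half_fan eps)"
proof unfold_locales
 show "coordinate_lattice (UNIV :: (int^'d) set)" by (rule coordinate_lattice_UNIV)
 show "fan UNIV (half_fan eps)" unfolding fan_def
 proof (intro conjI ballI allI impI)
  show "finite (half_fan eps)" using fanD(1)[OF S.fan] by (simp add: half_fan_def)
  show "half_fan eps ~= {}" using tilde_sub_half fanD(2)[OF T.fan] by blast
  fix cn assume cn: "cn : half_fan eps"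
  show "nonsingular_cone UNIV cn" using cn fanD(3)[OF S.fan] by (simp add: half_fan_def)
  show "tn : half_fan eps" if "tn face_of cn" "tn ~= {}" for tn
   using cn that fanD(4)[OF S.fan] face_of_imp_subset[OF that(1)] by (auto simp: half_fan_def)
  show "cn \<inter> tn face_of cn" "cn \<inter> tn face_of tn" if "tn : half_fan eps" for tn
   using cn that fanD(5,6)[OF S.fan] by (auto simp: half_fan_def)
 qed
qed

lemma gens_half: "gens (half_fan eps) \<subseteq> S.G" by (auto simp: gens_def half_fan_def)

lemma cone_gens_half: "tn : half_fan eps ==> S.cg tn = cone_gens (half_fan eps) tn"
proof -
 assume tn: "tn : half_fan eps"
 hence tn': "tn : Fn" by (simp add: half_fan_def)
 obtain m where m: "dual_to (S.cg tn) m" "tn = cone_gen (S.cg tn)" by (rule S.cone_dual[OF tn']) (rule that)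
 interpret H: toric UNIV "half_fan eps" by (rule toric_half)
 have "cone_gen (S.cg tn) : half_fan eps" using tn m(2) by simp
 from cone_gens_cone_gen[OF H.fan this m(1)] show ?thesis using m(2) by simp
qed

lemma gens_half_iff: "v : gens (half_fan eps) \<longleftrightarrow> v : S.G & 0 \<le> eps * v $ l"
proof
 assume v: "v : gens (half_fan eps)"
 hence "cone_gen {v} : half_fan eps" "v : S.G" using gens_half by (auto simp: gens_def)
 thus "v : S.G & 0 \<le> eps * v $ l" using half_fan_iff S.gens_ray_eq by auto
next
 assume v: "v : S.G & 0 \<le> eps * v $ l"
 hence "cone_gen {v} : half_fan eps" using half_fan_iff S.gens_ray_eq S.gens_ray by auto
 thus "v : gens (half_fan eps)" using v by (simp add: gens_def)
qed

text \<open>A point strictly inside the half space lies in a full-dimensional cone with a generator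
  on that side, and by \<open>cone_sign\<close> this cone does not cross. Boundary points follow
  because the finite union of these cones is closed.\<close>

lemma cover_half:
 assumes eps: "eps = 1 \<or> eps = - 1" and x: "0 \<le> of_int eps * x $ l"
 shows "EX cn:half_fan eps. lattice_basis UNIV (cone_gens (half_fan eps) cn) & x : cn"
proof -
 define F where "F = {cn : half_fan eps. lattice_basis UNIV (S.cg cn)}"
 have FS: "F \<subseteq> Fn" by (auto simp: F_def half_fan_def)
 have "closed cn" if cn: "cn : F" for cn
 proof -
  have "cn : Fn" using cn FS by blast
  then obtain m where "dual_to (S.cg cn) m" "cn = cone_gen (S.cg cn)" by (rule S.cone_dual) (rule that)
  thus ?thesis using closed_cone_gen by metis
 qed
 hence cl: "closed (\<Union>F)" using finite_subset[OF FS fanD(1)[OF S.fan]] by (intro closed_Union) auto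
 have pos: "y : \<Union>F" if y: "0 < of_int eps * y $ l" for y
 proof -
  obtain cn where cn: "cn : Fn" "lattice_basis UNIV (S.cg cn)" "y : cn"
   using complete_fan_full_cones[OF complete] by blast
  have "cn = cone_gen (S.cg cn)" using S.cone_dual[OF cn(1)] by metis
  then obtain c where c: "y = (\<Sum>v\<in>S.cg cn. c v *\<^sub>R real_vec v)" "ALL v:S.cg cn. 0 \<le> c v"
   using cn(3) cone_gen_eq[OF S.finite_cone_gens[OF cn(1)]] by blast
  have "of_int eps * y $ l = (\<Sum>v\<in>S.cg cn. c v * of_int (eps * v $ l))"
   by (simp add: c(1) sum_distrib_left mult_ac)
  then obtain v where v: "v : S.cg cn" "c v * of_int (eps * v $ l) > 0"
   using y sum_nonpos[of "S.cg cn" "%v. c v * of_int (eps * v $ l)"] by (metis not_le)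
  hence v1: "eps * v $ l > 0" using c(2) by (auto simp: zero_less_mult_iff)
  have "0 \<le> eps * w $ l" if w: "w : S.cg cn" for w
  proof (rule ccontr)
   assume "\<not> 0 \<le> eps * w $ l"
   thus False using eps v1 cone_sign[OF cn(1) v(1) _ w] cone_sign[OF cn(1) w _ v(1)] by auto
  qed
  hence "cn : half_fan eps" using half_fan_iff cn(1) by blast
  thus ?thesis using cn by (auto simp: F_def)
 qed
 \<comment> \<open>Pushes \<open>x\<close> off the hyperplane by \<open>1 / Suc k\<close>; since
   \<open>eps * eps = 1\<close>, the shift points inwards for both signs.\<close>
 define y where "y = (%k. x + (of_int eps / real (Suc k)) *\<^sub>R axis l 1)"
 have "y k : \<Union>F" for k
 proof (rule pos)
  have "of_int eps * y k $ l = of_int eps * x $ l + of_int (eps * eps) / real (Suc k)"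
   by (simp add: y_def axis_def distrib_left)
  moreover have "eps * eps = 1" using eps by auto
  ultimately show "0 < of_int eps * y k $ l" using x by (simp add: add_nonneg_pos)
 qed
 moreover have "y \<longlonglongrightarrow> x"
 proof -
  have "(%k. of_int eps * (1 / real (Suc k))) \<longlonglongrightarrow> of_int eps * 0"
   by (intro tendsto_mult tendsto_const LIMSEQ_Suc[OF lim_1_over_n])
  hence "(%k. x + (of_int eps / real (Suc k)) *\<^sub>R axis l 1) \<longlonglongrightarrow> x + 0 *\<^sub>R axis l 1"
   by (intro tendsto_add tendsto_scaleR tendsto_const) simp
  thus ?thesis by (simp add: y_def)
 qed
 ultimately have "x : \<Union>F" using cl closed_sequentially by blast
 thus ?thesis using cone_gens_half by (auto simp: F_def)
qed

lemma half_interpretation: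
 fixes bt :: "nat => int^'d"
 assumes eps: "eps = 1 \<or> eps = - 1" and M: "1 \<le> M" "inj_on bt {1..M}" "bt ` {1..M} \<inter> T.G = {}"
  and gens: "gens (half_fan eps) = bt ` {1..M} \<union> T.G"
  and basis: "basis_vecs l \<subseteq> T.G" and bt1: "bt 1 $ l = eps"
 shows "half l (half_fan eps) Fnt bt M eps"
proof -
 interpret H: toric UNIV "half_fan eps" by (rule toric_half)
 show ?thesis
 proof unfold_locales
  show "v $ l = 0" if "v : T.G" for v using gens_t_hyp that .
  show "0 < eps * bt j $ l" if j: "j : {1..M}" for j
  proof -
   have "bt j : gens (half_fan eps)" using j gens by blast
   hence 1: "bt j : S.G" "0 \<le> eps * bt j $ l" using gens_half_iff by blast+
   have "bt j ~: T.G" using j M(3) by blast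
   hence "bt j $ l ~= 0" using gens_hyp 1 by blast
   thus ?thesis using 1(2) eps by auto
  qed
  show "tn : half_fan eps & cone_gens (half_fan eps) tn = T.cg tn" if "tn : Fnt" for tn
   using that tilde_sub_half cone_gens_half cone_gens_t by blast
  show "cn : Fnt" if "cn : half_fan eps" "cone_gens (half_fan eps) cn \<subseteq> T.G" for cn
   using that tilde_cone[of cn] cone_gens_half[of cn eps] gens_t_hyp by (auto simp: half_fan_def)
  show "EX cn:half_fan eps. lattice_basis UNIV (cone_gens (half_fan eps) cn) & x : cn"
   if "0 \<le> of_int eps * x $ l" for x using cover_half[OF eps that] .
 qed (use assms in auto)
qed

lemma subfan_interpretation:
 assumes "B \<subseteq> gens (half_fan eps)" "dual_to B m" "\<And>x. x = (\<Sum>v\<in>B. pairing (m v) x *s v)"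
 shows "subfan (half_fan eps) Fn B m"
proof -
 interpret H: toric UNIV "half_fan eps" by (rule toric_half)
 show ?thesis
 proof unfold_locales
  show "gens (half_fan eps) \<subseteq> S.G" by (rule gens_half)
  show "tn : Fn & S.cg tn = cone_gens (half_fan eps) tn" if "tn : half_fan eps" for tn
   using that cone_gens_half by (auto simp: half_fan_def)
  show "cn : half_fan eps" if "cn : Fn" "S.cg cn \<subseteq> gens (half_fan eps)" for cn
   using that half_fan_iff gens_half_iff by blast
 qed (fact assms)+
qed

end

section \<open>Gluing two trivial families over the line\<close>

section \<open>Families obtained by patching two trivial families\<close>

text \<open>The parameter is the last coordinate of every chart, which gives the submersion;
  countability gives second countability of the glued space.\<close>

definition fibred_atlas ::
 "nat => 'a fspace => (((nat => complex) => 'a \<times> complex) \<times> ('a \<times> complex => nat => complex)) set => bool" where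
 "fibred_atlas n X C \<longleftrightarrow> countable C &
   (ALL (ps, ph):C. open_emb (affine_an {..<n + 1}) (prod_an X complex_line) ps ph & (ALL x. snd (ps x) = x n)) &
   points X \<times> UNIV \<subseteq> (\<Union>(ps, ph)\<in>C. ps ` points (affine_an {..<n + 1}))"

text \<open>The transition formula is needed twice: at a fixed parameter for a fiber, and with the
  parameter as a variable for the total space.\<close>

lemma morphism_over_line:
 assumes X: "curved X" and Y: "curved Y" and V: "curved V"
  and A: "opn X A" and B: "opn Y B"
  and j: "morphism (subspace_of X A) V j" and F: "morphism (prod_an V complex_line) V F"
  and h: "morphism V (subspace_of Y B) h"
 shows "morphism (subspace_of X A) (subspace_of Y B) (%p. h (F (j p, t)))"
  and "morphism (subspace_of (prod_an X complex_line) (A \<times> UNIV))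
   (subspace_of (prod_an Y complex_line) (B \<times> UNIV)) (%p. (h (F (j (fst p), snd p)), snd p))"
proof -
 note C = curved_complex_line
 note XA = curved_subspace[OF X A]
 have "morphism (subspace_of X A) (prod_an V complex_line) (%p. (j p, t))"
  by (rule morphism_pair[OF V C XA j morphism_const[OF XA C]]) simp
 from morphism_compose[OF morphism_compose[OF this F] h]
 show "morphism (subspace_of X A) (subspace_of Y B) (%p. h (F (j p, t)))" by (simp add: comp_def)
 have oA: "opn (prod_an X complex_line) (A \<times> UNIV)" using A by (simp add: openin_prod_Times_iff)
 let ?Z = "subspace_of (prod_an X complex_line) (A \<times> UNIV)"
 note Z = curved_subspace[OF curved_prod[OF X C] oA]
 note incl = morphism_subspace_incl[OF curved_prod[OF X C] oA]
 have s: "morphism ?Z complex_line snd" using morphism_compose[OF incl morphism_snd[OF X C]] by (simp add: comp_def)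
 have "morphism ?Z X fst" using morphism_compose[OF incl morphism_fst[OF X C]] by (simp add: comp_def)
 hence "morphism ?Z (subspace_of X A) fst"
  by (rule morphism_into_subspace[OF Z]) (use points_subspace_open[OF oA] in auto)
 note m = morphism_compose[OF morphism_compose[OF morphism_pair[OF V C Z morphism_compose[OF this j] s] F] h]
 have im: "h (F (j (fst z), snd z)) : B" if "z : points ?Z" for z
  using morphism_in[OF m that] unfolding points_subspace_open[OF B] by simp
 have "morphism ?Z Y (h \<circ> (F \<circ> (%z. ((j \<circ> fst) z, snd z))))"
  using morphism_compose[OF m morphism_subspace_incl[OF Y B]] by (simp add: comp_def)
 from morphism_pair[OF Y C Z this s]
 have "morphism ?Z (prod_an Y complex_line) (%p. (h (F (j (fst p), snd p)), snd p))" by (simp add: comp_def)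
 thus "morphism ?Z (subspace_of (prod_an Y complex_line) (B \<times> UNIV)) (%p. (h (F (j (fst p), snd p)), snd p))"
  by (rule morphism_into_subspace[OF Z]) (use im in auto)
qed

text \<open>The extension is constant in the direction of the parameter.\<close>

lemma fiber_function_extends:
 assumes X: "curved X" and Z: "curved Z" and e: "open_emb (prod_an X complex_line) Z f f'"
  and m: "morphism X Q m" and par: "\<And>p s. \<pi> (f (p, s)) = s" and \<nu>: "\<And>p. p : points X ==> \<nu> (f (p, t)) = m p"
  and W: "opn Q W" and g: "g : funs Q W"
 defines "U \<equiv> f ` ({p : points X. m p : W} \<times> UNIV)"
 shows "opn Z U" and "g \<circ> (m \<circ> (fst \<circ> f')) : funs Z U"
  and "\<And>y. y : U ==> \<pi> y = t ==> \<nu> y : W & (g \<circ> \<nu>) y = (g \<circ> (m \<circ> (fst \<circ> f'))) y"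
proof -
 note C = curved_complex_line
 have o: "opn (prod_an X complex_line) ({p : points X. m p : W} \<times> UNIV)"
  using morphism_preimage[OF m W] by (simp add: openin_prod_Times_iff)
 show oU: "opn Z U" unfolding U_def by (rule open_emb_image[OF e o])
 let ?I = "f ` points (prod_an X complex_line)"
 have pts: "points (prod_an X complex_line) = points X \<times> UNIV" by simp
 have "morphism (subspace_of Z ?I) X (fst \<circ> f')"
  by (rule morphism_compose[OF open_embD(3)[OF e] morphism_fst[OF X C]])
 from morphism_funs[OF morphism_compose[OF this m] W g]
 have "g \<circ> (m \<circ> (fst \<circ> f')) : funs (subspace_of Z ?I) {x : points (subspace_of Z ?I). (m \<circ> (fst \<circ> f')) x : W}" .
 moreover have "{x : points (subspace_of Z ?I). (m \<circ> (fst \<circ> f')) x : W} = U"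
  unfolding points_subspace_open[OF open_embD(1)[OF e]] U_def using open_embD(4)[OF e] by (fastforce simp: image_iff)
 moreover have "U \<subseteq> ?I" unfolding U_def by (rule image_mono) auto
 ultimately show "g \<circ> (m \<circ> (fst \<circ> f')) : funs Z U" using funs_subspace_open[OF Z oU] by simp
 fix y assume y: "y : U" "\<pi> y = t"
 then obtain p s where p: "p : points X" "m p : W" "y = f (p, s)" unfolding U_def by auto
 hence "s = t" using par y(2) by simp
 thus "\<nu> y : W & (g \<circ> \<nu>) y = (g \<circ> (m \<circ> (fst \<circ> f'))) y"
  using p \<nu>[OF p(1)] open_embD(4)[OF e, of "(p, t)"] by simp
qed

lemma funs_subspace:
 "funs (subspace_of X S) W = {f. ALL x:W. EX W' g. opn X W' & x : W' & g : funs X W' &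
   (ALL y:W \<inter> W'. f y = g y)}" by (simp add: subspace_of_def)

text \<open>What the gluing argument uses, freed from toric geometry: a transition \<open>F\<close>
  with inverse \<open>G\<close> on a common model \<open>V\<close> of the two overlaps, and heights
  whose nonvanishing loci are the overlaps and whose product is 1 on glued points.\<close>

locale patched_family =
 fixes X :: "'a fspace" and Y :: "'b fspace" and V :: "'c fspace"
  and A B j j' h h' and F G :: "'c \<times> complex => 'c"
  and zX :: "'a => complex" and zY :: "'b => complex" and n :: nat and CX CY
  and Rt :: "complex => ('a \<times> 'b) set"
 assumes X: "curved X" and Y: "curved Y" and V: "curved V"
  and A: "opn X A" and B: "opn Y B"
  and j: "morphism (subspace_of X A) V j" and j': "morphism V (subspace_of X A) j'"
  and j'_j: "\<And>p. p : A ==> j' (j p) = p" and j_j': "\<And>v. v : points V ==> j (j' v) = v"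
  and h: "morphism (subspace_of Y B) V h" and h': "morphism V (subspace_of Y B) h'"
  and h'_h: "\<And>q. q : B ==> h' (h q) = q" and h_h': "\<And>v. v : points V ==> h (h' v) = v"
  and F: "morphism (prod_an V complex_line) V F" and G: "morphism (prod_an V complex_line) V G"
  and GF: "\<And>v t. v : points V ==> G (F (v, t), t) = v"
  and FG: "\<And>v t. v : points V ==> F (G (v, t), t) = v"
  and Rt: "\<And>t p q. (p, q) : Rt t \<longleftrightarrow> p : A & q : B & j p = F (h q, t)"
  and zX: "morphism X complex_line zX" and zY: "morphism Y complex_line zY"
  and zX0: "\<And>p. p : points X ==> zX p ~= 0 \<longleftrightarrow> p : A" and zY0: "\<And>q. q : points Y ==> zY q ~= 0 \<longleftrightarrow> q : B"
  and zXY: "\<And>t p q. (p, q) : Rt t ==> zX p * zY q = 1"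
  and HX: "Hausdorff_space (top_of X)" and HY: "Hausdorff_space (top_of Y)"
  and KX: "compactin (top_of X) {p : points X. norm (zX p) \<le> 1}"
  and KY: "compactin (top_of Y) {q : points Y. norm (zY q) \<le> 1}"
  and ne: "points X ~= {}" and CX: "fibred_atlas n X CX" and CY: "fibred_atlas n Y CY"
begin

lemma points_j: "p : A ==> j p : points V" and points_h: "q : B ==> h q : points V"
 and points_j': "v : points V ==> j' v : A" and points_h': "v : points V ==> h' v : B"
 using morphism_in[OF j] morphism_in[OF h] morphism_in[OF j'] morphism_in[OF h']
 unfolding points_subspace_open[OF A] points_subspace_open[OF B] by blast+

lemma points_F: "v : points V ==> F (v, t) : points V" and points_G: "v : points V ==> G (v, t) : points V"
 using morphism_in[OF F, of "(v, t)"] morphism_in[OF G, of "(v, t)"] by simp_all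

lemma R_graph: "(p, q) : Rt t \<longleftrightarrow> p : A & q = h' (G (j p, t))"
 unfolding Rt using GF FG points_j points_h points_G points_h' h'_h h_h' by metis

lemma patching_fiber: "patching X Y A B (%p. h' (G (j p, t))) (%q. j' (F (h q, t))) (Rt t)"
proof
 show "morphism (subspace_of X A) (subspace_of Y B) (%p. h' (G (j p, t)))"
  by (rule morphism_over_line(1)[OF X Y V A B j G h'])
 show "morphism (subspace_of Y B) (subspace_of X A) (%q. j' (F (h q, t)))"
  by (rule morphism_over_line(1)[OF Y X V B A h F j'])
 show "j' (F (h (h' (G (j x, t))), t)) = x" if "x : A" for x using that FG points_j points_G h_h' j'_j by simp
 show "h' (G (j (j' (F (h y, t))), t)) = y" if "y : B" for y using that GF points_h points_F j_j' h'_h by simp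
qed (use X Y A B R_graph in simp_all)

definition "Rtot = {((p, t), (q, t)) | p q t. (p, q) : Rt t}"

sublocale tot: patching "prod_an X complex_line" "prod_an Y complex_line" "A \<times> UNIV" "B \<times> UNIV"
  "%p. (h' (G (j (fst p), snd p)), snd p)" "%q. (j' (F (h (fst q), snd q)), snd q)" Rtot
proof
 show "morphism (subspace_of (prod_an X complex_line) (A \<times> UNIV)) (subspace_of (prod_an Y complex_line) (B \<times> UNIV))
   (%p. (h' (G (j (fst p), snd p)), snd p))" by (rule morphism_over_line(2)[OF X Y V A B j G h'])
 show "morphism (subspace_of (prod_an Y complex_line) (B \<times> UNIV)) (subspace_of (prod_an X complex_line) (A \<times> UNIV))
   (%q. (j' (F (h (fst q), snd q)), snd q))" by (rule morphism_over_line(2)[OF Y X V B A h F j'])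
 show "(j' (F (h (fst (h' (G (j (fst x), snd x)), snd x)), snd (h' (G (j (fst x), snd x)), snd x))),
   snd (h' (G (j (fst x), snd x)), snd x)) = x" if "x : A \<times> UNIV" for x
  using that FG points_j points_G h_h' j'_j by auto
 show "(h' (G (j (fst (j' (F (h (fst y), snd y)), snd y)), snd (j' (F (h (fst y), snd y)), snd y))),
   snd (j' (F (h (fst y), snd y)), snd y)) = y" if "y : B \<times> UNIV" for y
  using that GF points_h points_F j_j' h'_h by auto
 show "(x, y) : Rtot \<longleftrightarrow> x : A \<times> UNIV & y = (h' (G (j (fst x), snd x)), snd x)" for x y
  using R_graph by (cases x; cases y) (auto simp: Rtot_def)
qed (use X Y A B curved_prod curved_complex_line in \<open>auto simp: openin_prod_Times_iff\<close>)

abbreviation "\<pi> \<equiv> (family_parameter :: (('a \<times> complex) + ('b \<times> complex)) set => complex)"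

lemma tot_class: "tot.inl x = insert (Inl x) (Inr ` {y. (x, y) : Rtot})"
  "tot.inr y = insert (Inr y) (Inl ` {x. (x, y) : Rtot})" unfolding tot.inl_def tot.inr_def
 by (rule patch_class_bi_unique; use tot.R tot.R' in metis)+

lemma Rtot_snd: "(x, y) : Rtot ==> snd x = snd y" by (auto simp: Rtot_def)

lemma in_tot_class:
 "z : tot.inl x ==> case_sum snd snd z = snd x" "z : tot.inr y ==> case_sum snd snd z = snd y"
 unfolding tot_class by (auto dest!: Rtot_snd)

text \<open>\<open>family_parameter\<close> evaluates an arbitrary member of a class; points are
  glued only at equal parameters, so the choice is harmless.\<close>

lemma parameter: "\<pi> (tot.inl x) = snd x" "\<pi> (tot.inr y) = snd y"
proof -
 have "representative (tot.inl x) : tot.inl x"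
  unfolding representative_def by (rule someI[where x = "Inl x"]) (simp add: tot_class)
 moreover have "representative (tot.inr y) : tot.inr y"
  unfolding representative_def by (rule someI[where x = "Inr y"]) (simp add: tot_class)
 moreover have "\<pi> C = case_sum snd snd (representative C)" for C :: "('a \<times> complex + 'b \<times> complex) set"
  by (simp add: family_parameter_def split: sum.split)
 ultimately show "\<pi> (tot.inl x) = snd x" "\<pi> (tot.inr y) = snd y" by (simp_all add: in_tot_class)
qed

lemma points_tot: "points tot.P = tot.inl ` (points X \<times> UNIV) \<union> tot.inr ` (points Y \<times> UNIV)"
 using tot.points_patch by simp

lemma points_cases:
 assumes "u : points tot.P"
 obtains p t where "p : points X" "u = tot.inl (p, t)" | q t where "q : points Y" "u = tot.inr (q, t)"
 using assms unfolding points_tot by auto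

lemma tot_glue: "(p, q) : Rt t ==> tot.inl (p, t) = tot.inr (q, t)" using tot.inl_inr_eq by (auto simp: Rtot_def)

lemma glue_A: "p : A ==> EX q:points Y. (p, q) : Rt t"
 using R_graph points_j points_G points_h' openin_subset[OF B] by blast

lemma glue_B: "q : B ==> EX p:points X. (p, q) : Rt t"
proof -
 assume q: "q : B"
 have "j' (F (h q, t)) : A" "j (j' (F (h q, t))) = F (h q, t)" using q points_h points_F points_j' j_j' by auto
 hence "(j' (F (h q, t)), q) : Rt t" using Rt q by blast
 thus ?thesis using Rt openin_subset[OF A] by blast
qed

lemma morphism_parameter: "morphism tot.P complex_line \<pi>"
proof -
 note C = curved_complex_line
 have "morphism (sum_space (prod_an X complex_line) (prod_an Y complex_line)) complex_line (case_sum snd snd)"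
  by (rule morphism_sum[OF morphism_snd[OF X C] morphism_snd[OF Y C]])
 hence "morphism (sum_space (prod_an X complex_line) (prod_an Y complex_line)) complex_line (\<pi> \<circ> patch_class Rtot)"
 proof (rule morphism_cong[OF curved_sum[OF tot.X tot.Y] C])
  show "case_sum snd snd x = (\<pi> \<circ> patch_class Rtot) x" for x
   using parameter unfolding tot.inl_def tot.inr_def by (cases x) simp_all
 qed
 from morphism_final[OF final_map_patch this] show ?thesis unfolding tot.P_def .
qed

lemma Hausdorff_tot: "Hausdorff_space (top_of tot.P)" unfolding Hausdorff_space_def
proof (intro allI impI)
 fix u v assume uv: "u : points tot.P & v : points tot.P & u ~= v"
 have sep: "EX U W. opn tot.P U & opn tot.P W & u : U & v : W & disjnt U W"
  if "Hausdorff_space (top_of E)" "open_emb E tot.P f f'" "x : points E" "y : points E" "u = f x" "v = f y"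
  for E :: "'e fspace" and f f' x y
 proof -
  have "x ~= y" using that uv by auto
  hence "EX S S'. opn E S & opn E S' & x : S & y : S' & disjnt S S'"
   using that(1,3,4) unfolding Hausdorff_space_def by blast
  then obtain S S' where S: "opn E S" "opn E S'" "x : S" "y : S'" "disjnt S S'" by blast
  have "disjnt (f ` S) (f ` S')" using S(5) open_emb_inj[OF that(2)] openin_subset[OF S(1)] openin_subset[OF S(2)]
   unfolding disjnt_iff by (metis image_iff subsetD)
  thus ?thesis using open_emb_image[OF that(2)] S that(5,6) by (metis image_eqI)
 qed
 have HX': "Hausdorff_space (top_of (prod_an X complex_line))" and HY': "Hausdorff_space (top_of (prod_an Y complex_line))"
  using HX HY by (simp_all add: Hausdorff_space_prod_topology)
 \<comment> \<open>Glued heights multiply to 1, so no points with both heights below 1 in norm are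
   glued. These two open sets separate points outside the overlaps; any other pair fits into one of
   the Hausdorff copies.\<close>
 define D where "D = tot.inl ` ({p : points X. zX p : ball 0 1} \<times> UNIV)"
 define E where "E = tot.inr ` ({q : points Y. zY q : ball 0 1} \<times> UNIV)"
 have oD: "opn tot.P D" unfolding D_def using morphism_preimage[OF zX, of "ball 0 1"]
  by (intro open_emb_image[OF tot.open_emb_inl]) (simp add: openin_prod_Times_iff)
 have oE: "opn tot.P E" unfolding E_def using morphism_preimage[OF zY, of "ball 0 1"]
  by (intro open_emb_image[OF tot.open_emb_inr]) (simp add: openin_prod_Times_iff)
 have DE: "disjnt D E"
 proof (rule ccontr)
  assume "\<not> disjnt D E"
  then obtain p t q s where pq: "tot.inl (p, t) = tot.inr (q, s)" "norm (zX p) < 1" "norm (zY q) < 1"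
   by (auto simp: D_def E_def disjnt_iff)
  hence "norm (zX p * zY q) = 1" using tot.inl_inr_eq zXY by (fastforce simp: Rtot_def)
  moreover have "norm (zX p) * norm (zY q) < 1 * 1" using pq by (intro mult_strict_mono') auto
  ultimately show False by (simp add: norm_mult)
 qed
 have mixed: "EX U W. opn tot.P U & opn tot.P W & tot.inl (p, t) : U & tot.inr (q, s) : W & disjnt U W"
  if pq: "p : points X" "p ~: A" "q : points Y" "q ~: B" for p t q s
 proof -
  have "zX p : ball 0 1" "zY q : ball 0 1" using pq zX0[of p] zY0[of q] by auto
  hence "tot.inl (p, t) : D" "tot.inr (q, s) : E" using pq unfolding D_def E_def by blast+
  thus ?thesis using oD oE DE by blast
 qed
 let ?sep = "%u v. EX U W. opn tot.P U & opn tot.P W & u : U & v : W & disjnt U W"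
 have E1: "?sep u v" if "u = tot.inl (p, t)" "v = tot.inl (p', t')" "p : points X" "p' : points X" for p t p' t'
  by (rule sep[OF HX' tot.open_emb_inl _ _ that(1,2)]) (use that in simp_all)
 have E2: "?sep u v" if "u = tot.inr (q, t)" "v = tot.inr (q', t')" "q : points Y" "q' : points Y" for q t q' t'
  by (rule sep[OF HY' tot.open_emb_inr _ _ that(1,2)]) (use that in simp_all)
 have inlA: "EX q:points Y. tot.inl (p, t) = tot.inr (q, t)" if "p : A" for p t
  using glue_A[OF that] tot_glue by blast
 have inrB: "EX p:points X. tot.inr (q, t) = tot.inl (p, t)" if "q : B" for q t
  using glue_B[OF that] tot_glue by metis
 from uv have u: "u : points tot.P" and v: "v : points tot.P" by auto
 show "?sep u v"
 proof (cases rule: points_cases[OF u])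
  case (1 p t)
  show ?thesis
  proof (cases rule: points_cases[OF v])
   case (1 p' t')
   thus ?thesis using E1 \<open>u = _\<close> \<open>p : _\<close> by blast
  next
   case (2 q' t')
   consider "p : A" | "q' : B" | "p ~: A" "q' ~: B" by blast
   thus ?thesis
   proof cases
    case 1
    then obtain q where "q : points Y" "u = tot.inr (q, t)" using inlA \<open>u = _\<close> by metis
    thus ?thesis using E2 2 by blast
   next
    case 2
    then obtain p' where "p' : points X" "v = tot.inl (p', t')" using inrB \<open>v = _\<close> by metis
    thus ?thesis using E1 \<open>u = _\<close> \<open>p : _\<close> by blast
   next
    case 3
    thus ?thesis using mixed[of p q' t t'] \<open>u = _\<close> \<open>v = _\<close> \<open>p : _\<close> \<open>q' : points Y\<close> by simp
   qed
  qed
 next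
  case (2 q t)
  show ?thesis
  proof (cases rule: points_cases[OF v])
   case (1 p' t')
   consider "p' : A" | "q : B" | "p' ~: A" "q ~: B" by blast
   thus ?thesis
   proof cases
    case 1
    then obtain q' where "q' : points Y" "v = tot.inr (q', t')" using inlA \<open>v = _\<close> by metis
    thus ?thesis using E2 \<open>u = _\<close> \<open>q : points Y\<close> by blast
   next
    case 2
    then obtain p where "p : points X" "u = tot.inl (p, t)" using inrB \<open>u = _\<close> by metis
    thus ?thesis using E1 \<open>v = _\<close> \<open>p' : points X\<close> by blast
   next
    case 3
    hence "?sep v u" using mixed[of p' q t' t] \<open>u = _\<close> \<open>v = _\<close> \<open>p' : _\<close> \<open>q : points Y\<close> by simp
    thus ?thesis using disjnt_sym by blast
   qed
  next
   case 2
   thus ?thesis using E2 \<open>u = _\<close> \<open>q : points Y\<close> by blast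
  qed
 qed
qed

lemma tot_emb:
 assumes "(ps, ph) : CX"
 shows "open_emb (affine_an {..<n + 1}) tot.P (tot.inl \<circ> ps) (ph \<circ> tot.inl')"
  and "\<pi> ((tot.inl \<circ> ps) x) = x n"
proof -
 have e: "open_emb (affine_an {..<n + 1}) (prod_an X complex_line) ps ph" "snd (ps x) = x n" for x
  using CX assms by (auto simp: fibred_atlas_def)
 show "open_emb (affine_an {..<n + 1}) tot.P (tot.inl \<circ> ps) (ph \<circ> tot.inl')"
  by (rule open_emb_compose[OF tot.X tot.curved_patch e(1) tot.open_emb_inl])
 show "\<pi> ((tot.inl \<circ> ps) x) = x n" using e(2) parameter by simp
qed

lemma tot_emb':
 assumes "(ps, ph) : CY"
 shows "open_emb (affine_an {..<n + 1}) tot.P (tot.inr \<circ> ps) (ph \<circ> tot.inr')"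
  and "\<pi> ((tot.inr \<circ> ps) x) = x n"
proof -
 have e: "open_emb (affine_an {..<n + 1}) (prod_an Y complex_line) ps ph" "snd (ps x) = x n" for x
  using CY assms by (auto simp: fibred_atlas_def)
 show "open_emb (affine_an {..<n + 1}) tot.P (tot.inr \<circ> ps) (ph \<circ> tot.inr')"
  by (rule open_emb_compose[OF tot.Y tot.curved_patch e(1) tot.open_emb_inr])
 show "\<pi> ((tot.inr \<circ> ps) x) = x n" using e(2) parameter by simp
qed

definition "Ctot = (%(ps, ph). (tot.inl \<circ> ps, ph \<circ> tot.inl')) ` CX \<union> (%(ps, ph). (tot.inr \<circ> ps, ph \<circ> tot.inr')) ` CY"

lemma Ctot: "(ps, ph) : Ctot ==> open_emb (affine_an {..<n + 1}) tot.P ps ph & (ALL x. \<pi> (ps x) = x n)"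
 unfolding Ctot_def using tot_emb tot_emb' by fast

lemma countable_Ctot: "countable Ctot" unfolding Ctot_def using CX CY by (simp add: fibred_atlas_def)

lemma Ctot_cover:
 assumes u: "u : points tot.P"
 obtains ps ph where "(ps, ph) : Ctot" "u : ps ` points (affine_an {..<n + 1})"
proof (cases rule: points_cases[OF u])
 case (1 p t)
 have "(p, t) : (\<Union>(ps, ph)\<in>CX. ps ` points (affine_an {..<n + 1}))"
  using CX 1 unfolding fibred_atlas_def by blast
 then obtain ps ph x where p: "(ps, ph) : CX" "x : points (affine_an {..<n + 1})" "(p, t) = ps x" by fast
 have "(tot.inl \<circ> ps, ph \<circ> tot.inl') : Ctot" using p(1) by (auto simp: Ctot_def)
 moreover have "u = (tot.inl \<circ> ps) x" using p 1 by simp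
 ultimately show ?thesis using that p(2) by blast
next
 case (2 p t)
 have "(p, t) : (\<Union>(ps, ph)\<in>CY. ps ` points (affine_an {..<n + 1}))"
  using CY 2 unfolding fibred_atlas_def by blast
 then obtain ps ph x where p: "(ps, ph) : CY" "x : points (affine_an {..<n + 1})" "(p, t) = ps x" by fast
 have "(tot.inr \<circ> ps, ph \<circ> tot.inr') : Ctot" using p(1) by (auto simp: Ctot_def)
 moreover have "u = (tot.inr \<circ> ps) x" using p 2 by simp
 ultimately show ?thesis using that p(2) by blast
qed

lemma manifold_tot: "complex_manifold (n + 1) tot.P" unfolding complex_manifold_def
proof (intro conjI ballI)
 show "Hausdorff_space (top_of tot.P)" by (rule Hausdorff_tot)
 show "second_countable (top_of tot.P)"
 proof (rule second_countable_open_cover[OF countable_Ctot])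
  fix i assume i: "i : Ctot"
  hence e: "open_emb (affine_an {..<n + 1}) tot.P (fst i) (snd i)" using Ctot by (cases i) auto
  show "opn tot.P (fst i ` points (affine_an {..<n + 1}))" by (rule open_embD(1)[OF e])
  show "second_countable (subtopology (top_of tot.P) (fst i ` points (affine_an {..<n + 1})))"
   by (rule second_countable_open_emb[OF e second_countable_affine])
 next
  show "points tot.P \<subseteq> (\<Union>i\<in>Ctot. fst i ` points (affine_an {..<n + 1}))"
  proof
   fix u assume "u : points tot.P"
   then obtain ps ph where "(ps, ph) : Ctot" "u : ps ` points (affine_an {..<n + 1})" by (rule Ctot_cover)
   thus "u : (\<Union>i\<in>Ctot. fst i ` points (affine_an {..<n + 1}))" by force
  qed
 qed
 fix u assume "u : points tot.P"
 then obtain ps ph where c: "(ps, ph) : Ctot" "u : ps ` points (affine_an {..<n + 1})" by (rule Ctot_cover)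
 hence "is_chart (n + 1) tot.P (ps ` points (affine_an {..<n + 1})) ph ps"
  using Ctot open_emb_chart[OF _ tot.curved_patch] by blast
 with c(2) show "EX W ph ps. u : W & is_chart (n + 1) tot.P W ph ps" by (intro exI conjI)
qed

text \<open>In the charts of the atlas the parameter is itself a coordinate, so its partial
  derivative in that direction is 1.\<close>

lemma submersion_tot: "submersion_to_line (n + 1) tot.P \<pi>" unfolding submersion_to_line_def
proof
 fix u assume "u : points tot.P"
 then obtain ps ph where c: "(ps, ph) : Ctot" "u : ps ` points (affine_an {..<n + 1})" by (rule Ctot_cover)
 hence "is_chart (n + 1) tot.P (ps ` points (affine_an {..<n + 1})) ph ps"
  using Ctot open_emb_chart[OF _ tot.curved_patch] by blast
 moreover have "(%z. \<pi> (ps ((ph u)(n := z)))) = (%z. z)" using Ctot[OF c(1)] by auto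
 hence "deriv (%z. \<pi> (ps ((ph u)(n := z)))) (ph u n) ~= 0" by simp
 ultimately show "EX W ph ps. u : W & is_chart (n + 1) tot.P W ph ps &
   (EX i<n + 1. deriv (%z. \<pi> (ps ((ph u)(i := z)))) (ph u i) ~= 0)"
  using c(2) by (intro exI[of _ "ps ` points (affine_an {..<n + 1})"] exI[of _ ph] exI[of _ ps] exI[of _ n] conjI) auto
qed

lemma proper_tot: "proper_map (top_of tot.P) euclidean \<pi>"
proof (rule compact_imp_proper_map)
 \<comment> \<open>For a continuous map into a Hausdorff k-space, compactness of the preimages of
   compact sets already implies that the map is proper, including its closedness.\<close>
 show "k_space (euclidean :: complex topology)" by (rule k_space_euclideanreal)
 show "kc_space (euclidean :: complex topology)" by (rule Hausdorff_imp_kc_space) simp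
 show "continuous_map (top_of tot.P) euclidean \<pi> \<or> kc_space (top_of tot.P)"
  using morphism_continuous[OF morphism_parameter] by simp
 fix K :: "complex set" assume K: "compactin euclidean K"
 let ?E = "tot.inl ` ({p : points X. norm (zX p) \<le> 1} \<times> K) \<union> tot.inr ` ({q : points Y. norm (zY q) \<le> 1} \<times> K)"
 have "compactin (top_of tot.P) ?E"
 proof (rule compactin_Un)
  show "compactin (top_of tot.P) (tot.inl ` ({p : points X. norm (zX p) \<le> 1} \<times> K))"
   by (rule image_compactin[OF _ morphism_continuous[OF tot.morphism_inl]])
    (unfold top_of_prod_an compactin_Times top_of_complex_line, use KX K in blast)
  show "compactin (top_of tot.P) (tot.inr ` ({q : points Y. norm (zY q) \<le> 1} \<times> K))"
   by (rule image_compactin[OF _ morphism_continuous[OF tot.morphism_inr]])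
    (unfold top_of_prod_an compactin_Times top_of_complex_line, use KY K in blast)
 qed
 moreover have "?E = {x : points tot.P. \<pi> x : K}"
 proof
  show "?E \<subseteq> {x : points tot.P. \<pi> x : K}" unfolding points_tot using parameter by auto
  show "{x : points tot.P. \<pi> x : K} \<subseteq> ?E"
  proof clarify
   fix u assume u: "u : points tot.P" "\<pi> u : K" "u ~: tot.inr ` ({q : points Y. norm (zY q) \<le> 1} \<times> K)"
   show "u : tot.inl ` ({p : points X. norm (zX p) \<le> 1} \<times> K)"
   proof (cases rule: points_cases[OF u(1)])
    case (1 p t)
    hence t: "t : K" using u(2) parameter by simp
    \<comment> \<open>A height above 1 would force the point into the overlap, where its partner has
      height below 1 and is already accounted for in the second copy.\<close>
    have "norm (zX p) \<le> 1"
    proof (rule ccontr)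
     assume n: "\<not> norm (zX p) \<le> 1"
     hence "zX p ~= 0" by auto
     then obtain q where q: "q : points Y" "(p, q) : Rt t" using zX0 1(1) glue_A by blast
     have "norm (zX p) * norm (zY q) = 1" using zXY[OF q(2)] by (metis norm_mult norm_one)
     hence "norm (zY q) \<le> 1" using n
      by (metis linorder_le_cases mult_le_cancel_left1 norm_not_less_zero not_le order_less_trans zero_less_one)
     thus False using u(3) tot_glue[OF q(2)] 1(2) q(1) t by auto
    qed
    thus ?thesis using 1 t by auto
   next
    case (2 q t)
    hence t: "t : K" using u(2) parameter by simp
    hence n: "\<not> norm (zY q) \<le> 1" using u(3) 2 by auto
    hence "zY q ~= 0" by auto
    then obtain p where p: "p : points X" "(p, q) : Rt t" using zY0 2(1) glue_B by blast
    have "norm (zX p) * norm (zY q) = 1" using zXY[OF p(2)] by (metis norm_mult norm_one)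
    hence "norm (zX p) \<le> 1" using n
     by (metis linorder_le_cases mult_le_cancel_right1 norm_not_less_zero not_le order_less_trans zero_less_one)
    thus ?thesis using tot_glue[OF p(2)] 2(2) p(1) t by auto
   qed
  qed
 qed
 ultimately show "compactin (top_of tot.P) {x : points tot.P. \<pi> x : K}" by simp
qed auto

lemma fiber_tot: "isomorphic (subspace_of tot.P {x : points tot.P. \<pi> x = t}) (patch X Y (Rt t))"
proof -
 interpret f: patching X Y A B "%p. h' (G (j p, t))" "%q. j' (F (h q, t))" "Rt t" by (rule patching_fiber)
 note C = curved_complex_line
 let ?F = "{x : points tot.P. \<pi> x = t}"
 \<comment> \<open>The case distinctions prefer the first copy. On the overlap both formulas agree,
   since the relation of the total space at parameter \<open>t\<close> is that of the fiber.\<close>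
 define \<mu> where "\<mu> = (%c. if c : f.inl ` points X then tot.inl (f.inl' c, t) else tot.inr (f.inr' c, t))"
 define \<nu> where "\<nu> = (%c. if c : tot.inl ` (points X \<times> UNIV) then f.inl (fst (tot.inl' c)) else f.inr (fst (tot.inr' c)))"
 have \<mu>1: "\<mu> (f.inl p) = tot.inl (p, t)" if "p : points X" for p using that by (simp add: \<mu>_def)
 have \<nu>1: "\<nu> (tot.inl (p, s)) = f.inl p" if "p : points X" for p s using that by (simp add: \<nu>_def)
 have \<mu>2: "\<mu> (f.inr q) = tot.inr (q, t)" if q: "q : points Y" for q
 proof (cases "f.inr q : f.inl ` points X")
  case True
  then obtain p where p: "p : points X" "f.inl p = f.inr q" by auto
  hence "\<mu> (f.inr q) = tot.inl (p, t)" using \<mu>1 by metis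
  thus ?thesis using tot_glue p(2) f.inl_inr_eq by simp
 qed (simp add: \<mu>_def)
 have \<nu>2: "\<nu> (tot.inr (q, t)) = f.inr q" if q: "q : points Y" for q
 proof (cases "tot.inr (q, t) : tot.inl ` (points X \<times> UNIV)")
  case True
  then obtain p s where p: "p : points X" "tot.inl (p, s) = tot.inr (q, t)" by auto
  hence "\<nu> (tot.inr (q, t)) = f.inl p" "(p, q) : Rt t" using \<nu>1 tot.inl_inr_eq by (metis, auto simp: Rtot_def)
  thus ?thesis using f.inl_inr_eq by simp
 qed (simp add: \<nu>_def)
 have \<mu>m: "morphism f.P tot.P \<mu>"
 proof -
  have "morphism X tot.P (tot.inl \<circ> (%p. (p, t)))"
   by (rule morphism_compose[OF morphism_pair[OF X C X morphism_id[OF X] morphism_const[OF X C]] tot.morphism_inl]) simp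
  moreover have "morphism Y tot.P (tot.inr \<circ> (%p. (p, t)))"
   by (rule morphism_compose[OF morphism_pair[OF Y C Y morphism_id[OF Y] morphism_const[OF Y C]] tot.morphism_inr]) simp
  ultimately have "morphism (sum_space X Y) tot.P (case_sum (tot.inl \<circ> (%p. (p, t))) (tot.inr \<circ> (%p. (p, t))))"
   by (rule morphism_sum)
  hence "morphism (sum_space X Y) tot.P (\<mu> \<circ> patch_class (Rt t))"
  proof (rule morphism_cong[OF curved_sum[OF X Y] tot.curved_patch])
   show "case_sum (tot.inl \<circ> (%p. (p, t))) (tot.inr \<circ> (%p. (p, t))) x = (\<mu> \<circ> patch_class (Rt t)) x"
    if "x : points (sum_space X Y)" for x using that \<mu>1 \<mu>2 unfolding points_sum f.inl_def f.inr_def by auto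
  qed
  from morphism_final[OF final_map_patch this] show ?thesis unfolding f.P_def .
 qed
 have \<mu>in: "\<mu> w : ?F" if w: "w : points f.P" for w
  using w morphism_in[OF \<mu>m w] \<mu>1 \<mu>2 parameter unfolding f.points_patch by auto
 have \<mu>s: "morphism f.P (subspace_of tot.P ?F) \<mu>"
  by (rule morphism_into_subspace[OF f.curved_patch \<mu>m]) (use \<mu>in in blast)
 have ptF: "points (subspace_of tot.P ?F) = ?F" by auto
 \<comment> \<open>Functions on the closed fiber are by definition local restrictions of functions
   on open sets of the total space, so every function on the gluing has to be extended off the
   fiber.\<close>
 have ext: "EX U g'. opn tot.P U & u : U & g' : funs tot.P U &
   (ALL y:U. \<pi> y = t --> \<nu> y : W & (g \<circ> \<nu>) y = g' y)"
  if W: "opn f.P W" "g : funs f.P W" and u: "u : ?F" "\<nu> u : W" for W g u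
 proof -
  from u have "u : points tot.P" by simp
  thus ?thesis
  proof (cases rule: points_cases)
   case (1 p s)
   have "\<pi> (tot.inl (p, s)) = s" for p s using parameter by simp
   note e = fiber_function_extends[where \<pi> = \<pi> and t = t, OF X tot.curved_patch tot.open_emb_inl f.morphism_inl this \<nu>1 W]
   have "u : tot.inl ` ({p : points X. f.inl p : W} \<times> UNIV)" using 1 u \<nu>1 by auto
   thus ?thesis using e by blast
  next
   case (2 q s)
   have "\<pi> (tot.inr (q, s)) = s" for q s using parameter by simp
   note e = fiber_function_extends[where \<pi> = \<pi> and t = t, OF Y tot.curved_patch tot.open_emb_inr f.morphism_inr this \<nu>2 W]
   have "s = t" using 2 u parameter by auto
   hence "u : tot.inr ` ({q : points Y. f.inr q : W} \<times> UNIV)" using 2 u \<nu>2 by auto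
   thus ?thesis using e by blast
  qed
 qed
 have \<nu>in: "\<nu> u : points f.P" if u: "u : ?F" for u
 proof -
  from u have "u : points tot.P" by simp
  thus ?thesis by (cases rule: points_cases) (use u \<nu>1 \<nu>2 parameter f.points_patch in auto)
 qed
 have oF: "opn (subspace_of tot.P ?F) {u : ?F. \<nu> u : W}" if W: "opn f.P W" for W
 proof (subst openin_subopen, intro ballI)
  fix u assume u: "u : {u : ?F. \<nu> u : W}"
  have "(%x. 0) : funs f.P W" by (rule curved_const[OF f.curved_patch W])
  from ext[OF W this, of u] u obtain U g' where U: "opn tot.P U" "u : U" "ALL y:U. \<pi> y = t --> \<nu> y : W" by blast
  have "opn (subspace_of tot.P ?F) (U \<inter> ?F)" using U(1) by (auto simp: openin_subtopology)
  thus "EX T. opn (subspace_of tot.P ?F) T & u : T & T \<subseteq> {u : ?F. \<nu> u : W}"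
   using U u by (intro exI[of _ "U \<inter> ?F"]) auto
 qed
 have \<nu>s: "morphism (subspace_of tot.P ?F) f.P \<nu>" unfolding morphism_def
 proof (intro conjI allI impI)
  show "continuous_map (top_of (subspace_of tot.P ?F)) (top_of f.P) \<nu>"
   unfolding continuous_map_def using oF \<nu>in unfolding ptF by auto
  fix W g assume W: "opn f.P W" "g : funs f.P W"
  show "g \<circ> \<nu> : funs (subspace_of tot.P ?F) {x : points (subspace_of tot.P ?F). \<nu> x : W}"
   unfolding ptF funs_subspace
  proof (intro CollectI ballI)
   fix u assume u: "u : {x : ?F. \<nu> x : W}"
   then obtain U g' where U: "opn tot.P U" "u : U" "g' : funs tot.P U"
     "ALL y:U. \<pi> y = t --> \<nu> y : W & (g \<circ> \<nu>) y = g' y" using ext[OF W, of u] by blast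
   show "EX W' g'. opn tot.P W' & u : W' & g' : funs tot.P W' &
     (ALL y:{x : ?F. \<nu> x : W} \<inter> W'. (g \<circ> \<nu>) y = g' y)"
    using U by (intro exI[of _ U] conjI exI[of _ g']) auto
  qed
 qed
 have "isomorphism_pair (subspace_of tot.P ?F) f.P \<nu> \<mu>" unfolding isomorphism_pair_def ptF
 proof (intro conjI ballI)
  fix u assume u: "u : ?F"
  hence "u : points tot.P" by simp
  thus "\<mu> (\<nu> u) = u" by (cases rule: points_cases) (use u \<nu>1 \<nu>2 \<mu>1 \<mu>2 parameter in auto)
 next
  fix w assume "w : points f.P"
  thus "\<nu> (\<mu> w) = w" unfolding f.points_patch using \<nu>1 \<nu>2 \<mu>1 \<mu>2 by auto
 qed (rule \<nu>s \<mu>s)+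
 thus ?thesis unfolding isomorphic_def isomorphism_def f.P_def by blast
qed

theorem family: "complex_analytic_family n (patch (prod_an X complex_line) (prod_an Y complex_line) Rtot) \<pi> (%t. patch X Y (Rt t))"
proof -
 have surj: "\<pi> ` points tot.P = UNIV"
 proof -
  obtain p where p: "p : points X" using ne by blast
  have "EX u:points tot.P. t = \<pi> u" for t
   using p parameter(1)[of "(p, t)"] by (intro bexI[of _ "tot.inl (p, t)"]) (auto simp: points_tot)
  thus ?thesis by blast
 qed
 show ?thesis unfolding complex_analytic_family_def tot.P_def[symmetric]
  using manifold_tot morphism_parameter proper_tot submersion_tot surj fiber_tot by simp
qed

end

section \<open>The shear as transition map, and the resulting deformation\<close>

section \<open>Shears of a toric variety\<close>

locale shear_fan = T: toric "hyperplane_lattice l" Fnt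
 for l :: "'d::finite" and Fnt :: "(real^'d) set set" +
 fixes i1 :: 'd and a1 cv :: "int^'d"
 assumes i1: "i1 ~= l" and basis: "basis_vecs l \<subseteq> gens Fnt"
  and a1: "a1 : gens Fnt" "a1 ~: basis_vecs l" "a1 $ i1 = - 1"
  and first_coord: "\<And>v. v : gens Fnt ==> v ~= axis i1 1 ==> v ~= a1 ==> v $ i1 = 0"
  and hyp: "\<And>v. v : gens Fnt ==> v $ l = 0"
  and cover: "\<And>x. x $ l = 0 ==> EX cn:Fnt. x : cn"
begin

abbreviation "e1 \<equiv> axis i1 (1::int)"

text \<open>With \<open>cv = c_1\<close> these are the factors \<open>w^{c_{1,i}}\<close> of the
  gluing, the torus part that is already present at parameter 0; the summand with \<kappa> in
  \<open>shear\<close> carries the deformation.\<close>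

definition "weight w v = (if v : basis_vecs l then w powi pairing cv v else 1 :: complex)"

definition shear :: "complex => complex => (int^'d => complex) => int^'d => complex" where
 "shear \<kappa> w H = (%v. if v = e1 then weight w v * H v + \<kappa> * H a1 else weight w v * H v)"

lemma e1: "e1 : basis_vecs l" "e1 : T.G" "e1 ~= a1" using i1 basis a1(2) by (auto simp: basis_vecs_def)

lemma weight_nonzero: "w ~= 0 ==> weight w v ~= 0" by (simp add: weight_def)

lemma weight_a1: "weight w a1 = 1" using a1(2) by (simp add: weight_def)

text \<open>Only \<open>e_1\<close> and \<open>a_1\<close> have a nonzero first coordinate, with
  opposite values, so the first character ties their multipliers together. This is the linear
  equivalence of the two divisors that permits adding a multiple of one coordinate to the
  other.\<close>

lemma tgroup_e1:
 assumes h: "h : tgroup T.G"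
 shows "h e1 = h a1"
proof -
 have "(\<Prod>v\<in>T.G. h v powi (v $ i1)) = (\<Prod>v\<in>{e1, a1}. h v powi (v $ i1))"
  using T.finite_gens e1 a1(1) first_coord by (intro prod.mono_neutral_right) auto
 also have "\<dots> = h e1 / h a1" using e1(3) a1(3) by (simp add: axis_def power_int_minus divide_inverse)
 finally show ?thesis using tgroup_prod[OF h, of i1] tgroup_nonzero[OF h a1(1)] by simp
qed

lemma shear_zero: "shear 0 w H v = weight w v * H v" by (simp add: shear_def)

lemma weight_axis: "i ~= l ==> weight w (axis i 1) = w powi (cv $ i)"
 by (auto simp: weight_def basis_vecs_def pairing_def axis_def if_distrib[of "%y. _ * y"] cong: if_cong)

lemma shear_act: "h : tgroup T.G ==> shear \<kappa> w (act h H) = act h (shear \<kappa> w H)"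
proof
 fix v assume "h : tgroup T.G"
 thus "shear \<kappa> w (act h H) v = act h (shear \<kappa> w H) v"
  by (cases "v = e1") (simp_all add: tgroup_e1 shear_def act_def algebra_simps)
qed

lemma shear_coord: "H : coord_space T.G ==> shear \<kappa> w H : coord_space T.G"
 using e1(2) by (auto simp: shear_def coord_space_def)

text \<open>Start at \<open>e_1\<close> and go far in the direction of an interior point of the cone
  over \<open>Z\<close>, which has first coordinate 0. The cone reached contains \<open>Z\<close>
  and a point of first coordinate 1, and no generator but \<open>e_1\<close> contributes a positive
  first coordinate.\<close>

lemma cone_insert_e1:
 assumes cn: "cn : Fnt" "Z \<subseteq> T.cg cn" and Z: "e1 ~: Z" "a1 ~: Z"
 shows "EX tn:Fnt. insert e1 Z \<subseteq> T.cg tn"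
proof -
 define w :: "real^'d" where "w = (\<Sum>v\<in>Z. real_vec v)"
 have Zg: "Z \<subseteq> T.G" using cn(2) by (auto simp: cone_gens_def)
 have "v $ l = 0 & v $ i1 = 0" if "v : Z" for v using that Zg hyp first_coord Z by blast
 hence w: "w $ l = 0" "w $ i1 = 0" unfolding w_def by simp_all
 have "real_vec e1 + real s *\<^sub>R w : \<Union>Fnt" for s
  using cover[of "real_vec e1 + real s *\<^sub>R w"] i1 w by (auto simp: axis_def)
 then obtain tn where tn: "tn : Fnt" "Z \<subseteq> T.cg tn" "infinite {s::nat. real_vec e1 + real s *\<^sub>R w : tn}"
  using T.eventually_in_cone[OF subset_refl cn w_def, of 0 "real_vec e1"] by metis
 from tn(3) obtain s where s: "real_vec e1 + real s *\<^sub>R w : tn" using not_finite_existsD by blast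
 have "tn = cone_gen (T.cg tn)" using T.cone_dual[OF tn(1)] by metis
 then obtain c where c: "real_vec e1 + real s *\<^sub>R w = (\<Sum>v\<in>T.cg tn. c v *\<^sub>R real_vec v)"
   "ALL v:T.cg tn. 0 \<le> c v" using s cone_gen_eq[OF T.finite_cone_gens[OF tn(1)]] by blast
 have "e1 : T.cg tn"
 proof (rule ccontr)
  assume n: "e1 ~: T.cg tn"
  have "c v * real_of_int (v $ i1) \<le> 0" if v: "v : T.cg tn" for v
  proof -
   have "v : T.G" "v ~= e1" using v n by (auto simp: cone_gens_def)
   hence "v $ i1 \<le> 0" using first_coord[of v] a1(3) by (cases "v = a1") auto
   thus ?thesis using c(2) v by (simp add: mult_nonneg_nonpos)
  qed
  hence "(\<Sum>v\<in>T.cg tn. c v * real_of_int (v $ i1)) \<le> 0" by (rule sum_nonpos)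
  moreover have "(real_vec e1 + real s *\<^sub>R w) $ i1 = 1" using w by (simp add: axis_def)
  ultimately show False unfolding c(1) by simp
 qed
 thus ?thesis using tn(1,2) by blast
qed

text \<open>The coordinate of \<open>e1\<close> may newly vanish only at points where the coordinate of \<open>a1\<close>
 does not; since \<open>a1\<close> is the only generator opposite to \<open>e1\<close>, the vanishing set stays a cone.\<close>

lemma shear_domain:
 assumes H: "H : T.hcd" and w: "w ~= 0"
 shows "shear \<kappa> w H : T.hcd"
proof -
 let ?Z = "{v : T.G. H v = 0}" and ?Z' = "{v : T.G. shear \<kappa> w H v = 0}"
 obtain cn where cn: "cn : Fnt" "?Z \<subseteq> T.cg cn" using H unfolding T.hc_domain_iff by blast
 have off: "v ~= e1 ==> shear \<kappa> w H v = 0 \<longleftrightarrow> H v = 0" for v using weight_nonzero[OF w] by (simp add: shear_def)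
 have "EX tn:Fnt. ?Z' \<subseteq> T.cg tn"
 proof (cases "shear \<kappa> w H e1 = 0 & H e1 ~= 0")
  case True
  hence "H a1 ~= 0" using weight_nonzero[OF w] by (auto simp: shear_def)
  then obtain tn where "tn : Fnt" "insert e1 ?Z \<subseteq> T.cg tn" using cone_insert_e1[OF cn] True by blast
  moreover have "?Z' \<subseteq> insert e1 ?Z" using off by blast
  ultimately show ?thesis by blast
 next
  case False
  hence "shear \<kappa> w H v = 0 ==> H v = 0" for v using off by (cases "v = e1") simp_all
  hence "?Z' \<subseteq> ?Z" by blast
  thus ?thesis using cn by blast
 qed
 thus ?thesis unfolding T.hc_domain_iff using shear_coord[OF T.hc_domain_coord[OF H]] by blast
qed

text \<open>Coefficient and exponent are parameters so that the inverse transition has the same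
  form: the pair \<open>1\<close>, \<open>k\<close> is undone by \<open>- 1\<close>,
  \<open>c_{1,1} - k\<close>. The latter exponent may be negative, hence an integer.\<close>

definition shear_map :: "complex => int => ('d tpoint \<times> complex) \<times> complex => 'd tpoint \<times> complex" where
 "shear_map s e = (%((p, w), t). (T.orb (shear (s * t * w powi e) w (representative p)), 1 / w))"

lemma shear_map_orbit:
 assumes H: "H : T.hcd"
 shows "shear_map s e ((T.orb H, w), t) = (T.orb (shear (s * t * w powi e) w H), 1 / w)"
proof -
 have Hc: "H : coord_space T.G" by (rule T.hc_domain_coord[OF H])
 obtain h where h: "h : tgroup T.G" "representative (T.orb H) = act h H" using T.representative_orbit[OF Hc] .
 show ?thesis using T.orbit_act[OF shear_coord[OF Hc] h(1)] by (simp add: shear_map_def h(2) shear_act[OF h(1)])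
qed

abbreviation "V \<equiv> prod_an T.TV punctured_line"

lemma curved_V: "curved V" by (rule curved_prod[OF T.curved_toric curved_punctured_line])

lemma points_V: "x : points V \<longleftrightarrow> (EX H:T.hcd. EX w. w ~= 0 & x = (T.orb H, w))"
 using T.points_toric points_punctured_line by (cases x) auto

lemma shear_map_inverse:
 assumes x: "x : points V"
 shows "shear_map s e (shear_map (- s) (cv $ i1 - e) (x, t), t) = x"
proof -
 obtain H w where H: "H : T.hcd" "w ~= 0" "x = (T.orb H, w)" using x points_V by blast
 let ?K = "shear (- s * t * w powi (cv $ i1 - e)) w H"
 have K: "?K : T.hcd" by (rule shear_domain[OF H(1,2)])
 have ww: "weight (1 / w) v * weight w v = 1" for v using H(2) by (simp add: weight_def power_int_divide_distrib)
 have we: "weight (1 / w) e1 = w powi (- cv $ i1)"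
  using e1(1) by (simp add: weight_def pairing_def axis_def power_int_minus power_int_inverse inverse_eq_divide[symmetric]
   if_distrib[of "%y. _ * y"] cong: if_cong)
 \<comment> \<open>Inverting \<open>w\<close> undoes the weight, and the power acquired by the first
   added multiple of \<open>H a1\<close> is the one at which the second shear cancels it.\<close>
 have "w powi (- cv $ i1) * (s * t * w powi (cv $ i1 - e)) = s * t * (1 / w) powi e"
  using H(2) by (simp add: power_int_diff power_int_minus power_int_divide_distrib field_simps)
 hence "shear (s * t * (1 / w) powi e) (1 / w) ?K v = H v" for v
  using ww[of v] e1(3) weight_a1 we by (auto simp: shear_def algebra_simps)
 hence "shear (s * t * (1 / w) powi e) (1 / w) ?K = H" by blast
 thus ?thesis unfolding H(3) shear_map_orbit[OF H(1)] using shear_map_orbit[OF K] by simp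
qed

lemma morphism_shear_map: "morphism (prod_an V complex_line) V (shear_map s e)"
proof -
 note P = curved_punctured_line and C = curved_complex_line and H = T.curved_HC
 let ?L = "prod_an punctured_line complex_line"
 note L = curved_prod[OF P C]
 let ?E = "prod_an T.HC ?L"
 note E = curved_prod[OF H L]
 have pE: "points ?E = T.hcd \<times> ((UNIV - {0}) \<times> UNIV)" using T.points_HC points_punctured_line by simp
 have oE: "opn ?E (points ?E)" by blast
 have h: "(%x. fst x v) : funs ?E (points ?E)" for v by (rule funs_pullback[OF morphism_fst[OF H L], of "%x. x v"])
   (use coord_fun_subspace[OF T.finite_gens T.open_hc_domain] T.points_HC in simp)
 have w: "(%x. fst (snd x)) : funs ?E (points ?E)"
  using morphism_compose[OF morphism_compose[OF morphism_snd[OF H L] morphism_fst[OF P C]]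
   morphism_subspace_incl[OF C open_punctured]] morphism_complex_line[OF E] by (simp add: comp_def)
 have t: "(%x. snd (snd x)) : funs ?E (points ?E)"
  using morphism_compose[OF morphism_snd[OF H L] morphism_snd[OF P C]] morphism_complex_line[OF E]
  by (simp add: comp_def)
 have w0: "fst (snd x) ~= 0" if "x : points ?E" for x using that unfolding pE by auto
 note c = curved_const[OF E oE]
 note pw = funs_power_int[OF E oE w w0]
 have wt: "(%x. weight (fst (snd x)) v) : funs ?E (points ?E)" for v
  using pw c by (cases "v : basis_vecs l") (simp_all add: weight_def)
 let ?f = "%x. shear (s * snd (snd x) * fst (snd x) powi e) (fst (snd x)) (fst x)"
 have "morphism ?E (affine_an T.G) ?f"
 proof (rule morphism_into_affine[OF E T.finite_gens])
  show "?f x : coord_space T.G" if "x : points ?E" for x using shear_coord T.hc_domain_coord that unfolding pE by auto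
  fix v
  have "(%x. weight (fst (snd x)) v * fst x v + s * snd (snd x) * fst (snd x) powi e * fst x a1) : funs ?E (points ?E)"
   by (intro funs_add[OF E oE] funs_mult[OF E oE] wt h c t pw)
  moreover have "(%x. weight (fst (snd x)) v * fst x v) : funs ?E (points ?E)" by (intro funs_mult[OF E oE] wt h)
  ultimately show "(%x. ?f x v) : funs ?E (points ?E)" by (cases "v = e1") (simp_all add: shear_def)
 qed
 hence "morphism ?E T.HC ?f"
 proof (rule morphism_into_subspace[OF E], intro image_subsetI shear_domain)
  show "fst x : T.hcd" if "x : points ?E" for x using that unfolding pE by auto
 qed (erule w0)
 from morphism_compose[OF this final_map_morphism[OF T.final_toric]]
 have 1: "morphism ?E T.TV (%x. T.orb (?f x))" by (simp add: comp_def)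
 have "(%x. 1 / fst (snd x)) : funs ?E (points ?E)" using pw[of "- 1"] by (simp add: divide_inverse)
 hence 2: "morphism ?E punctured_line (%x. 1 / fst (snd x))" by (rule morphism_punctured_line[OF E]) (use w0 in simp)
 \<comment> \<open>\<open>final_map_prod\<close> descends along the orbit map as first factor, so
   the two line factors are grouped together before descending; the association is changed back
   afterwards.\<close>
 let ?g = "shear_map s e \<circ> (%x. ((fst x, fst (snd x)), snd (snd x)))"
 have "morphism ?E V (?g \<circ> map_prod (T.orb) id)"
  by (rule morphism_cong[OF E curved_V morphism_pair[OF T.curved_toric P E 1 2]])
   (use shear_map_orbit in \<open>auto simp: pE\<close>)
 from morphism_final[OF final_map_prod[OF H L T.final_toric T.open_orbit_map] this]
 have m: "morphism (prod_an T.TV ?L) V ?g" .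
 note VC = curved_prod[OF curved_V C] and T' = T.curved_toric
 have f: "morphism (prod_an V complex_line) T.TV (fst \<circ> fst)"
  and g: "morphism (prod_an V complex_line) punctured_line (snd \<circ> fst)"
  using morphism_compose morphism_fst[OF curved_V C] morphism_fst[OF T' P] morphism_snd[OF T' P] by blast+
 have "morphism (prod_an V complex_line) (prod_an T.TV ?L)
   (%z. ((fst \<circ> fst) z, ((snd \<circ> fst) z, snd z)))"
  by (rule morphism_pair[OF T' L VC f morphism_pair[OF P C VC g morphism_snd[OF curved_V C]]])
 from morphism_compose[OF this m] show ?thesis by (simp add: comp_def)
qed

lemma isomorphism_shear_map: "isomorphism V V (%x. shear_map s e (x, t))"
proof -
 note C = curved_complex_line
 have m: "morphism V V (%x. shear_map s' e' (x, t))" for s' e'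
  using morphism_compose[OF morphism_pair[OF curved_V C curved_V morphism_id[OF curved_V]
   morphism_const[OF curved_V C]] morphism_shear_map] by (simp add: comp_def)
 have "isomorphism_pair V V (%x. shear_map s e (x, t)) (%x. shear_map (- s) (cv $ i1 - e) (x, t))"
  unfolding isomorphism_pair_def
  using m shear_map_inverse[of _ s e t] shear_map_inverse[of _ "- s" "cv $ i1 - e" t] by simp
 thus ?thesis unfolding isomorphism_def by blast
qed

end

section \<open>The family of the theorem\<close>

declare One_nat_def [simp del]

text \<open>Charts are chosen once per cone and not once per point, which makes the atlas
  finite.\<close>

lemma (in half) fibred_atlas_exists: "EX C. fibred_atlas CARD('d) U.TV C"
proof -
 let ?P = "%cn (ps, ph). open_emb (affine_an {..<CARD('d) + 1}) (prod_an U.TV complex_line) ps ph &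
  (ALL x. snd (ps x) = x CARD('d)) & ps ` points (affine_an {..<CARD('d) + 1}) = (U.orb ` U.chart cn) \<times> UNIV"
 define S where "S = {cn\<in>Fn'. EX c. ?P cn c}"
 define f where "f = (%cn. SOME c. ?P cn c)"
 have f: "?P cn (f cn)" if "cn : S" for cn
 proof -
  have "EX c. ?P cn c" using that unfolding S_def by simp
  thus ?thesis unfolding f_def by (rule someI_ex)
 qed
 have "points U.TV \<times> UNIV \<subseteq> (\<Union>(ps, ph)\<in>f ` S. ps ` points (affine_an {..<CARD('d) + 1}))"
 proof clarify
  fix p and t :: complex assume "p : points U.TV"
  then obtain X where X: "X : U.hcd" "p = U.orb X" unfolding U.points_toric by blast
  obtain ps ph where c: "open_emb (affine_an {..<CARD('d) + 1}) (prod_an U.TV complex_line) ps ph"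
    "\<And>t. (U.orb X, t) : ps ` points (affine_an {..<CARD('d) + 1})"
    "\<And>x. snd (ps x) = x CARD('d)"
    "EX cn:Fn'. lattice_basis UNIV (U.cg cn) &
     ps ` points (affine_an {..<CARD('d) + 1}) = (U.orb ` U.chart cn) \<times> UNIV"
   by (rule product_chart[OF X(1)]) (rule that)
  then obtain cn where cn: "cn : Fn'"
    "ps ` points (affine_an {..<CARD('d) + 1}) = (U.orb ` U.chart cn) \<times> UNIV" by blast
  have "?P cn (ps, ph)" using c(1,3) cn(2) by simp
  hence s: "cn : S" using cn(1) unfolding S_def by blast
  obtain ps' ph' where f': "f cn = (ps', ph')" by (cases "f cn")
  have "ps' ` points (affine_an {..<CARD('d) + 1}) = (U.orb ` U.chart cn) \<times> UNIV" using f[OF s] f' by simp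
  hence "(p, t) : ps' ` points (affine_an {..<CARD('d) + 1})" using c(2)[of t] cn(2) X(2) by simp
  moreover have "(ps', ph') : f ` S" using s f' by (metis image_eqI)
  ultimately show "(p, t) : (\<Union>(ps, ph)\<in>f ` S. ps ` points (affine_an {..<CARD('d) + 1}))" by blast
 qed
 moreover have "countable (f ` S)" unfolding S_def using finite_fan by (simp add: countable_finite)
 moreover have "open_emb (affine_an {..<CARD('d) + 1}) (prod_an U.TV complex_line) ps ph &
   (ALL x. snd (ps x) = x CARD('d))" if "(ps, ph) : f ` S" for ps ph
 proof -
  from that obtain cn where "cn : S" "f cn = (ps, ph)" by force
  thus ?thesis using f[of cn] by simp
 qed
 ultimately have "fibred_atlas CARD('d) U.TV (f ` S)" unfolding fibred_atlas_def by fast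
 thus ?thesis ..
qed

lemma (in half) points_nonempty: "points U.TV ~= {}"
proof -
 obtain cn where cn: "cn : Fn'" using fanD(2)[OF U.fan] by blast
 have "(%v. if v : U.G then 1 else 0) : U.chart cn" unfolding U.hc_chart_iff by (simp add: coord_space_def)
 thus ?thesis using cn unfolding U.points_toric hc_domain_def by blast
qed

lemma tilde_coords_eq:
 assumes "\<And>v. v ~: basis_vecs l \<union> a ` {1..r} ==> H v = 0"
  and "\<And>i. i ~= l ==> H (axis i 1) = x i" and "\<And>j. j : {1..r} ==> H (a j) = y j"
 shows "tilde_coords l r a x y = H" unfolding tilde_coords_def
proof (rule the_equality)
 fix H' assume H': "(ALL i. i ~= l --> H' (axis i 1) = x i) & (ALL j:{1..r}. H' (a j) = y j) &
   (ALL v. v ~: basis_vecs l \<union> a ` {1..r} --> H' v = 0)"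
 show "H' = H"
 proof
  fix v
  consider i where "i ~= l" "v = axis i 1" | j where "j : {1..r}" "v = a j" | "v ~: basis_vecs l \<union> a ` {1..r}"
   unfolding basis_vecs_def by blast
  thus "H' v = H v" using H' assms by cases simp_all
 qed
qed (use assms in blast)

text \<open>Unfolds the normalisation into monomials; their exponents are the values of the dual
  basis \<open>m0\<close> on the generators being normalised.\<close>

lemma (in half) J_formula:
 fixes p
 assumes gt: "T.G = basis_vecs l \<union> a ` {1..r}" and disj_a: "a ` {1..r} \<inter> basis_vecs l = {}"
 defines "X \<equiv> representative p"
 shows "J p = (T.orb (tilde_coords l r a
   (%i. X (axis i 1) * (\<Prod>j=2..M. X (bt j) powi (bt j $ i - eps * bt 1 $ i * bt j $ l))) (%j. X (a j))),
   X (bt 1) * (\<Prod>j=2..M. X (bt j) powi (eps * bt j $ l)))"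
proof -
 have inj2: "inj_on bt {2..M}" using inj by (rule inj_on_subset) auto
 have Z: "(\<Prod>u\<in>Z0. f u) = (\<Prod>j=2..M. f (bt j))" for f :: "int^'d => complex"
  unfolding Z0_def by (rule prod.reindex[OF inj2, unfolded comp_def])
 have b: "axis i 1 : basis_vecs l" if "i ~= l" for i using that by (auto simp: basis_vecs_def)
 have N1: "N X (axis i 1) = X (axis i 1) * (\<Prod>j=2..M. X (bt j) powi (bt j $ i - eps * bt 1 $ i * bt j $ l))"
  if "i ~= l" for i using b[OF that] by (simp add: N_def norm_coords_def B0_def Z m0_axis[OF that])
 have N2: "N X (bt 1) = X (bt 1) * (\<Prod>j=2..M. X (bt j) powi (eps * bt j $ l))"
  by (simp add: N_def norm_coords_def B0_def Z m0_bt1)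
 have N3: "N X (a j) = X (a j)" if "j : {1..r}" for j
 proof -
  have "a j : Gt" using gt that by blast
  hence "a j ~: Z0" "a j ~= bt 1" using Z0_notin bt1_notin by metis+
  moreover have "a j ~: basis_vecs l" using disj_a that by blast
  ultimately show ?thesis by (simp add: N_def norm_coords_def B0_def)
 qed
 have "tilde_coords l r a (%i. X (axis i 1) * (\<Prod>j=2..M. X (bt j) powi (bt j $ i - eps * bt 1 $ i * bt j $ l)))
   (%j. X (a j)) = rs (N X)"
 proof (rule tilde_coords_eq)
  show "rs (N X) v = 0" if "v ~: basis_vecs l \<union> a ` {1..r}" for v using that gt by (simp add: rs_def)
  show "rs (N X) (axis i 1) = X (axis i 1) * (\<Prod>j=2..M. X (bt j) powi (bt j $ i - eps * bt 1 $ i * bt j $ l))"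
   if "i ~= l" for i using N1[OF that] b[OF that] basis by (auto simp: rs_def)
  show "rs (N X) (a j) = X (a j)" if "j : {1..r}" for j
  proof -
   have "a j : Gt" using gt that by blast
   thus ?thesis using N3[OF that] by (simp add: rs_def)
  qed
 qed
 thus ?thesis unfolding N2[symmetric] by (simp add: J_def X_def Let_def)
qed

lemma isomorphism_cong:
 assumes "isomorphism X Y f" "curved X" "curved Y" "\<And>x. x : points X ==> f x = g x"
 shows "isomorphism X Y g"
proof -
 obtain h where h: "morphism X Y f" "morphism Y X h" "ALL x:points X. h (f x) = x" "ALL y:points Y. f (h y) = y"
  using assms(1) by (auto simp: isomorphism_def isomorphism_pair_def)
 have "isomorphism_pair X Y g h"
  unfolding isomorphism_pair_def using morphism_cong[OF assms(2,3) h(1) assms(4)] h assms(4) morphism_in[OF h(2)]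
  by metis
 thus ?thesis by (auto simp: isomorphism_def)
qed

text \<open>Of the isomorphism type of the hypersurface only the first coordinates of the generators
  survive here; the family and its special fiber follow from these and the shape of the fan.\<close>

locale deformation =
 fixes i1 l :: "'d::finite" and Fn Fnt :: "(real^'d) set set" and r m n k :: nat
  and a b c :: "nat => int^'d"
 assumes i1: "i1 ~= l" and complete: "complete_fan UNIV Fn"
  and complete_t: "complete_fan (hyperplane_lattice l) Fnt" and sub: "Fnt \<subseteq> Fn"
  and r: "1 \<le> r" and m: "1 \<le> m" and n: "1 \<le> n"
  and disj_a: "a ` {1..r} \<inter> basis_vecs l = {}"
  and gens_t: "gens Fnt = basis_vecs l \<union> a ` {1..r}"
  and inj_b: "inj_on b {1..m}" and disj_b: "b ` {1..m} \<inter> gens Fnt = {}"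
  and gens_b: "gens (upper_fan l Fn) = b ` {1..m} \<union> gens Fnt"
  and inj_c: "inj_on c {1..n}" and disj_c: "c ` {1..n} \<inter> gens Fnt = {}"
  and gens_c: "gens (lower_fan l Fn) = c ` {1..n} \<union> gens Fnt"
  and b1: "b 1 = axis l 1"
  and c1_cone: "cone_gen (basis_vecs l \<union> {c 1}) : lower_fan l Fn"
  and first_coord: "\<And>v. v : gens Fnt ==> v ~= axis i1 1 ==> v ~= a 1 ==> v $ i1 = 0"
  and a1_coord: "a 1 $ i1 = - 1"
begin

sublocale sp: split_fan l Fn Fnt by unfold_locales
  (use complete complete_t sub coordinate_lattice_UNIV coordinate_lattice_hyperplane in \<open>auto simp: complete_fan_def\<close>)

text \<open>The functional dual to \<open>c 1\<close> kills the basis vectors of the hyperplane, so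
  it is a multiple of the last coordinate. Its value 1 at \<open>c 1\<close> makes that coordinate a
  divisor of 1, and the sign is that of the lower half.\<close>

lemma c1: "c 1 $ l = - 1"
proof -
 have c1: "c 1 : c ` {1..n}" using n by simp
 hence "c 1 : gens (lower_fan l Fn)" using gens_c by blast
 hence g: "c 1 : gens Fn" "c 1 $ l \<le> 0" using sp.gens_half_iff[of _ "- 1"] sp.lower_fan_eq by auto
 let ?cn = "cone_gen (basis_vecs l \<union> {c 1})"
 have cn: "?cn : Fn" using c1_cone by (simp add: lower_fan_def)
 obtain B \<mu> where B: "dual_to B \<mu>" "cone_gens Fn ?cn \<subseteq> B" by (rule sp.S.cone[OF cn]) (rule that)
 have "basis_vecs l \<union> {c 1} \<subseteq> gens Fn" using g(1) gens_t sp.gens_t_sub by blast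
 hence "basis_vecs l \<union> {c 1} \<subseteq> cone_gens Fn ?cn"
  unfolding cone_gens_def using gen_in_cone_gen[of _ "basis_vecs l \<union> {c 1}"] by fast
 hence BB: "basis_vecs l \<union> {c 1} \<subseteq> B" using B(2) by blast
 have z: "\<mu> (c 1) $ i = 0" if "i ~= l" for i
 proof -
  have e: "axis i 1 : basis_vecs l" using that by (auto simp: basis_vecs_def)
  have "axis i 1 : gens Fnt" using e gens_t by blast
  hence ne: "c 1 ~= axis i 1" using c1 disj_c by fastforce
  have "pairing (\<mu> (c 1)) (axis i 1) = (if c 1 = axis i 1 then 1 else 0)"
   using B(1) BB e unfolding dual_to_def by blast
  hence "pairing (\<mu> (c 1)) (axis i 1) = 0" using ne by simp
  thus ?thesis by (simp add: pairing_def axis_def if_distrib[of "%y. _ * y"] cong: if_cong)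
 qed
 have "1 = pairing (\<mu> (c 1)) (c 1)" using B(1) BB by (simp add: dual_to_def)
 also have "\<dots> = (\<Sum>i\<in>UNIV. if i = l then \<mu> (c 1) $ l * c 1 $ l else 0)"
  unfolding pairing_def using z by (intro sum.cong) auto
 also have "\<dots> = \<mu> (c 1) $ l * c 1 $ l" by simp
 finally have "c 1 $ l dvd 1" by (metis dvd_triv_right)
 thus ?thesis using g(2) by (auto simp: zdvd1_eq abs_if split: if_splits)
qed

sublocale hp: half l "upper_fan l Fn" Fnt b m 1 unfolding sp.upper_fan_eq by (rule sp.half_interpretation)
  (use m inj_b disj_b gens_b gens_t b1 sp.upper_fan_eq in \<open>auto simp: axis_def\<close>)

sublocale hm: half l "lower_fan l Fn" Fnt c n "- 1" unfolding sp.lower_fan_eq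
 by (rule sp.half_interpretation) (use n inj_c disj_c gens_c gens_t c1 sp.lower_fan_eq in auto)

sublocale sh: shear_fan l Fnt i1 "a 1" "c 1"
proof
 have "a 1 : a ` {1..r}" using r by simp
 thus "a 1 : gens Fnt" "a 1 ~: basis_vecs l" using gens_t disj_a by blast+
 show "EX cn:Fnt. x : cn" if "x $ l = 0" for x using that sp.cover_t by blast
qed (use i1 gens_t a1_coord first_coord sp.gens_t_hyp in auto)

text \<open>Since \<open>b 1\<close> is the last basis vector, the correction in the dual basis
  vanishes at every index other than \<open>l\<close>, and \<open>tilde_coords\<close> does not read
  its argument at \<open>l\<close>.\<close>

lemma plus_ident_eq: "plus_ident l Fnt r m a b p = hp.J p"
proof -
 have z: "b 1 $ i = 0" if "i ~= l" for i using that by (simp add: b1 axis_def)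
 have "tilde_coords l r a (%i. representative p (axis i 1) * (\<Prod>j=2..m. representative p (b j) powi (b j $ i - 1 * b 1 $ i * b j $ l))) y =
   tilde_coords l r a (%i. representative p (axis i 1) * (\<Prod>j=2..m. representative p (b j) powi (b j $ i))) y" for y
  unfolding tilde_coords_def by (simp add: z cong: imp_cong)
 thus ?thesis unfolding hp.J_formula[OF gens_t disj_a] by (simp add: plus_ident_def Let_def)
qed

lemma minus_ident_eq: "minus_ident l Fnt r n a c p = hm.J p"
 unfolding hm.J_formula[OF gens_t disj_a] by (simp add: minus_ident_def Let_def)

lemma patching_map_eq:
 assumes x: "x : points sh.V"
 shows "patching_map i1 l Fnt r a c k t x = sh.shear_map 1 (int k) (x, t)"
proof -
 obtain H w where H: "H : sp.T.hcd" "x = (sp.T.orb H, w)" using x sh.points_V by blast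
 have Hc: "H : coord_space sp.T.G" by (rule sp.T.hc_domain_coord[OF H(1)])
 obtain h where h: "h : tgroup sp.T.G" "representative (sp.T.orb H) = act h H"
  using sp.T.representative_orbit[OF Hc] .
 let ?H = "act h H"
 have c: "sh.shear (t * w ^ k) w ?H : coord_space sp.T.G" by (intro sh.shear_coord act_in_coord_space Hc)
 have b: "axis i 1 : basis_vecs l" if "i ~= l" for i using that by (auto simp: basis_vecs_def)
 have ax: "axis i 1 = axis i1 (1::int) \<longleftrightarrow> i = i1" for i by (simp add: axis_eq_axis)
 have "tilde_coords l r a (%i. if i = i1 then ?H (axis i1 1) * w powi (c 1 $ i1) + t * ?H (a 1) * w ^ k
   else ?H (axis i 1) * w powi (c 1 $ i)) (%j. ?H (a j)) = sh.shear (t * w ^ k) w ?H"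
 proof (rule tilde_coords_eq)
  show "sh.shear (t * w ^ k) w ?H v = 0" if "v ~: basis_vecs l \<union> a ` {1..r}" for v
   using that c gens_t by (simp add: coord_space_def)
  show "sh.shear (t * w ^ k) w ?H (axis i 1) = (if i = i1 then ?H (axis i1 1) * w powi (c 1 $ i1) + t * ?H (a 1) * w ^ k
   else ?H (axis i 1) * w powi (c 1 $ i))" if "i ~= l" for i
   using sh.weight_axis[OF that] by (cases "i = i1") (simp_all add: sh.shear_def ax mult_ac)
  show "sh.shear (t * w ^ k) w ?H (a j) = ?H (a j)" if "j : {1..r}" for j
  proof -
   have "a j ~: basis_vecs l" using disj_a that by blast
   moreover from this have "a j ~= axis i1 1" using b[OF i1] by metis
   ultimately show ?thesis by (simp add: sh.shear_def sh.weight_def)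
  qed
 qed
 thus ?thesis unfolding patching_map_def sh.shear_map_def H(2) by (simp add: h(2) Let_def cong: if_cong)
qed

lemma isomorphism_patching_map: "isomorphism sh.V sh.V (patching_map i1 l Fnt r a c k t)"
 by (rule isomorphism_cong[OF sh.isomorphism_shear_map sh.curved_V sh.curved_V]) (simp add: patching_map_eq)

abbreviation "Rt \<equiv> patching_relation i1 l Fn Fnt r m n a b c k"

lemma Rt_iff: "(p, q) : Rt t \<longleftrightarrow> p : hp.A & q : hm.A & hp.J p = sh.shear_map 1 (int k) (hm.J q, t)"
 unfolding patching_relation_def plus_ident_eq minus_ident_eq hp.A_eq[symmetric] hm.A_eq[symmetric]
 using patching_map_eq[OF hm.J_in] by (auto simp del: top_of_prod_an)

definition "CX = (SOME C. fibred_atlas CARD('d) hp.U.TV C)"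
definition "CY = (SOME C. fibred_atlas CARD('d) hm.U.TV C)"

sublocale fam: patched_family "hp.U.TV" "hm.U.TV" sh.V
  hp.A hm.A hp.J hp.J' hm.J hm.J' "sh.shear_map 1 (int k)" "sh.shear_map (- 1) (c 1 $ i1 - int k)"
  hp.zf hm.zf "CARD('d)" CX CY Rt
proof
 show "sh.shear_map (- 1) (c 1 $ i1 - int k) (sh.shear_map 1 (int k) (v, t), t) = v" if "v : points sh.V" for v t
  using sh.shear_map_inverse[OF that, of "- 1" "c 1 $ i1 - int k" t] by simp
 show "sh.shear_map 1 (int k) (sh.shear_map (- 1) (c 1 $ i1 - int k) (v, t), t) = v" if "v : points sh.V" for v t
  by (rule sh.shear_map_inverse[OF that])
 show "hp.zf p * hm.zf q = 1" if "(p, q) : Rt t" for t p q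
 proof -
  from that have pq: "p : hp.A" "q : hm.A" "hp.J p = sh.shear_map 1 (int k) (hm.J q, t)" using Rt_iff by auto
  hence "hp.zf p = 1 / hm.zf q"
   using hp.zf_J[OF pq(1)] hm.zf_J[OF pq(2)] by (cases "hm.J q") (simp add: sh.shear_map_def)
  moreover have "hm.zf q ~= 0" using hm.zf_eq_0 pq(2) openin_subset[OF hm.open_A] by blast
  ultimately show ?thesis by simp
 qed
 show "fibred_atlas CARD('d) hp.U.TV CX" unfolding CX_def by (rule someI_ex[OF hp.fibred_atlas_exists])
 show "fibred_atlas CARD('d) hm.U.TV CY" unfolding CY_def by (rule someI_ex[OF hm.fibred_atlas_exists])
qed (fact hp.U.curved_toric hm.U.curved_toric sh.curved_V hp.open_A hm.open_A hp.morphism_J hp.morphism_J'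
 hm.morphism_J hm.morphism_J' hp.J'_J hp.J_J' hm.J'_J hm.J_J' sh.morphism_shear_map Rt_iff hp.morphism_zf
 hm.morphism_zf hp.zf_eq_0 hm.zf_eq_0 hp.Hausdorff hm.Hausdorff hp.compact_sublevel hm.compact_sublevel
 hp.points_nonempty)+

lemma family: "complex_analytic_family CARD('d) (total_space i1 l Fn Fnt r m n a b c k) family_parameter
  (patched_variety i1 l Fn Fnt r m n a b c k)"
 using fam.family unfolding fam.Rtot_def total_space_def patched_variety_def .

sublocale ip: subfan "upper_fan l Fn" Fn hp.B0 hp.m0 unfolding sp.upper_fan_eq
 by (rule sp.subfan_interpretation) (use hp.B0_sub hp.dual_m0 hp.m0_exp sp.upper_fan_eq in auto)

sublocale im: subfan "lower_fan l Fn" Fn hm.B0 hm.m0 unfolding sp.lower_fan_eq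
 by (rule sp.subfan_interpretation) (use hm.B0_sub hm.dual_m0 hm.m0_exp sp.lower_fan_eq in auto)

lemma gens_all: "sp.S.G = sp.T.G \<union> b ` {1..m} \<union> c ` {1..n}"
proof
 show "sp.S.G \<subseteq> sp.T.G \<union> b ` {1..m} \<union> c ` {1..n}"
 proof
  fix v assume "v : sp.S.G"
  hence "v : hp.U.G \<or> v : hm.U.G" unfolding sp.upper_fan_eq sp.lower_fan_eq sp.gens_half_iff by auto
  thus "v : sp.T.G \<union> b ` {1..m} \<union> c ` {1..n}" using gens_b gens_c by blast
 qed
 show "sp.T.G \<union> b ` {1..m} \<union> c ` {1..n} \<subseteq> sp.S.G"
  using ip.gens_sub im.gens_sub gens_b gens_c by blast
qed

lemma disj_bc: "b ` {1..m} \<inter> c ` {1..n} = {}" using hp.pos hm.pos by fastforce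

lemma bc: "b 1 ~: sp.T.G" "c 1 ~: sp.T.G" "b 1 ~= c 1" "b 1 : sp.S.G" "c 1 : sp.S.G"
  "b 1 ~: c ` {1..n}" "c 1 ~: b ` {1..m}"
proof -
 show "b 1 ~: sp.T.G" "c 1 ~: sp.T.G" by (fact hp.bt1_notin hm.bt1_notin)+
 show "b 1 : sp.S.G" "c 1 : sp.S.G" using hp.bt1_in hm.bt1_in gens_all by simp_all
 show "b 1 ~: c ` {1..n}" "c 1 ~: b ` {1..m}" using hp.bt1_in hm.bt1_in disj_bc by fast+
 thus "b 1 ~= c 1" using hp.bt1_in by metis
qed

lemma Z0s: "v : hp.Z0 \<union> hm.Z0 ==> v ~: sp.T.G & v ~= b 1 & v ~= c 1 & v : sp.S.G"
proof (elim UnE)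
 assume v: "v : hp.Z0"
 have "v : b ` {1..m}" using v unfolding hp.Gb_eq by blast
 hence "v ~= c 1" "v : sp.S.G" using bc(7) gens_all by blast+
 thus ?thesis using hp.Z0_notin[OF v] hp.bt1_Z0 v by metis
next
 assume v: "v : hm.Z0"
 have "v : c ` {1..n}" using v unfolding hm.Gb_eq by blast
 hence "v ~= b 1" "v : sp.S.G" using bc(6) gens_all by blast+
 thus ?thesis using hm.Z0_notin[OF v] hm.bt1_Z0 v by metis
qed

lemma gens_all': "sp.S.G = insert (b 1) (insert (c 1) sp.T.G) \<union> (hp.Z0 \<union> hm.Z0)"
 unfolding gens_all hp.Gb_eq hm.Gb_eq by blast

text \<open>The last character compares the values at \<open>b_1\<close> and \<open>c_1\<close>, and
  the other characters see \<open>c_1\<close> only through \<open>w^{c_{1,i}}\<close>, which the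
  weight absorbs. This is the origin of \<open>z = 1 / w\<close> and of the powers of
  \<open>w\<close> in the gluing.\<close>

lemma tgroup_split:
 assumes one: "\<And>v. v : hp.Z0 \<union> hm.Z0 ==> g v = 1" and w: "w ~= 0" and g: "g (b 1) = z" "g (c 1) = w" and z: "z ~= 0"
 shows "g : tgroup sp.S.G \<longleftrightarrow> z = w & (%v. g v * sh.weight w v) : tgroup sp.T.G"
proof -
 note all = gens_all'
 have P: "(\<Prod>v\<in>sp.S.G. g v powi (v $ i)) = z powi (b 1 $ i) * (w powi (c 1 $ i) * (\<Prod>v\<in>sp.T.G. g v powi (v $ i)))" for i
 proof -
  have "(\<Prod>v\<in>sp.S.G. g v powi (v $ i)) = (\<Prod>v\<in>insert (b 1) (insert (c 1) sp.T.G). g v powi (v $ i))"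
   by (rule prod.mono_neutral_right) (use sp.S.finite_gens all one in auto)
  thus ?thesis using bc sp.T.finite_gens g by simp
 qed
 have Q: "(\<Prod>v\<in>sp.T.G. (g v * sh.weight w v) powi (v $ i)) = w powi (c 1 $ i) * (\<Prod>v\<in>sp.T.G. g v powi (v $ i))"
  if i: "i ~= l" for i
 proof -
  have e: "axis i 1 : basis_vecs l" "axis i 1 : sp.T.G" using i gens_t by (auto simp: basis_vecs_def)
  have "(\<Prod>v\<in>sp.T.G. sh.weight w v powi (v $ i)) = (\<Prod>v\<in>{axis i 1}. sh.weight w v powi (v $ i))"
   by (rule prod.mono_neutral_right)
    (use sp.T.finite_gens e in \<open>auto simp: sh.weight_def basis_vecs_def axis_def\<close>)
  also have "\<dots> = w powi (c 1 $ i)" using sh.weight_axis[OF i, of w] by (simp add: axis_def)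
  finally show ?thesis by (simp add: power_int_mult_distrib prod.distrib mult.commute)
 qed
 have Ql: "(\<Prod>v\<in>sp.T.G. f v powi (v $ l)) = (1::complex)" for f using sp.gens_t_hyp by simp
 have nz: "(ALL v:sp.S.G. g v ~= 0) \<longleftrightarrow> (ALL v:sp.T.G. g v * sh.weight w v ~= 0)"
  unfolding all using one g w z sh.weight_nonzero[OF w] by auto
 have b1i: "b 1 $ i = (if i = l then 1 else 0)" for i by (simp add: b1 axis_def)
 have l0: "z powi (b 1 $ l) * (w powi (c 1 $ l) * (\<Prod>v\<in>sp.T.G. g v powi (v $ l))) = z / w"
  by (simp add: Ql b1i c1 power_int_minus divide_inverse)
 have "(ALL i. (\<Prod>v\<in>sp.S.G. g v powi (v $ i)) = 1) \<longleftrightarrow>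
   z = w & (ALL i. (\<Prod>v\<in>sp.T.G. (g v * sh.weight w v) powi (v $ i)) = 1)" (is "(ALL i. ?P i) \<longleftrightarrow> _ & (ALL i. ?Q i)")
 proof -
  have 3: "?Q l" by (rule Ql)
  have 1: "?P i \<longleftrightarrow> ?Q i" if "i ~= l" for i unfolding P Q[OF that] using that by (simp add: b1i)
  have 2: "?P l \<longleftrightarrow> z = w" unfolding P l0 using w by simp
  have all_split: "(ALL i. S i) \<longleftrightarrow> S l & (ALL i. i ~= l --> S i)" for S by metis
  have "(ALL i. ?P i) \<longleftrightarrow> ?P l & (ALL i. i ~= l --> ?P i)" by (rule all_split)
  also have "\<dots> \<longleftrightarrow> z = w & (ALL i. i ~= l --> ?Q i)" using 1 2 by simp
  also have "\<dots> \<longleftrightarrow> z = w & (ALL i. ?Q i)" using 3 all_split[of ?Q] by simp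
  finally show ?thesis .
 qed
 thus ?thesis unfolding tgroup_def using nz by blast
qed

text \<open>Points of the two halves coincide in the whole variety when their extensions by 1 are
  related by its group. \<open>tgroup_split\<close> decouples this into a condition on
  \<open>z\<close> and \<open>w\<close> and an equality of weighted orbits in the hypersurface,
  which is the transition at parameter 0.\<close>

lemma glue_iff:
 assumes p: "p : points hp.U.TV" and q: "q : points hm.U.TV"
 shows "(p, q) : Rt 0 \<longleftrightarrow> ip.\<iota> p = im.\<iota> q"
proof (cases "p : hp.A & q : hm.A")
 case True
 obtain H z where H: "H : sp.T.hcd" "z ~= 0" "hp.J p = (sp.T.orb H, z)" using hp.J_in True sh.points_V by metis
 obtain K w where K: "K : sp.T.hcd" "w ~= 0" "hm.J q = (sp.T.orb K, w)" using hm.J_in True sh.points_V by metis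
 have p: "p = hp.U.orb (hp.lift H z)" using hp.J'_J True H(3) hp.J'_orbit[OF H(1,2)] by metis
 have q: "q = hm.U.orb (hm.lift K w)" using hm.J'_J True K(3) hm.J'_orbit[OF K(1,2)] by metis
 let ?E = "ip.ext (hp.lift H z)" and ?E' = "im.ext (hm.lift K w)"
 note dH = hp.At_dom[OF hp.lift_At(1)[OF H(1,2)]] and dK = hm.At_dom[OF hm.lift_At(1)[OF K(1,2)]]
 note cE = ip.Dm_coord[OF ip.ext_Dm(1)[OF dH]] and cE' = im.Dm_coord[OF im.ext_Dm(1)[OF dK]]
 have Hc: "H : coord_space sp.T.G" and Kc: "K : coord_space sp.T.G" using sp.T.hc_domain_coord H(1) K(1) by blast+
 have E: "?E v = (if v : sp.T.G then H v else if v = b 1 then z else if v : sp.S.G then 1 else 0)" for v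
  using gens_b gens_all bc hp.bt1_in by (auto simp: ip.ext_def hp.lift_def)
 have E': "?E' v = (if v : sp.T.G then K v else if v = c 1 then w else if v : sp.S.G then 1 else 0)" for v
  using gens_c gens_all bc hm.bt1_in by (auto simp: im.ext_def hm.lift_def)
 have "ip.\<iota> p = im.\<iota> q \<longleftrightarrow> sp.S.orb ?E = sp.S.orb ?E'"
  unfolding p q ip.\<iota>_orbit[OF dH] im.\<iota>_orbit[OF dK] ..
 also have "\<dots> \<longleftrightarrow> (EX g:tgroup sp.S.G. ?E' = act g ?E)" by (rule sp.S.orbit_eq_iff[OF cE cE'])
 \<comment> \<open>The first extension has entries \<open>z\<close> and 1 at \<open>b_1\<close> and
   \<open>c_1\<close>, the second has 1 and \<open>w\<close>. So the multipliers there are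
   \<open>1 / z\<close> and \<open>w\<close>, and the last character makes them equal.\<close>
 also have "\<dots> \<longleftrightarrow> z = 1 / w & (EX h:tgroup sp.T.G. sh.shear 0 w K = act h H)"
 proof
  assume "EX g:tgroup sp.S.G. ?E' = act g ?E"
  then obtain g where g: "g : tgroup sp.S.G" "\<And>v. ?E' v = g v * ?E v" by (auto simp: act_def)
  have g1: "g v = 1" if "v : hp.Z0 \<union> hm.Z0" for v using g(2)[of v] Z0s[OF that] by (simp add: E E')
  have gb: "1 = g (b 1) * z" and gc: "w = g (c 1)" using g(2)[of "b 1"] g(2)[of "c 1"] bc by (simp_all add: E E')
  have "g (b 1) ~= 0" using gb by auto
  note s = iffD1[OF tgroup_split[where w = w, OF g1 K(2) refl gc[symmetric] this] g(1)]
  have "sh.shear 0 w K v = act (%v. g v * sh.weight w v) H v" for v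
   using g(2)[of v] Hc Kc by (cases "v : sp.T.G") (simp_all add: E E' sh.shear_zero act_def coord_space_def)
  thus "z = 1 / w & (EX h:tgroup sp.T.G. sh.shear 0 w K = act h H)"
   using s gb K(2) by (intro conjI bexI[of _ "%v. g v * sh.weight w v"]) (auto simp: field_simps)
 next
  assume "z = 1 / w & (EX h:tgroup sp.T.G. sh.shear 0 w K = act h H)"
  then obtain h where h: "z = 1 / w" "h : tgroup sp.T.G" "sh.shear 0 w K = act h H" by blast
  define g where "g = (%v. if v : sp.T.G then h v / sh.weight w v else if v = b 1 \<or> v = c 1 then w else 1)"
  have gh: "g v * sh.weight w v = h v" if "v : sp.T.G" for v
   using that sh.weight_nonzero[OF K(2)] by (simp add: g_def)
  have "(%v. g v * sh.weight w v) : tgroup sp.T.G" using h(2) gh by (simp add: tgroup_def)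
  moreover have "g v = 1" if "v : hp.Z0 \<union> hm.Z0" for v using Z0s[OF that] by (simp add: g_def)
  moreover have "g (b 1) = w" "g (c 1) = w" using bc by (simp_all add: g_def)
  ultimately have "g : tgroup sp.S.G" using tgroup_split[of g w w] K(2) by blast
  moreover have "?E' v = act g ?E v" for v
  proof (cases "v : sp.T.G")
   case True
   have "sh.weight w v * K v = h v * H v" using fun_cong[OF h(3), of v] by (simp add: sh.shear_zero act_def)
   thus ?thesis using True sh.weight_nonzero[OF K(2), of v] by (simp add: E E' act_def g_def field_simps)
  next
   case False
   thus ?thesis using bc h(1) K(2) unfolding act_def E E' g_def by simp
  qed
  ultimately show "EX g:tgroup sp.S.G. ?E' = act g ?E" by blast
 qed
 also have "\<dots> \<longleftrightarrow> hp.J p = sh.shear_map 1 (int k) (hm.J q, 0)"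
  unfolding H(3) K(3) sh.shear_map_orbit[OF K(1)] using sp.T.orbit_eq_iff[OF Hc sh.shear_coord[OF Kc, of 0 w]] by auto
 finally show ?thesis using True Rt_iff by blast
next
 case False
 \<comment> \<open>An extension by 1 from the other half is nonzero at every generator strictly on
   this side, hence so is the coordinate it is matched with. Equal images therefore lie in the
   overlap.\<close>
 have "p : hp.A & q : hm.A" if eq: "ip.\<iota> p = im.\<iota> q"
 proof -
  obtain X where X: "X : hp.U.hcd" "p = hp.U.orb X" using p hp.U.points_toric by auto
  obtain Y where Y: "Y : hm.U.hcd" "q = hm.U.orb Y" using q hm.U.points_toric by auto
  obtain g where g: "g : tgroup sp.S.G" "im.ext Y = act g (ip.ext X)"
   using eq sp.S.orbit_eq_iff[OF ip.Dm_coord[OF ip.ext_Dm(1)[OF X(1)]] im.Dm_coord[OF im.ext_Dm(1)[OF Y(1)]]]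
   unfolding X(2) Y(2) ip.\<iota>_orbit[OF X(1)] im.\<iota>_orbit[OF Y(1)] by blast
  have "X u ~= 0" if u: "u : b ` {1..m}" for u
  proof -
   have u': "u : hp.U.G" "u ~: hm.U.G" "u : sp.S.G" using u gens_b gens_c gens_all disj_bc disj_b by blast+
   thus ?thesis using fun_cong[OF g(2), of u] by (auto simp: im.ext_def ip.ext_def act_def)
  qed
  moreover have "Y u ~= 0" if u: "u : c ` {1..n}" for u
  proof -
   have u': "u : hm.U.G" "u ~: hp.U.G" "u : sp.S.G" using u gens_b gens_c gens_all disj_bc disj_c by blast+
   thus ?thesis using fun_cong[OF g(2), of u] tgroup_nonzero[OF g(1)] by (auto simp: im.ext_def ip.ext_def act_def)
  qed
  ultimately have "X : hp.At" "Y : hm.At" using X(1) Y(1) hp.At_iff hm.At_iff by simp_all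
  thus ?thesis using X(2) Y(2) by (simp add: hp.A_def hm.A_def)
 qed
 thus ?thesis using False Rt_iff by blast
qed

text \<open>The gluing and the variety are quotients of the same disjoint sum, and
  \<open>glue_iff\<close> shows that they identify the same points.\<close>

lemma special_fiber: "isomorphic (patched_variety i1 l Fn Fnt r m n a b c k 0) sp.S.TV"
proof -
 let ?X = "hp.U.TV" and ?Y = "hm.U.TV"
 interpret f: patching ?X ?Y hp.A hm.A "%p. hm.J' (sh.shear_map (- 1) (c 1 $ i1 - int k) (hp.J p, 0))"
  "%q. hp.J' (sh.shear_map 1 (int k) (hm.J q, 0))" "Rt 0" by (rule fam.patching_fiber)
 have cov: "points sp.S.TV = ip.\<iota> ` points ?X \<union> im.\<iota> ` points ?Y"
  unfolding ip.\<iota>_image im.\<iota>_image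
 proof
  show "points sp.S.TV \<subseteq> sp.S.orb ` ip.Dm \<union> sp.S.orb ` im.Dm"
  proof
   fix x assume "x : points sp.S.TV"
   then obtain X cn where X: "x = sp.S.orb X" "X : sp.S.chart cn" "cn : Fn"
    unfolding sp.S.points_toric hc_domain_def by blast
   have "(ALL v:sp.S.cg cn. 0 \<le> 1 * v $ l) \<or> (ALL v:sp.S.cg cn. 0 \<le> - 1 * v $ l)"
   proof (cases "EX v:sp.S.cg cn. v $ l > 0")
    case True
    thus ?thesis using sp.cone_sign[OF X(3)] by auto
   next
    case False
    thus ?thesis by (auto simp: not_less)
   qed
   hence "cn : upper_fan l Fn \<or> cn : lower_fan l Fn"
    unfolding sp.upper_fan_eq sp.lower_fan_eq sp.half_fan_iff using X(3) by blast
   thus "x : sp.S.orb ` ip.Dm \<union> sp.S.orb ` im.Dm" using X unfolding ip.Dm_def im.Dm_def by blast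
  qed
  show "sp.S.orb ` ip.Dm \<union> sp.S.orb ` im.Dm \<subseteq> points sp.S.TV"
   unfolding sp.S.points_toric using ip.Dm_dom im.Dm_dom by blast
 qed
 note fin = final_map_of_open_emb[OF hp.U.curved_toric hm.U.curved_toric sp.S.curved_toric
  ip.open_emb_\<iota> im.open_emb_\<iota> cov]
 show ?thesis unfolding patched_variety_def
 proof (rule final_map_isomorphic[OF final_map_patch fin])
  show "curved (sum_space ?X ?Y)" by (rule curved_sum[OF hp.U.curved_toric hm.U.curved_toric])
  fix e e' assume e: "e : points (sum_space ?X ?Y)" and e': "e' : points (sum_space ?X ?Y)"
  have 1: "f.inl x = f.inl x' \<longleftrightarrow> ip.\<iota> x = ip.\<iota> x'" if "x : points ?X" "x' : points ?X" for x x'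
   using f.inl_eq open_emb_inj[OF ip.open_emb_\<iota> that] by blast
  have 2: "f.inr x = f.inr x' \<longleftrightarrow> im.\<iota> x = im.\<iota> x'" if "x : points ?Y" "x' : points ?Y" for x x'
   using f.inr_eq open_emb_inj[OF im.open_emb_\<iota> that] by blast
  have 3: "f.inl x = f.inr y \<longleftrightarrow> ip.\<iota> x = im.\<iota> y" if "x : points ?X" "y : points ?Y" for x y
   using f.inl_inr_eq glue_iff[OF that] by blast
  have c: "patch_class (Rt 0) x = case_sum f.inl f.inr x" for x by (cases x) (simp_all add: f.inl_def f.inr_def)
  have "case_sum f.inl f.inr e = case_sum f.inl f.inr e' \<longleftrightarrow> case_sum ip.\<iota> im.\<iota> e = case_sum ip.\<iota> im.\<iota> e'"
  proof (cases e)
   case el: (Inl x)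
   hence x: "x : points ?X" using e by (auto simp: points_sum)
   show ?thesis
   proof (cases e')
    case (Inl x')
    hence "x' : points ?X" using e' by (auto simp: points_sum)
    thus ?thesis using 1[OF x] el Inl by simp
   next
    case (Inr y)
    hence "y : points ?Y" using e' by (auto simp: points_sum)
    thus ?thesis using 3[OF x] el Inr by simp
   qed
  next
   case er: (Inr y)
   hence y: "y : points ?Y" using e by (auto simp: points_sum)
   show ?thesis
   proof (cases e')
    case (Inl x')
    hence "x' : points ?X" using e' by (auto simp: points_sum)
    from 3[OF this y] show ?thesis unfolding er Inl sum.case by metis
   next
    case (Inr y')
    hence "y' : points ?Y" using e' by (auto simp: points_sum)
    thus ?thesis using 2[OF y] er Inr by simp
   qed
  qed
  thus "patch_class (Rt 0) e = patch_class (Rt 0) e' \<longleftrightarrow> case_sum ip.\<iota> im.\<iota> e = case_sum ip.\<iota> im.\<iota> e'"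
   unfolding c .
 qed
qed

end

section \<open>First coordinates of the generators, read off from the geometry of the
  hypersurface\<close>

section \<open>Regular functions along polynomial maps\<close>

text \<open>Functions on a parameter set, kept abstract so that one pullback lemma serves
  polynomials on a line as well as families of polynomials depending on a second parameter.\<close>

definition function_ring :: "('p => complex) set => bool" where
 "function_ring R \<longleftrightarrow> (ALL c. (%y. c) : R) & (ALL f:R. ALL g:R. (%y. f y + g y) : R & (%y. f y * g y) : R)"

lemma function_ring_prod:
 assumes "function_ring R" "finite I" "\<And>i. i : I ==> f i : R"
 shows "(%y. \<Prod>i\<in>I. f i y) : R"
 using assms(2,3) by (induction I rule: finite_induct) (use assms(1) in \<open>auto simp: function_ring_def\<close>)

lemma function_ring_sum:
 assumes "function_ring R" "finite I" "\<And>i. i : I ==> f i : R"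
 shows "(%y. \<Sum>i\<in>I. f i y) : R"
 using assms(2,3) by (induction I rule: finite_induct) (use assms(1) in \<open>auto simp: function_ring_def\<close>)

lemma function_ring_power: "function_ring R ==> f : R ==> (%y. f y ^ n) : R"
 by (induction n) (auto simp: function_ring_def)

lemma function_ring_poly_funs: "function_ring (poly_funs I)" by (auto simp: function_ring_def intro: poly_funs.intros)

lemma function_ring_poly: "function_ring (range poly :: (complex => complex) set)" unfolding function_ring_def
proof (intro conjI allI ballI)
 show "(%y. c) : range poly" for c :: complex by (rule range_eqI[of _ _ "[:c:]"]) auto
 fix f g :: "complex => complex" assume "f : range poly" "g : range poly"
 then obtain p q where pq: "f = poly p" "g = poly q" by blast
 show "(%y. f y + g y) : range poly" unfolding pq by (rule range_eqI[of _ _ "p + q"]) auto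
 show "(%y. f y * g y) : range poly" unfolding pq by (rule range_eqI[of _ _ "p * q"]) auto
qed

lemma poly_funs_compose:
 assumes "function_ring R" "\<And>i. i : I ==> (%y. gm y i) : R" "p : poly_funs I"
 shows "(%y. p (gm y)) : R"
 using assms(3) by (induction rule: poly_funs.induct) (use assms(1,2) in \<open>auto simp: function_ring_def\<close>)

lemma openin_affine_alg: "opn (affine_alg I) W \<longleftrightarrow> zariski_open I W"
 by (simp add: affine_alg_def topology_inverse' istopology_zariski_open)

lemma points_affine_alg: "points (affine_alg I) = coord_space I"
proof -
 have "zariski_open I (coord_space I)" unfolding zariski_open_def
  by (rule exI[of _ "{%x. 1}"]) (auto intro: poly_funs.const)
 thus ?thesis unfolding topspace_def openin_affine_alg by (auto simp: zariski_open_def)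
qed

lemma zariski_openD:
 assumes "zariski_open I W" "x : W"
 obtains p where "p : poly_funs I" "p x ~= 0" "\<And>y. y : coord_space I ==> p y ~= 0 ==> y : W"
 using assms unfolding zariski_open_def by blast

text \<open>Local fractions pull back to fractions over \<open>R\<close> once denominators are
  cleared; the conclusion is multiplicative because \<open>R\<close> has no division.\<close>

lemma regular_along:
 assumes R: "function_ring R" and gm: "\<And>i. i : I ==> (%y. gm y i) : R"
  and Y: "\<And>y. y : Y ==> gm y : D \<inter> coord_space I"
  and W: "openin (top_of (quotient_space (subspace_of (affine_alg I) D) q)) W"
  and g: "g : funs (quotient_space (subspace_of (affine_alg I) D) q) W"
  and y: "y : Y" "q (gm y) : W"
 obtains P S where "P : R" "S : R" "S y ~= 0"
  "\<And>y'. y' : Y ==> S y' ~= 0 ==> q (gm y') : W & g (q (gm y')) * S y' = P y'"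
proof -
 let ?E = "subspace_of (affine_alg I) D"
 let ?W = "{x : points ?E. q x : W}"
 have "opn ?E ?W" using W unfolding top_of_quotient by blast
 then obtain T where T: "zariski_open I T" "?W = T \<inter> D"
  unfolding top_of_subspace openin_subtopology openin_affine_alg by blast
 have gy: "gm y : ?W" using Y[OF y(1)] y(2) by (simp add: points_affine_alg)
 then obtain r where r: "r : poly_funs I" "r (gm y) ~= 0" "\<And>x. x : coord_space I ==> r x ~= 0 ==> x : T"
  using zariski_openD[OF T(1)] T(2) by blast
 have "g \<circ> q : funs ?E ?W" using g unfolding quotient_space_def by simp
 then obtain W' g' where W': "zariski_open I W'" "gm y : W'" "g' : funs (affine_alg I) W'"
   "\<And>x. x : ?W ==> x : W' ==> g (q x) = g' x" using gy unfolding funs_subspace openin_affine_alg by fastforce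
 obtain r' where r': "r' : poly_funs I" "r' (gm y) ~= 0" "\<And>x. x : coord_space I ==> r' x ~= 0 ==> x : W'"
  using zariski_openD[OF W'(1,2)] by blast
 obtain a b where ab: "a : poly_funs I" "b : poly_funs I" "b (gm y) ~= 0" "\<And>x. x : W' ==> b x ~= 0 ==> g' x = a x / b x"
  using W'(2,3) unfolding affine_alg_def by auto
 \<comment> \<open>The factors \<open>r\<close> and \<open>r'\<close> put into the denominator that
   the point lies in \<open>W\<close> and in the open set on which the fraction is valid, so its
   nonvanishing implies both.\<close>
 show thesis
 proof (rule that[of "%y. a (gm y) * (r (gm y) * r' (gm y))" "%y. b (gm y) * (r (gm y) * r' (gm y))"])
  have "(%y. p (gm y)) : R" if "p : poly_funs I" for p by (rule poly_funs_compose[OF R gm that])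
  thus "(%y. a (gm y) * (r (gm y) * r' (gm y))) : R" "(%y. b (gm y) * (r (gm y) * r' (gm y))) : R"
   using R ab(1,2) r(1) r'(1) by (auto simp: function_ring_def)
  show "b (gm y) * (r (gm y) * r' (gm y)) ~= 0" using ab r r' by simp
  fix y' assume y': "y' : Y" "b (gm y') * (r (gm y') * r' (gm y')) ~= 0"
  hence c: "gm y' : coord_space I" "gm y' : D" using Y by blast+
  have w: "gm y' : ?W" unfolding T(2) using r(3)[OF c(1)] y'(2) c(2) by simp
  hence "g (q (gm y')) = a (gm y') / b (gm y')" using W'(4) r'(3)[OF c(1)] ab(4) y'(2) by simp
  thus "q (gm y') : W & g (q (gm y')) * (b (gm y') * (r (gm y') * r' (gm y'))) = a (gm y') * (r (gm y') * r' (gm y'))"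
   using w y'(2) by simp
 qed
qed

text \<open>Take a denominator of least degree valid on the whole line. At a root, comparison with a
  local fraction shows that the numerator vanishes too, so a linear factor cancels, the value at the
  root being supplied by the local fraction. Hence there are no roots and the denominator is
  constant.\<close>

lemma regular_line_polynomial:
 fixes h :: "complex => complex"
 assumes h: "\<And>z. EX P S. poly S z ~= 0 & (ALL y. poly S y ~= 0 --> h y * poly S y = poly P y)"
 obtains P where "h = poly P"
proof -
 define Q where "Q = (%S. S ~= 0 & (EX P. ALL y. poly S y ~= 0 --> h y * poly S y = poly P y))"
 obtain P0 S0 where "poly S0 0 ~= 0" "ALL y. poly S0 y ~= 0 --> h y * poly S0 y = poly P0 y" using h by blast
 hence "Q S0" unfolding Q_def by auto
 then obtain S where S: "Q S" "\<And>S'. degree S' < degree S ==> \<not> Q S'"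
  using ex_has_least_nat[of Q S0 degree] by (metis not_le)
 then obtain P where P: "S ~= 0" "\<And>y. poly S y ~= 0 ==> h y * poly S y = poly P y" unfolding Q_def by blast
 \<comment> \<open>Two fractions of the same function agree off the finitely many zeros of the
   denominators, hence their cross products agree as polynomials.\<close>
 have eq: "P * S' = P' * S" if S': "S' ~= 0" "\<And>y. poly S' y ~= 0 ==> h y * poly S' y = poly P' y" for P' S'
 proof -
  have "(P * S' - P' * S) * (S * S') = 0"
  proof (rule ccontr)
   assume "\<not> ?thesis"
   then obtain y where "poly ((P * S' - P' * S) * (S * S')) y ~= 0" using poly_all_0_iff_0 by blast
   hence "poly P y * poly S' y ~= poly P' y * poly S y" "poly S y ~= 0" "poly S' y ~= 0" by auto
   thus False using P(2)[of y, symmetric] S'(2)[of y, symmetric] by simp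
  qed
  thus ?thesis using P(1) S'(1) by simp
 qed
 have nz: "poly S z ~= 0" for z
 proof
  assume z: "poly S z = 0"
  obtain P' S' where S': "poly S' z ~= 0" "ALL y. poly S' y ~= 0 --> h y * poly S' y = poly P' y" using h by blast
  hence "poly (P * S') z = poly (P' * S) z" using eq[of S' P'] by fastforce
  hence "poly P z = 0" using z S'(1) by simp
  define L where "L = [:- z, 1:]"
  obtain P1 S1 where d: "P = L * P1" "S = L * S1"
   using z \<open>poly P z = 0\<close> unfolding L_def by (auto simp: poly_eq_0_iff_dvd dvd_def)
  have L: "L ~= 0" "degree L = 1" "poly L y = y - z" for y by (auto simp: L_def)
  have S1: "S1 ~= 0" using P(1) d(2) by auto
  moreover have "h y * poly S1 y = poly P1 y" if y: "poly S1 y ~= 0" for y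
  proof (cases "y = z")
   case False
   hence "(y - z) * (h y * poly S1 y) = (y - z) * poly P1 y"
    using P(2)[of y] y by (simp add: d L(3) mult.left_commute)
   thus ?thesis using False by simp
  next
   case True
   have "S' ~= 0" using S'(1) by auto
   hence "L * (P1 * S') = L * (P' * S1)" using eq[of S' P'] S'(2) by (simp add: d mult_ac)
   hence "P1 * S' = P' * S1" using L(1) by simp
   hence "poly P1 z * poly S' z = poly P' z * poly S1 z" by (metis poly_mult)
   moreover have "h z * poly S' z = poly P' z" using S' by blast
   ultimately have "poly S' z * (h z * poly S1 z) = poly S' z * poly P1 z" by (simp add: mult_ac)
   thus ?thesis using S'(1) True by simp
  qed
  ultimately have "Q S1" unfolding Q_def by blast
  moreover have "degree S1 < degree S" using S1 L unfolding d(2) by (subst degree_mult_eq) auto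
  ultimately show False using S(2) by blast
 qed
 then obtain s where s: "S = [:s:]" using fundamental_theorem_of_algebra_alt[of S] by blast
 have c: "poly S y = poly S 0" for y by (simp add: s)
 have "h y = poly (smult (1 / poly S 0) P) y" for y
  using P(2)[OF nz, of y] nz[of 0] c[of y] by (simp add: field_simps)
 thus thesis using that[of "smult (1 / poly S 0) P"] by blast
qed

text \<open>After the full power of the variable is split off, no root is left, so the cofactor is
  constant by the fundamental theorem of algebra.\<close>

lemma regular_line_monomial:
 fixes h :: "complex => complex"
 assumes h: "\<And>z. EX P S. poly S z ~= 0 & (ALL y. poly S y ~= 0 --> h y * poly S y = poly P y)"
  and nz: "\<And>z. z ~= 0 ==> h z ~= 0"
 obtains c k where "c ~= 0" "\<And>z. h z = c * z ^ k"
proof -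
 obtain P where P: "h = poly P" by (rule regular_line_polynomial[OF h]) (rule that)
 have "P ~= 0" using nz[of 1] P by auto
 then obtain R where R: "P = [:- 0, 1:] ^ Polynomial.order 0 P * R" "\<not> [:- 0, 1:] dvd R" using order_decomp by blast
 have PR: "poly P z = poly R z * z ^ Polynomial.order 0 P" for z by (subst R(1)) (simp add: mult.commute)
 have nR: "poly R z ~= 0" for z
 proof (cases "z = 0")
  case True
  thus ?thesis using R(2) by (simp add: poly_eq_0_iff_dvd)
 next
  case False
  thus ?thesis using nz[OF False] PR[of z] unfolding P by auto
 qed
 then obtain s where s: "R = [:s:]" using fundamental_theorem_of_algebra_alt[of R] by blast
 show thesis by (rule that[of s "Polynomial.order 0 P"]) (use nR[of 0] PR in \<open>simp_all add: P s\<close>)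
qed

definition proj_point :: "('n::finite => complex) => ('n => complex) set" where
 "proj_point x = {(%i. c * x i) | c. c ~= 0}"

definition lin_form :: "('n::finite => complex) => ('n => complex) => complex" where
 "lin_form c x = (\<Sum>i\<in>UNIV. c i * x i)"

lemma lin_form_poly_funs: "lin_form c : poly_funs UNIV" unfolding lin_form_def[abs_def]
 by (intro function_ring_sum[OF function_ring_poly_funs] poly_funs.mult poly_funs.const poly_funs.coord) auto

lemma lin_form_scale: "lin_form c (%i. k * x i) = k * lin_form c x"
 by (simp add: lin_form_def sum_distrib_left mult_ac)

lemma proj_space_eq:
 "proj_space = quotient_space (subspace_of (affine_alg UNIV) (UNIV - {%_. 0})) proj_point"
 unfolding proj_space_def proj_point_def[abs_def] ..

lemma proj_point_scale:
 assumes "k ~= 0"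
 shows "proj_point (%i. k * x i) = proj_point x" unfolding proj_point_def
proof (intro equalityI subsetI; clarify)
 show "EX ca. (%i. c * (k * x i)) = (%i. ca * x i) & ca ~= 0" if "c ~= 0" for c
  using that assms by (intro exI[of _ "c * k"]) (simp add: mult.assoc)
 show "EX ca. (%i. c * x i) = (%i. ca * (k * x i)) & ca ~= 0" if "c ~= 0" for c
  using that assms by (intro exI[of _ "c / k"]) simp
qed

lemma in_proj_point: "r : proj_point x \<longleftrightarrow> (EX k. k ~= 0 & r = (%i. k * x i))"
 unfolding proj_point_def by blast

text \<open>Representatives of a point of projective space differ by a scalar, which cancels in a
  ratio of two linear forms.\<close>

lemma proj_ratio:
 fixes c d :: "'n::finite => complex"
 defines "W \<equiv> {y : points proj_space. lin_form d (representative y) ~= 0}"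
 shows "opn proj_space W" "(%y. lin_form c (representative y) / lin_form d (representative y)) : funs proj_space W"
  and "\<And>x :: 'n => complex. EX k. k ~= 0 & representative (proj_point x) = (%i. k * x i)"
  and "points proj_space = proj_point ` (UNIV - {%_ :: 'n. 0})"
proof -
 show rep: "EX k. k ~= 0 & representative (proj_point x) = (%i. k * x i)" for x :: "'n => complex"
 proof -
  have "(%i. 1 * x i) : proj_point x" unfolding in_proj_point by (intro exI[of _ 1] conjI refl) simp
  hence "representative (proj_point x) : proj_point x"
   unfolding representative_def by (rule someI[where P = "%r. r : proj_point x"])
  thus ?thesis by (simp add: in_proj_point)
 qed
 let ?E = "subspace_of (affine_alg (UNIV :: 'n set)) (UNIV - {%_. 0})"
 have cs: "coord_space (UNIV :: 'n set) = UNIV" by (auto simp: coord_space_def)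
 have pE: "points ?E = UNIV - {%_. 0}" by (simp add: points_affine_alg cs)
 note ps = proj_space_eq[where 'a = 'n]
 show pts: "points proj_space = proj_point ` (UNIV - {%_ :: 'n. 0})" unfolding ps points_quotient pE ..
 have l0: "lin_form d (representative (proj_point x)) ~= 0 \<longleftrightarrow> lin_form d x ~= 0"
  and r: "lin_form c (representative (proj_point x)) / lin_form d (representative (proj_point x)) = lin_form c x / lin_form d x" for x
  using rep[of x] by (auto simp: lin_form_scale)
 note lp = lin_form_poly_funs
 let ?T = "{x. lin_form d x ~= 0}"
 have T: "zariski_open UNIV ?T" unfolding zariski_open_def cs by (rule exI[of _ "{lin_form d}"]) (use lp in auto)
 have nz: "lin_form d (%_. 0) = 0" by (simp add: lin_form_def)
 have pre: "{x : points ?E. proj_point x : W} = ?T" unfolding W_def pts pE using l0 nz by auto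
 have o: "opn ?E ?T"
  unfolding top_of_subspace openin_subtopology openin_affine_alg by (rule exI[of _ ?T]) (use T nz in auto)
 thus "opn proj_space W"
 proof -
  assume o: "opn ?E ?T"
  have "W \<subseteq> proj_point ` points ?E" unfolding pE W_def pts by blast
  thus ?thesis unfolding ps top_of_quotient pre using o by (rule conjI)
 qed
 have f: "(%x. lin_form c x / lin_form d x) : funs (affine_alg UNIV) ?T" unfolding affine_alg_def using lp by auto
 have "(%y. lin_form c (representative y) / lin_form d (representative y)) \<circ> proj_point : funs ?E ?T"
  unfolding funs_subspace openin_affine_alg comp_def r using T f by blast
 thus "(%y. lin_form c (representative y) / lin_form d (representative y)) : funs proj_space W"
  unfolding ps quotient_space_def using pre by (simp add: ps)
qed

section \<open>Divisors of a complete toric variety\<close>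

context toric
begin

lemma zariski_hc_chart: "zariski_open G (chart cn)" unfolding zariski_open_def
proof (intro exI conjI)
 show "{%X. \<Prod>v\<in>G - cg cn. X v} \<subseteq> poly_funs G"
  using function_ring_prod[OF function_ring_poly_funs[of G], of "G - cg cn" "%v X. X v"] finite_gens
  by (simp add: poly_funs.coord)
qed (auto simp: hc_chart_def)

lemma points_alg_domain: "points (subspace_of (affine_alg G) (hcd)) = hcd"
 using hc_domain_coord by (auto simp: points_affine_alg)

lemma points_toric_alg: "points AV = orb ` hcd" unfolding toric_alg_def points_quotient points_alg_domain ..

lemma prime_divisor_iff:
 assumes X: "X : hcd" and w: "w : G"
 shows "orb X : prime_divisor Fn w \<longleftrightarrow> X w = 0"
proof
 assume "orb X : prime_divisor Fn w"
 then obtain Y where Y: "Y : hcd" "Y w = 0" "orb X = orb Y" by (auto simp: prime_divisor_def)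
 then obtain h where h: "h : tgroup G" "Y = act h X" using orbit_eq_iff[OF hc_domain_coord[OF X] hc_domain_coord] by blast
 show "X w = 0" using Y(2) tgroup_nonzero[OF h(1) w] by (simp add: h(2) act_def)
qed (use X in \<open>auto simp: prime_divisor_def\<close>)

lemma regular_along_toric:
 assumes R: "function_ring R" and gm: "\<And>v. v : G ==> (%y. gm y v) : R" and Y: "\<And>y. y : Y ==> gm y : hcd"
  and W: "opn AV W" "g : funs AV W" and y: "y : Y" "orb (gm y) : W"
 obtains P S where "P : R" "S : R" "S y ~= 0"
  "\<And>y'. y' : Y ==> S y' ~= 0 ==> orb (gm y') : W & g (orb (gm y')) * S y' = P y'"
 by (rule regular_along[OF R gm _ W[unfolded toric_alg_def] y]) (use Y hc_domain_coord that in blast)+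

text \<open>On the chart of a cone containing \<open>w\<close>, the divisor of \<open>w\<close> is cut out by the character dual
 to \<open>w\<close>, completed by the other homogeneous coordinates.\<close>

lemma local_equation:
 assumes cn: "cn : Fn" and w: "w : G"
 obtains U \<xi> where "opn AV U" "\<xi> : funs AV U"
  "\<And>X. X : chart cn ==> orb X : U" "\<And>c. c : U ==> \<xi> c = 0 \<longleftrightarrow> c : prime_divisor Fn w"
proof -
 obtain \<mu> where \<mu>: "dual_to (cg cn) \<mu>" by (rule cone_dual[OF cn])
 \<comment> \<open>For \<open>w\<close> outside the cone the character is trivial and the equation
   is the constant 1, in accordance with the divisor missing this chart.\<close>
 define m where "m = (if w : cg cn then \<mu> w else 0)"
 have m: "pairing m v = (if v = w then 1 else 0)" if "v : cg cn" for v
  using \<mu> that by (auto simp: m_def dual_to_def pairing_def)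
 define p where "p = (%X :: int^'d => complex. \<Prod>v\<in>G. X v ^ nat (pairing m v))"
 define q where "q = (%X :: int^'d => complex. \<Prod>v\<in>G. X v ^ nat (- pairing m v))"
 let ?U = "orb ` chart cn" and ?\<xi> = "%c. p (representative c) / q (representative c)"
 have sub: "chart cn \<subseteq> hcd" using cn by (auto simp: hc_domain_def)
 have "p (act h X) / q (act h X) = p X / q X" if h: "h : tgroup G" for h X
 proof -
  have "p h / q h = (\<Prod>v\<in>G. h v powi pairing m v)"
   unfolding p_def q_def prod_dividef[symmetric] using tgroup_nonzero[OF h]
   by (intro prod.cong refl) (auto simp: power_int_def power_inverse divide_inverse)
  hence "p h / q h = 1" using tgroup_pairing[OF h] by simp
  thus ?thesis by (simp add: p_def q_def act_def power_mult_distrib prod.distrib)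
 qed
 hence \<xi>: "?\<xi> (orb X) = p X / q X" if "X : chart cn" for X
  using representative_orbit[of X] that sub hc_domain_coord by (metis subsetD)
 have chart: "v : cg cn" if "X : chart cn" "v : G" "X v = 0" for X v using that unfolding hc_chart_iff by blast
 have q0: "q X ~= 0" if "X : chart cn" for X unfolding q_def prod_zero_iff[OF finite_gens]
 proof clarify
  fix v assume v: "v : G" "X v ^ nat (- pairing m v) = 0"
  thus False using m[OF chart[OF that v(1)]] by (cases "v = w") (auto simp: nat_0_iff)
 qed
 have p0: "p X = 0 \<longleftrightarrow> X w = 0" if X: "X : chart cn" for X
 proof
  assume "p X = 0"
  then obtain v where v: "v : G" "X v = 0" "nat (pairing m v) ~= 0" unfolding p_def using finite_gens by (auto simp: prod_zero_iff)
  thus "X w = 0" using m[OF chart[OF X v(1,2)]] by (auto split: if_splits)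
 next
  assume 0: "X w = 0"
  hence "pairing m w = 1" using m[OF chart[OF X w]] by simp
  thus "p X = 0" unfolding p_def using finite_gens w 0 by (auto simp: prod_zero_iff intro!: bexI[of _ w])
 qed
 have pre: "{X : points (subspace_of (affine_alg G) (hcd)). orb X : ?U} = chart cn" unfolding points_alg_domain
 proof (intro equalityI subsetI)
  fix X assume "X : {X : hcd. orb X : ?U}"
  then obtain Y where Y: "X : hcd" "Y : chart cn" "orb Y = orb X" by auto
  thus "X : chart cn" using orbit_eq_iff[of Y X] act_hc_chart sub hc_domain_coord by blast
 qed (use sub in auto)
 show thesis
 proof (rule that[of ?U ?\<xi>])
  have "opn (subspace_of (affine_alg G) (hcd)) (chart cn)"
   unfolding top_of_subspace openin_subtopology openin_affine_alg using zariski_hc_chart[of cn] sub by blast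
  thus "opn AV ?U"
   unfolding toric_alg_def top_of_quotient points_alg_domain pre[unfolded points_alg_domain] using sub by blast
  have pq: "p : poly_funs G" "q : poly_funs G" unfolding p_def q_def
   by (intro function_ring_prod[OF function_ring_poly_funs] function_ring_power[OF function_ring_poly_funs]
    poly_funs.coord finite_gens; assumption)+
  have f: "(%X. p X / q X) : funs (affine_alg G) (chart cn)" unfolding affine_alg_def using pq q0 by auto
  show "?\<xi> : funs AV ?U"
   unfolding toric_alg_def final_map_funs[OF final_map_quotient \<open>opn AV ?U\<close>[unfolded toric_alg_def]]
    pre funs_subspace openin_affine_alg
   using zariski_hc_chart[of cn] f \<xi> by (intro CollectI ballI exI[of _ "chart cn"] exI[of _ "%X. p X / q X"]) auto
  show "?\<xi> c = 0 \<longleftrightarrow> c : prime_divisor Fn w" if c: "c : ?U" for c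
  proof -
   obtain X where X: "X : chart cn" "c = orb X" using c by blast
   show ?thesis unfolding X(2) \<xi>[OF X(1)] using prime_divisor_iff[of X w] X(1) sub w p0 q0 by auto
  qed
 qed blast
qed

end

locale corner_fan = T: toric "hyperplane_lattice l" Fnt
 for l :: "'d::finite" and Fnt :: "(real^'d) set set" +
 fixes i1 :: 'd
 assumes i1: "i1 ~= l" and basis: "basis_vecs l \<subseteq> gens Fnt" and hyp: "\<And>v. v : gens Fnt ==> v $ l = 0"
  and cover: "\<And>x. x $ l = 0 ==> EX cn:Fnt. x : cn" and corner: "cone_gen (basis_vecs l) : Fnt"
begin

abbreviation "e1 \<equiv> axis i1 (1::int)"

lemma e1: "e1 : basis_vecs l" "e1 : T.G" using i1 basis by (auto simp: basis_vecs_def)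

lemma corner_gens: "basis_vecs l \<subseteq> T.cg (cone_gen (basis_vecs l))"
 unfolding cone_gens_def using basis gen_in_cone_gen[of _ "basis_vecs l"] by blast

text \<open>Wall crossing: start at \<open>- e_1\<close> and go far along the interior of the wall
  spanned by the other basis vectors. The cone reached contains the wall and a generator on the far
  side, and the integral dual vector of that generator forces its first coordinate to be -1.\<close>

lemma opposite:
 obtains v tn where "v : T.G" "v $ i1 = - 1" "tn : Fnt" "insert v (basis_vecs l - {e1}) \<subseteq> T.cg tn"
proof -
 define Z where "Z = basis_vecs l - {e1}"
 define w :: "real^'d" where "w = (\<Sum>v\<in>Z. real_vec v)"
 have Z: "Z \<subseteq> T.cg (cone_gen (basis_vecs l))" using corner_gens by (auto simp: Z_def)
 have "v $ l = 0 & v $ i1 = 0" if "v : Z" for v using that by (auto simp: Z_def basis_vecs_def axis_def)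
 hence w: "w $ l = 0" "w $ i1 = 0" unfolding w_def by simp_all
 have "- real_vec e1 + real s *\<^sub>R w : \<Union>Fnt" for s
  using cover[of "- real_vec e1 + real s *\<^sub>R w"] i1 w by (auto simp: axis_def)
 then obtain tn where tn: "tn : Fnt" "Z \<subseteq> T.cg tn" "infinite {s::nat. - real_vec e1 + real s *\<^sub>R w : tn}"
  using T.eventually_in_cone[OF subset_refl corner Z w_def, of 0 "- real_vec e1"] by metis
 from tn(3) obtain s where s: "- real_vec e1 + real s *\<^sub>R w : tn" using not_finite_existsD by blast
 obtain \<mu> where \<mu>: "dual_to (T.cg tn) \<mu>" "tn = cone_gen (T.cg tn)" by (rule T.cone_dual[OF tn(1)])
 then obtain c where c: "- real_vec e1 + real s *\<^sub>R w = (\<Sum>v\<in>T.cg tn. c v *\<^sub>R real_vec v)"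
   "ALL v:T.cg tn. 0 \<le> c v" using s cone_gen_eq[OF T.finite_cone_gens[OF tn(1)]] by blast
 have "EX v:T.cg tn. v $ i1 < 0"
 proof (rule ccontr)
  assume "\<not> ?thesis"
  hence "0 \<le> (\<Sum>v\<in>T.cg tn. c v * real_of_int (v $ i1))"
   using c(2) by (intro sum_nonneg mult_nonneg_nonneg) (auto simp: not_less)
  moreover have "(- real_vec e1 + real s *\<^sub>R w) $ i1 = - 1" using w by (simp add: axis_def)
  ultimately show False unfolding c(1) by simp
 qed
 then obtain v where v: "v : T.cg tn" "v $ i1 < 0" by blast
 have vg: "v : T.G" using v(1) by (simp add: cone_gens_def)
 have z: "\<mu> v $ i = 0" if i: "i ~= l" "i ~= i1" for i
 proof -
  have e: "axis i 1 : Z" using i by (auto simp: Z_def basis_vecs_def axis_eq_axis)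
  have "v ~= axis i 1" using v(2) i by (auto simp: axis_def)
  moreover have "pairing (\<mu> v) (axis i 1) = (if v = axis i 1 then 1 else 0)"
   using \<mu>(1) v(1) e tn(2) unfolding dual_to_def by blast
  ultimately show ?thesis by (simp add: pairing_def axis_def if_distrib[of "%y. _ * y"] cong: if_cong)
 qed
 have "1 = pairing (\<mu> v) v" using \<mu>(1) v(1) by (simp add: dual_to_def)
 also have "\<dots> = (\<Sum>i\<in>UNIV. if i = i1 then \<mu> v $ i1 * v $ i1 else 0)" unfolding pairing_def
 proof (intro sum.cong refl)
  show "\<mu> v $ i * v $ i = (if i = i1 then \<mu> v $ i1 * v $ i1 else 0)" for i
   using z[of i] hyp[OF vg] by (cases "i = l") auto
 qed
 also have "\<dots> = \<mu> v $ i1 * v $ i1" by simp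
 finally have "v $ i1 dvd 1" by (metis dvd_triv_right)
 hence "v $ i1 = - 1" using v(2) by (auto simp: zdvd1_eq)
 thus thesis using that[OF vg _ tn(1)] v(1) tn(2) by (simp add: Z_def)
qed

text \<open>The group element that undoes the coordinate at \<open>v\<close> acts on the basis
  vectors with the coordinates of \<open>v\<close> as exponents. A curve in the coordinate of
  \<open>v\<close> thus becomes a monomial curve in the corner chart.\<close>

lemma dehomogenize:
 assumes v: "v : T.G" "v ~: basis_vecs l" and z: "z ~= 0"
  and X: "X : coord_space T.G" "X v = z" "\<And>u. u : T.G ==> u ~= v ==> u ~: basis_vecs l ==> X u = 1"
 shows "T.orb X = T.orb (%u. if u : basis_vecs l then z powi pairing v u * X u else if u : T.G then 1 else 0)"
proof -
 define h where "h = (%u. if u : basis_vecs l then z powi pairing v u else if u = v then inverse z else 1)"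
 have "(\<Prod>u\<in>T.G. h u powi (u $ i)) = 1" for i
 proof (cases "i = l")
  case False
  have e: "axis i 1 : basis_vecs l" using False by (auto simp: basis_vecs_def)
  have "(\<Prod>u\<in>T.G. h u powi (u $ i)) = (\<Prod>u\<in>{axis i 1, v}. h u powi (u $ i))"
  proof (rule prod.mono_neutral_right[OF T.finite_gens], use e v basis in blast, intro ballI)
   fix u assume u: "u : T.G - {axis i 1, v}"
   show "h u powi (u $ i) = 1" using u by (cases "u : basis_vecs l") (auto simp: h_def basis_vecs_def axis_def)
  qed
  also have "\<dots> = (z powi (v $ i)) * inverse z powi (v $ i)"
  proof -
   have "pairing v (axis i 1) = v $ i" by (simp add: pairing_def axis_def if_distrib[of "%y. _ * y"] cong: if_cong)
   moreover have "axis i 1 ~= v" using e v by auto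
   ultimately show ?thesis using e v(2) by (simp add: h_def axis_nth)
  qed
  also have "\<dots> = 1" using z by (simp add: power_int_inverse)
  finally show ?thesis .
 qed (simp add: hyp)
 hence "h : tgroup T.G" using z by (simp add: tgroup_def h_def)
 moreover have "(%u. if u : basis_vecs l then z powi pairing v u * X u else if u : T.G then 1 else 0) = act h X"
  using X v z by (auto simp: act_def h_def coord_space_def)
 ultimately show ?thesis using T.orbit_act[OF X(1)] by simp
qed

text \<open>The ratio \<open>g\<close> of linear forms vanishing at \<open>s1\<close> and
  \<open>s2\<close> is regular and without zeros off the two divisors, so it is constant along
  affine lines that miss both. On the corner chart it is therefore a constant times a positive power
  of the coordinate of \<open>e1\<close>, and a line in the coordinate of \<open>v\<close>
  multiplies it by a power with exponent proportional to \<open>v $ i1\<close>. Constancy along that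
  line forces the exponent to vanish.\<close>

lemma bundle_first_coord:
 assumes F: "morphism T.AV (proj_space :: (bool => complex) set fspace) F"
  and a1: "a1 : T.G" "a1 ~: basis_vecs l"
  and s1: "s1 : points proj_space" "prime_divisor Fnt e1 = {c : points T.AV. F c = s1}"
  and s2: "s2 : points proj_space" "prime_divisor Fnt a1 = {c : points T.AV. F c = s2}"
  and v: "v : T.G" "v ~= e1" "v ~= a1"
 shows "v $ i1 = 0"
proof (cases "v : basis_vecs l")
 case True
 thus ?thesis using v(2) by (auto simp: basis_vecs_def axis_def)
next
 case vb: False
 note pr = proj_ratio[where 'n = bool]
 \<comment> \<open>The linear form on the projective line whose only zero is the point \<alpha>,
   namely the determinant with \<alpha>.\<close>
 define form where "form = (%\<alpha> :: bool => complex. %i. if i then - \<alpha> False else \<alpha> True)"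
 have form: "lin_form (form \<alpha>) (representative y) = 0 \<longleftrightarrow> y = proj_point \<alpha>" if y: "y : points proj_space" and \<alpha>: "\<alpha> ~= (%_. 0)" for y \<alpha>
 proof -
  obtain x where x: "x ~= (%_. 0)" "y = proj_point x" using y unfolding pr(4) by blast
  obtain k where k: "k ~= 0" "representative (proj_point x) = (%i. k * x i)" using pr(3) by blast
  have l: "lin_form (form \<alpha>) (representative y) = k * (\<alpha> True * x False - \<alpha> False * x True)"
   unfolding x(2) k(2) by (simp add: lin_form_def form_def UNIV_bool algebra_simps)
  have "\<alpha> True * x False = \<alpha> False * x True \<longleftrightarrow> proj_point x = proj_point \<alpha>"
  proof
   assume e: "\<alpha> True * x False = \<alpha> False * x True"
   obtain i where i: "\<alpha> i ~= 0" using \<alpha> by auto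
   have xe: "x j = x i / \<alpha> i * \<alpha> j" for j using e i by (cases i; cases j) (auto simp: field_simps)
   have "x i ~= 0"
   proof
    assume "x i = 0"
    hence "x j = 0" for j using xe[of j] by simp
    thus False using x(1) by auto
   qed
   hence r: "x i / \<alpha> i ~= 0" using i by simp
   have "x = (%j. x i / \<alpha> i * \<alpha> j)" using xe by blast
   thus "proj_point x = proj_point \<alpha>" using proj_point_scale[OF r, of \<alpha>] by simp
  next
   assume "proj_point x = proj_point \<alpha>"
   then obtain k' where k': "k' ~= 0" "representative (proj_point x) = (%i. k' * \<alpha> i)" using pr(3)[of \<alpha>] by metis
   hence "k * x i = k' * \<alpha> i" for i using k(2) by metis
   hence "k * (\<alpha> True * x False) = k * (\<alpha> False * x True)" by (metis mult.assoc mult.commute)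
   thus "\<alpha> True * x False = \<alpha> False * x True" using k(1) by simp
  qed
  thus ?thesis using l k(1) x(2) by simp
 qed
 obtain \<alpha> where \<alpha>: "\<alpha> ~= (%_. 0)" "s1 = proj_point \<alpha>" using s1(1) unfolding pr(4) by blast
 obtain bt where bt: "bt ~= (%_. 0)" "s2 = proj_point bt" using s2(1) unfolding pr(4) by blast
 define W where "W = {y : points proj_space. lin_form (form bt) (representative y) ~= 0}"
 define g where "g = (%y. lin_form (form \<alpha>) (representative y) / lin_form (form bt) (representative y)) \<circ> F"
 define W' where "W' = {c : points T.AV. F c : W}"
 have gf: "g : funs T.AV W'" "opn T.AV W'"
  unfolding g_def W'_def W_def using morphism_funs[OF F pr(1,2)] morphism_preimage[OF F pr(1)] by blast+
 have W': "T.orb X : W'" and g0: "g (T.orb X) = 0 \<longleftrightarrow> X e1 = 0"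
  if X: "X : T.hcd" "X a1 ~= 0" for X
 proof -
  have p: "T.orb X : points T.AV" using X T.points_toric_alg by blast
  note Fp = morphism_in[OF F p]
  have "F (T.orb X) ~= s2" using T.prime_divisor_iff[OF X(1) a1(1)] X(2) p unfolding s2(2) by blast
  hence l: "lin_form (form bt) (representative (F (T.orb X))) ~= 0" using form[OF Fp bt(1)] bt(2) by blast
  thus "T.orb X : W'" using p Fp by (simp add: W'_def W_def)
  have "F (T.orb X) = s1 \<longleftrightarrow> X e1 = 0" using T.prime_divisor_iff[OF X(1) e1(2)] p unfolding s1(2) by blast
  thus "g (T.orb X) = 0 \<longleftrightarrow> X e1 = 0" using form[OF Fp \<alpha>(1)] \<alpha>(2) l by (simp add: g_def)
 qed
 have line: "EX P S. poly S z ~= 0 & (ALL y. poly S y ~= 0 --> g (T.orb (gm y)) * poly S y = poly P y)"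
  if gm: "\<And>u. (%y. gm y u) : range poly" "\<And>y. gm y : T.hcd" "\<And>y. gm y a1 ~= 0" for gm z
 proof -
  have "T.orb (gm z) : W'" by (rule W'[OF gm(2,3)])
  note r = T.regular_along_toric[where Y = UNIV and y = z and gm = gm, OF function_ring_poly gm(1,2) gf(2,1) UNIV_I this]
  obtain P S where "P : range poly" "S : range poly" "S z ~= 0"
    "\<And>y. y : UNIV ==> S y ~= 0 ==> T.orb (gm y) : W' & g (T.orb (gm y)) * S y = P y" by (rule r) (rule that)
  thus ?thesis by auto
 qed
 \<comment> \<open>Pulled back to such a line, \<open>g\<close> is a monomial by
   \<open>regular_line_monomial\<close>; having no zero at 0 either, it has exponent 0.\<close>
 have const: "g (T.orb (gm y)) = g (T.orb (gm 0))"
  if gm: "\<And>u. (%y. gm y u) : range poly" "\<And>y. gm y : T.hcd" "\<And>y. gm y a1 ~= 0" "\<And>y. gm y e1 ~= 0" for gm y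
 proof -
  have nz: "g (T.orb (gm y)) ~= 0" for y using g0[OF gm(2,3)] gm(4) by simp
  obtain c k where c: "c ~= 0" "\<And>z. g (T.orb (gm z)) = c * z ^ k"
   by (rule regular_line_monomial[OF line[OF gm(1-3)] nz]) (rule that)
  hence "k = 0" using nz[of 0] by (auto simp: power_0_left split: if_splits)
  thus ?thesis using c by simp
 qed
 have poly_upd: "(%y. (X(w := y)) u) : range poly" for X :: "int^'d => complex" and w u
  by (cases "u = w"; rule range_eqI[of _ _ "if u = w then [:0, 1:] else [:X u:]"]) auto
 \<comment> \<open>The corner chart: all coordinates except those of the basis vectors are 1, in
   particular that of \<open>a1\<close>, so the second divisor is never met.\<close>
 define pt where "pt = (%x u. if u : basis_vecs l then x u else if u : T.G then 1 else (0::complex))"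
 have pt: "pt x : T.hcd" "pt x a1 ~= 0" for x
 proof -
  have "{u : T.G. pt x u = 0} \<subseteq> basis_vecs l" by (auto simp: pt_def)
  moreover have "pt x : coord_space T.G" using basis by (auto simp: pt_def coord_space_def)
  ultimately show "pt x : T.hcd" using corner corner_gens unfolding T.hc_domain_iff by blast
  show "pt x a1 ~= 0" using a1 by (simp add: pt_def)
 qed
 have pt_upd: "pt (x(u := y)) = (pt x)(u := y)" if "u : basis_vecs l" for x u y using that by (auto simp: pt_def)
 define E where "E = (%x. g (T.orb (pt x)))"
 have indep: "E (x(u := y)) = E x" if u: "u : basis_vecs l" "u ~= e1" and x: "x e1 ~= 0" for x u y
 proof -
  have "E (x(u := y)) = E (x(u := 0))" for y unfolding E_def
  proof (rule const[where gm = "%y. pt (x(u := y))"])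
   show "(%y. pt (x(u := y)) w) : range poly" for w unfolding pt_upd[OF u(1)] by (rule poly_upd)
   show "pt (x(u := y)) e1 ~= 0" for y using u x e1(1) by (simp add: pt_def)
  qed (rule pt)+
  from this[of y] this[of "x u"] show ?thesis by simp
 qed
 \<comment> \<open>Off the divisor of \<open>e1\<close> the remaining coordinates of the corner
   chart can be changed one at a time, each along a line on which \<open>g\<close> is
   constant.\<close>
 have E1: "E x = E ((%_. 1)(e1 := x e1))" if x: "x e1 ~= 0" for x
 proof -
  have "finite S ==> S \<subseteq> basis_vecs l - {e1} ==> E (%u. if u : S then 1 else x u) = E x" for S
  proof (induction S rule: finite_induct)
   case (insert u S)
   have "(%w. if w : insert u S then 1 else x w) = (%w. if w : S then 1 else x w)(u := 1)" by auto
   thus ?case using indep[of u "%w. if w : S then 1 else x w" 1] insert x by auto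
  qed simp
  moreover have "finite (basis_vecs l - {e1})" using finite_subset[OF basis T.finite_gens] by simp
  ultimately have "E (%u. if u : basis_vecs l - {e1} then 1 else x u) = E x" by blast
  hence "E x = E (%u. if u : basis_vecs l - {e1} then 1 else x u)" ..
  also have "pt (%u. if u : basis_vecs l - {e1} then 1 else x u) = pt ((%_. 1)(e1 := x e1))" by (auto simp: pt_def)
  hence "E (%u. if u : basis_vecs l - {e1} then 1 else x u) = E ((%_. 1)(e1 := x e1))" by (simp add: E_def)
  finally show ?thesis .
 qed
 obtain c k where c: "c ~= 0" "\<And>z. E ((%_. 1)(e1 := z)) = c * z ^ k"
 proof -
  note witness = that
  show thesis
  proof (rule regular_line_monomial[where h = "%z. E ((%_. 1)(e1 := z))"])
   show "EX P S. poly S z ~= 0 & (ALL y. poly S y ~= 0 --> E ((%_. 1)(e1 := y)) * poly S y = poly P y)" for z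
    unfolding E_def
   proof (rule line)
    show "(%y. pt ((%_. 1)(e1 := y)) w) : range poly" for w unfolding pt_upd[OF e1(1)] by (rule poly_upd)
   qed (rule pt)+
   show "E ((%_. 1)(e1 := z)) ~= 0" if "z ~= 0" for z unfolding E_def using g0[OF pt] e1(1) that by (simp add: pt_def)
   show thesis if "c ~= 0" "\<And>z. E ((%_. 1)(e1 := z)) = c * z ^ k" for c k by (rule witness[OF that])
  qed
 qed
 \<comment> \<open>The exponent is positive because \<open>g\<close> does vanish on the divisor of
   \<open>e1\<close>.\<close>
 have k: "k ~= 0"
 proof
  assume "k = 0"
  hence "E ((%_. 1)(e1 := 0)) ~= 0" using c by simp
  thus False unfolding E_def using g0[OF pt] e1(1) by (simp add: pt_def)
 qed
 \<comment> \<open>A line crossing the divisor of \<open>v\<close> with all other coordinates equal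
   to 1, hence missing both divisors. It stays in the domain at 0 because \<open>v\<close> alone
   spans a cone.\<close>
 define gm where "gm = (%z. (%u. if u : T.G then 1 else (0::complex))(v := z))"
 have gmd: "gm z : T.hcd" for z
 proof -
  have "{u : T.G. gm z u = 0} \<subseteq> T.cg (cone_gen {v})" using T.gens_ray[OF v(1)] by (auto simp: gm_def)
  thus ?thesis using T.gens_ray[OF v(1)] v(1) unfolding T.hc_domain_iff by (auto simp: gm_def coord_space_def)
 qed
 have gmc: "g (T.orb (gm y)) = g (T.orb (gm 0))" for y
  by (rule const) (use gmd poly_upd v a1 e1 in \<open>auto simp: gm_def simp del: fun_upd_apply\<close>, auto simp: fun_upd_def)
 have "g (T.orb (gm z)) = c * (z powi (v $ i1)) ^ k" if z: "z ~= 0" for z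
 proof -
  have "T.orb (gm z) = T.orb (%u. if u : basis_vecs l then z powi pairing v u * gm z u else if u : T.G then 1 else 0)"
   by (rule dehomogenize[OF v(1) vb z T.hc_domain_coord[OF gmd]]) (simp_all add: gm_def)
  also have "(%u. if u : basis_vecs l then z powi pairing v u * gm z u else if u : T.G then 1 else 0) =
    pt (%u. z powi pairing v u)" by (rule ext) (use basis vb in \<open>auto simp: pt_def gm_def\<close>)
  finally have "g (T.orb (gm z)) = E (%u. z powi pairing v u)" by (simp add: E_def)
  also have "\<dots> = c * (z powi pairing v e1) ^ k" using E1 c(2) z by simp
  also have "pairing v e1 = v $ i1" by (simp add: pairing_def axis_def if_distrib[of "%y. _ * y"] cong: if_cong)
  finally show ?thesis .
 qed
 \<comment> \<open>The parameters 1 and 2 suffice: equal absolute values there already exclude a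
   nonzero exponent.\<close>
 from this[of 1] this[of 2] have "((2::complex) powi (v $ i1)) ^ k = 1" using gmc[of 1] gmc[of 2] c(1) by simp
 hence "norm (((2::complex) powi (v $ i1)) ^ k) = 1" by simp
 hence "((2::real) powi (v $ i1)) ^ k = 1 ^ k" by (simp add: norm_power norm_power_int)
 hence "(2::real) powi (v $ i1) = 1" using k by (metis power_eq_imp_eq_base zero_le_power_int zero_le_numeral zero_le_one neq0_conv)
 hence p: "(2::real) powi (v $ i1) = 2 powi 0" by simp
 show ?thesis
 proof (rule ccontr)
  assume "v $ i1 ~= 0"
  then consider "v $ i1 < 0" | "0 < v $ i1" by linarith
  thus False by cases (use p power_int_strict_increasing[of _ _ "2::real"] in fastforce)+
 qed
qed

end

section \<open>Toric varieties isomorphic to projective space\<close>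

text \<open>Polynomial along the moving curve but merely continuous in the parameter of the motion:
  enough to isolate zeros in the first variable and to control them under small changes of the
  second.\<close>

definition poly_family :: "(complex \<times> complex => complex) set" where
 "poly_family = {f. continuous_on UNIV f & (ALL t. EX p. ALL s. f (s, t) = poly p s)}"

lemma function_ring_poly_family: "function_ring poly_family" unfolding function_ring_def
proof (intro conjI allI ballI)
 show "(%y. c) : poly_family" for c unfolding poly_family_def by (auto intro!: exI[of _ "[:c:]"])
 fix f g assume f: "f : poly_family" and g: "g : poly_family"
 have "EX p. ALL s. f (s, t) + g (s, t) = poly p s" "EX p. ALL s. f (s, t) * g (s, t) = poly p s" for t
 proof -
  obtain p q where "ALL s. f (s, t) = poly p s" "ALL s. g (s, t) = poly q s"
   using f g unfolding poly_family_def by blast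
  hence "ALL s. f (s, t) + g (s, t) = poly (p + q) s" "ALL s. f (s, t) * g (s, t) = poly (p * q) s" by simp_all
  thus "EX p. ALL s. f (s, t) + g (s, t) = poly p s" "EX p. ALL s. f (s, t) * g (s, t) = poly p s" by blast+
 qed
 thus "(%y. f y + g y) : poly_family" "(%y. f y * g y) : poly_family"
  using f g unfolding poly_family_def by (auto intro: continuous_intros)
qed

text \<open>Think of \<open>N j\<close> as the points where a moving projective line, in its two affine charts,
 meets a divisor: the line can neither begin nor cease to meet the divisor.\<close>

lemma moving_line_misses:
 fixes N :: "bool => (complex \<times> complex) set"
 assumes loc: "\<And>j s0 t0. EX P:poly_family. EX S:poly_family. S (s0, t0) ~= 0 &
   (ALL s t. S (s, t) ~= 0 --> (s, t) : N j \<longleftrightarrow> P (s, t) = 0)"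
  and one: "\<And>j t. (1, t) ~: N j" and zero: "\<And>j s. (s, 0) ~: N j"
  and flip: "\<And>j s t. s ~= 0 ==> (s, t) : N j ==> (1 / s, t) : N (\<not> j)"
 shows "(s, t) ~: N j"
proof -
 \<comment> \<open>The parameters at which the whole curve misses the divisor. This set is shown to
   be open and closed, and it contains 0.\<close>
 define A where "A = {t. ALL j s. (s, t) ~: N j}"
 have open_nz: "open {y. f y ~= 0}" if "f : poly_family" for f
  using that open_Collect_neq[of f "%_. 0"] unfolding poly_family_def by auto
 have clN: "closed (N j)" for j
 proof -
  have "EX T. open T & y : T & T \<subseteq> - N j" if y: "y ~: N j" for y
  proof -
   obtain s0 t0 where y0: "y = (s0, t0)" by (cases y)
   obtain P S where PS: "P : poly_family" "S : poly_family" "S y ~= 0" "\<And>z. S z ~= 0 ==> z : N j \<longleftrightarrow> P z = 0"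
    using loc[of s0 t0 j] unfolding y0 by fastforce
   have "open ({z. P z ~= 0} \<inter> {z. S z ~= 0})" using open_nz PS(1,2) by blast
   thus ?thesis using PS(3,4) y by (intro exI[of _ "{z. P z ~= 0} \<inter> {z. S z ~= 0}"]) auto
  qed
  thus ?thesis unfolding closed_def open_subopen[of "- N j"] by blast
 qed
 \<comment> \<open>A point with \<open>norm s > 1\<close> is seen in the other chart at
   \<open>1 / s\<close>, so two closed unit discs suffice; projection along a compact factor
   preserves closed sets.\<close>
 have "- A = {t. EX s. s : cball 0 1 & (s, t) : N True} \<union> {t. EX s. s : cball 0 1 & (s, t) : N False}"
 proof -
  have "EX j s. s : cball 0 1 & (s, t) : N j" if "(s, t) : N j" for s t j
  proof (cases "norm s \<le> 1")
   case False
   hence "s ~= 0" "1 / s : cball 0 1" by (auto simp: norm_divide divide_simps)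
   thus ?thesis using flip that by blast
  qed (use that in auto)
  hence "t : - A \<longleftrightarrow> (EX j s. s : cball 0 1 & (s, t) : N j)" for t unfolding A_def by blast
  thus ?thesis unfolding ex_bool_eq by blast
 qed
 hence "closed (- A)" using clN by (simp only:) (intro closed_Un closed_compact_projection compact_cball)
 hence oA: "open A" by (simp add: closed_def)
 have "t0 : A" if t0: "t0 : closure A" for t0
 proof (rule ccontr)
  assume "t0 ~: A"
  then obtain j s0 where sN: "(s0, t0) : N j" by (auto simp: A_def)
  obtain P S where PS: "P : poly_family" "S : poly_family" "S (s0, t0) ~= 0" "\<And>s t. S (s, t) ~= 0 ==> (s, t) : N j \<longleftrightarrow> P (s, t) = 0"
   using loc[of s0 t0 j] by blast
  \<comment> \<open>At \<open>s = 1\<close> the curve is known to miss the divisor. A second local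
    equation, around that point, shows that the first one is not identically zero on the slice at
    \<open>t0\<close>.\<close>
  obtain P1 S1 where PS1: "P1 : poly_family" "S1 : poly_family" "S1 (1, t0) ~= 0" "\<And>s t. S1 (s, t) ~= 0 ==> (s, t) : N j \<longleftrightarrow> P1 (s, t) = 0"
   using loc[of 1 t0 j] by blast
  have pol: "EX p. ALL s. f (s, t) = poly p s" if "f : poly_family" for f t using that by (simp add: poly_family_def)
  obtain p q p1 q1 where pq: "\<And>s. P (s, t0) = poly p s" "\<And>s. S (s, t0) = poly q s"
   "\<And>s. P1 (s, t0) = poly p1 s" "\<And>s. S1 (s, t0) = poly q1 s"
   using pol[OF PS(1), of t0] pol[OF PS(2), of t0] pol[OF PS1(1), of t0] pol[OF PS1(2), of t0] by auto
  have "P1 (1, t0) ~= 0" using PS1(4)[OF PS1(3)] one[of t0 j] by blast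
  hence "poly q s0 ~= 0" "poly p1 1 ~= 0" "poly q1 1 ~= 0" using PS(3) PS1(3) pq by simp_all
  hence "q ~= 0" "p1 ~= 0" "q1 ~= 0" by auto
  hence "q * (p1 * q1) ~= 0" by simp
  then obtain s where "poly (q * (p1 * q1)) s ~= 0" using poly_all_0_iff_0 by blast
  hence s: "S1 (s, t0) ~= 0" "P1 (s, t0) ~= 0" "S (s, t0) ~= 0" using pq by simp_all
  hence "P (s, t0) ~= 0" using PS1(4)[OF s(1)] PS(4)[OF s(3)] by simp
  hence "p ~= 0" using pq(1)[of s] by auto
  hence "finite {s. poly p s = 0}" by (rule poly_roots_finite)
  then obtain d where d: "d > 0" "\<And>s. poly p s = 0 ==> s ~= s0 ==> d \<le> dist s0 s"
   using finite_set_avoid[of "{s. poly p s = 0}" s0] by auto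
  obtain e where e: "e > 0" "\<And>y. dist y (s0, t0) < e ==> S y ~= 0"
   using open_nz[OF PS(2), unfolded open_dist] PS(3) by (metis (mono_tags, lifting) mem_Collect_eq)
  \<comment> \<open>Dividing by 3 keeps the circle clear of the other roots of \<open>p\<close>, and
    leaves room for a displacement in both variables within the ball on which the denominator is
    nonzero.\<close>
  define \<rho> where "\<rho> = min d e / 3"
  have \<rho>: "\<rho> > 0" "\<rho> < d" "2 * \<rho> < e" using d(1) e(1) by (auto simp: \<rho>_def)
  have cP: "continuous_on UNIV P" using PS(1) by (simp add: poly_family_def)
  have "continuous_on (sphere s0 \<rho>) (%s. norm (poly p s))" by (intro continuous_intros)
  moreover have "sphere s0 \<rho> ~= {}" using \<rho>(1) by simp
  ultimately obtain s1 where s1: "s1 : sphere s0 \<rho>" "\<And>s. s : sphere s0 \<rho> ==> norm (poly p s1) \<le> norm (poly p s)"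
   using continuous_attains_inf[OF compact_sphere] by metis
  define m where "m = norm (poly p s1)"
  have m: "m > 0" using d(2)[of s1] s1(1) \<rho> by (auto simp: m_def)
  let ?K = "cball s0 \<rho> \<times> cball t0 \<rho>"
  have "uniformly_continuous_on ?K P"
   by (intro compact_uniformly_continuous continuous_on_subset[OF cP] compact_Times compact_cball) auto
  then obtain \<delta> where \<delta>: "\<delta> > 0" "\<And>y y'. y : ?K ==> y' : ?K ==> dist y' y < \<delta> ==> dist (P y') (P y) < m / 2"
   unfolding uniformly_continuous_on_def using half_gt_zero[OF m] by metis
  obtain t where t: "t : A" "dist t t0 < min \<rho> \<delta>"
   using t0 \<rho>(1) \<delta>(1) unfolding closure_approachable by (metis min_less_iff_conj)
  have near: "norm (P (s, t) - poly p s) < m / 2" if "s : cball s0 \<rho>" for s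
   using \<delta>(2)[of "(s, t0)" "(s, t)"] that t(2) \<rho>(1) pq(1)
   by (simp add: dist_Pair_Pair dist_norm norm_minus_commute)
  obtain f where f: "\<And>s. P (s, t) = poly f s" using pol[OF PS(1), of t] by blast
  have nz: "poly f s ~= 0" if s: "s : cball s0 \<rho>" for s
  proof -
   have "dist (s, t) (s0, t0) \<le> dist (s, t) (s0, t) + dist (s0, t) (s0, t0)" by (rule dist_triangle)
   also have "\<dots> < e" using s t(2) \<rho>(3) by (simp add: dist_Pair_Pair dist_commute)
   finally have "S (s, t) ~= 0" by (rule e(2))
   thus ?thesis using PS(4)[of s t] t(1) f by (auto simp: A_def)
  qed
  \<comment> \<open>Hurwitz's argument: for a parameter in \<open>A\<close> close to
    \<open>t0\<close> there are no zeros in the disc, so the maximum principle for the reciprocal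
    bounds the value at the centre from below by half the minimum on the circle at
    \<open>t0\<close>. Continuity and the zero at \<open>t0\<close> give the opposite bound.\<close>
  have "norm (1 / poly f s0) \<le> 2 / m"
  proof (rule maximum_modulus_frontier[where S = "cball s0 \<rho>" and f = "%s. 1 / poly f s"])
   show "(%s. 1 / poly f s) holomorphic_on interior (cball s0 \<rho>)"
   proof (rule holomorphic_on_divide)
    show "(%s. poly f s) holomorphic_on interior (cball s0 \<rho>)"
     unfolding holomorphic_on_def field_differentiable_def using has_field_derivative_at_within[OF poly_DERIV] by blast
    show "poly f s ~= 0" if "s : interior (cball s0 \<rho>)" for s by (rule nz) (use that interior_subset in blast)
    show "(%z. 1) holomorphic_on interior (cball s0 \<rho>)" by (rule holomorphic_on_const)
   qed
   show "continuous_on (closure (cball s0 \<rho>)) (%s. 1 / poly f s)" by (intro continuous_intros) (use nz in auto)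
   fix s assume "s : frontier (cball s0 \<rho>)"
   hence s: "s : sphere s0 \<rho>" using \<rho>(1) by (simp add: frontier_cball)
   hence "norm (poly p s) \<le> norm (poly f s) + norm (P (s, t) - poly p s)"
    unfolding f by (metis add.commute norm_minus_commute norm_triangle_sub)
   hence "m / 2 \<le> norm (poly f s)" using near[of s] s1(2)[OF s] s by (simp add: m_def)
   moreover from this m have "norm (poly f s) > 0" by linarith
   ultimately show "norm (1 / poly f s) \<le> 2 / m" using m by (simp add: norm_divide field_simps)
  qed (use \<rho> in auto)
  moreover have "norm (poly f s0) < m / 2" using near[of s0] \<rho>(1) f PS(4)[OF PS(3)] sN pq(1)[of s0] by simp
  moreover have "poly f s0 ~= 0" using nz[of s0] \<rho>(1) by simp
  ultimately show False using m by (simp add: norm_divide field_simps)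
 qed
 hence "closed A" using closure_subset closure_subset_eq by blast
 hence "A = {} \<or> A = UNIV" using oA clopen[of A] by blast
 moreover have "0 : A" using zero by (simp add: A_def)
 ultimately have "A = UNIV" by blast
 thus ?thesis by (auto simp: A_def)
qed

text \<open>Near a given parameter the ratios of homogeneous coordinates of the image are fractions
  over \<open>R\<close>. Multiplying through by all denominators gives homogeneous coordinates in
  \<open>R\<close> itself, valid where the common denominator does not vanish.\<close>

lemma (in toric) polynomial_lift:
 fixes ph :: "'d tpoint => ('n::finite => complex) set"
 assumes ph: "morphism AV proj_space ph" and R: "function_ring R"
  and gm: "\<And>v. v : G ==> (%y. gm y v) : R" "\<And>y. gm y : hcd"
 obtains p S where "\<And>i. (%y. p y i) : R" "S : R" "S y0 ~= 0"
  "\<And>y. S y ~= 0 ==> EX k. k ~= 0 & p y = (%i. k * representative (ph (orb (gm y))) i)"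
proof -
 let ?r = "%y. representative (ph (orb (gm y)))"
 note pr = proj_ratio[where 'n = 'n]
 have pt: "orb (gm y) : points AV" for y using gm(2) points_toric_alg by blast
 note Fp = morphism_in[OF ph pt]
 have "?r y0 ~= (%_. 0)"
 proof -
  obtain x where x: "x ~= (%_. 0)" "ph (orb (gm y0)) = proj_point x" using Fp[of y0] unfolding pr(4) by blast
  obtain k where k: "k ~= 0" "representative (proj_point x) = (%i. k * x i)" using pr(3) by blast
  show ?thesis unfolding x(2) k(2) using x(1) k(1) by (auto simp: fun_eq_iff)
 qed
 then obtain i where i: "?r y0 i ~= 0" by auto
 let ?u = "%k j. if j = k then 1 else 0 :: complex"
 have u: "lin_form (?u k) x = x k" for k and x :: "'n => complex"
  by (simp add: lin_form_def if_distrib[of "%y. y * _"] cong: if_cong)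
 define W where "W = {c : points AV. representative (ph c) i ~= 0}"
 have W: "{c : points AV. ph c : {y : points proj_space. lin_form (?u i) (representative y) ~= 0}} = W"
  unfolding W_def u using morphism_in[OF ph] by blast
 have oW: "opn AV W" using morphism_preimage[OF ph pr(1)[where d = "?u i"]] unfolding W .
 have gW: "(%c. representative (ph c) k / representative (ph c) i) : funs AV W" for k
  using morphism_funs[OF ph pr(1)[where d = "?u i"] pr(2)[where c = "?u k" and d = "?u i"]] unfolding W unfolding u comp_def .
 have y0: "orb (gm y0) : W" using pt i by (simp add: W_def)
 have "EX P S. P : R & S : R & S y0 ~= 0 & (ALL y. S y ~= 0 --> ?r y i ~= 0 & ?r y k / ?r y i * S y = P y)" for k
 proof -
  note r = regular_along_toric[where Y = UNIV and y = y0 and gm = gm, OF R gm oW gW[of k] UNIV_I y0]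
  obtain P S where "P : R" "S : R" "S y0 ~= 0" "\<And>y. y : UNIV ==> S y ~= 0 ==>
    orb (gm y) : W & ?r y k / ?r y i * S y = P y" by (rule r) (assumption, rule that)
  thus ?thesis unfolding W_def by blast
 qed
 hence "ALL k. EX P S. P : R & S : R & S y0 ~= 0 & (ALL y. S y ~= 0 --> ?r y i ~= 0 & ?r y k / ?r y i * S y = P y)" ..
 from choice[OF this] obtain P where
  "ALL k. EX S. P k : R & S : R & S y0 ~= 0 & (ALL y. S y ~= 0 --> ?r y i ~= 0 & ?r y k / ?r y i * S y = P k y)" ..
 from choice[OF this] obtain S where
  PS: "P k : R & S k : R & S k y0 ~= 0 & (ALL y. S k y ~= 0 --> ?r y i ~= 0 & ?r y k / ?r y i * S k y = P k y)" for k by blast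
 show thesis
 proof (rule that[of "%y k. P k y * (\<Prod>j\<in>UNIV - {k}. S j y)" "%y. \<Prod>j\<in>UNIV. S j y"])
  show "(%y. \<Prod>j\<in>UNIV. S j y) : R" by (rule function_ring_prod[OF R]) (use PS in auto)
  have "(%y. \<Prod>j\<in>UNIV - {k}. S j y) : R" for k by (rule function_ring_prod[OF R]) (use PS in auto)
  moreover have "(%y. f y * g y) : R" if "f : R" "g : R" for f g using R that unfolding function_ring_def by blast
  ultimately show "(%y. P k y * (\<Prod>j\<in>UNIV - {k}. S j y)) : R" for k using PS by blast
  show "(\<Prod>j\<in>UNIV. S j y0) ~= 0" using PS by (simp add: prod_zero_iff)
  fix y assume "(\<Prod>j\<in>UNIV. S j y) ~= 0"
  hence S: "S j y ~= 0" for j by (simp add: prod_zero_iff)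
  have "P k y * (\<Prod>j\<in>UNIV - {k}. S j y) = (\<Prod>j\<in>UNIV. S j y) / ?r y i * ?r y k" for k
  proof -
   have "P k y = ?r y k / ?r y i * S k y" using PS S by metis
   thus ?thesis using prod.remove[of UNIV k "%j. S j y"] by simp
  qed
  moreover have "(\<Prod>j\<in>UNIV. S j y) / ?r y i ~= 0" using S PS[of i] by (simp add: prod_zero_iff)
  ultimately show "EX k. k ~= 0 & (%k. P k y * (\<Prod>j\<in>UNIV - {k}. S j y)) = (%i. k * ?r y i)" by blast
 qed
qed

text \<open>Pulls back a local equation of the divisor from a chart containing the image of
  \<open>y0\<close>. The set \<open>Y\<close> allows for lifts to homogeneous coordinates that
  vanish at some parameters.\<close>

lemma (in toric) divisor_along:
 fixes gm :: "'p => 'n::finite => complex"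
 assumes ps: "morphism proj_space AV ps" and w: "w : G" and R: "function_ring R"
  and gm: "\<And>i. (%y. gm y i) : R" "\<And>y. y : Y ==> gm y ~= (%_. 0)" and y0: "y0 : Y"
 obtains P S where "P : R" "S : R" "S y0 ~= 0"
  "\<And>y. y : Y ==> S y ~= 0 ==> ps (proj_point (gm y)) : prime_divisor Fn w \<longleftrightarrow> P y = 0"
proof -
 have "proj_point (gm y0) : points proj_space" using gm(2)[OF y0] unfolding proj_ratio(4) by blast
 from morphism_in[OF ps this] obtain X cn where X: "ps (proj_point (gm y0)) = orb X" "cn : Fn" "X : chart cn"
  unfolding points_toric_alg hc_domain_def by blast
 obtain U \<xi> where U: "opn AV U" "\<xi> : funs AV U"
  "\<And>X. X : chart cn ==> orb X : U" "\<And>c. c : U ==> \<xi> c = 0 \<longleftrightarrow> c : prime_divisor Fn w"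
  by (rule local_equation[OF X(2) w]) (rule that)
 let ?W = "{y : points proj_space. ps y : U}"
 note W = morphism_preimage[OF ps U(1), unfolded proj_space_eq] and g = morphism_funs[OF ps U(1,2), unfolded proj_space_eq]
 have q: "proj_point (gm y0) : ?W" using U(3)[OF X(3)] X(1) \<open>proj_point (gm y0) : points proj_space\<close> by simp
 obtain P S where PS: "P : R" "S : R" "S y0 ~= 0" "\<And>y. y : Y ==> S y ~= 0 ==>
   proj_point (gm y) : ?W & (\<xi> \<circ> ps) (proj_point (gm y)) * S y = P y"
  by (rule regular_along[OF R gm(1) _ W g y0 q[unfolded proj_space_eq], folded proj_space_eq])
   (use gm(2) that in \<open>auto simp: coord_space_def\<close>)
 show thesis
 proof (rule that[OF PS(1-3)])
  fix y assume y: "y : Y" "S y ~= 0"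
  hence "ps (proj_point (gm y)) : U" "\<xi> (ps (proj_point (gm y))) * S y = P y" using PS(4)[OF y] by auto
  thus "ps (proj_point (gm y)) : prime_divisor Fn w \<longleftrightarrow> P y = 0" using U(4)[of "ps (proj_point (gm y))"] y(2) by (metis mult_eq_0_iff)
 qed
qed

text \<open>The 2 by 2 minors against a fixed nonzero entry of \<open>x\<close> vanish at
  \<open>x\<close> and detect every vector that is not a multiple of it. If one minor is nonzero at
  \<open>y\<close> and another at \<open>z\<close>, then one of the two or their sum is nonzero at
  both.\<close>

lemma lin_form_separating:
 fixes x y z :: "'n::finite => complex"
 assumes x: "x ~= (%_. 0)" and y: "\<And>k. y ~= (%i. k * x i)" and z: "\<And>k. z ~= (%i. k * x i)"
 obtains c where "lin_form c x = 0" "lin_form c y ~= 0" "lin_form c z ~= 0"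
proof -
 obtain i where i: "x i ~= 0" using x by auto
 define f where "f = (%k j. (if j = k then x i else 0) - (if j = i then x k else 0))"
 have f: "lin_form (f k) u = x i * u k - x k * u i" for k u
  by (simp add: lin_form_def f_def left_diff_distrib sum_subtractf if_distrib[of "%y. y * _"] cong: if_cong)
 have ex: "EX k. lin_form (f k) u ~= 0" if u: "\<And>k. u ~= (%i. k * x i)" for u
 proof (rule ccontr)
  assume "\<not> ?thesis"
  hence "u = (%k. u i / x i * x k)" using i by (auto simp: f fun_eq_iff field_simps)
  thus False using u by blast
 qed
 obtain k where k: "lin_form (f k) y ~= 0" using ex[OF y] by blast
 obtain k' where k': "lin_form (f k') z ~= 0" using ex[OF z] by blast
 have x0: "lin_form (f k) x = 0" for k by (simp add: f)
 have add: "lin_form (%j. f k j + f k' j) u = lin_form (f k) u + lin_form (f k') u" for u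
  by (simp add: lin_form_def distrib_right sum.distrib)
 show thesis using that[of "f k"] that[of "f k'"] that[of "%j. f k j + f k' j"] k k' x0 add by force
qed

text \<open>The isomorphism need not be equivariant, so fans cannot be compared directly. A further
  generator \<open>w\<close> has a nonempty divisor that is missed by the invariant curve crossing
  from the corner to its neighbour; projective space is homogeneous enough to move this curve onto
  the divisor with one point held fixed, contradicting \<open>moving_line_misses\<close>.\<close>

lemma (in corner_fan) projective_gens:
 fixes ph :: "'d tpoint => ('n::finite => complex) set"
 assumes iso: "isomorphism_pair T.AV proj_space ph ps"
  and v: "v : T.G" "v $ i1 = - 1" and tn: "tn : Fnt" "insert v (basis_vecs l - {e1}) \<subseteq> T.cg tn"
 shows "T.G \<subseteq> insert v (basis_vecs l)"
proof (rule ccontr)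
 assume "\<not> ?thesis"
 then obtain w where w: "w : T.G" "w ~= v" "w ~: basis_vecs l" by blast
 have vb: "v ~: basis_vecs l" using v(2) by (auto simp: basis_vecs_def axis_def split: if_splits)
 have ph: "morphism T.AV proj_space ph" and ps: "morphism proj_space T.AV ps"
  and psph: "\<And>c. c : points T.AV ==> ps (ph c) = c" using iso by (auto simp: isomorphism_pair_def)
 define rp where "rp = (%c. representative (ph c))"
 have rp: "rp c ~= (%_. 0)" "ph c = proj_point (rp c)" if c: "c : points T.AV" for c
 proof -
  obtain x where x: "x ~= (%_. 0)" "ph c = proj_point x" using morphism_in[OF ph c] unfolding proj_ratio(4) by blast
  obtain k where k: "k ~= 0" "rp c = (%i. k * x i)" using proj_ratio(3) unfolding rp_def x(2) by blast
  show "rp c ~= (%_. 0)" "ph c = proj_point (rp c)" unfolding x(2) k(2)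
   using x(1) k(1) proj_point_scale by (auto simp: fun_eq_iff)
 qed
 have rp_inj: "c = c'" if "c : points T.AV" "c' : points T.AV" "rp c = (%i. k * rp c' i)" for c c' k
 proof -
  have "k ~= 0" using rp(1)[OF that(1)] that(3) by auto
  hence "ph c = ph c'" unfolding rp(2)[OF that(1)] rp(2)[OF that(2)] that(3) by (rule proj_point_scale)
  thus ?thesis using psph that by metis
 qed
 \<comment> \<open>The invariant curve of the wall: the other basis coordinates are 0, and the
   coordinate of \<open>e1\<close> or of \<open>v\<close> runs, giving two affine charts exchanged
   by \<open>1 / s\<close>. The coordinate at \<open>w\<close> stays 1, so the divisor of
   \<open>w\<close> is missed.\<close>
 define crv where "crv = (%u0 s u. if u : basis_vecs l - {e1} then 0 else if u = u0 then s else if u : T.G then 1 else (0::complex))"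
 define u0 where "u0 = (%j. if j then e1 else v)"
 have u0: "u0 j : T.G" "u0 j ~: basis_vecs l - {e1}" "u0 j ~= w" for j using v(1) vb e1 w by (auto simp: u0_def)
 have dom: "crv (u0 j) s : T.hcd" for j s
 proof -
  have "{u : T.G. crv (u0 j) s u = 0} \<subseteq> insert (u0 j) (basis_vecs l - {e1})" by (auto simp: crv_def)
  moreover have "EX cn:Fnt. insert (u0 j) (basis_vecs l - {e1}) \<subseteq> T.cg cn"
   using tn corner corner_gens e1(1) unfolding u0_def by (cases j) auto
  moreover have "crv (u0 j) s : coord_space T.G" using basis u0(1) by (auto simp: crv_def coord_space_def)
  ultimately show ?thesis unfolding T.hc_domain_iff by blast
 qed
 define C where "C = (%j s. T.orb (crv (u0 j) s))"
 have Cp: "C j s : points T.AV" for j s using dom by (auto simp: C_def T.points_toric_alg)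
 have Cw: "C j s ~: prime_divisor Fnt w" for j s
  unfolding C_def T.prime_divisor_iff[OF dom w(1)] using w u0(3)[of j] by (auto simp: crv_def)
 have Cflip: "C (\<not> j) (1 / s) = C j s" if s: "s ~= 0" for j s
 proof -
  have "C False z = C True (1 / z)" if z: "z ~= 0" for z
  proof -
   have "C False z = T.orb (%u. if u : basis_vecs l then z powi pairing v u * crv v z u else if u : T.G then 1 else 0)"
    unfolding C_def u0_def using dehomogenize[OF v(1) vb z T.hc_domain_coord[OF dom[of False z, unfolded u0_def if_False]]] vb
    by (simp add: crv_def)
   also have "(%u. if u : basis_vecs l then z powi pairing v u * crv v z u else if u : T.G then 1 else 0) = crv e1 (1 / z)"
   proof
    fix u
    have "pairing v e1 = - 1" using v(2) by (simp add: pairing_def axis_def if_distrib[of "%y. _ * y"] cong: if_cong)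
    moreover have "e1 ~= v" using vb e1(1) by auto
    ultimately show "(if u : basis_vecs l then z powi pairing v u * crv v z u else if u : T.G then 1 else 0) = crv e1 (1 / z) u"
     using e1 by (cases "u = e1") (auto simp: crv_def power_int_minus divide_inverse)
   qed
   finally show ?thesis by (simp add: C_def u0_def)
  qed
  from this[of s] this[of "1 / s"] show ?thesis using s by (cases j) auto
 qed
 have C1: "C j 1 = C True 1" for j using Cflip[of 1 j] by (cases j) auto
 have "(%u. if u = w then 0 else if u : T.G then 1 else (0::complex)) : T.hcd" (is "?D : _")
  unfolding T.hc_domain_iff using T.gens_ray[OF w(1)] by (auto simp: coord_space_def)
 hence Dp: "T.orb ?D : points T.AV" "T.orb ?D : prime_divisor Fnt w"
  using T.points_toric_alg T.prime_divisor_iff[OF _ w(1)] by auto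
 \<comment> \<open>The point at \<open>s = 1\<close> is common to both charts and will stay fixed;
   the point at \<open>s = 0\<close> will be carried to \<open>d\<close>, a point of the divisor of
   \<open>w\<close>.\<close>
 define x0 where "x0 = rp (C True 1)"
 define x1 where "x1 = rp (C True 0)"
 define d where "d = rp (T.orb ?D)"
 have C01: "C True 0 : prime_divisor Fnt e1" "C True 1 ~: prime_divisor Fnt e1"
  unfolding C_def T.prime_divisor_iff[OF dom e1(2)] using e1 by (auto simp: crv_def u0_def)
 have sep1: "x1 ~= (%i. k * x0 i)" for k 
 proof
  assume "x1 = (%i. k * x0 i)"
  hence "C True 0 = C True 1" using rp_inj[OF Cp Cp, of True 0 k True 1] by (simp add: x0_def x1_def)
  thus False using C01 by simp
 qed
 have sep2: "d ~= (%i. k * x0 i)" for k 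
 proof
  assume "d = (%i. k * x0 i)"
  hence "T.orb ?D = C True 1" using rp_inj[OF Dp(1) Cp, of k True 1] by (simp add: x0_def d_def)
  thus False using Cw[of True 1] Dp(2) by simp
 qed
 have "x0 ~= (%_. 0)" unfolding x0_def by (rule rp(1)[OF Cp])
 from lin_form_separating[OF this sep1 sep2]
 obtain cL where L: "lin_form cL x0 = 0" "lin_form cL x1 ~= 0" "lin_form cL d ~= 0" .
 \<comment> \<open>A transvection fixing the hyperplane of \<open>cL\<close> pointwise, in
   particular \<open>x0\<close>. Its direction is annihilated by \<open>cL\<close> and chosen such
   that \<open>B 1 x1\<close> is a multiple of \<open>d\<close>.\<close>
 define B where "B = (%t x i. x i + t * lin_form cL x * (d i / lin_form cL d - x1 i / lin_form cL x1))"
 have B_scale: "B t (%i. k * x i) = (%i. k * B t x i)" for t k x by (auto simp: B_def lin_form_scale algebra_simps)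
 have LB: "lin_form cL (B t x) = lin_form cL x" for t x
 proof -
  have add: "lin_form cL (%i. f i + k * g i) = lin_form cL f + k * lin_form cL g" for f g k
   by (simp add: lin_form_def distrib_left sum.distrib sum_distrib_left mult.left_commute)
  have eq: "B t x = (%i. (x i + t * lin_form cL x / lin_form cL d * d i) + (- t * lin_form cL x / lin_form cL x1) * x1 i)"
   by (rule ext) (simp add: B_def algebra_simps)
  show ?thesis unfolding eq add using L by simp
 qed
 have B_nz: "B t x ~= (%_. 0)" if "x ~= (%_. 0)" for t x
 proof
  assume b: "B t x = (%_. 0)"
  hence "lin_form cL x = 0" using LB[of t x] by (simp add: lin_form_def)
  hence "B t x = x" by (simp add: B_def)
  thus False using b that by simp
 qed
 define N where "N = (%j. {(s, t). ps (proj_point (B t (rp (C j s)))) : prime_divisor Fnt w})"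
 have "(0, 1) ~: N True"
 proof (rule moving_line_misses)
  fix j :: bool and s0 t0 :: complex
  let ?gm = "%y :: complex \<times> complex. crv (u0 j) (fst y)"
  have fstR: "fst : poly_family" and sndR: "snd : poly_family"
   unfolding poly_family_def by (auto intro: continuous_intros exI[of _ "[:0, 1:]"] exI[of _ "[:_:]"])
  note R = function_ring_poly_family
  have cR: "(%y. c) : poly_family" and aR: "f : poly_family ==> g : poly_family ==> (%y. f y + g y) : poly_family"
   and mR: "f : poly_family ==> g : poly_family ==> (%y. f y * g y) : poly_family" for c f g
   using R unfolding function_ring_def by blast+
  have "(%y. ?gm y u) : poly_family" for u
  proof -
   have "(%y. ?gm y u) = (if u : basis_vecs l - {e1} then (%y. 0) else if u = u0 j then fst
    else if u : T.G then (%y. 1) else (%y. 0))" by (auto simp: crv_def)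
   thus ?thesis using fstR cR by simp
  qed
  then obtain p S where p: "\<And>i. (%y. p y i) : poly_family" "S : poly_family" "S (s0, t0) ~= 0"
   "\<And>y. S y ~= 0 ==> EX k. k ~= 0 & p y = (%i. k * representative (ph (T.orb (?gm y))) i)"
   using T.polynomial_lift[OF ph R, of ?gm "(s0, t0)"] dom by metis
  have pc: "EX k. k ~= 0 & p y = (%i. k * rp (C j (fst y)) i)" if "S y ~= 0" for y
   using p(4)[OF that] by (simp add: rp_def C_def)
  \<comment> \<open>Polynomial homogeneous coordinates of the curve exist only locally and up to a
    nonzero factor; since \<open>B\<close> is homogeneous, the factor disappears in projective
    space.\<close>
  have pB: "B t (p y) ~= (%_. 0)" "proj_point (B t (p y)) = proj_point (B t (rp (C j (fst y))))" if y: "S y ~= 0" for y t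
  proof -
   obtain k where k: "k ~= 0" "p y = (%i. k * rp (C j (fst y)) i)" using pc[OF y] by blast
   have "p y ~= (%_. 0)" using k rp(1)[OF Cp[of j "fst y"]] by (auto simp: fun_eq_iff)
   thus "B t (p y) ~= (%_. 0)" by (rule B_nz)
   show "proj_point (B t (p y)) = proj_point (B t (rp (C j (fst y))))"
    unfolding k(2) B_scale using k(1) by (rule proj_point_scale)
  qed
  have linR: "(%y. lin_form cL (p y)) : poly_family"
   unfolding lin_form_def by (rule function_ring_sum[OF R]) (auto intro: mR cR p(1))
  have "(%y. B (snd y) (p y) i) : poly_family" for i unfolding B_def by (intro aR mR cR p(1) linR sndR)
  note da = T.divisor_along[where gm = "%y. B (snd y) (p y)" and Y = "{y. S y ~= 0}" and ?y0.0 = "(s0, t0)", OF ps w(1) R this]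
  obtain P S' where PS: "P : poly_family" "S' : poly_family" "S' (s0, t0) ~= 0"
   "\<And>y. y : {y. S y ~= 0} ==> S' y ~= 0 ==> ps (proj_point (B (snd y) (p y))) : prime_divisor Fnt w \<longleftrightarrow> P y = 0"
   by (rule da) (use pB(1) p(3) in simp, use p(3) in simp, rule that)
  show "EX P:poly_family. EX S:poly_family. S (s0, t0) ~= 0 & (ALL s t. S (s, t) ~= 0 --> (s, t) : N j \<longleftrightarrow> P (s, t) = 0)"
  proof (intro bexI conjI allI impI)
   show "(%y. S y * S' y) : poly_family" by (rule mR[OF p(2) PS(2)])
   show "S (s0, t0) * S' (s0, t0) ~= 0" using p(3) PS(3) by simp
   fix s t assume "S (s, t) * S' (s, t) ~= 0"
   thus "(s, t) : N j \<longleftrightarrow> P (s, t) = 0" using PS(4)[of "(s, t)"] pB(2)[of "(s, t)" t] by (simp add: N_def)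
  qed (rule PS(1))
 next
  show "(1, t) ~: N j" for j t
  proof -
   have "B t x0 = x0" using L(1) by (simp add: B_def)
   hence "ps (proj_point (B t (rp (C j 1)))) = C j 1"
    using psph[OF Cp] rp(2)[OF Cp] C1[of j] unfolding x0_def by metis
   thus ?thesis using Cw by (simp add: N_def)
  qed
  show "(s, 0) ~: N j" for j s
  proof -
   have "B 0 (rp (C j s)) = rp (C j s)" by (simp add: B_def)
   hence "ps (proj_point (B 0 (rp (C j s)))) = C j s" using psph[OF Cp] rp(2)[OF Cp] by metis
   thus ?thesis using Cw by (simp add: N_def)
  qed
  show "(1 / s, t) : N (\<not> j)" if "s ~= 0" "(s, t) : N j" for j s t
   using that Cflip[OF that(1), of j] by (simp add: N_def)
 qed
 moreover have "(0, 1) : N True"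
 proof -
  have "B 1 x1 = (%i. lin_form cL x1 / lin_form cL d * d i)" using L by (auto simp: B_def field_simps)
  moreover have "lin_form cL x1 / lin_form cL d ~= 0" using L by simp
  ultimately have "proj_point (B 1 x1) = proj_point d" using proj_point_scale by metis
  hence "ps (proj_point (B 1 x1)) = T.orb ?D" using psph[OF Dp(1)] rp(2)[OF Dp(1)] by (simp add: d_def)
  thus ?thesis using Dp(2) by (simp add: N_def x1_def)
 qed
 ultimately show False by blast
qed

theorem theorem3p2:
  fixes i1 l :: "'d::finite"
    and \<Sigma> \<Sigma>t :: "(real^'d) set set"
    and r m n k :: nat
    and a b c :: "nat \<Rightarrow> int^'d"
  assumes "i1 \<noteq> l"
    and "complete_fan UNIV \<Sigma>"
    and "complete_fan (hyperplane_lattice l) \<Sigma>t"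
    and "\<Sigma>t \<subseteq> \<Sigma>"
    and "1 \<le> r" and "1 \<le> m" and "1 \<le> n"
    and "inj_on a {1..r}" and "a ` {1..r} \<inter> basis_vecs l = {}"
    and "gens \<Sigma>t = basis_vecs l \<union> a ` {1..r}"
    and "inj_on b {1..m}" and "b ` {1..m} \<inter> gens \<Sigma>t = {}"
    and "gens (upper_fan l \<Sigma>) = b ` {1..m} \<union> gens \<Sigma>t"
    and "inj_on c {1..n}" and "c ` {1..n} \<inter> gens \<Sigma>t = {}"
    and "gens (lower_fan l \<Sigma>) = c ` {1..n} \<union> gens \<Sigma>t"
    and "b 1 = axis l 1"
    and "cone_gen (basis_vecs l \<union> {b 1}) \<in> upper_fan l \<Sigma>"
    and "cone_gen (basis_vecs l \<union> {c 1}) \<in> lower_fan l \<Sigma>"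
    and "isomorphic (toric_alg \<Sigma>t) (proj_space :: ('d \<Rightarrow> complex) set fspace) \<or>
      (\<exists>\<Delta> \<Delta>' p \<phi>.
         toric_bundle_over_P1 (hyperplane_lattice l) \<Delta>
           (hyperplane_lattice l \<inter> hyperplane_lattice i1) \<Delta>' p \<and>
         isomorphism (toric_alg \<Sigma>t) (toric_alg \<Delta>) \<phi> \<and>
         (\<forall>v \<in> {axis i1 1, a 1}. \<exists>s \<in> points proj_space.
            \<phi> ` prime_divisor \<Sigma>t v = {x \<in> points (toric_alg \<Delta>). p x = s}))"
  shows "(\<forall>t. isomorphism
            (prod_an (toric_an \<Sigma>t) (subspace_of complex_line (UNIV - {0})))
            (prod_an (toric_an \<Sigma>t) (subspace_of complex_line (UNIV - {0})))
            (patching_map i1 l \<Sigma>t r a c k t)) \<and>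
    complex_analytic_family CARD('d)
      (total_space i1 l \<Sigma> \<Sigma>t r m n a b c k) family_parameter
      (patched_variety i1 l \<Sigma> \<Sigma>t r m n a b c k) \<and>
    isomorphic (patched_variety i1 l \<Sigma> \<Sigma>t r m n a b c k 0)
      (toric_an \<Sigma> :: 'd tpoint fspace)"
proof -
 note a = assms
 have basis: "basis_vecs l \<subseteq> gens \<Sigma>t" using a(10) by blast
 interpret sp: split_fan l \<Sigma> \<Sigma>t by unfold_locales
   (use a(2-4) coordinate_lattice_UNIV coordinate_lattice_hyperplane in \<open>auto simp: complete_fan_def\<close>)
 \<comment> \<open>The cone over the basis vectors is a face of the given cone with
   \<open>b 1\<close>, and since it lies in the hyperplane it belongs to the fan \<Sigma>t.\<close>
 have corner: "cone_gen (basis_vecs l) \<in> \<Sigma>t"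
 proof -
  let ?S = "basis_vecs l \<union> {b 1}"
  have \<sigma>: "cone_gen ?S \<in> \<Sigma>" using a(18) by (simp add: upper_fan_def)
  have "b 1 \<in> gens (upper_fan l \<Sigma>)" using a(6,13) by auto
  hence "b 1 \<in> gens \<Sigma>" using sp.gens_half sp.upper_fan_eq by auto
  hence "?S \<subseteq> gens \<Sigma>" using basis sp.gens_t_sub by blast
  hence "basis_vecs l \<subseteq> cone_gens \<Sigma> (cone_gen ?S)"
   unfolding cone_gens_def using gen_in_cone_gen[of _ ?S] by fast
  note s = sp.S.subcone[OF \<sigma> this]
  have "v $ l = 0" if "v \<in> basis_vecs l" for v using that by (auto simp: basis_vecs_def axis_def)
  thus ?thesis by (intro sp.tilde_cone[OF s(1)]) (simp add: s(2))
 qed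
 interpret corner_fan l \<Sigma>t i1
 proof
  show "\<exists>\<sigma>\<in>\<Sigma>t. x \<in> \<sigma>" if "x $ l = 0" for x using that sp.cover_t by blast
 qed (use a(1) basis corner sp.gens_t_hyp in auto)
 have "a 1 \<in> a ` {1..r}" using a(5) by simp
 hence a1: "a 1 \<in> gens \<Sigma>t" "a 1 \<notin> basis_vecs l" using a(9,10) by blast+
 \<comment> \<open>The generator across the wall opposite \<open>e1\<close>. Both alternatives for
   the hypersurface lead to \<open>a 1 = v\<close>, and this is where the coordinate -1 comes
   from.\<close>
 obtain v \<tau> where v: "v \<in> gens \<Sigma>t" "v $ i1 = - 1" "\<tau> \<in> \<Sigma>t" "insert v (basis_vecs l - {e1}) \<subseteq> cone_gens \<Sigma>t \<tau>"
  by (rule opposite) (rule that)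
 have fc: "(\<forall>v\<in>gens \<Sigma>t. v \<noteq> e1 \<longrightarrow> v \<noteq> a 1 \<longrightarrow> v $ i1 = 0) \<and> a 1 $ i1 = - 1"
  using a(20)
 proof
  assume "isomorphic (toric_alg \<Sigma>t) (proj_space :: ('d \<Rightarrow> complex) set fspace)"
  then obtain \<phi> \<psi> where "isomorphism_pair (toric_alg \<Sigma>t) (proj_space :: ('d \<Rightarrow> complex) set fspace) \<phi> \<psi>"
   unfolding isomorphic_def isomorphism_def by blast
  from projective_gens[OF this v] have "gens \<Sigma>t \<subseteq> insert v (basis_vecs l)" .
  moreover from this have "a 1 = v" using a1 by blast
  ultimately show ?thesis using v(2) by (auto simp: basis_vecs_def axis_def)
 next
  assume "\<exists>\<Delta> \<Delta>' p \<phi>. toric_bundle_over_P1 (hyperplane_lattice l) \<Delta>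
    (hyperplane_lattice l \<inter> hyperplane_lattice i1) \<Delta>' p \<and>
   isomorphism (toric_alg \<Sigma>t) (toric_alg \<Delta>) \<phi> \<and>
   (\<forall>v \<in> {axis i1 1, a 1}. \<exists>s \<in> points proj_space.
    \<phi> ` prime_divisor \<Sigma>t v = {x \<in> points (toric_alg \<Delta>). p x = s})"
  then obtain \<Delta> \<Delta>' p \<phi> where B: "toric_bundle_over_P1 (hyperplane_lattice l) \<Delta>
    (hyperplane_lattice l \<inter> hyperplane_lattice i1) \<Delta>' p" "isomorphism (toric_alg \<Sigma>t) (toric_alg \<Delta>) \<phi>"
   and D: "\<And>v. v \<in> {e1, a 1} \<Longrightarrow> \<exists>s \<in> points proj_space. \<phi> ` prime_divisor \<Sigma>t v = {x \<in> points (toric_alg \<Delta>). p x = s}"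
   by (elim exE conjE) (rule that, assumption, assumption, erule bspec, assumption)
  have p: "morphism (toric_alg \<Delta>) proj_space p"
   using B(1) by (simp add: toric_bundle_over_P1_def toric_morphism_to_P1_def)
  obtain \<psi> where iso: "isomorphism_pair (toric_alg \<Sigma>t) (toric_alg \<Delta>) \<phi> \<psi>"
   using B(2) by (auto simp: isomorphism_def)
  have \<phi>: "morphism (toric_alg \<Sigma>t) (toric_alg \<Delta>) \<phi>" "\<And>c. c \<in> points (toric_alg \<Sigma>t) \<Longrightarrow> \<psi> (\<phi> c) = c"
   using iso by (auto simp: isomorphism_pair_def)
  \<comment> \<open>The map \<phi> is injective on points, so a description of the image of a
    divisor as a fiber becomes one of the divisor itself, as a fiber of the composite with
    \<phi>.\<close>
  have fiber: "\<exists>s \<in> points proj_space. prime_divisor \<Sigma>t v = {c \<in> points (toric_alg \<Sigma>t). (p \<circ> \<phi>) c = s}"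
   if v: "v \<in> {e1, a 1}" for v
  proof -
   obtain s where s: "s \<in> points proj_space" "\<phi> ` prime_divisor \<Sigma>t v = {x \<in> points (toric_alg \<Delta>). p x = s}"
    using D[OF v] by blast
   have sub: "prime_divisor \<Sigma>t v \<subseteq> points (toric_alg \<Sigma>t)"
    unfolding prime_divisor_def sp.T.points_toric_alg by blast
   have "c \<in> prime_divisor \<Sigma>t v \<longleftrightarrow> p (\<phi> c) = s" if c: "c \<in> points (toric_alg \<Sigma>t)" for c
   proof -
    have "\<phi> c \<in> \<phi> ` prime_divisor \<Sigma>t v \<longleftrightarrow> p (\<phi> c) = s" using morphism_in[OF \<phi>(1) c] unfolding s(2) by blast
    moreover have "\<phi> c \<in> \<phi> ` prime_divisor \<Sigma>t v \<longleftrightarrow> c \<in> prime_divisor \<Sigma>t v"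
    proof
     assume "\<phi> c \<in> \<phi> ` prime_divisor \<Sigma>t v"
     then obtain c' where c': "c' \<in> prime_divisor \<Sigma>t v" "\<phi> c = \<phi> c'" by blast
     hence "c' \<in> points (toric_alg \<Sigma>t)" using sub by blast
     hence "c = c'" using \<phi>(2)[of c'] \<phi>(2)[OF c] c'(2) by simp
     thus "c \<in> prime_divisor \<Sigma>t v" using c'(1) by simp
    qed blast
    ultimately show ?thesis by simp
   qed
   thus ?thesis using s(1) sub by (intro bexI[of _ s]) auto
  qed
  obtain s1 where s1: "s1 \<in> points proj_space" "prime_divisor \<Sigma>t e1 = {c \<in> points (toric_alg \<Sigma>t). (p \<circ> \<phi>) c = s1}"
   using fiber[of e1] by blast
  obtain s2 where s2: "s2 \<in> points proj_space" "prime_divisor \<Sigma>t (a 1) = {c \<in> points (toric_alg \<Sigma>t). (p \<circ> \<phi>) c = s2}"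
   using fiber[of "a 1"] by blast
  note fc = bundle_first_coord[OF morphism_compose[OF \<phi>(1) p] a1 s1 s2]
  have "v \<noteq> e1" using v(2) by (auto simp: axis_def)
  hence "v = a 1" using fc[OF v(1)] v(2) by auto
  thus ?thesis using fc v(2) by simp
 qed
 interpret deformation i1 l \<Sigma> \<Sigma>t r m n k a b c by unfold_locales (fact a | use fc in blast)+
 show ?thesis using isomorphism_patching_map family special_fiber by blast
qed


end
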